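(* Let $n\ge1$ be an integer. For $\alpha>0$ and $\epsilon>0$ let $\mathcal{F}_{\alpha,\epsilon}$ denote the set of functions $f\ge0$ on $\mathbb{R}^n$ with $\sqrt f\in W^{1,2}(\mathbb{R}^n,d\gamma)$ that are normalized and centered in $L^1(\mathbb{R}^n,d\gamma)$, i.e. $\int f\,d\gamma=1$ and $\int xf\,d\gamma=0$, and satisfy $$\int_{\mathbb{R}^n}\int_{\mathbb{R}^n} f(x)f(y)\,e^{\epsilon|x-y|^2}\,d\gamma(x)\,d\gamma(y)\le\alpha .$$ (a) For all $\alpha>0$ and $\epsilon>0$ there exists a constant $a_{\alpha,\epsilon}>0$ such that $$W_1(f\,d\gamma,d\gamma)\le a_{\alpha,\epsilon}\,\delta(f)^{1/2}\qquad\text{for all } f\in\mathcal{F}_{\alpha,\epsilon}.$$ (b) Suppose in addition that $\epsilon<\tfrac14$ and $$\alpha>\frac{1}{(2\pi)^n}\left(\frac{\pi}{\tfrac12-2\epsilon}\right)^n .$$ Then the best (smallest) possible constant $a_{\alpha,\epsilon}$ in the inequality in (a) satisfies $$a_{\alpha,\epsilon}\ge\frac{|n\,m_1(\gamma)-m_3(\gamma)|}{\sqrt n},$$ and, when $n=1$, $$a_{\alpha,\epsilon}\ge\sqrt{\frac{2}{\pi}} .$$ Moreover, the exponent $\tfrac12$ on the deficit is sharp: for no $\beta>\tfrac12$ does there exist a constant $C>0$ such that $W_1(f\,d\gamma,d\gamma)\le C\,\delta(f)^{\beta}$ for all $f\in\mathcal{F}_{\alpha,\epsilon}$.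
   Context: $d\gamma=(2\pi)^{-n/2}e^{-|x|^2/2}dx$ is the standard Gaussian measure on $\mathbb{R}^n$, and $m_p(\gamma)=\int_{\mathbb{R}^n}|x|^p\,d\gamma$. The logarithmic Sobolev deficit of $f$ is $$\delta(f)=\frac12\int\frac{|\nabla f|^2}{f}\,d\gamma-\int f\log f\,d\gamma ,$$ which is nonnegative (with $0\log 0=0$, and $|\nabla f|^2/f=4|\nabla\sqrt f|^2$). $W_1$ is the Kantorovich–Rubinstein (1-Wasserstein) distance between probability measures $\mu,\nu$ with finite first moments: $W_1(\mu,\nu)=\inf_\pi\iint_{\mathbb{R}^n\times\mathbb{R}^n}|x-y|\,d\pi(x,y)$, the infimum being over all probability measures $\pi$ on $\mathbb{R}^n\times\mathbb{R}^n$ with marginals $\mu$ and $\nu$. $W^{1,2}(\mathbb{R}^n,d\gamma)$ is the Sobolev space of functions $g$ with $\int (|g|^2+|\nabla g|^2)\,d\gamma<\infty$. *)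

theory Defs
  imports "HOL-Probability.Probability"
begin

definition std_gauss :: "'a::euclidean_space measure"  (\<open>\<gamma>\<close>) where
  "\<gamma> = density lborel
     (\<lambda>x. ennreal ((2 * pi) powr (- real DIM('a) / 2) * exp (- (norm x)\<^sup>2 / 2)))"

definition abs_moment :: "real \<Rightarrow> 'a::euclidean_space measure \<Rightarrow> real" where
  "abs_moment p M = (LINT x|M. norm x powr p)"

primrec continuously_differentiable :: "nat \<Rightarrow> ('a::euclidean_space \<Rightarrow> real) \<Rightarrow> bool" where
  "continuously_differentiable 0 f \<longleftrightarrow> continuous_on UNIV f"
| "continuously_differentiable (Suc k) f \<longleftrightarrow>
     f differentiable_on UNIV \<and>
     (\<forall>i\<in>Basis. continuously_differentiable k (\<lambda>x. frechet_derivative f (at x) i))"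

definition test_function :: "('a::euclidean_space \<Rightarrow> real) \<Rightarrow> bool" where
  "test_function \<phi> \<longleftrightarrow>
     (\<forall>k. continuously_differentiable k \<phi>) \<and> compact (closure {x. \<phi> x \<noteq> 0})"

definition locally_integrable :: "('a::euclidean_space \<Rightarrow> 'b::euclidean_space) \<Rightarrow> bool" where
  "locally_integrable g \<longleftrightarrow> (\<forall>K. compact K \<longrightarrow> set_integrable lborel K g)"

definition has_weak_gradient ::
    "('a::euclidean_space \<Rightarrow> real) \<Rightarrow> ('a \<Rightarrow> 'a) \<Rightarrow> bool" where
  "has_weak_gradient g G \<longleftrightarrow>
     locally_integrable g \<and> locally_integrable G \<and>
     (\<forall>\<phi>. test_function \<phi> \<longrightarrow>
        (\<forall>i\<in>Basis. (LINT x|lborel. g x * frechet_derivative \<phi> (at x) i)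
                   = - (LINT x|lborel. (G x \<bullet> i) * \<phi> x)))"

text \<open>A weak gradient is unique up to Lebesgue-null sets; this picks a representative.\<close>

definition weak_gradient :: "('a::euclidean_space \<Rightarrow> real) \<Rightarrow> 'a \<Rightarrow> 'a" where
  "weak_gradient g = (SOME G. has_weak_gradient g G)"

definition sobolev_gauss :: "('a::euclidean_space \<Rightarrow> real) set"  (\<open>W\<^sup>1\<^sup>,\<^sup>2'(\<gamma>')\<close>) where
  "W\<^sup>1\<^sup>,\<^sup>2(\<gamma>) = {g. \<exists>G. has_weak_gradient g G \<and>
                      integrable \<gamma> (\<lambda>x. (g x)\<^sup>2 + (norm (G x))\<^sup>2)}"

text \<open>
  In \<open>deficit\<close> the Fisher information density \<open>|\<nabla>f|\<^sup>2 / f\<close> is read as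
  \<open>4 |\<nabla>\<surd>f|\<^sup>2\<close>, which has a meaning on the zero set of \<open>f\<close> as well. If
  \<open>f \<ge> 0\<close> and \<open>\<surd>f\<close> is in \<open>W\<^sup>1\<^sup>,\<^sup>2(\<gamma>)\<close>, both integrals converge (the second one by
  the logarithmic Sobolev inequality), so the value 0 that the Bochner integral assigns to
  non-integrable functions plays no role.
\<close>

definition deficit :: "('a::euclidean_space \<Rightarrow> real) \<Rightarrow> real"  (\<open>\<delta>\<close>) where
  "\<delta> f = 1/2 * (LINT x|\<gamma>. 4 * (norm (weak_gradient (\<lambda>y. sqrt (f y)) x))\<^sup>2)
         - (LINT x|\<gamma>. f x * ln (f x))"

definition couplings ::
    "'a::euclidean_space measure \<Rightarrow> 'a measure \<Rightarrow> ('a \<times> 'a) measure set" where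
  "couplings \<mu> \<nu> = {\<pi>. prob_space \<pi> \<and> sets \<pi> = sets (borel \<Otimes>\<^sub>M borel) \<and>
                       distr \<pi> borel fst = \<mu> \<and> distr \<pi> borel snd = \<nu>}"

definition wasserstein1 ::
    "'a::euclidean_space measure \<Rightarrow> 'a measure \<Rightarrow> ennreal"  (\<open>W\<^sub>1\<close>) where
  "W\<^sub>1 \<mu> \<nu> = (INF \<pi> \<in> couplings \<mu> \<nu>. \<integral>\<^sup>+(x, y). ennreal (norm (x - y)) \<partial>\<pi>)"

text \<open>Functions are represented by Borel representatives, nonnegative everywhere.\<close>

definition exp_class :: "real \<Rightarrow> real \<Rightarrow> ('a::euclidean_space \<Rightarrow> real) set"  (\<open>\<F>\<close>) where
  "\<F> \<alpha> \<epsilon> = {f. (\<forall>x. 0 \<le> f x) \<and> (\<lambda>x. sqrt (f x)) \<in> W\<^sup>1\<^sup>,\<^sup>2(\<gamma>) \<and>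
     has_bochner_integral \<gamma> f 1 \<and>
     has_bochner_integral \<gamma> (\<lambda>x. f x *\<^sub>R x) 0 \<and>
     (\<integral>\<^sup>+x. \<integral>\<^sup>+y. ennreal (f x * f y * exp (\<epsilon> * (norm (x - y))\<^sup>2)) \<partial>\<gamma> \<partial>\<gamma>) \<le> ennreal \<alpha>}"

text \<open>\<open>W\<^sub>1(f d\<gamma>, d\<gamma>) \<le> C \<delta>(f)\<^sup>\<beta>\<close> for all \<open>f\<close> in \<open>S\<close>\<close>

definition deficit_bound :: "('a::euclidean_space \<Rightarrow> real) set \<Rightarrow> real \<Rightarrow> real \<Rightarrow> bool" where
  "deficit_bound S \<beta> C \<longleftrightarrow>
     (\<forall>f\<in>S. W\<^sub>1 (density \<gamma> (\<lambda>x. ennreal (f x))) \<gamma> \<le> ennreal (C * \<delta> f powr \<beta>))"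

definition best_constant :: "('a::euclidean_space \<Rightarrow> real) set \<Rightarrow> real" where
  "best_constant S = Inf {a. 0 < a \<and> deficit_bound S (1/2) a}"

end

theory Submission
  imports Defs "HOL-Real_Asymp.Real_Asymp"
begin

text \<open>
  Write \<open>H = \<integral> f ln f d\<gamma>\<close> and \<open>J = \<integral> |\<nabla>\<surd>f|\<^sup>2 d\<gamma>\<close>, so that the deficit is \<open>\<delta>(f) = 2 J - H\<close>. The
  upper bound holds because on the class considered the deficit controls \<open>J\<close> itself, which is
  far more than its nonnegativity (lemma \<open>fisher_le_deficit\<close>).

  Let \<open>P\<^sub>r f(y)\<close> be the mean of \<open>f(r y + \<surd>(1 - r\<^sup>2) Z)\<close> for a standard Gaussian \<open>Z\<close>. If \<open>y\<close> has
  law \<open>\<gamma>\<close>, so has the argument of \<open>f\<close>, and the entropy splits into the entropy of \<open>P\<^sub>r f\<close> and the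
  mean of the conditional entropies given \<open>y\<close>. The conditional laws are Gaussian with variance
  \<open>1 - r\<^sup>2\<close>, and their logarithmic Sobolev inequality (lemma \<open>conditional_log_sobolev\<close>) gives
  \<open>H \<le> H(P\<^sub>r f) + 2 (1 - r\<^sup>2) J\<close>: compared with the inequality \<open>H \<le> 2 J\<close>, an amount \<open>2 r\<^sup>2 J\<close> is
  gained. The entropy of \<open>P\<^sub>r f\<close> is at most \<open>\<integral> (P\<^sub>r f - 1)\<^sup>2 d\<gamma>\<close>, and this is of order \<open>r\<^sup>4 J\<close> (lemma
  \<open>ou_minus_1_square_le\<close>): since \<open>f\<close> has mass one and is centred, the Mehler kernel may be replaced by
  its part orthogonal to affine functions, which is of order \<open>r\<^sup>2\<close>, and
  \<open>f - 1 = (\<surd>f - 1) (\<surd>f + 1)\<close> together with the exponential moment of \<open>f\<close> leaves the Hellinger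
  distance \<open>\<integral> (\<surd>f - 1)\<^sup>2 d\<gamma> \<le> H \<le> 2 J\<close>. For small \<open>r\<close> the gain wins, so \<open>r\<^sup>2 J \<le> \<delta>(f)\<close>. Finally
  the coupling that leaves the common mass of \<open>f\<close> and 1 in place shows that \<open>W\<^sub>1\<close> is at most
  \<open>\<integral> |x| |f - 1| d\<gamma>\<close>, which is bounded by the square root of the Hellinger distance times a second
  moment, hence by a multiple of \<open>\<surd>J\<close> and of \<open>\<surd>\<delta>(f)\<close>.

  The logarithmic Sobolev inequality is proved for functions with a Lipschitz gradient by cutting
  the heat flow into short steps and expanding the entropy to second order in each of them
  (lemmas \<open>heat_entropy_step\<close> and \<open>log_sobolev_C11\<close>). It extends to weak gradients because a cut-off
  followed by \<open>P\<^sub>r\<close> with \<open>r\<close> near 1 approximates a Sobolev function together with its gradient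
  (lemma \<open>C11_approximation\<close>).

  The lower bounds come from centred Gaussians of variance \<open>s\<^sup>2\<close> with \<open>s < 1\<close>. Their deficit is
  \<open>n/2 (1/s\<^sup>2 - 1 + 2 ln s)\<close>, which behaves like \<open>n (1 - s)\<^sup>2\<close> as \<open>s\<close> tends to 1, while the transport
  distance is at least \<open>(1 - s) m\<^sub>1\<close>. The constants agree because \<open>m\<^sub>3 = (n + 1) m\<^sub>1\<close>, and
  \<open>m\<^sub>1 = \<surd>(2/\<pi>)\<close> in dimension one.
\<close>

section \<open>Gaussian measures\<close>

definition normal_dens :: "'a::euclidean_space \<Rightarrow> real \<Rightarrow> 'a \<Rightarrow> real" where
  "normal_dens m s x = (1 / sqrt (2 * pi * s\<^sup>2)) ^ DIM('a) * exp (- (norm (x - m))\<^sup>2 / (2 * s\<^sup>2))"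

lemma normal_dens_nonneg [simp]: "0 \<le> normal_dens m s x"
  by (simp add: normal_dens_def)

lemma normal_dens_pos: "0 < s \<Longrightarrow> 0 < normal_dens m s x"
  by (simp add: normal_dens_def)

lemma measurable_normal_dens [measurable]: "normal_dens m s \<in> borel_measurable borel"
  unfolding normal_dens_def[abs_def] by measurable

lemma normal_dens_prod:
  "normal_dens m s (x::'a::euclidean_space) = (\<Prod>b\<in>Basis. normal_density (m \<bullet> b) s (x \<bullet> b))"
proof -
  have "(\<Prod>b\<in>Basis. normal_density (m \<bullet> b) s (x \<bullet> b)) =
      (1 / sqrt (2 * pi * s\<^sup>2)) ^ DIM('a) * exp (\<Sum>b\<in>Basis. - ((x - m) \<bullet> b)\<^sup>2 / (2 * s\<^sup>2))"
    unfolding normal_density_def by (simp add: prod.distrib exp_sum inner_diff_left prod_dividef power_divide)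
  also have "(\<Sum>b\<in>Basis. - ((x - m) \<bullet> b)\<^sup>2 / (2 * s\<^sup>2)) = - (norm (x - m))\<^sup>2 / (2 * s\<^sup>2)"
    unfolding power2_norm_eq_inner euclidean_inner[of "x - m" "x - m"]
    by (simp add: sum_negf sum_divide_distrib power2_eq_square)
  finally show ?thesis by (simp add: normal_dens_def)
qed

lemma nn_integral_normal_dens:
  assumes "0 < s" shows "(\<integral>\<^sup>+x. ennreal (normal_dens m s x) \<partial>lborel) = 1"
proof -
  have *: "(\<integral>\<^sup>+x. ennreal (normal_density \<mu> s x) \<partial>lborel) = 1" for \<mu>
    using assms by (subst nn_integral_eq_integral) auto
  show ?thesis
    unfolding normal_dens_prod
    by (subst prod_ennreal[symmetric], simp)
       (subst nn_integral_lborel_prod; simp add: *)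
qed

lemma std_gauss_eq: "\<gamma> = density lborel (\<lambda>x::'a::euclidean_space. ennreal (normal_dens 0 1 x))"
proof -
  have "(2 * pi) powr (- real DIM('a) / 2) = (1 / sqrt (2 * pi)) ^ DIM('a)"
    by (simp add: powr_minus_divide powr_half_sqrt[symmetric] powr_realpow[symmetric] powr_powr
        powr_divide field_simps)
  then show ?thesis
    by (simp add: std_gauss_def normal_dens_def)
qed

lemma sets_std_gauss [simp, measurable_cong]: "sets \<gamma> = sets borel"
  by (simp add: std_gauss_eq)

lemma space_std_gauss [simp]: "space \<gamma> = UNIV"
  by (simp add: std_gauss_eq)

interpretation gauss: prob_space "\<gamma> :: 'a::euclidean_space measure"
  by (rule prob_spaceI) (simp add: std_gauss_eq emeasure_density nn_integral_normal_dens)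

lemma emeasure_std_gauss_UNIV [simp]: "emeasure \<gamma> UNIV = 1"
  using gauss.emeasure_space_1 by simp

lemma measure_std_gauss_UNIV [simp]: "measure \<gamma> UNIV = 1"
  using gauss.prob_space by simp

lemma nn_integral_std_gauss:
  "f \<in> borel_measurable borel \<Longrightarrow> (\<integral>\<^sup>+x. f x \<partial>\<gamma>) = (\<integral>\<^sup>+x. ennreal (normal_dens 0 1 x) * f x \<partial>lborel)"
  unfolding std_gauss_eq by (subst nn_integral_density) auto

lemma distr_std_gauss_affine:
  fixes m :: "'a::euclidean_space"
  assumes s: "0 < s"
  shows "distr \<gamma> borel (\<lambda>z. m + s *\<^sub>R z) = density lborel (\<lambda>x. ennreal (normal_dens m s x))"
proof (rule measure_eqI)
  fix A :: "'a set" assume "A \<in> sets (distr \<gamma> borel (\<lambda>z. m + s *\<^sub>R z))"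
  then have A [measurable]: "A \<in> sets borel" by simp
  have eq: "s ^ DIM('a) * normal_dens m s (m + s *\<^sub>R z) = normal_dens 0 1 z" for z :: 'a
    using s by (simp add: normal_dens_def real_sqrt_mult power_divide power_mult_distrib
        power2_norm_eq_inner power2_eq_square)
  have "emeasure (density lborel (\<lambda>x. ennreal (normal_dens m s x))) A =
      (\<integral>\<^sup>+x. ennreal (normal_dens m s x) * indicator A x \<partial>lborel)"
    by (simp add: emeasure_density)
  also have "\<dots> = (\<integral>\<^sup>+z. ennreal (s ^ DIM('a)) * (ennreal (normal_dens m s (m + s *\<^sub>R z)) *
      indicator A (m + s *\<^sub>R z)) \<partial>lborel)"
    using s by (subst lborel_affine[of s m]) (simp_all add: nn_integral_density nn_integral_distr)
  also have "\<dots> = (\<integral>\<^sup>+z. ennreal (normal_dens 0 1 z) * indicator A (m + s *\<^sub>R z) \<partial>lborel)"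
    using s by (simp add: mult.assoc[symmetric] ennreal_mult'[symmetric] eq)
  also have "\<dots> = (\<integral>\<^sup>+z. indicator A (m + s *\<^sub>R z) \<partial>\<gamma>)"
    by (subst nn_integral_std_gauss) auto
  also have "\<dots> = emeasure (distr \<gamma> borel (\<lambda>z. m + s *\<^sub>R z)) A"
  proof -
    have "emeasure (distr \<gamma> borel (\<lambda>z. m + s *\<^sub>R z)) A =
        (\<integral>\<^sup>+x. indicator A x \<partial>distr \<gamma> borel (\<lambda>z. m + s *\<^sub>R z))"
      by (rule nn_integral_indicator[symmetric]) simp
    also have "\<dots> = (\<integral>\<^sup>+z. indicator A (m + s *\<^sub>R z) \<partial>\<gamma>)"
      by (rule nn_integral_distr) simp_all
    finally show ?thesis by simp
  qed
  finally show "emeasure (distr \<gamma> borel (\<lambda>z. m + s *\<^sub>R z)) A =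
      emeasure (density lborel (\<lambda>x. ennreal (normal_dens m s x))) A" by simp
qed simp

lemma nn_integral_gauss_affine:
  fixes m :: "'a::euclidean_space"
  assumes "0 < s" and [measurable]: "f \<in> borel_measurable borel"
  shows "(\<integral>\<^sup>+z. f (m + s *\<^sub>R z) \<partial>\<gamma>) = (\<integral>\<^sup>+x. ennreal (normal_dens m s x) * f x \<partial>lborel)"
proof -
  have "(\<integral>\<^sup>+z. f (m + s *\<^sub>R z) \<partial>\<gamma>) = (\<integral>\<^sup>+x. f x \<partial>distr \<gamma> borel (\<lambda>z. m + s *\<^sub>R z))"
    by (subst nn_integral_distr) auto
  then show ?thesis
    using assms by (simp add: distr_std_gauss_affine nn_integral_density)
qed

text \<open>
  Completing the square turns the integrand into a multiple of a normal density with variance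
  \<open>1 / (1 + a)\<close>. The explicit constants below, in the exponential moments and in the square integral of
  the Mehler kernel, come from this formula.
\<close>

lemma nn_integral_exp_quadratic:
  fixes b :: "'a::euclidean_space"
  assumes a: "-1 < a"
  shows "(\<integral>\<^sup>+y. ennreal (exp (b \<bullet> y - a * (norm y)\<^sup>2 / 2)) \<partial>\<gamma>) =
    ennreal ((1 / sqrt (1 + a)) ^ DIM('a) * exp ((norm b)\<^sup>2 / (2 * (1 + a))))"
proof -
  \<comment> \<open>Standard deviation and mean of the normal density that completing the square produces.\<close>
  define s where "s = 1 / sqrt (1 + a)"
  have s: "0 < s" "s\<^sup>2 = 1 / (1 + a)" using a by (auto simp: s_def power_divide)
  define m where "m = s\<^sup>2 *\<^sub>R b"
  have sq: "sqrt (2 * pi * s\<^sup>2) = sqrt (2 * pi) * s" using s(1) by (simp add: real_sqrt_mult)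
  have a2: "2 + a * 2 > 0" using a by simp
  have "normal_dens 0 1 y * exp (b \<bullet> y - a * (norm y)\<^sup>2 / 2) =
      (s ^ DIM('a) * exp ((norm b)\<^sup>2 / (2 * (1 + a)))) * normal_dens m s y" for y
  proof -
    have "- (norm y)\<^sup>2 / 2 + (b \<bullet> y - a * (norm y)\<^sup>2 / 2) =
        (norm b)\<^sup>2 / (2 * (1 + a)) + - (norm (y - m))\<^sup>2 / (2 * s\<^sup>2)"
      using a2 a unfolding power2_norm_eq_inner m_def s(2)
      by (simp add: inner_diff_left inner_diff_right inner_commute divide_simps) (simp add: algebra_simps)
    from arg_cong[OF this, of exp] show ?thesis
      using s(1) unfolding normal_dens_def sq by (simp only: mult_exp_exp[symmetric])
        (simp add: mult_exp_exp power_divide power_mult_distrib)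
  qed
  then have "(\<integral>\<^sup>+y. ennreal (exp (b \<bullet> y - a * (norm y)\<^sup>2 / 2)) \<partial>\<gamma>) =
      (\<integral>\<^sup>+y. ennreal (s ^ DIM('a) * exp ((norm b)\<^sup>2 / (2 * (1 + a)))) * ennreal (normal_dens m s y) \<partial>lborel)"
    using s(1) by (subst nn_integral_std_gauss) (simp_all add: ennreal_mult[symmetric])
  also have "\<dots> = ennreal (s ^ DIM('a) * exp ((norm b)\<^sup>2 / (2 * (1 + a))))"
    by (subst nn_integral_cmult) (simp_all add: nn_integral_normal_dens s(1))
  finally show ?thesis by (simp add: s_def)
qed

text \<open>
  Two independent Gaussian vectors add up to one whose variance is the sum. This is the source of
  the semigroup law of the heat flow and of the invariance of \<open>\<gamma>\<close> under Ornstein-Uhlenbeck averages.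
\<close>

lemma nn_integral_gauss_sum:
  fixes f :: "'a::euclidean_space \<Rightarrow> ennreal"
  assumes "0 \<le> a" "0 \<le> b" and [measurable]: "f \<in> borel_measurable borel"
  shows "(\<integral>\<^sup>+x. \<integral>\<^sup>+y. f (a *\<^sub>R x + b *\<^sub>R y) \<partial>\<gamma> \<partial>\<gamma>) = (\<integral>\<^sup>+z. f (sqrt (a\<^sup>2 + b\<^sup>2) *\<^sub>R z) \<partial>\<gamma>)"
proof (cases "a = 0 \<or> b = 0")
  case True
  then show ?thesis using assms by auto
next
  case False
  then have a: "0 < a" and b: "0 < b" using assms by auto
  define c where "c = sqrt (a\<^sup>2 + b\<^sup>2)"
  have c: "0 < c" "c\<^sup>2 = a\<^sup>2 + b\<^sup>2" using a b by (auto simp: c_def add_pos_pos)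
  have inner: "(\<integral>\<^sup>+x. ennreal (normal_dens (a *\<^sub>R x) b u) \<partial>\<gamma>) = ennreal (normal_dens 0 c u)" for u :: 'a
  proof -
    have e: "normal_dens (a *\<^sub>R x) b u = normal_dens 0 b u * exp (((a / b\<^sup>2) *\<^sub>R u) \<bullet> x - (a\<^sup>2/b\<^sup>2) * (norm x)\<^sup>2 / 2)" for x
    proof -
      have "- (norm (u - a *\<^sub>R x))\<^sup>2 / (2 * b\<^sup>2) = - (norm u)\<^sup>2 / (2 * b\<^sup>2) +
          (((a / b\<^sup>2) *\<^sub>R u) \<bullet> x - (a\<^sup>2/b\<^sup>2) * (norm x)\<^sup>2 / 2)"
        using b unfolding power2_norm_eq_inner
        by (simp add: inner_diff_left inner_diff_right inner_commute divide_simps power2_eq_square)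
      then show ?thesis unfolding normal_dens_def by (simp only: exp_add) simp
    qed
    have p: "-1 < a\<^sup>2/b\<^sup>2" using a b by (smt (verit) divide_nonneg_nonneg zero_le_power2)
    have s2: "1 + a\<^sup>2/b\<^sup>2 = c\<^sup>2 / b\<^sup>2" using b by (simp add: c field_simps)
    have ex: "- (norm u)\<^sup>2 / (2 * b\<^sup>2) + (norm ((a / b\<^sup>2) *\<^sub>R u))\<^sup>2 / (2 * (c\<^sup>2 / b\<^sup>2)) = - (norm u)\<^sup>2 / (2 * c\<^sup>2)"
    proof -
      have "(norm ((a / b\<^sup>2) *\<^sub>R u))\<^sup>2 / (2 * (c\<^sup>2 / b\<^sup>2)) = a\<^sup>2 * (norm u)\<^sup>2 / (2 * c\<^sup>2 * b\<^sup>2)"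
        using b by (simp add: power_mult_distrib power_divide field_simps power2_eq_square)
      moreover have "- (norm u)\<^sup>2 / (2 * b\<^sup>2) = - c\<^sup>2 * (norm u)\<^sup>2 / (2 * c\<^sup>2 * b\<^sup>2)"
        using c(1) by simp
      moreover have "- (norm u)\<^sup>2 / (2 * c\<^sup>2) = - b\<^sup>2 * (norm u)\<^sup>2 / (2 * c\<^sup>2 * b\<^sup>2)"
        using b by simp
      ultimately show ?thesis unfolding c(2) by (simp add: algebra_simps flip: add_divide_distrib diff_divide_distrib)
    qed
    have "(\<integral>\<^sup>+x. ennreal (normal_dens (a *\<^sub>R x) b u) \<partial>\<gamma>) =
       ennreal (normal_dens 0 b u) * ennreal ((1 / sqrt (1 + a\<^sup>2/b\<^sup>2)) ^ DIM('a) * exp ((norm ((a / b\<^sup>2) *\<^sub>R u))\<^sup>2 / (2 * (1 + a\<^sup>2/b\<^sup>2))))"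
      unfolding e by (simp only: ennreal_mult[OF normal_dens_nonneg exp_ge_zero])
        (subst nn_integral_cmult, measurable, simp only: nn_integral_exp_quadratic[OF p])
    also have "\<dots> = ennreal (normal_dens 0 b u * ((b / c) ^ DIM('a) * exp ((norm ((a / b\<^sup>2) *\<^sub>R u))\<^sup>2 / (2 * (c\<^sup>2 / b\<^sup>2)))))"
      unfolding s2 using b c(1) by (simp add: ennreal_mult real_sqrt_divide)
    also have "normal_dens 0 b u * ((b / c) ^ DIM('a) * exp ((norm ((a / b\<^sup>2) *\<^sub>R u))\<^sup>2 / (2 * (c\<^sup>2 / b\<^sup>2)))) = normal_dens 0 c u"
      using arg_cong[OF ex, of exp, unfolded exp_add] b c(1) unfolding normal_dens_def
      by (simp add: real_sqrt_mult power_divide power_mult_distrib)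
    finally show ?thesis .
  qed
  have "(\<integral>\<^sup>+x. \<integral>\<^sup>+y. f (a *\<^sub>R x + b *\<^sub>R y) \<partial>\<gamma> \<partial>\<gamma>) =
      (\<integral>\<^sup>+x. \<integral>\<^sup>+u. ennreal (normal_dens (a *\<^sub>R x) b u) * f u \<partial>lborel \<partial>\<gamma>)"
    using b by (simp add: nn_integral_gauss_affine)
  also have "\<dots> = (\<integral>\<^sup>+u. \<integral>\<^sup>+x. ennreal (normal_dens (a *\<^sub>R x) b u) * f u \<partial>\<gamma> \<partial>lborel)"
  proof (rule pair_sigma_finite.Fubini')
    show "pair_sigma_finite lborel (\<gamma> :: 'a measure)" ..
    show "(\<lambda>(u, x). ennreal (normal_dens (a *\<^sub>R x) b u) * f u) \<in> borel_measurable (lborel \<Otimes>\<^sub>M \<gamma>)"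
      unfolding normal_dens_def by measurable
  qed
  also have "\<dots> = (\<integral>\<^sup>+u. ennreal (normal_dens 0 c u) * f u \<partial>lborel)"
  proof -
    have "(\<lambda>x. ennreal (normal_dens (a *\<^sub>R x) b u)) \<in> borel_measurable \<gamma>" for u :: 'a
      unfolding normal_dens_def by measurable
    then show ?thesis by (simp add: nn_integral_multc inner)
  qed
  also have "\<dots> = (\<integral>\<^sup>+z. f (c *\<^sub>R z) \<partial>\<gamma>)"
    using nn_integral_gauss_affine[of c f 0] c by simp
  finally show ?thesis by (simp add: c_def)
qed

section \<open>Moments and the Mehler kernel\<close>

lemma integrable_std_gauss_exp:
  fixes b :: "'a::euclidean_space"
  assumes "c < 1/2"
  shows "integrable \<gamma> (\<lambda>x. exp (b \<bullet> x + c * (norm x)\<^sup>2))"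
proof (rule integrableI_nn_integral_finite)
  show "(\<integral>\<^sup>+x. ennreal (exp (b \<bullet> x + c * (norm x)\<^sup>2)) \<partial>\<gamma>) =
    ennreal ((1 / sqrt (1 + - 2 * c)) ^ DIM('a) * exp ((norm b)\<^sup>2 / (2 * (1 + - 2 * c))))"
    using nn_integral_exp_quadratic[of "- 2 * c" b] assms by simp
qed auto

lemma integral_std_gauss_exp:
  fixes b :: "'a::euclidean_space"
  assumes "c < 1/2"
  shows "(\<integral>x. exp (b \<bullet> x + c * (norm x)\<^sup>2) \<partial>\<gamma>) =
    (1 / sqrt (1 - 2 * c)) ^ DIM('a) * exp ((norm b)\<^sup>2 / (2 * (1 - 2 * c)))"
  using nn_integral_exp_quadratic[of "- 2 * c" b] assms
  by (intro integral_eq_nn_integral[THEN trans]) auto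

lemma power_le_fact_exp:
  fixes x :: real assumes "0 \<le> x" shows "x ^ k \<le> fact k * exp x"
proof -
  have "x ^ k /\<^sub>R fact k \<le> exp x"
    unfolding exp_def using assms
    by (intro sum_le_suminf[OF summable_exp_generic, of "{k}", simplified]) (auto)
  then show ?thesis by (simp add: field_simps)
qed

text \<open>
  An arbitrarily small part of the quadratic exponent absorbs the power and the linear exponent.
\<close>

lemma integrable_norm_power_exp:
  assumes "c < 1/2"
  shows "integrable \<gamma> (\<lambda>x::'a::euclidean_space. norm x ^ k * exp (d * norm x + c * (norm x)\<^sup>2))"
proof -
  define e where "e = (1/2 - c) / 2"
  have e: "0 < e" "c + e < 1/2" using assms by (auto simp: e_def field_simps)
  define K where "K = (1 + \<bar>d\<bar>)\<^sup>2 / (4 * e)"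
  show ?thesis
  proof (rule Bochner_Integration.integrable_bound)
    show "integrable \<gamma> (\<lambda>x::'a. fact k * exp K * exp (0 \<bullet> x + (c + e) * (norm x)\<^sup>2))"
      using integrable_std_gauss_exp[OF e(2)] by (intro integrable_mult_right) 
    show "AE x in \<gamma>. norm (norm (x::'a) ^ k * exp (d * norm x + c * (norm x)\<^sup>2))
       \<le> norm (fact k * exp K * exp (0 \<bullet> x + (c + e) * (norm x)\<^sup>2))"
    proof (rule AE_I2)
      fix x :: 'a
      define t where "t = norm x"
      have t: "0 \<le> t" by (simp add: t_def)
      have "K - (1 + \<bar>d\<bar>) * t + e * t\<^sup>2 = (2 * e * t - (1 + \<bar>d\<bar>))\<^sup>2 / (4 * e)"
        using e(1) by (simp add: K_def power2_diff field_simps power2_eq_square)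
      also have "\<dots> \<ge> 0" using e by simp
      finally have 1: "t + \<bar>d\<bar> * t \<le> K + e * t\<^sup>2" by (simp add: algebra_simps)
      have "t ^ k * exp (d * t + c * t\<^sup>2) \<le> (fact k * exp t) * exp (d * t + c * t\<^sup>2)"
        by (intro mult_right_mono power_le_fact_exp t) simp
      also have "\<dots> = fact k * exp (t + d * t + c * t\<^sup>2)"
        by (simp add: mult_exp_exp add.assoc)
      also have "\<dots> \<le> fact k * exp (K + (c + e) * t\<^sup>2)"
        using 1 mult_right_mono[OF abs_ge_self t, of d] by (simp add: algebra_simps)
      finally show "norm (norm (x::'a) ^ k * exp (d * norm x + c * (norm x)\<^sup>2))
       \<le> norm (fact k * exp K * exp (0 \<bullet> x + (c + e) * (norm x)\<^sup>2))"
        using t by (simp add: t_def[symmetric] mult_exp_exp[symmetric] abs_mult mult.assoc)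
    qed
  qed simp
qed

lemma integrable_norm_power [simp]: "integrable \<gamma> (\<lambda>x::'a::euclidean_space. norm x ^ k)"
  using integrable_norm_power_exp[of 0 k 0] by simp

lemma integrable_std_gauss_norm [simp]: "integrable \<gamma> (\<lambda>x::'a::euclidean_space. norm x)"
  using integrable_norm_power[of 1] by simp

lemma distr_std_gauss_uminus: "distr \<gamma> borel uminus = (\<gamma> :: 'a::euclidean_space measure)"
proof (rule measure_eqI)
  fix A :: "'a set" assume "A \<in> sets (distr \<gamma> borel uminus)"
  then have [measurable]: "A \<in> sets borel" by simp
  have "emeasure (distr \<gamma> borel uminus) A = (\<integral>\<^sup>+x. indicator A x \<partial>distr \<gamma> borel uminus)"
    by simp
  also have "\<dots> = (\<integral>\<^sup>+x. indicator A (- x) \<partial>\<gamma>)"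
    by (rule nn_integral_distr) simp_all
  also have "\<dots> = (\<integral>\<^sup>+x. ennreal (normal_dens 0 1 x) * indicator A (- x) \<partial>lborel)"
    by (rule nn_integral_std_gauss) simp
  also have "\<dots> = (\<integral>\<^sup>+x. ennreal (normal_dens 0 1 x) * indicator A x \<partial>lborel)"
    by (subst lborel_affine[of "-1" 0]) (simp_all add: nn_integral_density nn_integral_distr normal_dens_def)
  also have "\<dots> = emeasure \<gamma> A" by (simp flip: nn_integral_std_gauss)
  finally show "emeasure (distr \<gamma> borel uminus) A = emeasure \<gamma> A" .
qed simp

lemma integral_std_gauss_inner [simp]: "(\<integral>x. v \<bullet> x \<partial>\<gamma>) = (0::real)"
proof -
  have "(\<integral>x. v \<bullet> x \<partial>\<gamma>) = (\<integral>x. v \<bullet> x \<partial>distr \<gamma> borel uminus)"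
    by (simp only: distr_std_gauss_uminus)
  also have "\<dots> = (\<integral>x. v \<bullet> (- x) \<partial>\<gamma>)" by (rule integral_distr) simp_all
  finally show ?thesis by simp
qed

lemma integrable_std_gauss_inner [simp]: "integrable \<gamma> (\<lambda>x. v \<bullet> x)"
  by (rule Bochner_Integration.integrable_bound[of _ "\<lambda>x. norm v * norm x"])
     (auto intro: Cauchy_Schwarz_ineq2)

lemma inner_sq_le: "(v \<bullet> x)\<^sup>2 \<le> (norm v)\<^sup>2 * (norm x)\<^sup>2"
  using power_mono[OF Cauchy_Schwarz_ineq2[of v x], of 2] by (simp add: power_mult_distrib)

lemma integrable_std_gauss_inner_sq [simp]: "integrable \<gamma> (\<lambda>x. (v \<bullet> x)\<^sup>2)"
  by (rule Bochner_Integration.integrable_bound[of _ "\<lambda>x. (norm v)\<^sup>2 * norm x ^ 2"])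
     (simp_all add: inner_sq_le)

lemma two_cosh_minus_2_le: "exp s + exp (- s) - 2 \<le> s\<^sup>2 * exp \<bar>s\<bar>" for s :: real
proof -
  have "\<bar>exp (s/2) - exp (- (s/2))\<bar> \<le> \<bar>s\<bar> * exp (\<bar>s\<bar>/2)"
  proof -
    have *: "exp t - exp (- t) \<le> (2 * t) * exp t" if "0 \<le> t" for t :: real
    proof -
      have "1 - exp (- (2*t)) \<le> 2 * t" using exp_ge_add_one_self[of "-(2*t)"] by simp
      from mult_right_mono[OF this exp_ge_zero[of t]] show ?thesis
        by (simp add: left_diff_distrib mult_exp_exp)
    qed
    have **: "exp t - exp (- t) \<ge> 0" if "0 \<le> t" for t :: real using that by simp
    show ?thesis using *[of "s/2"] *[of "-s/2"] **[of "s/2"] **[of "-s/2"]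
      by (cases "0 \<le> s") (auto simp: abs_if)
  qed
  from power_mono[OF this, of 2] have "(exp (s/2) - exp (- (s/2)))\<^sup>2 \<le> s\<^sup>2 * (exp (\<bar>s\<bar>/2))\<^sup>2"
    by (simp add: power_mult_distrib)
  moreover have "(exp (s/2) - exp (- (s/2)))\<^sup>2 = exp s + exp (-s) - 2"
    by (simp add: power2_diff exp_double[symmetric] mult_exp_exp)
  ultimately show ?thesis by (simp add: exp_double[symmetric])
qed

text \<open>
  The second difference quotient of the moment generating function \<open>exp (\<bar>v\<bar>\<^sup>2 t\<^sup>2 / 2)\<close> of \<open>v \<bullet> x\<close> at
  \<open>t = 0\<close> has the limit \<open>\<bar>v\<bar>\<^sup>2\<close>; dominated convergence identifies it with the second moment.
\<close>

lemma integral_std_gauss_inner_sq [simp]: "(\<integral>x. (v \<bullet> x)\<^sup>2 \<partial>\<gamma>) = (norm (v::'a::euclidean_space))\<^sup>2"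
proof -
  define u where "u k x = (exp (v \<bullet> x / (real k + 1)) + exp (- (v \<bullet> x) / (real k + 1)) - 2) * (real k + 1)\<^sup>2"
    for k :: nat and x :: 'a
  have "(\<lambda>k. \<integral>x. u k x \<partial>\<gamma>) \<longlonglongrightarrow> (\<integral>x. (v \<bullet> x)\<^sup>2 \<partial>\<gamma>)"
  proof (rule integral_dominated_convergence)
    show "integrable \<gamma> (\<lambda>x. (norm v)\<^sup>2 * (norm x ^ 2 * exp (norm v * norm x + 0 * (norm x)\<^sup>2)))"
      by (intro integrable_mult_right integrable_norm_power_exp) simp
    show "AE x in \<gamma>. (\<lambda>k. u k x) \<longlonglongrightarrow> (v \<bullet> x)\<^sup>2"
    proof (rule AE_I2)
      have "(\<lambda>k. (exp (s / (real k + 1)) + exp (- s / (real k + 1)) - 2) * (real k + 1)\<^sup>2) \<longlonglongrightarrow> s * s" for s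
        by real_asymp
      then show "(\<lambda>k. u k x) \<longlonglongrightarrow> (v \<bullet> x)\<^sup>2" for x
        by (simp add: u_def power2_eq_square)
    qed
    show "AE x in \<gamma>. norm (u k x) \<le> (norm v)\<^sup>2 * (norm x ^ 2 * exp (norm v * norm x + 0 * (norm x)\<^sup>2))" for k
    proof (rule AE_I2)
      fix x :: 'a
      define s where "s = (v \<bullet> x) / (real k + 1)"
      have s: "\<bar>s\<bar> \<le> \<bar>v \<bullet> x\<bar>" by (simp add: s_def field_simps mult_left_mono)
      have "2 \<le> exp s + exp (- s)"
        using exp_ge_add_one_self[of s] exp_ge_add_one_self[of "-s"] by linarith
      then have "norm (u k x) = (exp s + exp (- s) - 2) * (real k + 1)\<^sup>2"
        by (simp add: u_def s_def)
      also have "\<dots> \<le> (s\<^sup>2 * exp \<bar>s\<bar>) * (real k + 1)\<^sup>2"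
        by (intro mult_right_mono two_cosh_minus_2_le) simp
      also have "\<dots> = (v \<bullet> x)\<^sup>2 * exp \<bar>s\<bar>" by (simp add: s_def power_divide)
      also have "\<dots> \<le> (norm v * norm x)\<^sup>2 * exp (norm v * norm x)"
        using s Cauchy_Schwarz_ineq2[of v x]
        by (intro mult_mono) (auto simp flip: abs_le_square_iff)
      finally show "norm (u k x) \<le> (norm v)\<^sup>2 * (norm x ^ 2 * exp (norm v * norm x + 0 * (norm x)\<^sup>2))"
        by (simp add: power_mult_distrib)
    qed
  qed (simp_all add: u_def)
  moreover have "(\<integral>x. u k x \<partial>\<gamma>) = 2 * (exp ((norm v)\<^sup>2 / (2 * (real k + 1)\<^sup>2)) - 1) * (real k + 1)\<^sup>2" for k
  proof -
    have i: "integrable \<gamma> (\<lambda>x. exp (c * (v \<bullet> x)))" "(\<integral>x. exp (c * (v \<bullet> x)) \<partial>\<gamma>) = exp (c\<^sup>2 * (norm v)\<^sup>2 / 2)" for c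
      using integrable_std_gauss_exp[of 0 "c *\<^sub>R v"] integral_std_gauss_exp[of 0 "c *\<^sub>R v"]
      by (simp_all add: power_mult_distrib)
    show ?thesis using i[of "1 / (real k + 1)"] i[of "- 1 / (real k + 1)"]
      by (simp add: u_def power_divide mult.commute)
  qed
  moreover have "(\<lambda>k. 2 * (exp ((norm v)\<^sup>2 / (2 * (real k + 1)\<^sup>2)) - 1) * (real k + 1)\<^sup>2) \<longlonglongrightarrow> (norm v)\<^sup>2"
    by real_asymp
  ultimately show ?thesis using LIMSEQ_unique by simp
qed

lemma integral_std_gauss_norm_sq: "(\<integral>(x::'a::euclidean_space). (norm x)\<^sup>2 \<partial>\<gamma>) = real DIM('a)"
proof -
  have "(\<integral>(x::'a). (norm x)\<^sup>2 \<partial>\<gamma>) = (\<integral>(x::'a). (\<Sum>b\<in>Basis. (b \<bullet> x)\<^sup>2) \<partial>\<gamma>)"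
    unfolding power2_norm_eq_inner by (subst euclidean_inner) (simp add: power2_eq_square inner_commute)
  then show ?thesis by simp
qed

text \<open>
  The density with respect to \<open>\<gamma>\<close> of the normal law with mean \<open>r y\<close> and variance \<open>1 - r\<^sup>2\<close>.
\<close>

definition mehler :: "real \<Rightarrow> 'a::euclidean_space \<Rightarrow> 'a \<Rightarrow> real" where
  "mehler r y x = (1 / sqrt (1 - r\<^sup>2)) ^ DIM('a) *
     exp (- (r\<^sup>2 * (norm x)\<^sup>2 + r\<^sup>2 * (norm y)\<^sup>2 - 2 * r * (x \<bullet> y)) / (2 * (1 - r\<^sup>2)))"

lemma mehler_commute: "mehler r y x = mehler r x y"
  by (simp add: mehler_def inner_commute add.commute)

lemma measurable_mehler [measurable]: "(\<lambda>(y, x). mehler r y x) \<in> borel_measurable (borel \<Otimes>\<^sub>M borel)"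
  unfolding mehler_def by measurable

lemma measurable_mehler' [measurable]: "mehler r y \<in> borel_measurable borel"
  unfolding mehler_def by measurable

lemma mehler_nonneg [simp]: "\<bar>r\<bar> < 1 \<Longrightarrow> 0 \<le> mehler r y x"
  by (simp add: mehler_def abs_square_le_1)

text \<open>
  The conditional variance is smaller than 1, so the kernel is bounded in \<open>x\<close>. Convergence in
  \<open>L\<^sup>1(\<gamma>)\<close> or \<open>L\<^sup>2(\<gamma>)\<close> is therefore inherited by every conditional law.
\<close>

lemma mehler_le:
  fixes x y :: "'a::euclidean_space"
  assumes "\<bar>r\<bar> < 1"
  shows "mehler r y x \<le> (1 / sqrt (1 - r\<^sup>2)) ^ DIM('a) * exp ((norm y)\<^sup>2 / 2)"
proof -
  have p: "0 < 1 - r\<^sup>2" using assms by (simp add: abs_square_less_1)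
  have "0 \<le> (norm (r *\<^sub>R x - y))\<^sup>2" by simp
  then have "- (r\<^sup>2 * (norm x)\<^sup>2 + r\<^sup>2 * (norm y)\<^sup>2 - 2 * r * (x \<bullet> y)) \<le> (1 - r\<^sup>2) * (norm y)\<^sup>2"
    unfolding power2_norm_eq_inner
    by (simp add: inner_diff_left inner_diff_right inner_commute algebra_simps power2_eq_square)
  then have "- (r\<^sup>2 * (norm x)\<^sup>2 + r\<^sup>2 * (norm y)\<^sup>2 - 2 * r * (x \<bullet> y)) / (2 * (1 - r\<^sup>2)) \<le> (norm y)\<^sup>2 / 2"
    using p by (simp add: divide_le_eq algebra_simps)
  then show ?thesis
    unfolding mehler_def using p by (intro mult_left_mono) auto
qed

lemma normal_dens_eq_mehler:
  assumes "\<bar>r\<bar> < 1"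
  shows "normal_dens (r *\<^sub>R y) (sqrt (1 - r\<^sup>2)) x = normal_dens 0 1 x * mehler r y x"
proof -
  have p: "0 < 1 - r\<^sup>2" using assms by (simp add: abs_square_less_1)
  have e: "- (norm (x - r *\<^sub>R y))\<^sup>2 / (2 * (1 - r\<^sup>2)) =
      - (norm x)\<^sup>2 / 2 + (- (r\<^sup>2 * (norm x)\<^sup>2 + r\<^sup>2 * (norm y)\<^sup>2 - 2 * r * (x \<bullet> y)) / (2 * (1 - r\<^sup>2)))"
  proof -
    have "2 - r\<^sup>2 * 2 \<noteq> 0" using p by simp
    then show ?thesis unfolding power2_norm_eq_inner
      by (simp add: inner_diff_left inner_diff_right inner_commute divide_simps)
         (simp add: algebra_simps power2_eq_square)
  qed
  have s: "(sqrt (1 - r\<^sup>2))\<^sup>2 = 1 - r\<^sup>2" using p by simp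
  show ?thesis
    unfolding normal_dens_def mehler_def s e exp_add
    by (simp add: real_sqrt_mult power_divide power_mult_distrib)
qed

lemma distr_std_gauss_mehler:
  assumes "\<bar>r\<bar> < 1"
  shows "distr \<gamma> borel (\<lambda>z. r *\<^sub>R y + sqrt (1 - r\<^sup>2) *\<^sub>R z) = density \<gamma> (\<lambda>x. ennreal (mehler r y x))"
proof -
  have "0 < sqrt (1 - r\<^sup>2)" using assms by (simp add: abs_square_less_1)
  from distr_std_gauss_affine[OF this, of "r *\<^sub>R y"] show ?thesis
    unfolding std_gauss_eq using assms
    by (subst density_density_eq) (simp_all add: normal_dens_eq_mehler ennreal_mult)
qed

section \<open>Smooth functions\<close>

definition smooth :: "('a::euclidean_space \<Rightarrow> real) \<Rightarrow> bool" where
  "smooth f \<longleftrightarrow> (\<forall>k. continuously_differentiable k f)"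

lemma continuously_differentiable_const: "continuously_differentiable k (\<lambda>x. c)"
  by (induction k arbitrary: c) auto

lemma continuously_differentiable_Suc_D:
  "continuously_differentiable (Suc k) f \<Longrightarrow> continuously_differentiable k f"
  by (induction k arbitrary: f) (auto dest: differentiable_imp_continuous_on)

lemma continuously_differentiable_SucI:
  assumes "\<And>x. (f has_derivative D x) (at x)"
    and "\<And>i. i \<in> Basis \<Longrightarrow> continuously_differentiable k (\<lambda>x. D x i)"
  shows "continuously_differentiable (Suc k) f"
proof -
  have "frechet_derivative f (at x) = D x" for x
    using frechet_derivative_at[OF assms(1)] by simp
  then show ?thesis using assms
    by (auto simp: differentiable_on_def intro: differentiableI differentiable_at_withinI)
qed

lemma continuously_differentiable_Suc_has_derivative:
  "continuously_differentiable (Suc k) f \<Longrightarrow> (f has_derivative frechet_derivative f (at x)) (at x)"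
  by (auto simp: differentiable_on_def frechet_derivative_works)

lemma continuously_differentiable_add:
  "continuously_differentiable k f \<Longrightarrow> continuously_differentiable k g \<Longrightarrow>
   continuously_differentiable k (\<lambda>x. f x + g x)"
proof (induction k arbitrary: f g)
  case 0 then show ?case by (auto intro: continuous_intros)
next
  case (Suc k)
  show ?case
    by (rule continuously_differentiable_SucI[where D = "\<lambda>x v. frechet_derivative f (at x) v + frechet_derivative g (at x) v"])
       (use Suc continuously_differentiable_Suc_has_derivative[OF Suc.prems(1)]
          continuously_differentiable_Suc_has_derivative[OF Suc.prems(2)] in \<open>auto intro: has_derivative_add\<close>)
qed

lemma continuously_differentiable_mult:
  "continuously_differentiable k f \<Longrightarrow> continuously_differentiable k g \<Longrightarrow>
   continuously_differentiable k (\<lambda>x. f x * g x)"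
proof (induction k arbitrary: f g)
  case 0 then show ?case by (auto intro: continuous_intros)
next
  case (Suc k)
  show ?case
    by (rule continuously_differentiable_SucI[where D = "\<lambda>x v. f x * frechet_derivative g (at x) v + frechet_derivative f (at x) v * g x"])
       (use Suc continuously_differentiable_Suc_has_derivative[OF Suc.prems(1)]
          continuously_differentiable_Suc_has_derivative[OF Suc.prems(2)]
          continuously_differentiable_Suc_D[OF Suc.prems(1)] continuously_differentiable_Suc_D[OF Suc.prems(2)] 
        in \<open>auto intro: has_derivative_mult continuously_differentiable_add\<close>)
qed

lemma smooth_mult: "smooth f \<Longrightarrow> smooth g \<Longrightarrow> smooth (\<lambda>x. f x * g x)"
  by (simp add: smooth_def continuously_differentiable_mult)

text \<open>
  The outer function comes as the sequence of all its derivatives, so that the induction on the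
  order can move along the sequence.
\<close>

lemma continuously_differentiable_compose:
  fixes h :: "nat \<Rightarrow> real \<Rightarrow> real"
  assumes h: "\<And>m x. (h m has_real_derivative h (Suc m) x) (at x)"
  shows "continuously_differentiable k f \<Longrightarrow> continuously_differentiable k (\<lambda>x. h m (f x))"
proof (induction k arbitrary: f m)
  case 0
  have "continuous_on UNIV (h m)" using h by (auto intro: DERIV_isCont continuous_at_imp_continuous_on)
  with 0 show ?case by (auto intro: continuous_on_compose2)
next
  case (Suc k)
  show ?case
  proof (rule continuously_differentiable_SucI[where D = "\<lambda>x v. h (Suc m) (f x) * frechet_derivative f (at x) v"])
    show "((\<lambda>x. h m (f x)) has_derivative (\<lambda>v. h (Suc m) (f x) * frechet_derivative f (at x) v)) (at x)" for x
      using has_derivative_compose[OF continuously_differentiable_Suc_has_derivative[OF Suc.prems]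
          h[unfolded has_field_derivative_def]] by simp
    show "continuously_differentiable k (\<lambda>x. h (Suc m) (f x) * frechet_derivative f (at x) i)" if "i \<in> Basis" for i
      using Suc.prems that
      by (intro continuously_differentiable_mult Suc.IH continuously_differentiable_Suc_D[OF Suc.prems]) auto
  qed
qed

lemma smooth_compose:
  assumes "\<And>m x. (h m has_real_derivative h (Suc m) x) (at x)" and "smooth f"
  shows "smooth (\<lambda>x. h m (f x))"
  using assms by (simp add: smooth_def continuously_differentiable_compose)

lemma smooth_quadratic: "smooth (\<lambda>x. a + b \<bullet> x + c * (x \<bullet> x))"
proof -
  have "continuously_differentiable k (\<lambda>x. a + b \<bullet> x + c * (x \<bullet> x))" for k
  proof (induction k arbitrary: a b c)
    case 0 then show ?case by (auto intro!: continuous_intros)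
  next
    case (Suc k)
    show ?case
    proof (rule continuously_differentiable_SucI[where D = "\<lambda>x v. b \<bullet> v + 2 * c * (x \<bullet> v)"])
      show "((\<lambda>x. a + b \<bullet> x + c * (x \<bullet> x)) has_derivative (\<lambda>v. b \<bullet> v + 2 * c * (x \<bullet> v))) (at x)" for x
        by (auto intro!: derivative_eq_intros simp: inner_commute algebra_simps)
      show "continuously_differentiable k (\<lambda>x. b \<bullet> i + 2 * c * (x \<bullet> i))" for i
        using Suc[of "b \<bullet> i" "(2 * c) *\<^sub>R i" 0] by (simp add: inner_commute)
    qed
  qed
  then show ?thesis by (simp add: smooth_def)
qed

lemma smooth_exp: "smooth f \<Longrightarrow> smooth (\<lambda>x. exp (f x))"
  by (rule smooth_compose[of "\<lambda>_. exp"]) (auto intro: DERIV_exp)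

text \<open>
  On the positive axis, the \<open>m\<close>-th derivative of \<open>exp (- 1 / t)\<close> is \<open>exp (- 1 / t)\<close> times the polynomial
  \<open>bump_poly m\<close> in \<open>1 / t\<close>.
\<close>

primrec bump_poly :: "nat \<Rightarrow> real poly" where
  "bump_poly 0 = 1"
| "bump_poly (Suc m) = [:0, 0, 1:] * (bump_poly m - pderiv (bump_poly m))"

text \<open>
  All derivatives of the function that is \<open>exp (- 1 / t)\<close> for positive \<open>t\<close> and 0 elsewhere.
\<close>

definition bump_deriv :: "nat \<Rightarrow> real \<Rightarrow> real" where
  "bump_deriv m t = (if t \<le> 0 then 0 else poly (bump_poly m) (1 / t) * exp (- (1 / t)))"

lemma poly_times_exp_tendsto_0: "((\<lambda>u. poly p u * exp (- u)) \<longlongrightarrow> 0) at_top" for p :: "real poly"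
proof -
  have "((\<lambda>u. \<Sum>i\<le>degree p. coeff p i * (u ^ i / exp u)) \<longlongrightarrow> (\<Sum>i\<le>degree p. coeff p i * 0)) at_top"
    by (intro tendsto_intros tendsto_power_div_exp_0)
  moreover have "(\<Sum>i\<le>degree p. coeff p i * (u ^ i / exp u)) = poly p u * exp (- u)" for u
    by (simp add: poly_altdef sum_distrib_right exp_minus divide_inverse mult.assoc)
  ultimately show ?thesis by simp
qed

lemma bump_deriv_has_derivative: "(bump_deriv m has_real_derivative bump_deriv (Suc m) t) (at t)"
proof -
  consider "t < 0" | "t > 0" | "t = 0" by linarith
  then show ?thesis
  proof cases
    case 1
    have "((\<lambda>_. 0) has_real_derivative 0) (at t)" by simp
    then show ?thesis
    proof (rule DERIV_cong_ev[THEN iffD1, rotated -1])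
      show "\<forall>\<^sub>F x in nhds t. 0 = bump_deriv m x"
        using eventually_nhds_in_open[of "{..<0}" t] 1 by (auto elim!: eventually_mono simp: bump_deriv_def)
    qed (use 1 in \<open>auto simp: bump_deriv_def\<close>)
  next
    case 2
    have "((\<lambda>t. poly (bump_poly m) (1 / t) * exp (- (1 / t))) has_real_derivative bump_deriv (Suc m) t) (at t)"
      using 2
      by (auto intro!: derivative_eq_intros simp: bump_deriv_def field_simps power2_eq_square)
    then show ?thesis
    proof (rule DERIV_cong_ev[THEN iffD1, rotated -1])
      show "\<forall>\<^sub>F x in nhds t. poly (bump_poly m) (1 / x) * exp (- (1 / x)) = bump_deriv m x"
        using eventually_nhds_in_open[of "{0<..}" t] 2 by (auto elim!: eventually_mono simp: bump_deriv_def)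
    qed auto
  next
    case 3
    have "((\<lambda>h. (bump_deriv m h - 0) / h) \<longlongrightarrow> 0) (at_left 0)"
      by (rule tendsto_eventually) (auto simp: eventually_at_filter bump_deriv_def)
    moreover have "((\<lambda>h. (bump_deriv m h - 0) / h) \<longlongrightarrow> 0) (at_right 0)"
    proof -
      have "((\<lambda>h. poly (pCons 0 (bump_poly m)) (inverse h) * exp (- inverse h)) \<longlongrightarrow> 0) (at_right (0::real))"
        by (rule filterlim_compose[OF poly_times_exp_tendsto_0 filterlim_inverse_at_top_right])
      then show ?thesis
        by (rule Lim_transform_eventually) (auto simp: eventually_at_filter bump_deriv_def field_simps)
    qed
    ultimately have "((\<lambda>h. (bump_deriv m h - 0) / h) \<longlongrightarrow> 0) (at 0)"
      by (simp add: filterlim_split_at)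
    then show ?thesis using 3 by (simp add: DERIV_def bump_deriv_def)
  qed
qed

lemma smooth_bump: "smooth f \<Longrightarrow> smooth (\<lambda>x. bump_deriv m (f x))"
  by (rule smooth_compose[of bump_deriv]) (rule bump_deriv_has_derivative)

section \<open>Ornstein-Uhlenbeck averages\<close>

text \<open>
  One definition for two semigroups: \<open>r = 1\<close> gives the heat flow at time \<open>s\<^sup>2\<close>, and \<open>r\<^sup>2 + s\<^sup>2 = 1\<close> gives
  the Ornstein-Uhlenbeck semigroup, under which \<open>\<gamma>\<close> is invariant.
\<close>

definition gauss_avg :: "real \<Rightarrow> real \<Rightarrow> ('a::euclidean_space \<Rightarrow> 'b::{banach,second_countable_topology}) \<Rightarrow> 'a \<Rightarrow> 'b" where
  "gauss_avg r s f x = (\<integral>z. f (r *\<^sub>R x + s *\<^sub>R z) \<partial>\<gamma>)"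

abbreviation ou :: "real \<Rightarrow> ('a::euclidean_space \<Rightarrow> 'b::{banach,second_countable_topology}) \<Rightarrow> 'a \<Rightarrow> 'b" where
  "ou r \<equiv> gauss_avg r (sqrt (1 - r\<^sup>2))"

lemma measurable_gauss_avg [measurable]:
  assumes [measurable]: "f \<in> borel_measurable borel"
  shows "gauss_avg r s f \<in> borel_measurable borel"
  unfolding gauss_avg_def[abs_def] by measurable

lemma nn_integral_ou:
  fixes f :: "'a::euclidean_space \<Rightarrow> ennreal"
  assumes "0 \<le> r" "r \<le> 1" and [measurable]: "f \<in> borel_measurable borel"
  shows "(\<integral>\<^sup>+x. \<integral>\<^sup>+z. f (r *\<^sub>R x + sqrt (1 - r\<^sup>2) *\<^sub>R z) \<partial>\<gamma> \<partial>\<gamma>) = (\<integral>\<^sup>+z. f z \<partial>\<gamma>)"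
  using nn_integral_gauss_sum[of r "sqrt (1 - r\<^sup>2)" f] assms by (simp add: power_le_one)

lemma integrable_mult_mehler:
  fixes f :: "'a::euclidean_space \<Rightarrow> 'b::{banach,second_countable_topology}"
  assumes r: "\<bar>r\<bar> < 1" and f: "integrable \<gamma> f"
  shows "integrable \<gamma> (\<lambda>x. mehler r y x *\<^sub>R f x)"
proof -
  define B where "B = (1 / sqrt (1 - r\<^sup>2)) ^ DIM('a) * exp ((norm y)\<^sup>2 / 2)"
  have [measurable]: "f \<in> borel_measurable borel" using borel_measurable_integrable[OF f] by simp
  show ?thesis
  proof (rule Bochner_Integration.integrable_bound)
    show "integrable \<gamma> (\<lambda>x. B *\<^sub>R f x)" using f by simp
    show "AE x in \<gamma>. norm (mehler r y x *\<^sub>R f x) \<le> norm (B *\<^sub>R f x)"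
      using mehler_le[OF r, of y] mehler_nonneg[OF r, of y]
      by (intro AE_I2) (simp add: B_def mult_right_mono order_trans[OF _ abs_ge_self])
  qed simp
qed

lemma integrable_ou_inner:
  fixes f :: "'a::euclidean_space \<Rightarrow> 'b::{banach,second_countable_topology}"
  assumes r: "\<bar>r\<bar> < 1" and f: "integrable \<gamma> f"
  shows "integrable \<gamma> (\<lambda>z. f (r *\<^sub>R y + sqrt (1 - r\<^sup>2) *\<^sub>R z))"
    and ou_eq_mehler: "ou r f y = (\<integral>x. mehler r y x *\<^sub>R f x \<partial>\<gamma>)"
proof -
  have [measurable]: "f \<in> borel_measurable borel" using borel_measurable_integrable[OF f] by simp
  have "integrable (density \<gamma> (\<lambda>x. ennreal (mehler r y x))) f"
    using integrable_mult_mehler[OF r f] by (subst integrable_density) (auto simp: r)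
  then show "integrable \<gamma> (\<lambda>z. f (r *\<^sub>R y + sqrt (1 - r\<^sup>2) *\<^sub>R z))"
    unfolding distr_std_gauss_mehler[OF r, symmetric] by (subst (asm) integrable_distr_eq) auto
  have "ou r f y = (\<integral>x. f x \<partial>distr \<gamma> borel (\<lambda>z. r *\<^sub>R y + sqrt (1 - r\<^sup>2) *\<^sub>R z))"
    unfolding gauss_avg_def by (subst integral_distr) auto
  also have "\<dots> = (\<integral>x. mehler r y x *\<^sub>R f x \<partial>\<gamma>)"
    unfolding distr_std_gauss_mehler[OF r] by (subst integral_density) (auto simp: r)
  finally show "ou r f y = (\<integral>x. mehler r y x *\<^sub>R f x \<partial>\<gamma>)" .
qed

lemma (in prob_space) nn_integral_power_le:
  fixes f :: "'a \<Rightarrow> ennreal"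
  assumes [measurable]: "f \<in> borel_measurable M" and p: "p = 1 \<or> p = 2"
  shows "(\<integral>\<^sup>+x. f x \<partial>M) ^ p \<le> (\<integral>\<^sup>+x. f x ^ p \<partial>M)"
  using p Cauchy_Schwarz_nn_integral[of f M "\<lambda>_. 1"] by (auto simp: emeasure_space_1)

text \<open>
  Jensen's inequality under the average, followed by the invariance of \<open>\<gamma>\<close>.
\<close>

lemma ou_contraction:
  fixes f :: "'a::euclidean_space \<Rightarrow> real"
  assumes r: "0 \<le> r" "r < 1" and p: "p = 1 \<or> p = 2" and [measurable]: "f \<in> borel_measurable borel"
  shows "(\<integral>\<^sup>+x. ennreal (\<bar>ou r f x\<bar> ^ p) \<partial>\<gamma>) \<le> (\<integral>\<^sup>+x. ennreal (\<bar>f x\<bar> ^ p) \<partial>\<gamma>)"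
proof -
  have "ennreal (\<bar>ou r f x\<bar> ^ p) \<le> (\<integral>\<^sup>+z. ennreal (\<bar>f (r *\<^sub>R x + sqrt (1 - r\<^sup>2) *\<^sub>R z)\<bar> ^ p) \<partial>\<gamma>)" for x
  proof -
    have "ennreal \<bar>ou r f x\<bar> \<le> (\<integral>\<^sup>+z. ennreal \<bar>f (r *\<^sub>R x + sqrt (1 - r\<^sup>2) *\<^sub>R z)\<bar> \<partial>\<gamma>)"
      unfolding gauss_avg_def
      by (cases "integrable \<gamma> (\<lambda>z. f (r *\<^sub>R x + sqrt (1 - r\<^sup>2) *\<^sub>R z))")
         (auto dest: integral_norm_bound_ennreal simp: not_integrable_integral_eq)
    then have "ennreal \<bar>ou r f x\<bar> ^ p \<le> (\<integral>\<^sup>+z. ennreal \<bar>f (r *\<^sub>R x + sqrt (1 - r\<^sup>2) *\<^sub>R z)\<bar> \<partial>\<gamma>) ^ p"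
      by (rule power_mono) simp
    also have "\<dots> \<le> (\<integral>\<^sup>+z. ennreal \<bar>f (r *\<^sub>R x + sqrt (1 - r\<^sup>2) *\<^sub>R z)\<bar> ^ p \<partial>\<gamma>)"
      by (rule gauss.nn_integral_power_le[OF _ p]) simp
    finally show ?thesis by (simp add: ennreal_power)
  qed
  then have "(\<integral>\<^sup>+x. ennreal (\<bar>ou r f x\<bar> ^ p) \<partial>\<gamma>) \<le>
      (\<integral>\<^sup>+x. \<integral>\<^sup>+z. ennreal (\<bar>f (r *\<^sub>R x + sqrt (1 - r\<^sup>2) *\<^sub>R z)\<bar> ^ p) \<partial>\<gamma> \<partial>\<gamma>)"
    by (intro nn_integral_mono) auto
  also have "\<dots> = (\<integral>\<^sup>+x. ennreal (\<bar>f x\<bar> ^ p) \<partial>\<gamma>)"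
    using r by (intro nn_integral_ou) auto
  finally show ?thesis .
qed

lemma AE_std_gauss: "(AE x in lborel. P x) \<Longrightarrow> (AE x in \<gamma>. P x)"
  unfolding std_gauss_eq by (subst AE_density) auto

lemma AE_std_gauss_iff: "(AE x in \<gamma>. P x) \<longleftrightarrow> (AE x in lborel. P x)"
  unfolding std_gauss_eq by (subst AE_density) (auto simp: normal_dens_pos)

lemma bounded_nn_integral_tendsto_0:
  fixes u :: "nat \<Rightarrow> 'a::euclidean_space \<Rightarrow> real"
  assumes [measurable]: "\<And>n. u n \<in> borel_measurable borel"
    and b: "\<And>n x. \<bar>u n x\<bar> \<le> v x" and i: "integrable \<gamma> (\<lambda>x. v x ^ p)" and lim: "AE x in \<gamma>. (\<lambda>n. u n x) \<longlonglongrightarrow> 0" and p: "0 < p"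
  shows "(\<lambda>n. \<integral>\<^sup>+x. ennreal (\<bar>u n x\<bar> ^ p) \<partial>\<gamma>) \<longlonglongrightarrow> 0"
proof -
  have [measurable]: "(\<lambda>x. v x ^ p) \<in> borel_measurable borel" using borel_measurable_integrable[OF i] by simp
  have v: "0 \<le> v x" for x using b[of 0 x] by linarith
  have "(\<lambda>n. \<integral>\<^sup>+x. ennreal (\<bar>u n x\<bar> ^ p) \<partial>\<gamma>) \<longlonglongrightarrow> (\<integral>\<^sup>+x. 0 \<partial>(\<gamma> :: 'a measure))"
  proof (rule nn_integral_dominated_convergence[where w = "\<lambda>x. ennreal (v x ^ p)"])
    show "AE x in \<gamma>. (\<lambda>n. ennreal (\<bar>u n x\<bar> ^ p)) \<longlonglongrightarrow> 0"
      using lim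
    proof eventually_elim
      case (elim x)
      then have "(\<lambda>n. \<bar>u n x\<bar> ^ p) \<longlonglongrightarrow> \<bar>0\<bar> ^ p" by (intro tendsto_intros)
      from tendsto_ennrealI[OF this] p show ?case by (simp add: zero_power)
    qed
    show "AE x in \<gamma>. ennreal (\<bar>u n x\<bar> ^ p) \<le> ennreal (v x ^ p)" for n
      using b by (intro AE_I2 ennreal_leI power_mono) auto
    show "(\<integral>\<^sup>+x. ennreal (v x ^ p) \<partial>\<gamma>) < \<infinity>"
      using i by (subst nn_integral_eq_integral) (auto simp: v less_top)
  qed auto
  then show ?thesis by simp
qed

lemma add_power_le: "\<bar>a + b\<bar> ^ p \<le> 2 ^ p * (\<bar>a\<bar> ^ p + \<bar>b\<bar> ^ p)" for a b :: real
proof -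
  have "\<bar>a + b\<bar> ^ p \<le> (2 * max \<bar>a\<bar> \<bar>b\<bar>) ^ p"
    by (intro power_mono) auto
  also have "\<dots> \<le> 2 ^ p * (\<bar>a\<bar> ^ p + \<bar>b\<bar> ^ p)"
    by (simp add: power_mult_distrib max_def)
  finally show ?thesis .
qed

lemma nn_integral_add_power_le:
  fixes f g :: "'a::euclidean_space \<Rightarrow> real"
  assumes [measurable]: "f \<in> borel_measurable borel" "g \<in> borel_measurable borel"
  shows "(\<integral>\<^sup>+x. ennreal (\<bar>f x + g x\<bar> ^ p) \<partial>\<gamma>) \<le>
    2 ^ p * ((\<integral>\<^sup>+x. ennreal (\<bar>f x\<bar> ^ p) \<partial>\<gamma>) + (\<integral>\<^sup>+x. ennreal (\<bar>g x\<bar> ^ p) \<partial>\<gamma>))"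
proof -
  have "(\<integral>\<^sup>+x. ennreal (\<bar>f x + g x\<bar> ^ p) \<partial>\<gamma>) \<le>
      (\<integral>\<^sup>+x. 2 ^ p * (ennreal (\<bar>f x\<bar> ^ p) + ennreal (\<bar>g x\<bar> ^ p)) \<partial>\<gamma>)"
  proof (rule nn_integral_mono)
    fix x
    have "ennreal (\<bar>f x + g x\<bar> ^ p) \<le> ennreal (2 ^ p * (\<bar>f x\<bar> ^ p + \<bar>g x\<bar> ^ p))"
      by (intro ennreal_leI add_power_le)
    then show "ennreal (\<bar>f x + g x\<bar> ^ p) \<le> 2 ^ p * (ennreal (\<bar>f x\<bar> ^ p) + ennreal (\<bar>g x\<bar> ^ p))"
      by (simp add: ennreal_mult flip: ennreal_power)
  qed
  then show ?thesis by (simp add: nn_integral_cmult nn_integral_add)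
qed

definition bounded_continuous :: "('a::euclidean_space \<Rightarrow> real) \<Rightarrow> bool" where
  "bounded_continuous f \<longleftrightarrow> continuous_on UNIV f \<and> (\<exists>K. \<forall>x. \<bar>f x\<bar> \<le> K)"

text \<open>
  A measurable function is an almost everywhere limit of continuous functions. Truncation at a
  high level changes it little and supplies the domination.
\<close>

lemma bounded_continuous_dense:
  fixes f :: "'a::euclidean_space \<Rightarrow> real"
  assumes f: "f \<in> borel_measurable borel" and i: "integrable \<gamma> (\<lambda>x. \<bar>f x\<bar> ^ p)" and p: "0 < p" and e: "0 < (e::real)"
  shows "\<exists>g. bounded_continuous g \<and> (\<integral>\<^sup>+x. ennreal (\<bar>f x - g x\<bar> ^ p) \<partial>\<gamma>) < ennreal e"
proof -
  note [measurable] = f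
  define tr where "tr = (\<lambda>K t :: real. max (- K) (min K t))"
  have tr_le: "\<bar>tr K t\<bar> \<le> K" "\<bar>t - tr K t\<bar> \<le> \<bar>t\<bar>" if "0 \<le> K" for K t
    using that by (auto simp: tr_def)
  have [measurable]: "tr K \<in> borel_measurable borel" for K unfolding tr_def by measurable
  have tr_cont: "isCont (tr K) t" for K t
    unfolding tr_def by (intro continuous_intros)
  obtain N g where N: "negligible N" and g: "\<And>n. continuous_on UNIV (g n)"
    and lim: "\<And>x. x \<notin> N \<Longrightarrow> (\<lambda>n. g n x) \<longlonglongrightarrow> f x"
    using lebesgue_measurable_imp_measurable_on_real[of f UNIV] measurable_completion[of f lborel borel] f
    unfolding measurable_on_def by auto
  have [measurable]: "g n \<in> borel_measurable borel" for n
    using g by (rule borel_measurable_continuous_onI)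
  \<comment> \<open>Two errors of this size add up to \<open>e\<close> by \<open>add_power_le\<close>.\<close>
  define d where "d = ennreal (e / (2 * 2 ^ p))"
  have d: "0 < d" using e by (simp add: d_def)
  have "(\<lambda>n. \<integral>\<^sup>+x. ennreal (\<bar>f x - tr (real n) (f x)\<bar> ^ p) \<partial>\<gamma>) \<longlonglongrightarrow> 0"
  proof (rule bounded_nn_integral_tendsto_0[OF _ _ i _ p])
    show "AE x in \<gamma>. (\<lambda>n. f x - tr (real n) (f x)) \<longlonglongrightarrow> 0"
    proof (rule AE_I2, rule tendsto_eventually)
      fix x
      obtain m where "\<bar>f x\<bar> \<le> real m" using real_arch_simple by blast
      then show "\<forall>\<^sub>F n in sequentially. f x - tr (real n) (f x) = 0"
        by (intro eventually_sequentiallyI[of m]) (auto simp: tr_def)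
    qed
  qed (use tr_le in auto)
  then have "\<forall>\<^sub>F n in sequentially. (\<integral>\<^sup>+x. ennreal (\<bar>f x - tr (real n) (f x)\<bar> ^ p) \<partial>\<gamma>) < d"
    using d by (rule order_tendstoD(2))
  then obtain K where K: "(\<integral>\<^sup>+x. ennreal (\<bar>f x - tr (real K) (f x)\<bar> ^ p) \<partial>\<gamma>) < d"
    by (auto simp: eventually_sequentially)
  have "(\<lambda>n. \<integral>\<^sup>+x. ennreal (\<bar>tr (real K) (f x) - tr (real K) (g n x)\<bar> ^ p) \<partial>\<gamma>) \<longlonglongrightarrow> 0"
  proof (rule bounded_nn_integral_tendsto_0[of _ "\<lambda>_. 2 * real K"])
    have "AE x in lborel. x \<notin> N"
      using N by (auto simp: negligible_iff_null_sets AE_completion_iff dest: AE_not_in)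
    then show "AE x in \<gamma>. (\<lambda>n. tr (real K) (f x) - tr (real K) (g n x)) \<longlonglongrightarrow> 0"
    proof (rule AE_mp[OF AE_std_gauss], intro AE_I2 impI)
      fix x assume "x \<notin> N"
      from tendsto_diff[OF tendsto_const isCont_tendsto_compose[OF tr_cont lim[OF this]], of "tr (real K) (f x)" "real K"]
      show "(\<lambda>n. tr (real K) (f x) - tr (real K) (g n x)) \<longlonglongrightarrow> 0" by simp
    qed
    show "\<bar>tr (real K) (f x) - tr (real K) (g n x)\<bar> \<le> 2 * real K" for n x
      using tr_le(1)[of "real K" "f x"] tr_le(1)[of "real K" "g n x"] by linarith
  qed (use p in auto)
  then have "\<forall>\<^sub>F n in sequentially. (\<integral>\<^sup>+x. ennreal (\<bar>tr (real K) (f x) - tr (real K) (g n x)\<bar> ^ p) \<partial>\<gamma>) < d"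
    using d by (rule order_tendstoD(2))
  then obtain n where n: "(\<integral>\<^sup>+x. ennreal (\<bar>tr (real K) (f x) - tr (real K) (g n x)\<bar> ^ p) \<partial>\<gamma>) < d"
    by (auto simp: eventually_sequentially)
  have "(\<integral>\<^sup>+x. ennreal (\<bar>f x - tr (real K) (g n x)\<bar> ^ p) \<partial>\<gamma>) \<le>
     2 ^ p * ((\<integral>\<^sup>+x. ennreal (\<bar>f x - tr (real K) (f x)\<bar> ^ p) \<partial>\<gamma>) +
      (\<integral>\<^sup>+x. ennreal (\<bar>tr (real K) (f x) - tr (real K) (g n x)\<bar> ^ p) \<partial>\<gamma>))"
    using nn_integral_add_power_le[of "\<lambda>x. f x - tr (real K) (f x)" "\<lambda>x. tr (real K) (f x) - tr (real K) (g n x)"]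
    by simp
  also have "\<dots> < 2 ^ p * (d + d)"
  proof (intro ennreal_mult_strict_left_mono add_strict_mono K n)
    have "(2::ennreal) ^ p = ennreal (2 ^ p)" by (simp flip: ennreal_power)
    then show "0 < (2::ennreal) ^ p" by simp
  qed (auto simp: power_less_top_ennreal)
  also have "2 ^ p * (d + d) = ennreal (2 ^ p * (e / (2 * 2 ^ p) + e / (2 * 2 ^ p)))"
    unfolding d_def using e by (subst ennreal_mult) (simp_all flip: ennreal_power ennreal_plus)
  also have "2 ^ p * (e / (2 * 2 ^ p) + e / (2 * 2 ^ p)) = e" by (simp add: field_simps)
  finally show ?thesis
    using tr_le(1)[of "real K"] continuous_on_compose2[of UNIV "tr (real K)" UNIV "g n"] g tr_cont
    by (intro exI[of _ "\<lambda>x. tr (real K) (g n x)"])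
       (auto simp: bounded_continuous_def continuous_at_imp_continuous_on)
qed

lemma ou_diff:
  fixes f g :: "'a::euclidean_space \<Rightarrow> 'b::{banach,second_countable_topology}"
  assumes "\<bar>r\<bar> < 1" "integrable \<gamma> f" "integrable \<gamma> g"
  shows "ou r (\<lambda>x. f x - g x) y = ou r f y - ou r g y"
  using integrable_ou_inner[of r] assms unfolding gauss_avg_def
  by (intro Bochner_Integration.integral_diff) auto

lemma integrable_of_power:
  fixes f :: "'a::euclidean_space \<Rightarrow> real"
  assumes [measurable]: "f \<in> borel_measurable borel" and i: "integrable \<gamma> (\<lambda>x. \<bar>f x\<bar> ^ p)" and p: "p = 1 \<or> p = 2"
  shows "integrable \<gamma> f"
proof (rule Bochner_Integration.integrable_bound)
  show "integrable \<gamma> (\<lambda>x. 1 + \<bar>f x\<bar> ^ p)" using i by simp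
  show "AE x in \<gamma>. norm (f x) \<le> norm (1 + \<bar>f x\<bar> ^ p)"
  proof (rule AE_I2)
    fix x
    have "2 * \<bar>f x\<bar> \<le> 1 + \<bar>f x\<bar>\<^sup>2" using sum_squares_ge_zero[of "\<bar>f x\<bar> - 1" 0] by (simp add: power2_eq_square algebra_simps)
    then show "norm (f x) \<le> norm (1 + \<bar>f x\<bar> ^ p)" using p by auto
  qed
qed simp

lemma bounded_continuous_integrable:
  assumes "bounded_continuous g" shows "g \<in> borel_measurable borel" "integrable \<gamma> g"
proof -
  show m: "g \<in> borel_measurable borel"
    using assms by (auto simp: bounded_continuous_def intro: borel_measurable_continuous_onI)
  obtain K where "\<And>x. \<bar>g x\<bar> \<le> K" using assms by (auto simp: bounded_continuous_def)
  then show "integrable \<gamma> g" using m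
    by (intro gauss.integrable_const_bound[of _ K]) auto
qed

lemma ou_tendsto_bounded_continuous:
  fixes g :: "'a::euclidean_space \<Rightarrow> real"
  assumes g: "bounded_continuous g" and r: "r \<longlonglongrightarrow> 1"
  shows "(\<lambda>k. ou (r k) g x) \<longlonglongrightarrow> g x"
proof -
  note [measurable] = bounded_continuous_integrable(1)[OF g]
  obtain K where K: "\<And>x. \<bar>g x\<bar> \<le> K" using g by (auto simp: bounded_continuous_def)
  have c: "isCont g x" for x using g by (simp add: bounded_continuous_def continuous_on_eq_continuous_at)
  have "(\<lambda>k. \<integral>z. g (r k *\<^sub>R x + sqrt (1 - (r k)\<^sup>2) *\<^sub>R z) \<partial>\<gamma>) \<longlonglongrightarrow> (\<integral>z. g x \<partial>(\<gamma> :: 'a measure))"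
  proof (rule integral_dominated_convergence[where w = "\<lambda>_. K"])
    show "AE z in \<gamma>. (\<lambda>k. g (r k *\<^sub>R x + sqrt (1 - (r k)\<^sup>2) *\<^sub>R z)) \<longlonglongrightarrow> g x"
    proof (rule AE_I2, rule isCont_tendsto_compose[OF c])
      fix z
      have "(\<lambda>k. r k *\<^sub>R x + sqrt (1 - (r k)\<^sup>2) *\<^sub>R z) \<longlonglongrightarrow> 1 *\<^sub>R x + sqrt (1 - 1\<^sup>2) *\<^sub>R z"
        by (intro tendsto_intros r)
      then show "(\<lambda>k. r k *\<^sub>R x + sqrt (1 - (r k)\<^sup>2) *\<^sub>R z) \<longlonglongrightarrow> x" by simp
    qed
  qed (use K in auto)
  then show ?thesis by (simp add: gauss_avg_def)
qed

text \<open>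
  By contractivity it is enough to treat bounded continuous functions, where the averages
  converge pointwise. The case \<open>p = 2\<close> serves the approximation of Sobolev functions, the case \<open>p = 1\<close> the
  uniqueness of weak gradients.
\<close>

lemma ou_tendsto_Lp:
  fixes f :: "'a::euclidean_space \<Rightarrow> real"
  assumes f: "f \<in> borel_measurable borel" and i: "integrable \<gamma> (\<lambda>x. \<bar>f x\<bar> ^ p)" and p: "p = 1 \<or> p = 2"
    and r: "\<And>k. 0 \<le> r k" "\<And>k. r k < 1" "r \<longlonglongrightarrow> 1"
  shows "(\<lambda>k. \<integral>\<^sup>+x. ennreal (\<bar>ou (r k) f x - f x\<bar> ^ p) \<partial>\<gamma>) \<longlonglongrightarrow> 0"
proof (rule order_tendstoI)
  note [measurable] = f
  have p0: "0 < p" using p by auto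
  have fi: "integrable \<gamma> f" by (rule integrable_of_power[OF f i p])
  fix e :: ennreal assume "0 < e"
  then obtain e0 where e0: "0 < e0" "e0 < e" using dense by blast
  then obtain e' where "e0 = ennreal e'" "0 \<le> e'" by (cases e0) auto
  with e0 have e': "0 < e'" "ennreal e' < e" by auto
  \<comment> \<open>Two applications of \<open>add_power_le\<close> give at most \<open>3 * 4 ^ p * d\<close>.\<close>
  define d where "d = e' / (4 * 4 ^ p)"
  have d: "0 < d" using e' by (simp add: d_def)
  obtain g where g: "bounded_continuous g" and gd: "(\<integral>\<^sup>+x. ennreal (\<bar>f x - g x\<bar> ^ p) \<partial>\<gamma>) < ennreal d"
    using bounded_continuous_dense[OF f i p0 d] by blast
  note [measurable] = bounded_continuous_integrable(1)[OF g]
  obtain K where K: "\<And>x. \<bar>g x\<bar> \<le> K" using g by (auto simp: bounded_continuous_def)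
  have ouK: "\<bar>ou s g x\<bar> \<le> K" for s x
  proof -
    have "\<bar>ou s g x\<bar> \<le> (\<integral>z. \<bar>g (s *\<^sub>R x + sqrt (1 - s\<^sup>2) *\<^sub>R z)\<bar> \<partial>\<gamma>)"
      unfolding gauss_avg_def by (rule integral_abs_bound)
    also have "\<dots> \<le> (\<integral>(z::'a). K \<partial>\<gamma>)"
      by (rule integral_mono) (use K in \<open>auto intro!: gauss.integrable_const_bound[of _ K]\<close>)
    finally show ?thesis by simp
  qed
  have "(\<lambda>k. \<integral>\<^sup>+x. ennreal (\<bar>ou (r k) g x - g x\<bar> ^ p) \<partial>\<gamma>) \<longlonglongrightarrow> 0"
  proof (rule bounded_nn_integral_tendsto_0[of _ "\<lambda>_. 2 * K"])
    show "\<bar>ou (r n) g x - g x\<bar> \<le> 2 * K" for n x using ouK[of "r n" x] K[of x] by linarith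
    show "AE x in \<gamma>. (\<lambda>n. ou (r n) g x - g x) \<longlonglongrightarrow> 0"
      by (intro AE_I2 LIM_zero ou_tendsto_bounded_continuous[OF g r(3)])
  qed (use p0 in auto)
  then have "\<forall>\<^sub>F k in sequentially. (\<integral>\<^sup>+x. ennreal (\<bar>ou (r k) g x - g x\<bar> ^ p) \<partial>\<gamma>) < ennreal d"
    using d by (intro order_tendstoD(2)) auto
  then show "\<forall>\<^sub>F k in sequentially. (\<integral>\<^sup>+x. ennreal (\<bar>ou (r k) f x - f x\<bar> ^ p) \<partial>\<gamma>) < e"
  proof eventually_elim
    case (elim k)
    have "(\<integral>\<^sup>+x. ennreal (\<bar>ou (r k) f x - f x\<bar> ^ p) \<partial>\<gamma>) \<le>
      2 ^ p * ((\<integral>\<^sup>+x. ennreal (\<bar>ou (r k) (\<lambda>x. f x - g x) x\<bar> ^ p) \<partial>\<gamma>) +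
        (\<integral>\<^sup>+x. ennreal (\<bar>(ou (r k) g x - g x) + (g x - f x)\<bar> ^ p) \<partial>\<gamma>))"
      using nn_integral_add_power_le[of "ou (r k) (\<lambda>x. f x - g x)" "\<lambda>x. (ou (r k) g x - g x) + (g x - f x)" p]
        r(1,2)[of k] fi bounded_continuous_integrable(2)[OF g] by (simp add: ou_diff)
    also have "\<dots> \<le> 2 ^ p * (ennreal d + 2 ^ p * (ennreal d + ennreal d))"
    proof (intro mult_left_mono add_mono)
      show "(\<integral>\<^sup>+x. ennreal (\<bar>ou (r k) (\<lambda>x. f x - g x) x\<bar> ^ p) \<partial>\<gamma>) \<le> ennreal d"
        using ou_contraction[of "r k" p "\<lambda>x. f x - g x"] r(1,2)[of k] p gd by simp
      have "(\<integral>\<^sup>+x. ennreal (\<bar>(ou (r k) g x - g x) + (g x - f x)\<bar> ^ p) \<partial>\<gamma>) \<le>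
         2 ^ p * ((\<integral>\<^sup>+x. ennreal (\<bar>ou (r k) g x - g x\<bar> ^ p) \<partial>\<gamma>) + (\<integral>\<^sup>+x. ennreal (\<bar>g x - f x\<bar> ^ p) \<partial>\<gamma>))"
        by (rule nn_integral_add_power_le) auto
      also have "\<dots> \<le> 2 ^ p * (ennreal d + ennreal d)"
        using elim gd by (intro mult_left_mono add_mono) (auto simp: abs_minus_commute)
      finally show "(\<integral>\<^sup>+x. ennreal (\<bar>(ou (r k) g x - g x) + (g x - f x)\<bar> ^ p) \<partial>\<gamma>) \<le> 2 ^ p * (ennreal d + ennreal d)" .
    qed auto
    also have "2 ^ p * (ennreal d + 2 ^ p * (ennreal d + ennreal d)) = ennreal (2 ^ p * (d + 2 ^ p * (d + d)))"
    proof -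
      have P: "(2::ennreal) ^ p = ennreal (2 ^ p)" by (simp flip: ennreal_power)
      show ?thesis
        by (simp only: P ennreal_mult[symmetric] ennreal_plus[symmetric] add_nonneg_nonneg
            mult_nonneg_nonneg zero_le_power zero_le_numeral less_imp_le[OF d])
    qed
    also have "\<dots> \<le> ennreal e'"
    proof (rule ennreal_leI)
      have "(1::real) \<le> 2 ^ p" by simp
      then have "2 ^ p * (d + 2 ^ p * (d + d)) \<le> 2 ^ p * (2 ^ p * d + 2 ^ p * (d + d))"
        using d by (intro mult_left_mono add_mono) auto
      also have "\<dots> = 3 * (4 ^ p * d)" by (simp add: algebra_simps power_mult_distrib[symmetric])
      also have "\<dots> \<le> e'" using e' by (simp add: d_def)
      finally show "2 ^ p * (d + 2 ^ p * (d + d)) \<le> e'" .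
    qed
    finally show ?case using e'(2) by (rule le_less_trans)
  qed
qed (simp add: not_less)

section \<open>Weak gradients tested against Gaussian kernels\<close>

text \<open>
  A bounded function with bounded gradient \<open>F\<close> and a uniform second order Taylor bound. In this form the
  class is visibly closed under Gaussian averages, with no differentiation under the integral.
\<close>

definition C11 :: "real \<Rightarrow> ('a::euclidean_space \<Rightarrow> real) \<Rightarrow> ('a \<Rightarrow> 'a) \<Rightarrow> bool" where
  "C11 L f F \<longleftrightarrow> f \<in> borel_measurable borel \<and> F \<in> borel_measurable borel \<and>
    (\<forall>x. \<bar>f x\<bar> \<le> L) \<and> (\<forall>x. norm (F x) \<le> L) \<and>
    (\<forall>x v. \<bar>f (x + v) - f x - F x \<bullet> v\<bar> \<le> L * (norm v)\<^sup>2)"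

lemma times_exp_neg_le: "u * exp (- (u / 2)) \<le> 2" for u :: real
proof -
  have "u / 2 \<le> exp (u / 2)" using exp_ge_add_one_self[of "u/2"] by linarith
  then have "u / 2 * exp (- (u / 2)) \<le> exp (u / 2) * exp (- (u / 2))" by (intro mult_right_mono) auto
  then show ?thesis by (simp add: mult_exp_exp)
qed

text \<open>
  The second derivative along a line is the kernel times a quadratic polynomial in the position,
  hence bounded uniformly in \<open>z\<close>.
\<close>

lemma gauss_kernel_taylor:
  fixes z v :: "'a::euclidean_space"
  assumes s: "0 < (c::real)"
  defines "k \<equiv> \<lambda>z. exp (- ((norm z)\<^sup>2 / (2 * c)))"
  shows "\<bar>k (z + v) - k z + (z \<bullet> v) / c * k z\<bar> \<le> 3 / c * (norm v)\<^sup>2"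
proof -
  define p where "p t = ((z + t *\<^sub>R v) \<bullet> v) / c" for t :: real
  define d where "d m t = (if m = 0 then k (z + t *\<^sub>R v) else if m = 1 then - p t * k (z + t *\<^sub>R v)
      else ((p t)\<^sup>2 - (norm v)\<^sup>2 / c) * k (z + t *\<^sub>R v))" for m :: nat and t
  have k_deriv: "((\<lambda>t. k (z + t *\<^sub>R v)) has_real_derivative - p t * k (z + t *\<^sub>R v)) (at t)" for t
    unfolding k_def p_def power2_norm_eq_inner
    using s by (auto intro!: derivative_eq_intros simp: has_field_derivative_def inner_commute field_simps inner_add_left inner_add_right)
  have p_deriv: "(p has_real_derivative (norm v)\<^sup>2 / c) (at t)" for t
    unfolding p_def power2_norm_eq_inner inner_add_left inner_scaleR_left using s
    by (auto intro!: derivative_eq_intros)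
  have "\<exists>t>0. t \<le> 1 \<and> d 0 1 = (\<Sum>m<2. d m 0 / fact m * 1 ^ m) + d 2 t / fact 2 * 1 ^ 2"
  proof (rule Maclaurin2)
    show "\<forall>m t. m < 2 \<and> 0 \<le> t \<and> t \<le> 1 \<longrightarrow> (d m has_real_derivative d (Suc m) t) (at t)"
    proof (intro allI impI)
      fix m :: nat and t :: real assume "m < 2 \<and> 0 \<le> t \<and> t \<le> 1"
      then consider "m = 0" | "m = 1" by linarith
      then show "(d m has_real_derivative d (Suc m) t) (at t)"
      proof cases
        case 1 then show ?thesis using k_deriv by (simp add: d_def[abs_def])
      next
        case 2
        have "((\<lambda>t. - p t * k (z + t *\<^sub>R v)) has_real_derivative
           - ((norm v)\<^sup>2 / c) * k (z + t *\<^sub>R v) + (- p t * k (z + t *\<^sub>R v)) * (- p t)) (at t)"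
          by (rule DERIV_mult[OF DERIV_minus[OF p_deriv] k_deriv])
        then show ?thesis using 2 by (simp add: d_def[abs_def] algebra_simps power2_eq_square)
      qed
    qed
  qed auto
  then obtain t where t: "d 0 1 = (\<Sum>m<2. d m 0 / fact m * 1 ^ m) + d 2 t / fact 2 * 1 ^ 2" by blast
  have eq: "k (z + v) - k z + (z \<bullet> v) / c * k z = d 2 t / 2"
    using t by (simp add: d_def p_def numeral_2_eq_2)
  have "\<bar>d 2 t\<bar> \<le> 3 / c * (norm v)\<^sup>2"
  proof -
    define u where "u = (norm (z + t *\<^sub>R v))\<^sup>2 / c"
    have k1: "k (z + t *\<^sub>R v) \<le> 1" "0 \<le> k (z + t *\<^sub>R v)" using s by (auto simp: k_def)
    have ku: "k (z + t *\<^sub>R v) = exp (- (u / 2))" by (simp add: k_def u_def)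
    have "(p t)\<^sup>2 \<le> u * ((norm v)\<^sup>2 / c)"
      using inner_sq_le[of "z + t *\<^sub>R v" v] s by (simp add: p_def u_def power_divide power2_eq_square divide_right_mono)
    then have "(p t)\<^sup>2 * k (z + t *\<^sub>R v) \<le> u * ((norm v)\<^sup>2 / c) * k (z + t *\<^sub>R v)"
      using k1 by (intro mult_right_mono)
    also have "\<dots> = (u * exp (- (u / 2))) * ((norm v)\<^sup>2 / c)" by (simp add: ku)
    also have "\<dots> \<le> 2 * ((norm v)\<^sup>2 / c)" using times_exp_neg_le s by (intro mult_right_mono) auto
    finally have 1: "(p t)\<^sup>2 * k (z + t *\<^sub>R v) \<le> 2 * ((norm v)\<^sup>2 / c)" .
    have 2: "(norm v)\<^sup>2 / c * k (z + t *\<^sub>R v) \<le> (norm v)\<^sup>2 / c"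
      using k1 s by (intro mult_left_le) auto
    have 3: "0 \<le> (p t)\<^sup>2 * k (z + t *\<^sub>R v)" "0 \<le> (norm v)\<^sup>2 / c * k (z + t *\<^sub>R v)" using k1 s by auto
    have "d 2 t = (p t)\<^sup>2 * k (z + t *\<^sub>R v) - (norm v)\<^sup>2 / c * k (z + t *\<^sub>R v)"
      by (simp add: d_def left_diff_distrib)
    with 1 2 3 show ?thesis by (simp add: abs_le_iff)
  qed
  then show ?thesis unfolding eq by simp
qed

text \<open>
  The factor \<open>exp 1\<close> makes the value at the origin equal to 1. As \<open>R\<close> grows the functions converge to 1,
  and their gradients are of order \<open>1 / R\<close>.
\<close>

definition cutoff :: "real \<Rightarrow> 'a::euclidean_space \<Rightarrow> real" where
  "cutoff R x = exp 1 * bump_deriv 0 (1 - (norm x)\<^sup>2 / R\<^sup>2)"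

definition cutoff_grad :: "real \<Rightarrow> 'a::euclidean_space \<Rightarrow> 'a" where
  "cutoff_grad R x = (- (2 * exp 1 / R\<^sup>2) * bump_deriv 1 (1 - (norm x)\<^sup>2 / R\<^sup>2)) *\<^sub>R x"

lemma smooth_cutoff: "smooth (cutoff R)"
proof -
  have eq: "cutoff R = (\<lambda>x. (exp 1 + 0 \<bullet> x + 0 * (x \<bullet> x)) * bump_deriv 0 (1 + 0 \<bullet> x + (- 1 / R\<^sup>2) * (x \<bullet> x)))"
    by (simp add: cutoff_def fun_eq_iff power2_norm_eq_inner)
  show ?thesis
    by (subst eq) (intro smooth_mult smooth_bump smooth_quadratic)
qed

lemma has_derivative_cutoff:
  "(cutoff R has_derivative (\<lambda>v. cutoff_grad R x \<bullet> v)) (at x)"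
proof -
  have "((\<lambda>x. 1 - (norm x)\<^sup>2 / R\<^sup>2) has_derivative (\<lambda>v. - (2 * (x \<bullet> v) / R\<^sup>2))) (at x)"
    unfolding power2_norm_eq_inner divide_inverse
    by (auto intro!: derivative_eq_intros simp: inner_commute)
  from has_derivative_compose[OF this bump_deriv_has_derivative[of 0, unfolded has_field_derivative_def]]
  show ?thesis unfolding cutoff_def[abs_def] cutoff_grad_def
    by (auto intro!: derivative_eq_intros simp: algebra_simps)
qed

lemma bump_deriv_0_bounds: "0 \<le> bump_deriv 0 t" "t \<le> 1 \<Longrightarrow> exp 1 * bump_deriv 0 t \<le> 1"
  by (auto simp: bump_deriv_def mult_exp_exp)

lemma bump_deriv_1_bound: "\<bar>bump_deriv 1 t\<bar> \<le> 2"
proof (cases "t \<le> 0")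
  case False
  define u where "u = 1 / t"
  have u: "0 < u" using False by (simp add: u_def)
  have "u\<^sup>2 \<le> 2 * exp u" using power_le_fact_exp[of u 2] u by simp
  then have "u\<^sup>2 * exp (- u) \<le> 2 * exp u * exp (- u)" by (intro mult_right_mono) auto
  also have "2 * exp u * exp (- u) = 2" by (simp add: exp_minus)
  finally show ?thesis using False u by (simp add: bump_deriv_def u_def[symmetric] power2_eq_square)
qed (simp add: bump_deriv_def)

lemma cutoff_bounds: "0 \<le> cutoff R x" "cutoff R x \<le> 1"
  using bump_deriv_0_bounds by (auto simp: cutoff_def)

lemma cutoff_eq_0: "0 < R \<Longrightarrow> R \<le> norm x \<Longrightarrow> cutoff R x = 0"
  using power_mono[of R "norm x" 2] by (simp add: cutoff_def bump_deriv_def)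

lemma cutoff_times_le: "0 < R \<Longrightarrow> 0 \<le> t \<Longrightarrow> \<bar>cutoff R x\<bar> * t \<le> (if norm x < R then 1 * t else 0)"
  using cutoff_bounds[of R x] cutoff_eq_0[of R x] by (auto intro: mult_left_le_one_le)

lemma cutoff_grad_eq_0: "0 < R \<Longrightarrow> R \<le> norm x \<Longrightarrow> cutoff_grad R x = 0"
  using power_mono[of R "norm x" 2] by (simp add: cutoff_grad_def bump_deriv_def)

lemma norm_cutoff_grad_le: assumes "0 < R" shows "norm (cutoff_grad R x) \<le> 4 * exp 1 / R"
proof (cases "R \<le> norm x")
  case True then show ?thesis using assms by (simp add: cutoff_grad_eq_0)
next
  case False
  have "norm (cutoff_grad R x) = (2 * exp 1 / R\<^sup>2) * \<bar>bump_deriv 1 (1 - (norm x)\<^sup>2 / R\<^sup>2)\<bar> * norm x"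
    by (simp add: cutoff_grad_def abs_mult)
  also have "\<dots> \<le> (2 * exp 1 / R\<^sup>2) * 2 * R"
    using False bump_deriv_1_bound assms by (intro mult_mono) auto
  also have "\<dots> = 4 * exp 1 / R" using assms by (simp add: power2_eq_square)
  finally show ?thesis .
qed

lemma measurable_cutoff [measurable]: "cutoff R \<in> borel_measurable borel" "cutoff_grad R \<in> borel_measurable borel"
proof -
  have [measurable]: "bump_deriv m \<in> borel_measurable borel" for m
    using bump_deriv_has_derivative
    by (auto intro!: borel_measurable_continuous_onI continuous_at_imp_continuous_on DERIV_isCont)
  show "cutoff R \<in> borel_measurable borel" "cutoff_grad R \<in> borel_measurable borel"
    unfolding cutoff_def[abs_def] cutoff_grad_def[abs_def] by measurable
qed

lemma cutoff_tendsto_1: "(\<lambda>n. cutoff (real n + 1) x) \<longlonglongrightarrow> 1"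
proof -
  have "(\<lambda>n. exp 1 * bump_deriv 0 (1 - (norm x)\<^sup>2 / (real n + 1)\<^sup>2)) \<longlonglongrightarrow> exp 1 * bump_deriv 0 1"
    by (intro tendsto_mult tendsto_const isCont_tendsto_compose[OF DERIV_isCont[OF bump_deriv_has_derivative]]) real_asymp
  then show ?thesis by (simp add: cutoff_def bump_deriv_def mult_exp_exp)
qed

lemma test_function_mult_cutoff:
  fixes f :: "'a::euclidean_space \<Rightarrow> real"
  assumes "smooth f" "0 < R"
  shows "test_function (\<lambda>y. f y * cutoff R y)"
proof -
  have "norm y \<le> R" if "cutoff R y \<noteq> 0" for y :: 'a
    using that cutoff_eq_0[OF assms(2), of y] by (cases "R \<le> norm y") auto
  then have "closure {y. f y * cutoff R y \<noteq> 0} \<subseteq> cball (0::'a) R"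
    by (intro closure_minimal) auto
  then have "compact (closure {y. f y * cutoff R y \<noteq> 0})"
    by (meson bounded_cball bounded_subset closed_closure compact_eq_bounded_closed)
  then show ?thesis
    using smooth_mult[OF assms(1) smooth_cutoff[of R]] by (simp add: test_function_def smooth_def)
qed

text \<open>
  A Gaussian kernel has full support and is no test function, but an integrable function with
  bounded support may still be tested against it. The factor of \<open>w y\<close> is the derivative of the kernel
  with respect to \<open>y\<close> in direction \<open>v\<close>.
\<close>

definition gauss_weak_gradient :: "('a::euclidean_space \<Rightarrow> real) \<Rightarrow> ('a \<Rightarrow> 'a) \<Rightarrow> bool" where
  "gauss_weak_gradient w W \<longleftrightarrow> integrable lborel w \<and> integrable lborel W \<and>
    (\<forall>c>0. \<forall>x. \<forall>v. (LINT y|lborel. w y * (((x - y) \<bullet> v) / c * exp (- ((norm (x - y))\<^sup>2 / (2 * c)))))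
       = - (LINT y|lborel. (W y \<bullet> v) * exp (- ((norm (x - y))\<^sup>2 / (2 * c)))))"

lemma locally_integrable_cball:
  fixes g :: "'a::euclidean_space \<Rightarrow> 'b::euclidean_space" and h :: "'a \<Rightarrow> 'c::{banach,second_countable_topology}"
  assumes "locally_integrable g" and "\<And>x. norm (h x) \<le> (if norm x < R then K * norm (g x) else 0)" and [measurable]: "h \<in> borel_measurable borel"
  shows "integrable lborel h"
proof (rule Bochner_Integration.integrable_bound)
  have "set_integrable lborel (cball 0 R) g" using assms(1) by (simp add: locally_integrable_def)
  then show "integrable lborel (\<lambda>x. K *\<^sub>R (indicator (cball 0 R) x *\<^sub>R g x))"
    unfolding set_integrable_def by (rule integrable_scaleR_right)
  show "AE x in lborel. norm (h x) \<le> norm (K *\<^sub>R (indicator (cball 0 R) x *\<^sub>R g x))"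
    by (rule AE_I2, rule order_trans[OF assms(2)])
       (auto simp: indicator_def intro: mult_right_mono)
qed simp

lemma locally_integrable_measurable:
  fixes g :: "'a::euclidean_space \<Rightarrow> 'b::euclidean_space"
  assumes "locally_integrable g" shows "g \<in> borel_measurable borel"
proof (rule borel_measurable_LIMSEQ_metric)
  show "(\<lambda>x. indicator (cball 0 (real n)) x *\<^sub>R g x) \<in> borel_measurable borel" for n
    using assms compact_cball unfolding locally_integrable_def set_integrable_def
    by (metis borel_measurable_integrable measurable_lborel2)
  show "(\<lambda>n. indicator (cball 0 (real n)) x *\<^sub>R g x) \<longlonglongrightarrow> g x" for x :: 'a
  proof (rule tendsto_eventually)
    obtain m where "norm x \<le> real m" using real_arch_simple by blast
    then show "\<forall>\<^sub>F n in sequentially. indicator (cball 0 (real n)) x *\<^sub>R g x = g x"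
      by (intro eventually_sequentiallyI[of m]) auto
  qed
qed

lemma integrable_mult_bounded:
  fixes F :: "'a \<Rightarrow> real"
  assumes F: "integrable M F" and k: "k \<in> borel_measurable M" and b: "\<And>y. \<bar>k y\<bar> \<le> B"
  shows "integrable M (\<lambda>y. F y * k y)"
proof (rule Bochner_Integration.integrable_bound)
  show "integrable M (\<lambda>y. B * F y)" using F by simp
  have [measurable]: "F \<in> borel_measurable M" using F by auto
  show "(\<lambda>y. F y * k y) \<in> borel_measurable M" using k by measurable
  show "AE y in M. norm (F y * k y) \<le> norm (B * F y)"
    using mult_left_mono[OF b abs_ge_zero] abs_ge_zero[THEN order_trans[OF _ b]]
    by (intro AE_I2) (auto simp: abs_mult mult.commute)
qed

text \<open>
  A Gaussian kernel times the cut-off is a test function. The product rule splits its derivative,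
  and the term with the derivative of the cut-off becomes part of the new gradient.
\<close>

lemma gauss_weak_gradient_cutoff:
  assumes g: "has_weak_gradient g G" and R: "0 < R"
  shows "gauss_weak_gradient (\<lambda>x. cutoff R x * g x) (\<lambda>x. cutoff R x *\<^sub>R G x + g x *\<^sub>R cutoff_grad R x)"
  unfolding gauss_weak_gradient_def
proof (intro conjI allI impI)
  have lg: "locally_integrable g" and lG: "locally_integrable G"
    using g by (auto simp: has_weak_gradient_def)
  note [measurable] = locally_integrable_measurable[OF lg] locally_integrable_measurable[OF lG]
  have i1: "integrable lborel (\<lambda>x. cutoff R x * g x)"
  proof (rule locally_integrable_cball[OF lg, of _ R 1])
    show "norm (cutoff R x * g x) \<le> (if norm x < R then 1 * norm (g x) else 0)" for x
      using cutoff_times_le[OF R norm_ge_zero, of x "g x"] by (simp add: abs_mult)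
  qed simp
  have i2: "integrable lborel (\<lambda>x. cutoff R x *\<^sub>R G x)"
  proof (rule locally_integrable_cball[OF lG, of _ R 1])
    show "norm (cutoff R x *\<^sub>R G x) \<le> (if norm x < R then 1 * norm (G x) else 0)" for x
      using cutoff_times_le[OF R norm_ge_zero, of x "G x"] by (simp add: abs_mult)
  qed simp
  have i3: "integrable lborel (\<lambda>x. g x *\<^sub>R cutoff_grad R x)"
  proof (rule locally_integrable_cball[OF lg, of _ R "4 * exp 1 / R"])
    show "norm (g x *\<^sub>R cutoff_grad R x) \<le> (if norm x < R then 4 * exp 1 / R * norm (g x) else 0)" for x
      using mult_right_mono[OF norm_cutoff_grad_le[OF R, of x] norm_ge_zero[of "g x"]] cutoff_grad_eq_0[OF R, of x]
      by (simp add: mult.commute)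
  qed simp
  show "integrable lborel (\<lambda>x. cutoff R x * g x)"
    "integrable lborel (\<lambda>x. cutoff R x *\<^sub>R G x + g x *\<^sub>R cutoff_grad R x)"
    using i1 i2 i3 by auto
  fix c :: real and x v :: 'a assume c: "0 < c"
  define k where "k y = exp (- ((norm (x - y))\<^sup>2 / (2 * c)))" for y
  have kb: "0 \<le> k y" "k y \<le> 1" for y using c by (auto simp: k_def)
  have [measurable]: "k \<in> borel_measurable borel" unfolding k_def[abs_def] by measurable
  have ks: "smooth k"
  proof -
    have "k = (\<lambda>y. exp (- (x \<bullet> x) / (2 * c) + (x /\<^sub>R c) \<bullet> y + (- 1 / (2 * c)) * (y \<bullet> y)))"
      using c by (simp add: k_def fun_eq_iff power2_norm_eq_inner inner_diff_left inner_diff_right inner_commute field_simps)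
    then show ?thesis by (simp only: smooth_exp smooth_quadratic)
  qed
  have kd: "(k has_derivative (\<lambda>v. ((x - y) \<bullet> v) / c * k y)) (at y)" for y
    unfolding k_def power2_norm_eq_inner using c
    by (auto intro!: derivative_eq_intros simp: inner_commute inner_diff_left inner_diff_right field_simps)
  have fd: "frechet_derivative (\<lambda>y. k y * cutoff R y) (at y) = (\<lambda>v. k y * (cutoff_grad R y \<bullet> v) + ((x - y) \<bullet> v) / c * k y * cutoff R y)" for y
    by (rule frechet_derivative_at[symmetric]) (rule has_derivative_mult[OF kd has_derivative_cutoff])
  have eqB: "(LINT y|lborel. (cutoff R y * g y) * (((x - y) \<bullet> i) / c * k y))
       = - (LINT y|lborel. ((cutoff R y *\<^sub>R G y + g y *\<^sub>R cutoff_grad R y) \<bullet> i) * k y)" 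
    and iB: "integrable lborel (\<lambda>y. (cutoff R y * g y) * (((x - y) \<bullet> i) / c * k y))"
    and iC: "integrable lborel (\<lambda>y. ((cutoff R y *\<^sub>R G y + g y *\<^sub>R cutoff_grad R y) \<bullet> i) * k y)"
    if i: "i \<in> Basis" for i
  proof -
    have "(LINT y|lborel. g y * (k y * (cutoff_grad R y \<bullet> i) + ((x - y) \<bullet> i) / c * k y * cutoff R y)) =
      - (LINT y|lborel. (G y \<bullet> i) * (k y * cutoff R y))"
      using g i test_function_mult_cutoff[OF ks R] unfolding has_weak_gradient_def by (auto simp: fd)
    moreover have j1: "integrable lborel (\<lambda>y. (g y *\<^sub>R cutoff_grad R y) \<bullet> i * k y)"
      by (rule integrable_mult_bounded[where B = 1, OF integrable_inner_left]) (use i3 kb in auto)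
    moreover have j2: "integrable lborel (\<lambda>y. (cutoff R y *\<^sub>R G y) \<bullet> i * k y)"
      by (rule integrable_mult_bounded[where B = 1, OF integrable_inner_left]) (use i2 kb in auto)
    moreover have j3: "integrable lborel (\<lambda>y. (cutoff R y * g y) * (((x - y) \<bullet> i) / c * k y))"
    proof (rule locally_integrable_cball[OF lg, of _ R "(norm x + R) / c"])
      fix y
      show "norm ((cutoff R y * g y) * (((x - y) \<bullet> i) / c * k y)) \<le> (if norm y < R then (norm x + R) / c * norm (g y) else 0)"
      proof (cases "norm y < R")
        case True
        have "\<bar>(x - y) \<bullet> i\<bar> \<le> norm x + R"
          using Basis_le_norm[OF i, of "x - y"] norm_triangle_ineq4[of x y] True by linarith
        then have f1: "\<bar>(x - y) \<bullet> i\<bar> / c * k y \<le> (norm x + R) / c * 1"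
          using kb c R by (intro mult_mono divide_right_mono) auto
        have "(cutoff R y * \<bar>g y\<bar>) * (\<bar>(x - y) \<bullet> i\<bar> / c * k y) \<le> (1 * \<bar>g y\<bar>) * ((norm x + R) / c * 1)"
          by (rule mult_mono[OF mult_right_mono[OF cutoff_bounds(2)] f1]) (use kb c in auto)
        then show ?thesis using True c kb cutoff_bounds
            by (simp add: abs_mult mult.commute abs_of_nonneg[OF cutoff_bounds(1)])
      qed (simp add: cutoff_eq_0[OF R])
    qed simp
    show "integrable lborel (\<lambda>y. (cutoff R y * g y) * (((x - y) \<bullet> i) / c * k y))" by (rule j3)
    show "integrable lborel (\<lambda>y. ((cutoff R y *\<^sub>R G y + g y *\<^sub>R cutoff_grad R y) \<bullet> i) * k y)"
      using Bochner_Integration.integrable_add[OF j1 j2] by (simp add: inner_add_left algebra_simps)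
    show "(LINT y|lborel. (cutoff R y * g y) * (((x - y) \<bullet> i) / c * k y))
       = - (LINT y|lborel. ((cutoff R y *\<^sub>R G y + g y *\<^sub>R cutoff_grad R y) \<bullet> i) * k y)"
    proof -
      have "(LINT y|lborel. g y * (k y * (cutoff_grad R y \<bullet> i) + ((x - y) \<bullet> i) / c * k y * cutoff R y)) =
         (LINT y|lborel. (g y *\<^sub>R cutoff_grad R y) \<bullet> i * k y) + (LINT y|lborel. (cutoff R y * g y) * (((x - y) \<bullet> i) / c * k y))"
        by (subst Bochner_Integration.integral_add[OF j1 j3, symmetric]) (simp add: algebra_simps)
      moreover have "(LINT y|lborel. ((cutoff R y *\<^sub>R G y + g y *\<^sub>R cutoff_grad R y) \<bullet> i) * k y) =
         (LINT y|lborel. (g y *\<^sub>R cutoff_grad R y) \<bullet> i * k y) + (LINT y|lborel. (cutoff R y *\<^sub>R G y) \<bullet> i * k y)"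
        by (subst Bochner_Integration.integral_add[OF j1 j2, symmetric]) (simp add: inner_add_left algebra_simps)
      moreover have "(LINT y|lborel. (cutoff R y *\<^sub>R G y) \<bullet> i * k y) = (LINT y|lborel. (G y \<bullet> i) * (k y * cutoff R y))"
        by (simp add: algebra_simps)
      ultimately show ?thesis using g i test_function_mult_cutoff[OF ks R] unfolding has_weak_gradient_def by (auto simp: fd)
    qed
  qed
  have vsum: "a \<bullet> v = (\<Sum>i\<in>Basis. (v \<bullet> i) * (a \<bullet> i))" for a :: 'a
    by (subst euclidean_inner) (simp add: mult.commute)
  have "(LINT y|lborel. (cutoff R y * g y) * (((x - y) \<bullet> v) / c * k y)) =
     (LINT y|lborel. (\<Sum>i\<in>Basis. (v \<bullet> i) * ((cutoff R y * g y) * (((x - y) \<bullet> i) / c * k y))))"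
    by (subst vsum) (simp add: sum_distrib_left sum_distrib_right sum_divide_distrib algebra_simps)
  also have "\<dots> = (\<Sum>i\<in>Basis. (v \<bullet> i) * - (LINT y|lborel. ((cutoff R y *\<^sub>R G y + g y *\<^sub>R cutoff_grad R y) \<bullet> i) * k y))"
    by (subst Bochner_Integration.integral_sum, intro integrable_mult_right iB, assumption)
       (intro sum.cong refl, simp only: integral_mult_right_zero eqB)
  also have "\<dots> = - (LINT y|lborel. (\<Sum>i\<in>Basis. (v \<bullet> i) * (((cutoff R y *\<^sub>R G y + g y *\<^sub>R cutoff_grad R y) \<bullet> i) * k y)))"
    by (subst Bochner_Integration.integral_sum, intro integrable_mult_right iC, assumption)
       (simp only: integral_mult_right_zero sum_negf[symmetric] mult_minus_right)
  also have "\<dots> = - (LINT y|lborel. ((cutoff R y *\<^sub>R G y + g y *\<^sub>R cutoff_grad R y) \<bullet> v) * k y)"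
    by (simp only: vsum sum_distrib_right mult.assoc)
  finally show "(LINT y|lborel. (cutoff R y * g y) * (((x - y) \<bullet> v) / c * exp (- ((norm (x - y))\<^sup>2 / (2 * c)))))
       = - (LINT y|lborel. ((cutoff R y *\<^sub>R G y + g y *\<^sub>R cutoff_grad R y) \<bullet> v) * exp (- ((norm (x - y))\<^sup>2 / (2 * c))))"
    by (simp add: k_def)
qed

section \<open>Regularisation and uniqueness of weak gradients\<close>

lemma cutoff_pos: assumes "norm x < R" shows "0 < cutoff R x"
proof -
  have "0 < R" using assms norm_ge_zero[of x] by linarith
  then have "(norm x)\<^sup>2 / R\<^sup>2 < 1" using power_strict_mono[OF assms, of 2] by simp
  then show ?thesis by (simp add: cutoff_def bump_deriv_def)
qed

lemma integrable_gauss_of_lborel: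
  fixes f :: "'a::euclidean_space \<Rightarrow> 'b::{banach,second_countable_topology}"
  assumes f: "integrable lborel f"
  shows "integrable \<gamma> f"
proof -
  have [measurable]: "f \<in> borel_measurable borel" using borel_measurable_integrable[OF f] by simp
  have "integrable lborel (\<lambda>x. normal_dens 0 1 x *\<^sub>R f x)"
  proof (rule Bochner_Integration.integrable_bound)
    show "integrable lborel (\<lambda>x. (1 / sqrt (2 * pi)) ^ DIM('a) *\<^sub>R f x)" using f by simp
    show "AE x in lborel. norm (normal_dens 0 1 x *\<^sub>R f x) \<le> norm ((1 / sqrt (2 * pi)) ^ DIM('a) *\<^sub>R f x)"
      by (intro AE_I2) (simp add: normal_dens_def mult_right_mono divide_right_mono)
  qed simp
  then show ?thesis unfolding std_gauss_eq by (subst integrable_density) auto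
qed

lemma ou_eq_lborel:
  fixes f :: "'a::euclidean_space \<Rightarrow> 'b::{banach,second_countable_topology}"
  assumes r: "\<bar>r\<bar> < 1" and [measurable]: "f \<in> borel_measurable borel"
  shows "ou r f x = ((1 / sqrt (2 * pi * (1 - r\<^sup>2))) ^ DIM('a)) *\<^sub>R
     (LINT y|lborel. exp (- ((norm (r *\<^sub>R x - y))\<^sup>2 / (2 * (1 - r\<^sup>2)))) *\<^sub>R f y)"
proof -
  have p: "0 < 1 - r\<^sup>2" using r by (simp add: abs_square_less_1)
  then have s: "0 < sqrt (1 - r\<^sup>2)" "(sqrt (1 - r\<^sup>2))\<^sup>2 = 1 - r\<^sup>2" by auto
  have "ou r f x = (\<integral>y. f y \<partial>distr \<gamma> borel (\<lambda>z. r *\<^sub>R x + sqrt (1 - r\<^sup>2) *\<^sub>R z))"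
    unfolding gauss_avg_def by (subst integral_distr) auto
  also have "\<dots> = (LINT y|lborel. normal_dens (r *\<^sub>R x) (sqrt (1 - r\<^sup>2)) y *\<^sub>R f y)"
    unfolding distr_std_gauss_affine[OF s(1)] by (subst integral_density) auto
  finally show ?thesis
    unfolding normal_dens_def s(2) by (simp add: norm_minus_commute flip: scaleR_scaleR)
qed

lemma rate_seq: "0 \<le> 1 - 1 / (real k + 2)" "1 - 1 / (real k + 2) < 1" "(\<lambda>k. 1 - 1 / (real k + 2)) \<longlonglongrightarrow> 1"
proof -
  show "(\<lambda>k. 1 - 1 / (real k + 2)) \<longlonglongrightarrow> 1" by real_asymp
qed (auto simp: field_simps)

text \<open>
  The averages converge to \<open>w\<close> in \<open>L\<^sup>1(\<gamma>)\<close> as \<open>r\<close> tends to 1.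
\<close>

lemma AE_eq_0_of_ou:
  fixes w :: "'a::euclidean_space \<Rightarrow> real"
  assumes [measurable]: "w \<in> borel_measurable borel" and i: "integrable \<gamma> w" and z: "\<And>r x. 0 \<le> r \<Longrightarrow> r < 1 \<Longrightarrow> ou r w x = 0"
  shows "AE x in lborel. w x = 0"
proof -
  have "(\<lambda>k. \<integral>\<^sup>+x. ennreal (\<bar>ou (1 - 1 / (real k + 2)) w x - w x\<bar> ^ 1) \<partial>\<gamma>) \<longlonglongrightarrow> 0"
    using i by (intro ou_tendsto_Lp rate_seq) auto
  moreover have "ou (1 - 1 / (real k + 2)) w x = 0" for k x by (rule z[OF rate_seq(1,2)])
  ultimately have "(\<integral>\<^sup>+x. ennreal \<bar>w x\<bar> \<partial>\<gamma>) = 0" by (simp add: LIMSEQ_const_iff)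
  then have "AE x in \<gamma>. w x = 0" by (subst (asm) nn_integral_0_iff_AE) auto
  then show ?thesis by (simp add: AE_std_gauss_iff)
qed

lemma gauss_weak_gradientD:
  assumes "gauss_weak_gradient w W" "0 < c"
  shows "(LINT y|lborel. w y * (((x - y) \<bullet> v) / c * exp (- ((norm (x - y))\<^sup>2 / (2 * c)))))
       = - (LINT y|lborel. (W y \<bullet> v) * exp (- ((norm (x - y))\<^sup>2 / (2 * c))))"
  using assms unfolding gauss_weak_gradient_def by blast

text \<open>
  The difference of two weak gradients, once cut off, integrates to zero against all Gaussian
  kernels. So its Ornstein-Uhlenbeck averages vanish, and it is their limit in \<open>L\<^sup>1(\<gamma>)\<close>.
\<close>

lemma weak_gradient_unique:
  assumes G: "has_weak_gradient g G" and G': "has_weak_gradient g G'"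
  shows "AE x in lborel. G x = G' x"
proof -
  have [measurable]: "g \<in> borel_measurable borel" "G \<in> borel_measurable borel" "G' \<in> borel_measurable borel"
    using G G' by (auto simp: has_weak_gradient_def intro: locally_integrable_measurable)
  have "AE x in lborel. cutoff (real n + 1) x * ((G x - G' x) \<bullet> b) = 0" for n :: nat and b
  proof (rule AE_eq_0_of_ou)
    let ?R = "real n + 1"
    define W where "W G x = cutoff ?R x *\<^sub>R G x + g x *\<^sub>R cutoff_grad ?R x" for G x
    have w: "gauss_weak_gradient (\<lambda>x. cutoff ?R x * g x) (W G)" "gauss_weak_gradient (\<lambda>x. cutoff ?R x * g x) (W G')"
      unfolding W_def using G G' by (auto intro!: gauss_weak_gradient_cutoff)
    have i: "integrable lborel (W G)" "integrable lborel (W G')" using w by (auto simp: gauss_weak_gradient_def)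
    have eq: "cutoff ?R x * ((G x - G' x) \<bullet> b) = W G x \<bullet> b - W G' x \<bullet> b" for x
      by (simp add: W_def inner_add_left inner_diff_left right_diff_distrib)
    show "integrable \<gamma> (\<lambda>x. cutoff ?R x * ((G x - G' x) \<bullet> b))"
      unfolding eq using i by (intro integrable_gauss_of_lborel) auto
    fix r :: real and x :: 'a assume r: "0 \<le> r" "r < 1"
    then have p: "0 < 1 - r\<^sup>2" by (simp add: abs_square_less_1)
    define k where "k y = exp (- ((norm (r *\<^sub>R x - y))\<^sup>2 / (2 * (1 - r\<^sup>2))))" for y
    have k: "k \<in> borel_measurable lborel" "\<bar>k y\<bar> \<le> 1" for y using p unfolding k_def[abs_def] by auto
    have j: "integrable lborel (\<lambda>y. (W G y \<bullet> b) * k y)" "integrable lborel (\<lambda>y. (W G' y \<bullet> b) * k y)"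
      using i by (auto intro!: integrable_mult_bounded[OF _ k])
    have "(LINT y|lborel. (W G y \<bullet> b) * k y) = (LINT y|lborel. (W G' y \<bullet> b) * k y)"
      using gauss_weak_gradientD[OF w(1) p, of "r *\<^sub>R x" b] gauss_weak_gradientD[OF w(2) p, of "r *\<^sub>R x" b]
      unfolding k_def by linarith
    then have "(LINT y|lborel. k y * (W G y \<bullet> b - W G' y \<bullet> b)) = 0"
      using Bochner_Integration.integral_diff[OF j] by (simp add: algebra_simps)
    then show "ou r (\<lambda>x. cutoff ?R x * ((G x - G' x) \<bullet> b)) x = 0"
      unfolding eq using r by (subst ou_eq_lborel) (auto simp: k_def W_def)
  qed simp
  then have "AE x in lborel. \<forall>n. \<forall>b\<in>Basis. cutoff (real n + 1) x * ((G x - G' x) \<bullet> b) = 0"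
    unfolding AE_all_countable by (intro allI AE_finite_allI) auto
  then show ?thesis
  proof eventually_elim
    case (elim x)
    obtain n where "norm x \<le> real n" using real_arch_simple by blast
    then have c: "cutoff (real n + 1) x \<noteq> 0" using cutoff_pos[of x "real n + 1"] by simp
    show "G x = G' x"
    proof (rule euclidean_eqI)
      fix b :: 'a assume b: "b \<in> Basis"
      have "cutoff (real n + 1) x * ((G x - G' x) \<bullet> b) = 0"
        by (rule bspec[OF spec[OF elim] b])
      then have "(G x - G' x) \<bullet> b = 0" using c by (rule mult_left_cancel[THEN iffD1, rotated, of _ _ 0, unfolded mult_zero_right])
      then show "G x \<bullet> b = G' x \<bullet> b" by (simp only: inner_diff_left right_minus_eq)
    qed
  qed
qed

text \<open>
  The average is a convolution with a Gaussian kernel, whose Taylor expansion is uniform; the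
  defining property of the weak gradient identifies the linear term with the averaged gradient.
\<close>

lemma ou_C11:
  fixes w :: "'a::euclidean_space \<Rightarrow> real"
  assumes w: "gauss_weak_gradient w W" and r: "0 \<le> r" "r < 1"
  shows "\<exists>L. C11 L (ou r w) (\<lambda>x. r *\<^sub>R ou r W x)"
proof -
  define c where "c = 1 - r\<^sup>2"
  have c: "0 < c" using r by (simp add: c_def abs_square_less_1)
  have iw: "integrable lborel w" and iW: "integrable lborel W" using w by (auto simp: gauss_weak_gradient_def)
  have [measurable]: "w \<in> borel_measurable borel" "W \<in> borel_measurable borel"
    using iw iW by (auto dest: borel_measurable_integrable)
  define k where "k z = exp (- ((norm z)\<^sup>2 / (2 * c)))" for z :: 'a
  have [measurable]: "k \<in> borel_measurable borel" unfolding k_def[abs_def] by measurable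
  have kb: "\<bar>k z\<bar> \<le> 1" "0 \<le> k z" "k z \<le> 1" for z using c by (auto simp: k_def)
  define D where "D = (1 / sqrt (2 * pi * c)) ^ DIM('a)"
  have D: "0 < D" using c by (simp add: D_def)
  have ow: "ou r w x = D * (LINT y|lborel. w y * k (r *\<^sub>R x - y))" for x
    using r by (subst ou_eq_lborel) (auto simp: D_def c_def k_def mult.commute)
  have oW: "ou r W x = D *\<^sub>R (LINT y|lborel. k (r *\<^sub>R x - y) *\<^sub>R W y)" for x
    using r by (subst ou_eq_lborel) (auto simp: D_def c_def k_def)
  have ikw: "integrable lborel (\<lambda>y. w y * k (a - y))" for a
    by (rule integrable_mult_bounded[OF iw _ kb(1)]) simp
  have ikW: "integrable lborel (\<lambda>y. k (a - y) *\<^sub>R W y)" for a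
    by (rule Bochner_Integration.integrable_bound[OF iW]) (use kb in \<open>auto intro!: AE_I2 mult_left_le_one_le\<close>)
  define A where "A = (LINT y|lborel. \<bar>w y\<bar>)"
  define B where "B = (LINT y|lborel. norm (W y))"
  have A0: "0 \<le> A" and B0: "0 \<le> B" by (auto simp: A_def B_def)
  have b1: "\<bar>LINT y|lborel. w y * k (a - y)\<bar> \<le> A" for a
    unfolding A_def
  proof (rule order_trans[OF integral_abs_bound integral_mono])
    show "\<bar>w y * k (a - y)\<bar> \<le> \<bar>w y\<bar>" for y unfolding abs_mult by (rule mult_left_le[OF kb(1)]) simp
  qed (use integrable_abs[OF ikw] integrable_abs[OF iw] in auto)
  have b2: "norm (LINT y|lborel. k (a - y) *\<^sub>R W y) \<le> B" for a
    unfolding B_def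
  proof (rule order_trans[OF integral_norm_bound integral_mono])
    show "norm (k (a - y) *\<^sub>R W y) \<le> norm (W y)" for y
      using mult_left_le_one_le[OF norm_ge_zero kb(2,3)] kb(2) by simp
  qed (use integrable_norm[OF ikW] integrable_norm[OF iW] in auto)
  have taylor: "\<bar>ou r w (x + v) - ou r w x - (r *\<^sub>R ou r W x) \<bullet> v\<bar> \<le> D * (3 / c) * A * (norm v)\<^sup>2" for x v
  proof -
    define z where "z y = r *\<^sub>R x - y" for y
    define u where "u = r *\<^sub>R v"
    have zu: "r *\<^sub>R (x + v) - y = z y + u" for y by (simp add: z_def u_def scaleR_add_right)
    have "(LINT y|lborel. w y * ((z y \<bullet> u) / c * k (z y))) = - (LINT y|lborel. (W y \<bullet> u) * k (z y))"
      using w c unfolding gauss_weak_gradient_def k_def z_def by blast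
    also have "(LINT y|lborel. (W y \<bullet> u) * k (z y)) = (LINT y|lborel. k (z y) *\<^sub>R W y) \<bullet> u"
      unfolding z_def by (subst integral_inner_left[symmetric]) (auto simp: ikW mult.commute)
    finally have e1: "(LINT y|lborel. w y * ((z y \<bullet> u) / c * k (z y))) = - ((LINT y|lborel. k (z y) *\<^sub>R W y) \<bullet> u)" .
    have tb: "\<bar>k (z y + u) - k (z y) + (z y \<bullet> u) / c * k (z y)\<bar> \<le> 3 / c * (norm u)\<^sup>2" for y
      unfolding k_def by (rule gauss_kernel_taylor[OF c])
    have it: "integrable lborel (\<lambda>y. w y * (k (z y + u) - k (z y) + (z y \<bullet> u) / c * k (z y)))"
      by (rule integrable_mult_bounded[OF iw _ tb]) (simp add: z_def)
    have i1: "integrable lborel (\<lambda>y. w y * k (z y + u))" "integrable lborel (\<lambda>y. w y * k (z y))"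
      using ikw[of "r *\<^sub>R (x + v)"] ikw[of "r *\<^sub>R x"] by (simp_all add: zu) (simp add: z_def)
    have i2: "integrable lborel (\<lambda>y. w y * ((z y \<bullet> u) / c * k (z y)))"
      using Bochner_Integration.integrable_diff[OF it Bochner_Integration.integrable_diff[OF i1]]
      by (simp add: algebra_simps)
    have "ou r w (x + v) - ou r w x - (r *\<^sub>R ou r W x) \<bullet> v =
       D * ((LINT y|lborel. w y * k (z y + u)) - (LINT y|lborel. w y * k (z y)) + (LINT y|lborel. w y * ((z y \<bullet> u) / c * k (z y))))"
      unfolding ow oW e1 zu by (simp add: z_def u_def algebra_simps)
    also have "\<dots> = D * (LINT y|lborel. w y * (k (z y + u) - k (z y) + (z y \<bullet> u) / c * k (z y)))"
      using i1 i2 by (simp add: distrib_left right_diff_distrib)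
    finally have "\<bar>ou r w (x + v) - ou r w x - (r *\<^sub>R ou r W x) \<bullet> v\<bar> =
        D * \<bar>LINT y|lborel. w y * (k (z y + u) - k (z y) + (z y \<bullet> u) / c * k (z y))\<bar>"
      using D by (simp add: abs_mult)
    also have "\<dots> \<le> D * (LINT y|lborel. \<bar>w y\<bar> * (3 / c * (norm u)\<^sup>2))"
    proof (intro mult_left_mono order_trans[OF integral_abs_bound integral_mono])
      show "\<bar>w y * (k (z y + u) - k (z y) + (z y \<bullet> u) / c * k (z y))\<bar> \<le> \<bar>w y\<bar> * (3 / c * (norm u)\<^sup>2)" for y
        unfolding abs_mult by (rule mult_left_mono[OF tb]) simp
    qed (use it iw D in auto)
    also have "\<dots> = D * (3 / c) * A * (norm u)\<^sup>2" by (simp add: A_def)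
    also have "\<dots> \<le> D * (3 / c) * A * (norm v)\<^sup>2"
      using r D c A0 by (intro mult_left_mono power_mono) (auto simp: u_def mult_left_le_one_le)
    finally show ?thesis .
  qed
  define L where "L = max (D * A) (max (D * B) (D * (3 / c) * A))"
  have "C11 L (ou r w) (\<lambda>x. r *\<^sub>R ou r W x)"
    unfolding C11_def
  proof (intro conjI allI)
    show "ou r w \<in> borel_measurable borel" "(\<lambda>x. r *\<^sub>R ou r W x) \<in> borel_measurable borel" by measurable
    fix x v
    show "\<bar>ou r w x\<bar> \<le> L"
      unfolding ow abs_mult using D b1[of "r *\<^sub>R x"] by (simp add: L_def le_max_iff_disj)
    have "norm (ou r W x) \<le> D * B" unfolding oW using D b2[of "r *\<^sub>R x"] by simp
    then have "norm (r *\<^sub>R ou r W x) \<le> D * B" using r mult_left_le_one_le[OF norm_ge_zero, of r "ou r W x"] by simp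
    then show "norm (r *\<^sub>R ou r W x) \<le> L" by (simp add: L_def)
    show "\<bar>ou r w (x + v) - ou r w x - (r *\<^sub>R ou r W x) \<bullet> v\<bar> \<le> L * (norm v)\<^sup>2"
      by (rule order_trans[OF taylor mult_right_mono]) (auto simp: L_def)
  qed
  then show ?thesis by blast
qed

section \<open>Approximation of Sobolev functions\<close>

lemma nn_integral_square_triangle:
  fixes f g h :: "'a::euclidean_space \<Rightarrow> real"
  assumes [measurable]: "f \<in> borel_measurable borel" "g \<in> borel_measurable borel" "h \<in> borel_measurable borel"
    and 1: "(\<integral>\<^sup>+x. ennreal (\<bar>f x - g x\<bar>\<^sup>2) \<partial>\<gamma>) < ennreal e" and 2: "(\<integral>\<^sup>+x. ennreal (\<bar>g x - h x\<bar>\<^sup>2) \<partial>\<gamma>) < ennreal e"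
  shows "(\<integral>\<^sup>+x. ennreal (\<bar>f x - h x\<bar>\<^sup>2) \<partial>\<gamma>) \<le> ennreal (8 * e)"
proof -
  have e: "0 < e"
  proof (rule ccontr)
    assume "\<not> 0 < e"
    then have "ennreal e = 0" by (simp add: ennreal_neg)
    with 1 show False by (simp only: not_less_zero)
  qed
  have "(\<integral>\<^sup>+x. ennreal (\<bar>f x - h x\<bar>\<^sup>2) \<partial>\<gamma>) \<le> 2\<^sup>2 * ((\<integral>\<^sup>+x. ennreal (\<bar>f x - g x\<bar>\<^sup>2) \<partial>\<gamma>) + (\<integral>\<^sup>+x. ennreal (\<bar>g x - h x\<bar>\<^sup>2) \<partial>\<gamma>))"
    using nn_integral_add_power_le[of "\<lambda>x. f x - g x" "\<lambda>x. g x - h x" 2] by simp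
  also have "\<dots> \<le> 2\<^sup>2 * (ennreal e + ennreal e)"
    by (intro mult_left_mono add_mono less_imp_le[OF 1] less_imp_le[OF 2]) simp
  also have "ennreal e + ennreal e = ennreal (2 * e)" using e by (simp flip: ennreal_plus)
  also have "2\<^sup>2 * ennreal (2 * e) = ennreal 4 * ennreal (2 * e)" by simp
  also have "\<dots> = ennreal (4 * (2 * e))" using e by (intro ennreal_mult[symmetric]) auto
  also have "4 * (2 * e) = 8 * e" by simp
  finally show ?thesis .
qed

text \<open>
  Cutting off and then averaging with \<open>r\<close> near 1 moves the function and each component of its
  gradient by little in \<open>L\<^sup>2(\<gamma>)\<close>. The gradient of the average is \<open>r\<close> times the average of the gradient, and
  this factor tends to 1.
\<close>

lemma C11_approximation:
  fixes g :: "'a::euclidean_space \<Rightarrow> real"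
  assumes G: "has_weak_gradient g G" and i: "integrable \<gamma> (\<lambda>x. (g x)\<^sup>2 + (norm (G x))\<^sup>2)" and e: "0 < (e::real)"
  shows "\<exists>L h H. C11 L h H \<and> (\<integral>\<^sup>+x. ennreal (\<bar>h x - g x\<bar>\<^sup>2) \<partial>\<gamma>) \<le> ennreal e \<and>
    (\<forall>b\<in>Basis. (\<integral>\<^sup>+x. ennreal (\<bar>H x \<bullet> b - G x \<bullet> b\<bar>\<^sup>2) \<partial>\<gamma>) \<le> ennreal e)"
proof -
  have [measurable]: "g \<in> borel_measurable borel" "G \<in> borel_measurable borel"
    using G by (auto simp: has_weak_gradient_def intro: locally_integrable_measurable)
  have ig: "integrable \<gamma> (\<lambda>x. (g x)\<^sup>2)" and iG: "integrable \<gamma> (\<lambda>x. (norm (G x))\<^sup>2)"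
    by (rule Bochner_Integration.integrable_bound[OF i]; simp)+
  \<comment> \<open>The triangle inequality for squared norms costs the factor 8.\<close>
  define d where "d = e / 8"
  have d: "0 < d" using e by (simp add: d_def)
  define R where "R n = real n + 1" for n :: nat
  have R: "0 < R n" "1 \<le> R n" for n by (auto simp: R_def)
  define w where "w n x = cutoff (R n) x * g x" for n x
  define W where "W n x = cutoff (R n) x *\<^sub>R G x + g x *\<^sub>R cutoff_grad (R n) x" for n x
  have [measurable]: "w n \<in> borel_measurable borel" "W n \<in> borel_measurable borel" for n
    unfolding w_def[abs_def] W_def[abs_def] by measurable
  have gw: "gauss_weak_gradient (w n) (W n)" for n
    unfolding w_def[abs_def] W_def[abs_def] by (rule gauss_weak_gradient_cutoff[OF G R(1)])
  have w_le: "\<bar>w n x\<bar> \<le> \<bar>g x\<bar>" for n x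
    using cutoff_bounds[of "R n" x] by (simp add: w_def abs_mult mult_left_le_one_le)
  have grad_le: "norm (cutoff_grad (R n) x) \<le> 4 * exp 1" for n x
  proof -
    have "4 * exp 1 / R n \<le> 4 * exp (1::real)" using R(2)[of n] by (simp add: divide_le_eq)
    then show ?thesis using norm_cutoff_grad_le[OF R(1), of n x] by linarith
  qed
  have W_le: "\<bar>W n x \<bullet> b\<bar> \<le> norm (G x) + \<bar>g x\<bar> * (4 * exp 1)" if b: "b \<in> Basis" for n x b
  proof -
    have "\<bar>W n x \<bullet> b\<bar> \<le> norm (W n x)" by (rule Basis_le_norm[OF b])
    also have "\<dots> \<le> norm (cutoff (R n) x *\<^sub>R G x) + norm (g x *\<^sub>R cutoff_grad (R n) x)"
      unfolding W_def by (rule norm_triangle_ineq)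
    also have "\<dots> \<le> norm (G x) + \<bar>g x\<bar> * (4 * exp 1)"
      using cutoff_bounds[of "R n" x] grad_le[of n x] by (intro add_mono) (auto simp: mult_left_le_one_le mult_left_mono)
    finally show ?thesis .
  qed
  define V where "V x = 2 * norm (G x) + \<bar>g x\<bar> * (4 * exp 1)" for x
  have iV: "integrable \<gamma> (\<lambda>x. (V x)\<^sup>2)"
  proof (rule Bochner_Integration.integrable_bound)
    show "integrable \<gamma> (\<lambda>x. 4 * (4 * (norm (G x))\<^sup>2 + (g x)\<^sup>2 * (4 * exp 1)\<^sup>2))" using ig iG by simp
    show "AE x in \<gamma>. norm ((V x)\<^sup>2) \<le> norm (4 * (4 * (norm (G x))\<^sup>2 + (g x)\<^sup>2 * (4 * exp 1)\<^sup>2))"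
    proof (rule AE_I2)
      fix x :: 'a
      have "(V x)\<^sup>2 \<le> 4 * ((2 * norm (G x))\<^sup>2 + (\<bar>g x\<bar> * (4 * exp 1))\<^sup>2)"
        using add_power_le[of "2 * norm (G x)" "\<bar>g x\<bar> * (4 * exp 1)" 2] by (simp add: V_def)
      then show "norm ((V x)\<^sup>2) \<le> norm (4 * (4 * (norm (G x))\<^sup>2 + (g x)\<^sup>2 * (4 * exp 1)\<^sup>2))"
        by (simp add: power_mult_distrib)
    qed
  qed (simp add: V_def[abs_def])
  have "(\<lambda>n. \<integral>\<^sup>+x. ennreal (\<bar>w n x - g x\<bar>\<^sup>2) \<partial>\<gamma>) \<longlonglongrightarrow> 0"
  proof (rule bounded_nn_integral_tendsto_0)
    show "\<bar>w n x - g x\<bar> \<le> 2 * \<bar>g x\<bar>" for n x using w_le[of n x] by linarith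
    show "integrable \<gamma> (\<lambda>x. (2 * \<bar>g x\<bar>)\<^sup>2)" using ig by (simp add: power_mult_distrib)
    show "AE x in \<gamma>. (\<lambda>n. w n x - g x) \<longlonglongrightarrow> 0"
    proof (rule AE_I2)
      fix x :: 'a
      have "(\<lambda>n. cutoff (real n + 1) x * g x - g x) \<longlonglongrightarrow> 1 * g x - g x"
        by (intro tendsto_intros cutoff_tendsto_1)
      then show "(\<lambda>n. w n x - g x) \<longlonglongrightarrow> 0" by (simp add: w_def R_def)
    qed
  qed auto
  then have ev1: "\<forall>\<^sub>F n in sequentially. (\<integral>\<^sup>+x. ennreal (\<bar>w n x - g x\<bar>\<^sup>2) \<partial>\<gamma>) < ennreal d"
    using d by (intro order_tendstoD(2)) auto
  have "\<forall>\<^sub>F n in sequentially. (\<integral>\<^sup>+x. ennreal (\<bar>W n x \<bullet> b - G x \<bullet> b\<bar>\<^sup>2) \<partial>\<gamma>) < ennreal d" if b: "b \<in> Basis" for b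
  proof (rule order_tendstoD(2))
    show "(\<lambda>n. \<integral>\<^sup>+x. ennreal (\<bar>W n x \<bullet> b - G x \<bullet> b\<bar>\<^sup>2) \<partial>\<gamma>) \<longlonglongrightarrow> 0"
    proof (rule bounded_nn_integral_tendsto_0[OF _ _ iV])
      show "\<bar>W n x \<bullet> b - G x \<bullet> b\<bar> \<le> V x" for n x
        using W_le[OF b, of n x] Basis_le_norm[OF b, of "G x"] by (simp add: V_def)
      show "AE x in \<gamma>. (\<lambda>n. W n x \<bullet> b - G x \<bullet> b) \<longlonglongrightarrow> 0"
      proof (rule AE_I2)
        fix x :: 'a
        have g0: "(\<lambda>n. cutoff_grad (real n + 1) x) \<longlonglongrightarrow> 0"
        proof (rule Lim_null_comparison[OF always_eventually])
          show "\<forall>n. norm (cutoff_grad (real n + 1) x) \<le> 4 * exp 1 / (real n + 1)"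
            by (auto intro: norm_cutoff_grad_le)
          show "(\<lambda>n. 4 * exp 1 / (real n + 1)) \<longlonglongrightarrow> 0" by real_asymp
        qed
        have "(\<lambda>n. (cutoff (real n + 1) x *\<^sub>R G x + g x *\<^sub>R cutoff_grad (real n + 1) x) \<bullet> b - G x \<bullet> b) \<longlonglongrightarrow>
           (1 *\<^sub>R G x + g x *\<^sub>R 0) \<bullet> b - G x \<bullet> b"
          by (intro tendsto_intros cutoff_tendsto_1 g0)
        then show "(\<lambda>n. W n x \<bullet> b - G x \<bullet> b) \<longlonglongrightarrow> 0" by (simp add: W_def R_def)
      qed
    qed auto
  qed (use d in auto)
  then have "\<forall>\<^sub>F n in sequentially. \<forall>b\<in>Basis. (\<integral>\<^sup>+x. ennreal (\<bar>W n x \<bullet> b - G x \<bullet> b\<bar>\<^sup>2) \<partial>\<gamma>) < ennreal d"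
    by (intro eventually_ball_finite) auto
  from eventually_happens'[OF sequentially_bot eventually_conj[OF ev1 this]] obtain n where n: "(\<integral>\<^sup>+x. ennreal (\<bar>w n x - g x\<bar>\<^sup>2) \<partial>\<gamma>) < ennreal d"
    "\<And>b. b \<in> Basis \<Longrightarrow> (\<integral>\<^sup>+x. ennreal (\<bar>W n x \<bullet> b - G x \<bullet> b\<bar>\<^sup>2) \<partial>\<gamma>) < ennreal d"
    by blast
  define r where "r k = 1 - 1 / (real k + 2)" for k :: nat
  have r: "0 \<le> r k" "r k < 1" "r \<longlonglongrightarrow> 1" for k
    using rate_seq by (auto simp: r_def[abs_def])
  have iw: "integrable \<gamma> (\<lambda>x. \<bar>w n x\<bar>\<^sup>2)"
    by (rule Bochner_Integration.integrable_bound[OF ig]) (use w_le in \<open>auto simp: abs_le_square_iff[symmetric]\<close>)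
  have V0: "0 \<le> V x" for x by (simp add: V_def)
  have iW: "integrable \<gamma> (\<lambda>x. \<bar>W n x \<bullet> b\<bar>\<^sup>2)" if b: "b \<in> Basis" for b
  proof (rule Bochner_Integration.integrable_bound[OF iV])
    have "\<bar>W n x \<bullet> b\<bar> \<le> V x" for x using W_le[OF b, of n x] by (simp add: V_def) (smt (verit) norm_ge_zero)
    then show "AE x in \<gamma>. norm (\<bar>W n x \<bullet> b\<bar>\<^sup>2) \<le> norm ((V x)\<^sup>2)"
      using V0 by (auto simp: abs_le_square_iff[symmetric])
  qed simp
  have ev3: "\<forall>\<^sub>F k in sequentially. (\<integral>\<^sup>+x. ennreal (\<bar>ou (r k) (w n) x - w n x\<bar>\<^sup>2) \<partial>\<gamma>) < ennreal d"
    by (rule order_tendstoD(2)[OF ou_tendsto_Lp[OF _ iw _ r]]) (use d in auto)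
  have iWn: "integrable \<gamma> (W n)" using gw[of n] by (intro integrable_gauss_of_lborel) (simp add: gauss_weak_gradient_def)
  have "\<forall>\<^sub>F k in sequentially. (\<integral>\<^sup>+x. ennreal (\<bar>(r k *\<^sub>R ou (r k) (W n) x) \<bullet> b - W n x \<bullet> b\<bar>\<^sup>2) \<partial>\<gamma>) < ennreal d" if b: "b \<in> Basis" for b
  proof -
    define u where "u x = W n x \<bullet> b" for x
    have [measurable]: "u \<in> borel_measurable borel" unfolding u_def[abs_def] by measurable
    have iu: "integrable \<gamma> (\<lambda>x. \<bar>u x\<bar>\<^sup>2)" unfolding u_def by (rule iW[OF b])
    have ou_b: "ou (r k) (W n) x \<bullet> b = ou (r k) u x" for k x
      using integrable_ou_inner(1)[of "r k" "W n" x] iWn r(1,2)[of k]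
      unfolding gauss_avg_def u_def by (subst integral_inner_left) auto
    have t: "(\<lambda>k. 8 * (\<integral>\<^sup>+x. ennreal (\<bar>ou (r k) u x - u x\<bar>\<^sup>2) \<partial>\<gamma>) + 8 * (\<integral>\<^sup>+x. ennreal (\<bar>r k * u x - u x\<bar>\<^sup>2) \<partial>\<gamma>)) \<longlonglongrightarrow> 8 * 0 + 8 * 0"
    proof (intro tendsto_add ennreal_tendsto_cmult)
      show "(\<lambda>k. \<integral>\<^sup>+x. ennreal (\<bar>ou (r k) u x - u x\<bar>\<^sup>2) \<partial>\<gamma>) \<longlonglongrightarrow> 0"
        by (rule ou_tendsto_Lp[OF _ iu _ r]) auto
      show "(\<lambda>k. \<integral>\<^sup>+x. ennreal (\<bar>r k * u x - u x\<bar>\<^sup>2) \<partial>\<gamma>) \<longlonglongrightarrow> 0"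
      proof (rule bounded_nn_integral_tendsto_0[OF _ _ iu])
        fix k x
        have "\<bar>r k * u x - u x\<bar> = \<bar>r k - 1\<bar> * \<bar>u x\<bar>" by (simp add: abs_mult[symmetric] left_diff_distrib)
        also have "\<dots> \<le> \<bar>u x\<bar>" using r(1,2)[of k] by (intro mult_left_le_one_le) auto
        finally show "\<bar>r k * u x - u x\<bar> \<le> \<bar>u x\<bar>" .
      next
        have "(\<lambda>k. r k * u x - u x) \<longlonglongrightarrow> 1 * u x - u x" for x by (intro tendsto_intros r)
        then show "AE x in \<gamma>. (\<lambda>k. r k * u x - u x) \<longlonglongrightarrow> 0" by simp
      qed auto
    qed auto
    have "\<forall>\<^sub>F k in sequentially. 8 * (\<integral>\<^sup>+x. ennreal (\<bar>ou (r k) u x - u x\<bar>\<^sup>2) \<partial>\<gamma>) + 8 * (\<integral>\<^sup>+x. ennreal (\<bar>r k * u x - u x\<bar>\<^sup>2) \<partial>\<gamma>) < ennreal d"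
      by (rule order_tendstoD(2)[OF t]) (use d in auto)
    then show ?thesis
    proof eventually_elim
      case (elim k)
      have "(\<integral>\<^sup>+x. ennreal (\<bar>(r k *\<^sub>R ou (r k) (W n) x) \<bullet> b - W n x \<bullet> b\<bar>\<^sup>2) \<partial>\<gamma>) =
         (\<integral>\<^sup>+x. ennreal (\<bar>r k * (ou (r k) u x - u x) + (r k * u x - u x)\<bar>\<^sup>2) \<partial>\<gamma>)"
        by (simp add: ou_b u_def right_diff_distrib)
      also have "\<dots> \<le> 2\<^sup>2 * ((\<integral>\<^sup>+x. ennreal (\<bar>r k * (ou (r k) u x - u x)\<bar>\<^sup>2) \<partial>\<gamma>) + (\<integral>\<^sup>+x. ennreal (\<bar>r k * u x - u x\<bar>\<^sup>2) \<partial>\<gamma>))"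
        by (rule nn_integral_add_power_le) auto
      also have "\<dots> \<le> 8 * ((\<integral>\<^sup>+x. ennreal (\<bar>ou (r k) u x - u x\<bar>\<^sup>2) \<partial>\<gamma>) + (\<integral>\<^sup>+x. ennreal (\<bar>r k * u x - u x\<bar>\<^sup>2) \<partial>\<gamma>))"
      proof (intro mult_mono add_mono nn_integral_mono ennreal_leI power_mono)
        show "\<bar>r k * (ou (r k) u x - u x)\<bar> \<le> \<bar>ou (r k) u x - u x\<bar>" for x
          using r(1,2)[of k] by (simp add: abs_mult mult_left_le_one_le)
      qed auto
      also have "\<dots> < ennreal d" using elim by (simp add: distrib_left)
      finally show ?case .
    qed
  qed
  then have "\<forall>\<^sub>F k in sequentially. \<forall>b\<in>Basis. (\<integral>\<^sup>+x. ennreal (\<bar>(r k *\<^sub>R ou (r k) (W n) x) \<bullet> b - W n x \<bullet> b\<bar>\<^sup>2) \<partial>\<gamma>) < ennreal d"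
    by (intro eventually_ball_finite) auto
  from eventually_happens'[OF sequentially_bot eventually_conj[OF ev3 this]] obtain k where k: "(\<integral>\<^sup>+x. ennreal (\<bar>ou (r k) (w n) x - w n x\<bar>\<^sup>2) \<partial>\<gamma>) < ennreal d"
    "\<And>b. b \<in> Basis \<Longrightarrow> (\<integral>\<^sup>+x. ennreal (\<bar>(r k *\<^sub>R ou (r k) (W n) x) \<bullet> b - W n x \<bullet> b\<bar>\<^sup>2) \<partial>\<gamma>) < ennreal d"
    by blast
  obtain L where L: "C11 L (ou (r k) (w n)) (\<lambda>x. r k *\<^sub>R ou (r k) (W n) x)"
    using ou_C11[OF gw r(1,2)] by blast
  have "(\<integral>\<^sup>+x. ennreal (\<bar>ou (r k) (w n) x - g x\<bar>\<^sup>2) \<partial>\<gamma>) \<le> ennreal e"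
    using nn_integral_square_triangle[OF _ _ _ k(1) n(1)] by (simp add: d_def)
  moreover have "(\<integral>\<^sup>+x. ennreal (\<bar>(r k *\<^sub>R ou (r k) (W n) x) \<bullet> b - G x \<bullet> b\<bar>\<^sup>2) \<partial>\<gamma>) \<le> ennreal e" if "b \<in> Basis" for b
    using nn_integral_square_triangle[OF _ _ _ k(2)[OF that] n(2)[OF that]] by (simp add: d_def)
  ultimately show ?thesis using L by blast
qed

section \<open>Expansion of the entropy density and the heat flow\<close>

text \<open>
  The difference of the two sides has the derivative \<open>w\<^sup>3 / (1 + w)\<close>, which changes sign at 0.
\<close>

lemma ln_1_add_le:
  fixes w :: real assumes "-1 < w"
  shows "ln (1 + w) \<le> w - w\<^sup>2 / 2 + w ^ 3 / 3"
proof -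
  define d where "d w = w - w\<^sup>2 / 2 + w ^ 3 / 3 - ln (1 + w)" for w :: real
  have D: "(d has_real_derivative (w ^ 3 / (1 + w))) (at w)" if "-1 < w" for w
    unfolding d_def using that
    by (auto intro!: derivative_eq_intros simp: field_simps power2_eq_square power3_eq_cube)
  have "d 0 \<le> d w"
  proof (cases "0 \<le> w")
    case True
    show ?thesis
    proof (rule DERIV_nonneg_imp_nondecreasing[OF True])
      fix x assume "0 \<le> x" "x \<le> w"
      then show "\<exists>y. (d has_real_derivative y) (at x) \<and> 0 \<le> y"
        using D[of x] by (intro exI[of _ "x ^ 3 / (1 + x)"]) auto
    qed
  next
    case False
    show ?thesis
    proof (rule DERIV_nonpos_imp_nonincreasing[of w 0 d])
      fix x assume "w \<le> x" "x \<le> 0"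
      then show "\<exists>y. (d has_real_derivative y) (at x) \<and> y \<le> 0"
        using assms D[of x] by (intro exI[of _ "x ^ 3 / (1 + x)"]) (auto simp: divide_le_0_iff power_le_zero_eq)
    qed (use False in auto)
  qed
  then show ?thesis by (simp add: d_def)
qed

text \<open>
  The coefficient \<open>1 / (2 a)\<close> of the square is exact: it becomes the constant of the logarithmic Sobolev
  inequality. The cubic and quartic terms only have to vanish faster.
\<close>

lemma xlnx_taylor:
  fixes a u :: real
  assumes a: "0 < a" and u: "0 < u"
  shows "u * ln u \<le> a * ln a + (ln a + 1) * (u - a) + (u - a)\<^sup>2 / (2 * a) + \<bar>u - a\<bar> ^ 3 / (6 * a\<^sup>2) + (u - a) ^ 4 / (3 * a ^ 3)"
proof -
  define w where "w = u / a - 1"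
  have w: "-1 < w" using a u by (simp add: w_def)
  have uw: "u = a * (1 + w)" using a by (simp add: w_def field_simps)
  have "(1 + w) * ln (1 + w) \<le> (1 + w) * (w - w\<^sup>2 / 2 + w ^ 3 / 3)"
    using w by (intro mult_left_mono ln_1_add_le) auto
  also have "\<dots> = w + w\<^sup>2 / 2 - w ^ 3 / 6 + w ^ 4 / 3"
    by (simp add: field_simps power2_eq_square power3_eq_cube power4_eq_xxxx)
  also have "\<dots> \<le> w + w\<^sup>2 / 2 + \<bar>w\<bar> ^ 3 / 6 + w ^ 4 / 3"
    using abs_ge_minus_self[of "w ^ 3"] by (simp add: power_abs)
  finally have "a * ((1 + w) * ln (1 + w)) \<le> a * (w + w\<^sup>2 / 2 + \<bar>w\<bar> ^ 3 / 6 + w ^ 4 / 3)"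
    using a by (intro mult_left_mono) auto
  moreover have "u * ln u = a * ((1 + w) * ln (1 + w)) + u * ln a"
  proof -
    have "ln u = ln a + ln (1 + w)" unfolding uw using a w by (intro ln_mult_pos) auto
    then show ?thesis by (simp add: uw algebra_simps)
  qed
  moreover have "a * (w + w\<^sup>2 / 2 + \<bar>w\<bar> ^ 3 / 6 + w ^ 4 / 3) =
      (u - a) + (u - a)\<^sup>2 / (2 * a) + \<bar>u - a\<bar> ^ 3 / (6 * a\<^sup>2) + (u - a) ^ 4 / (3 * a ^ 3)"
  proof -
    have ua: "u - a = a * w" using uw by (simp add: algebra_simps)
    show ?thesis unfolding ua using a
      by (simp add: abs_mult power_mult_distrib field_simps power2_eq_square power3_eq_cube power4_eq_xxxx)
  qed
  ultimately show ?thesis by (simp add: algebra_simps)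
qed

lemma xlnx_tangent:
  fixes a m :: real
  assumes "0 < a" "0 < m"
  shows "a * ln a + (ln a + 1) * (m - a) \<le> m * ln m"
proof -
  have "ln (a / m) \<le> a / m - 1" using assms by (intro ln_le_minus_one) auto
  then have "m * (ln a - ln m) \<le> m * (a / m - 1)" using assms by (intro mult_left_mono) (auto simp: ln_div)
  then show ?thesis using assms by (simp add: algebra_simps)
qed

abbreviation heat :: "real \<Rightarrow> ('a::euclidean_space \<Rightarrow> 'b::{banach,second_countable_topology}) \<Rightarrow> 'a \<Rightarrow> 'b" where
  "heat t \<equiv> gauss_avg 1 (sqrt t)"

lemma integrable_gauss_bounded:
  fixes f :: "'a::euclidean_space \<Rightarrow> 'b::{banach,second_countable_topology}"
  assumes "f \<in> borel_measurable borel" "\<And>x. norm (f x) \<le> B"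
  shows "integrable \<gamma> (\<lambda>z. f (a *\<^sub>R x + s *\<^sub>R z))"
  using assms by (intro gauss.integrable_const_bound[of _ B]) auto

lemma norm_gauss_avg_le:
  fixes f :: "'a::euclidean_space \<Rightarrow> 'b::{banach,second_countable_topology}"
  assumes "\<And>x. norm (f x) \<le> B" "f \<in> borel_measurable borel" 
  shows "norm (gauss_avg a s f x) \<le> B"
proof -
  have "norm (gauss_avg a s f x) \<le> (\<integral>z. norm (f (a *\<^sub>R x + s *\<^sub>R z)) \<partial>\<gamma>)"
    unfolding gauss_avg_def by (rule integral_norm_bound)
  also have "\<dots> \<le> (\<integral>(z::'a). B \<partial>\<gamma>)"
    using integrable_gauss_bounded[OF assms(2,1)] assms(1)
    by (intro integral_mono) auto
  finally show ?thesis by simp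
qed

lemma gauss_avg_mono:
  fixes f g :: "'a::euclidean_space \<Rightarrow> real"
  assumes "f \<in> borel_measurable borel" "\<And>x. \<bar>f x\<bar> \<le> B" "g \<in> borel_measurable borel" "\<And>x. \<bar>g x\<bar> \<le> B'" "\<And>x. f x \<le> g x"
  shows "gauss_avg a s f x \<le> gauss_avg a s g x"
  unfolding gauss_avg_def using assms
  by (intro integral_mono integrable_gauss_bounded[of _ B] integrable_gauss_bounded[of _ B']) auto

lemma heat_heat:
  fixes f :: "'a::euclidean_space \<Rightarrow> real"
  assumes "0 \<le> s" "0 \<le> t" and [measurable]: "f \<in> borel_measurable borel" and b: "\<And>x. \<bar>f x\<bar> \<le> B"
  shows "heat s (heat t f) x = heat (s + t) f x"
proof -
  have i: "integrable (\<gamma> \<Otimes>\<^sub>M \<gamma>) (\<lambda>(z, y). f (x + sqrt s *\<^sub>R z + sqrt t *\<^sub>R y))"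
  proof -
    interpret P: pair_prob_space "\<gamma> :: 'a measure" "\<gamma> :: 'a measure" ..
    show ?thesis by (rule P.P.integrable_const_bound[of _ B]) (use b in auto)
  qed
  have dist: "distr (\<gamma> \<Otimes>\<^sub>M \<gamma>) borel (\<lambda>(z::'a, y). sqrt s *\<^sub>R z + sqrt t *\<^sub>R y) = distr \<gamma> borel (\<lambda>z. sqrt (s + t) *\<^sub>R z)"
  proof (rule measure_eqI)
    fix A :: "'a set" assume "A \<in> sets (distr (\<gamma> \<Otimes>\<^sub>M \<gamma>) borel (\<lambda>(z::'a, y). sqrt s *\<^sub>R z + sqrt t *\<^sub>R y))"
    then have [measurable]: "A \<in> sets borel" by simp
    have "emeasure (distr (\<gamma> \<Otimes>\<^sub>M \<gamma>) borel (\<lambda>(z::'a, y). sqrt s *\<^sub>R z + sqrt t *\<^sub>R y)) A =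
       (\<integral>\<^sup>+x. indicator A x \<partial>distr (\<gamma> \<Otimes>\<^sub>M \<gamma>) borel (\<lambda>(z::'a, y). sqrt s *\<^sub>R z + sqrt t *\<^sub>R y))" by simp
    also have "\<dots> = (\<integral>\<^sup>+p. indicator A (case p of (z, y) \<Rightarrow> sqrt s *\<^sub>R z + sqrt t *\<^sub>R y) \<partial>(\<gamma> \<Otimes>\<^sub>M \<gamma>))"
      by (rule nn_integral_distr) auto
    also have "\<dots> = (\<integral>\<^sup>+z. \<integral>\<^sup>+y. indicator A (sqrt s *\<^sub>R z + sqrt t *\<^sub>R y) \<partial>\<gamma> \<partial>\<gamma>)"
      by (subst gauss.nn_integral_fst[symmetric]) auto
    also have "\<dots> = (\<integral>\<^sup>+z. indicator A (sqrt (s + t) *\<^sub>R z) \<partial>\<gamma>)"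
      using nn_integral_gauss_sum[of "sqrt s" "sqrt t" "indicator A"] assms by simp
    also have "\<dots> = (\<integral>\<^sup>+x. indicator A x \<partial>distr \<gamma> borel (\<lambda>z. sqrt (s + t) *\<^sub>R z))"
      by (rule nn_integral_distr[symmetric]) auto
    finally show "emeasure (distr (\<gamma> \<Otimes>\<^sub>M \<gamma>) borel (\<lambda>(z::'a, y). sqrt s *\<^sub>R z + sqrt t *\<^sub>R y)) A =
       emeasure (distr \<gamma> borel (\<lambda>z. sqrt (s + t) *\<^sub>R z)) A" by simp
  qed simp
  interpret P: pair_sigma_finite "\<gamma> :: 'a measure" "\<gamma> :: 'a measure" ..
  have "heat s (heat t f) x = (\<integral>z. \<integral>y. f (x + sqrt s *\<^sub>R z + sqrt t *\<^sub>R y) \<partial>\<gamma> \<partial>\<gamma>)"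
    by (simp add: gauss_avg_def)
  also have "\<dots> = (\<integral>p. (case p of (z, y) \<Rightarrow> f (x + sqrt s *\<^sub>R z + sqrt t *\<^sub>R y)) \<partial>(\<gamma> \<Otimes>\<^sub>M \<gamma>))"
    using P.integral_fst'[OF i] by simp
  also have "\<dots> = (\<integral>u. f (x + u) \<partial>distr (\<gamma> \<Otimes>\<^sub>M \<gamma>) borel (\<lambda>(z::'a, y). sqrt s *\<^sub>R z + sqrt t *\<^sub>R y))"
    by (subst integral_distr) (auto simp: split_beta' add.assoc)
  also have "\<dots> = (\<integral>z. f (x + sqrt (s + t) *\<^sub>R z) \<partial>\<gamma>)"
    unfolding dist by (subst integral_distr) auto
  finally show ?thesis by (simp add: gauss_avg_def)
qed

section \<open>The logarithmic Sobolev inequality for regular functions\<close>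

lemma C11D:
  assumes "C11 L f F"
  shows "f \<in> borel_measurable borel" "F \<in> borel_measurable borel" "\<bar>f x\<bar> \<le> L" "norm (F x) \<le> L"
    "\<bar>f (x + v) - f x - F x \<bullet> v\<bar> \<le> L * (norm v)\<^sup>2" "0 \<le> L"
  using assms unfolding C11_def by (auto intro: order_trans[OF abs_ge_zero])

lemma C11_increment:
  assumes "C11 L f F" shows "\<bar>f (x + v) - f x\<bar> \<le> L * (norm v + (norm v)\<^sup>2)"
proof -
  have "\<bar>F x \<bullet> v\<bar> \<le> L * norm v"
    using Cauchy_Schwarz_ineq2[of "F x" v] mult_right_mono[OF C11D(4)[OF assms, of x] norm_ge_zero[of v]] by linarith
  then show ?thesis using C11D(5)[OF assms, of x v] by (simp add: distrib_left)
qed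

lemma C11_continuous:
  assumes "C11 L f F" shows "isCont f x"
proof -
  have "((\<lambda>v. f (x + v) - f x) \<longlongrightarrow> 0) (at 0)"
  proof (rule Lim_null_comparison[OF always_eventually])
    show "\<forall>v. norm (f (x + v) - f x) \<le> L * (norm v + (norm v)\<^sup>2)" using C11_increment[OF assms] by simp
    have "((\<lambda>v::'a. L * (norm v + (norm v)\<^sup>2)) \<longlongrightarrow> L * (norm (0::'a) + (norm (0::'a))\<^sup>2)) (at 0)" by (intro tendsto_intros)
    then show "((\<lambda>v::'a. L * (norm v + (norm v)\<^sup>2)) \<longlongrightarrow> 0) (at 0)" by simp
  qed
  then have "((\<lambda>v. f (x + v)) \<longlongrightarrow> f x) (at 0)" by (rule LIM_zero_cancel)
  then show ?thesis by (simp add: isCont_iff)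
qed

text \<open>
  The coefficient of \<open>h\<^sup>3\<^sup>/\<^sup>2\<close> in the entropy produced by a heat step of length \<open>h\<close>. The three summands come from the
  quadratic, cubic and quartic terms of the expansion of \<open>u ln u\<close>.
\<close>

definition entropy_remainder :: "real \<Rightarrow> real \<Rightarrow> real \<Rightarrow> real" where
  "entropy_remainder L c q = (2 * L\<^sup>2 * q ^ 3 + L\<^sup>2 * q ^ 4) / (2 * c) + 8 * L ^ 3 * (q ^ 3 + q ^ 6) / (6 * c\<^sup>2) + 16 * L ^ 4 * (q ^ 4 + q ^ 8) / (3 * c ^ 3)"

lemma integrable_entropy_remainder: "integrable \<gamma> (\<lambda>z::'a::euclidean_space. entropy_remainder L c (norm z))"
  unfolding entropy_remainder_def
  by (intro Bochner_Integration.integrable_add integrable_divide integrable_mult_right integrable_norm_power)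

text \<open>
  The increment of \<open>f\<close> is \<open>\<surd>h (F x \<bullet> z)\<close> up to an error of order \<open>h\<close>. Hence its square is \<open>h (F x \<bullet> z)\<^sup>2\<close> up to
  order \<open>h\<^sup>3\<^sup>/\<^sup>2\<close>, and its higher powers are of that order.
\<close>

lemma xlnx_increment:
  fixes f :: "'a::euclidean_space \<Rightarrow> real"
  assumes f: "C11 L f F" and c: "0 < c" "\<And>x. c \<le> f x" and h: "0 < h" "h \<le> 1"
  shows "f (x + sqrt h *\<^sub>R z) * ln (f (x + sqrt h *\<^sub>R z)) \<le>
     f x * ln (f x) + (ln (f x) + 1) * (f (x + sqrt h *\<^sub>R z) - f x) + h * (F x \<bullet> z)\<^sup>2 / (2 * f x) +
      h * sqrt h * entropy_remainder L c (norm z)"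
proof -
  define a u q s where "a = f x" and "u = f (x + sqrt h *\<^sub>R z)" and "q = norm z" and "s = sqrt h"
  have a: "c \<le> a" "0 < a" and u: "0 < u" using c(2)[of x] c(2)[of "x + sqrt h *\<^sub>R z"] c(1) by (auto simp: a_def u_def)
  have L: "0 \<le> L" by (rule C11D(6)[OF f])
  have s: "0 < s" "s \<le> 1" "s * s = h" using h by (auto simp: s_def)
  have q: "0 \<le> q" by (simp add: q_def)
  have nv: "norm (sqrt h *\<^sub>R z) = s * q" using h by (simp add: s_def q_def)
  have s2: "s\<^sup>2 \<le> s" using mult_left_mono[of s 1 s] s(1,2) by (simp add: power2_eq_square)
  define w where "w = u - a"
  define p where "p = F x \<bullet> z"
  have w1: "\<bar>w\<bar> \<le> s * (L * (q + q\<^sup>2))"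
  proof -
    have "\<bar>w\<bar> \<le> L * (s * q + (s * q)\<^sup>2)"
      using C11_increment[OF f, of x "sqrt h *\<^sub>R z"] unfolding nv by (simp add: w_def u_def a_def)
    also have "\<dots> \<le> L * (s * q + s * q\<^sup>2)"
      using L s2 s(1) q by (intro mult_left_mono add_mono) (auto simp: power_mult_distrib mult_right_mono)
    finally show ?thesis by (simp add: algebra_simps)
  qed
  have w2: "\<bar>w - s * p\<bar> \<le> L * h * q\<^sup>2"
    using C11D(5)[OF f, of x "sqrt h *\<^sub>R z"] h unfolding nv by (simp add: w_def u_def a_def p_def s_def power_mult_distrib)
  have p: "\<bar>p\<bar> \<le> L * q"
    using Cauchy_Schwarz_ineq2[of "F x" z] mult_right_mono[OF C11D(4)[OF f, of x] norm_ge_zero[of z]]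
    unfolding p_def q_def by linarith
  have hs: "h * h \<le> h * s" using mult_left_mono[of h s h] s2 s(3) h by (simp add: power2_eq_square)
  have "w\<^sup>2 = (s * p)\<^sup>2 + 2 * (s * p) * (w - s * p) + (w - s * p)\<^sup>2"
    by (simp add: power2_eq_square algebra_simps)
  also have "\<dots> \<le> h * p\<^sup>2 + 2 * (s * (L * q)) * (L * h * q\<^sup>2) + (L * h * q\<^sup>2)\<^sup>2"
  proof (intro add_mono)
    show "(s * p)\<^sup>2 \<le> h * p\<^sup>2" by (simp add: power2_eq_square flip: s(3))
    have "2 * (s * p) * (w - s * p) \<le> 2 * ((s * \<bar>p\<bar>) * \<bar>w - s * p\<bar>)"
      using s abs_ge_self[of "(s * p) * (w - s * p)"] by (simp add: abs_mult)
    also have "\<dots> \<le> 2 * ((s * (L * q)) * (L * h * q\<^sup>2))"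
      using p w2 s L q by (intro mult_left_mono mult_mono) auto
    finally show "2 * (s * p) * (w - s * p) \<le> 2 * (s * (L * q)) * (L * h * q\<^sup>2)" by simp
    show "(w - s * p)\<^sup>2 \<le> (L * h * q\<^sup>2)\<^sup>2"
      using power_mono[OF w2 abs_ge_zero, of 2] by simp
  qed
  also have "\<dots> = h * p\<^sup>2 + (h * s * (2 * L\<^sup>2 * q ^ 3) + (h * h) * (L\<^sup>2 * q ^ 4))"
    by (simp add: power2_eq_square power3_eq_cube power4_eq_xxxx)
  also have "\<dots> \<le> h * p\<^sup>2 + (h * s * (2 * L\<^sup>2 * q ^ 3) + (h * s) * (L\<^sup>2 * q ^ 4))"
    using hs by (intro add_left_mono mult_right_mono) auto
  finally have sq: "w\<^sup>2 \<le> h * p\<^sup>2 + h * s * (2 * L\<^sup>2 * q ^ 3 + L\<^sup>2 * q ^ 4)" by (simp add: algebra_simps)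
  have qq: "(q + q\<^sup>2) ^ k \<le> 2 ^ k * (q ^ k + q ^ (2 * k))" for k
    using add_power_le[of q "q\<^sup>2" k] q by (simp add: power_mult)
  have cu: "\<bar>w\<bar> ^ 3 \<le> h * s * (8 * L ^ 3 * (q ^ 3 + q ^ 6))"
  proof -
    have "\<bar>w\<bar> ^ 3 \<le> (s * (L * (q + q\<^sup>2))) ^ 3" by (rule power_mono[OF w1]) simp
    also have "\<dots> = (h * s * L ^ 3) * (q + q\<^sup>2) ^ 3" using s(3) by (simp add: power_mult_distrib power3_eq_cube)
    also have "\<dots> \<le> (h * s * L ^ 3) * (2 ^ 3 * (q ^ 3 + q ^ (2 * 3)))"
      using h s L qq[of 3] by (intro mult_left_mono) auto
    finally show ?thesis by (simp add: algebra_simps)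
  qed
  have qu: "w ^ 4 \<le> h * s * (16 * L ^ 4 * (q ^ 4 + q ^ 8))"
  proof -
    have "w ^ 4 = \<bar>w\<bar> ^ 4" by simp
    also have "\<dots> \<le> (s * (L * (q + q\<^sup>2))) ^ 4" by (rule power_mono[OF w1]) simp
    also have "\<dots> = (h * h) * (L ^ 4 * (q + q\<^sup>2) ^ 4)" unfolding s(3)[symmetric] by (simp add: power_mult_distrib power4_eq_xxxx)
    also have "\<dots> \<le> (h * s) * (L ^ 4 * (2 ^ 4 * (q ^ 4 + q ^ (2 * 4))))"
      using h s L q qq[of 4] hs by (intro mult_mono mult_left_mono) auto
    finally show ?thesis by (simp add: algebra_simps)
  qed
  have hs0: "0 \<le> h * s" using h s by simp
  have "u * ln u \<le> a * ln a + (ln a + 1) * w + w\<^sup>2 / (2 * a) + \<bar>w\<bar> ^ 3 / (6 * a\<^sup>2) + w ^ 4 / (3 * a ^ 3)"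
    unfolding w_def by (rule xlnx_taylor) (use a u in auto)
  also have "\<dots> \<le> a * ln a + (ln a + 1) * w + (h * p\<^sup>2 / (2 * a) + h * s * (2 * L\<^sup>2 * q ^ 3 + L\<^sup>2 * q ^ 4) / (2 * c)) +
      h * s * (8 * L ^ 3 * (q ^ 3 + q ^ 6)) / (6 * c\<^sup>2) + h * s * (16 * L ^ 4 * (q ^ 4 + q ^ 8)) / (3 * c ^ 3)"
  proof (intro add_mono order_refl)
    have "w\<^sup>2 / (2 * a) \<le> h * p\<^sup>2 / (2 * a) + h * s * (2 * L\<^sup>2 * q ^ 3 + L\<^sup>2 * q ^ 4) / (2 * a)"
      using divide_right_mono[OF sq, of "2 * a"] a by (simp add: add_divide_distrib)
    also have "\<dots> \<le> h * p\<^sup>2 / (2 * a) + h * s * (2 * L\<^sup>2 * q ^ 3 + L\<^sup>2 * q ^ 4) / (2 * c)"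
      using a c hs0 q by (intro add_left_mono divide_left_mono) auto
    finally show "w\<^sup>2 / (2 * a) \<le> h * p\<^sup>2 / (2 * a) + h * s * (2 * L\<^sup>2 * q ^ 3 + L\<^sup>2 * q ^ 4) / (2 * c)" .
    show "\<bar>w\<bar> ^ 3 / (6 * a\<^sup>2) \<le> h * s * (8 * L ^ 3 * (q ^ 3 + q ^ 6)) / (6 * c\<^sup>2)"
      using cu a c hs0 q L by (intro frac_le) (auto intro!: power_mono)
    show "w ^ 4 / (3 * a ^ 3) \<le> h * s * (16 * L ^ 4 * (q ^ 4 + q ^ 8)) / (3 * c ^ 3)"
      using qu a c hs0 q L by (intro frac_le) (auto intro!: power_mono)
  qed
  also have "\<dots> = a * ln a + (ln a + 1) * w + h * p\<^sup>2 / (2 * a) + h * s * entropy_remainder L c q"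
    by (simp add: entropy_remainder_def distrib_left)
  finally show ?thesis by (simp add: a_def u_def w_def p_def q_def s_def)
qed

lemma xlnx_bounded:
  fixes f :: "'a \<Rightarrow> real"
  assumes "0 < c" "\<And>x. c \<le> f x" "\<And>x. \<bar>f x\<bar> \<le> L"
  shows "\<exists>B. \<forall>x. \<bar>f x * ln (f x)\<bar> \<le> B"
proof -
  have "\<bar>f x * ln (f x)\<bar> \<le> L * (\<bar>ln c\<bar> + \<bar>ln L\<bar>)" for x
  proof -
    have "c \<le> f x" "f x \<le> L" using assms(2)[of x] assms(3)[of x] by auto
    then have "ln c \<le> ln (f x)" "ln (f x) \<le> ln L" using assms(1) by auto
    then have "\<bar>ln (f x)\<bar> \<le> \<bar>ln c\<bar> + \<bar>ln L\<bar>" by linarith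
    then show ?thesis unfolding abs_mult using assms(3)[of x] by (intro mult_mono) auto
  qed
  then show ?thesis by blast
qed

definition xlnx :: "real \<Rightarrow> real" where "xlnx u = u * ln u"

lemma measurable_xlnx [measurable]: "xlnx \<in> borel_measurable borel"
  unfolding xlnx_def[abs_def] by measurable

lemma gauss_avg_ge:
  fixes f :: "'a::euclidean_space \<Rightarrow> real"
  assumes "f \<in> borel_measurable borel" "\<And>x. \<bar>f x\<bar> \<le> B" "\<And>x. c \<le> f x"
  shows "c \<le> gauss_avg a s f x"
proof -
  have "c = gauss_avg a s (\<lambda>_. c) x" by (simp add: gauss_avg_def)
  also have "\<dots> \<le> gauss_avg a s f x" by (rule gauss_avg_mono[of _ "\<bar>c\<bar>" _ B]) (use assms in auto)
  finally show ?thesis .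
qed

text \<open>
  Averaging the pointwise expansion over the Gaussian increment turns \<open>(F x \<bullet> z)\<^sup>2\<close> into \<open>\<bar>F x\<bar>\<^sup>2\<close>, and
  convexity bounds the tangent of \<open>u ln u\<close> at \<open>f x\<close> by the value at the mean.
\<close>

lemma heat_entropy_step:
  fixes f :: "'a::euclidean_space \<Rightarrow> real"
  assumes f: "C11 L f F" and c: "0 < c" "\<And>x. c \<le> f x" and h: "0 < h" "h \<le> 1"
  shows "heat h (\<lambda>x. xlnx (f x)) x - xlnx (heat h f x) \<le>
     h / 2 * ((norm (F x))\<^sup>2 / f x) + h * sqrt h * (\<integral>z. entropy_remainder L c (norm z) \<partial>(\<gamma>::'a measure))"
proof -
  note [measurable] = C11D(1)[OF f]
  obtain B where B: "\<And>x. \<bar>xlnx (f x)\<bar> \<le> B" using xlnx_bounded[of c f L] c C11D(3)[OF f] by (auto simp: xlnx_def)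
  have i1: "integrable \<gamma> (\<lambda>z. xlnx (f (x + sqrt h *\<^sub>R z)))"
    using integrable_gauss_bounded[of "\<lambda>x. xlnx (f x)" B 1 x "sqrt h"] B by simp
  have i2: "integrable \<gamma> (\<lambda>z. f (x + sqrt h *\<^sub>R z))"
    using integrable_gauss_bounded[of f L 1 x "sqrt h"] C11D(3)[OF f] by simp
  have m: "c \<le> heat h f x" by (rule gauss_avg_ge[OF _ C11D(3)[OF f] c(2)]) simp
  note i3 = integrable_entropy_remainder[of L c, where 'a = 'a]
  have "heat h (\<lambda>x. xlnx (f x)) x \<le> (\<integral>z. f x * ln (f x) + (ln (f x) + 1) * (f (x + sqrt h *\<^sub>R z) - f x) + h * (F x \<bullet> z)\<^sup>2 / (2 * f x) +
      h * sqrt h * entropy_remainder L c (norm z) \<partial>\<gamma>)"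
    unfolding gauss_avg_def
  proof (rule integral_mono)
    show "xlnx (f (1 *\<^sub>R x + sqrt h *\<^sub>R z)) \<le> f x * ln (f x) + (ln (f x) + 1) * (f (x + sqrt h *\<^sub>R z) - f x) + h * (F x \<bullet> z)\<^sup>2 / (2 * f x) +
      h * sqrt h * entropy_remainder L c (norm z)" for z
      using xlnx_increment[OF f c h, of x z] by (simp add: xlnx_def)
  qed (use i1 i2 i3 in auto)
  also have "\<dots> = f x * ln (f x) + (ln (f x) + 1) * (heat h f x - f x) + h * (norm (F x))\<^sup>2 / (2 * f x) +
      h * sqrt h * (\<integral>z. entropy_remainder L c (norm z) \<partial>(\<gamma>::'a measure))"
    using i2 i3 by (simp add: gauss_avg_def)
  also have "\<dots> \<le> xlnx (heat h f x) + h * (norm (F x))\<^sup>2 / (2 * f x) +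
      h * sqrt h * (\<integral>z. entropy_remainder L c (norm z) \<partial>(\<gamma>::'a measure))"
    using xlnx_tangent[of "f x" "heat h f x"] m c(1) c(2)[of x] by (simp add: xlnx_def)
  finally show ?thesis by simp
qed

lemma gauss_avg_C11:
  fixes f :: "'a::euclidean_space \<Rightarrow> real"
  assumes f: "C11 L f F"
  shows "C11 L (heat t f) (heat t F)"
  unfolding C11_def
proof (intro conjI allI)
  note [measurable] = C11D(1,2)[OF f]
  show "heat t f \<in> borel_measurable borel" "heat t F \<in> borel_measurable borel" by measurable
  show "\<bar>heat t f x\<bar> \<le> L" for x using norm_gauss_avg_le[of f L 1 "sqrt t" x] C11D(3)[OF f] by simp
  show "norm (heat t F x) \<le> L" for x by (rule norm_gauss_avg_le[OF C11D(4)[OF f]]) simp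
  fix x v
  have i1: "integrable \<gamma> (\<lambda>z. f (y + sqrt t *\<^sub>R z))" for y
    using integrable_gauss_bounded[of f L 1 y "sqrt t"] C11D(3)[OF f] by simp
  have i2: "integrable \<gamma> (\<lambda>z. F (y + sqrt t *\<^sub>R z))" for y
    using integrable_gauss_bounded[of F L 1 y "sqrt t"] C11D(4)[OF f] by simp
  have "heat t f (x + v) - heat t f x - heat t F x \<bullet> v =
     (\<integral>z. f ((x + sqrt t *\<^sub>R z) + v) - f (x + sqrt t *\<^sub>R z) - F (x + sqrt t *\<^sub>R z) \<bullet> v \<partial>\<gamma>)"
  proof -
    have "integrable \<gamma> (\<lambda>z. f ((x + sqrt t *\<^sub>R z) + v))" "heat t f (x + v) = (\<integral>z. f ((x + sqrt t *\<^sub>R z) + v) \<partial>\<gamma>)"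
      using i1[of "x + v"] by (simp_all add: gauss_avg_def ac_simps)
    then show ?thesis using i1[of x] i2[of x] by (simp add: gauss_avg_def)
  qed
  also have "\<bar>\<dots>\<bar> \<le> (\<integral>(z::'a). L * (norm v)\<^sup>2 \<partial>\<gamma>)"
    by (rule order_trans[OF integral_abs_bound integral_mono'])
       (use C11D(5)[OF f] order_trans[OF abs_ge_zero C11D(5)[OF f]] in auto)
  finally show "\<bar>heat t f (x + v) - heat t f x - heat t F x \<bullet> v\<bar> \<le> L * (norm v)\<^sup>2"
    by simp
qed

lemma fisher_bounded:
  assumes f: "C11 L f F" and c: "0 < c" "\<And>x. c \<le> f x"
  shows "\<bar>(norm (F x))\<^sup>2 / f x\<bar> \<le> L\<^sup>2 / c"
proof -
  have "0 < f x" using c(1) c(2)[of x] by linarith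
  then have "\<bar>(norm (F x))\<^sup>2 / f x\<bar> = (norm (F x))\<^sup>2 / f x" by simp
  also have "\<dots> \<le> L\<^sup>2 / c"
    using c C11D(4)[OF f, of x] by (intro frac_le power_mono) auto
  finally show ?thesis .
qed

text \<open>
  Jensen's inequality for the jointly convex function \<open>\<bar>P\<bar>\<^sup>2 / u\<close>, written as the supremum over \<open>p\<close> of the
  affine functions \<open>2 (P \<bullet> p) - u \<bar>p\<bar>\<^sup>2\<close>.
\<close>

lemma fisher_heat_le:
  fixes f :: "'a::euclidean_space \<Rightarrow> real"
  assumes f: "C11 L f F" and c: "0 < c" "\<And>x. c \<le> f x"
  shows "(norm (heat t F x))\<^sup>2 / heat t f x \<le> heat t (\<lambda>x. (norm (F x))\<^sup>2 / f x) x"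
proof -
  note [measurable] = C11D(1,2)[OF f]
  define m M where "m = heat t f x" and "M = heat t F x"
  have m: "0 < m" using gauss_avg_ge[of f L c 1 "sqrt t" x] C11D(3)[OF f] c by (simp add: m_def)
  \<comment> \<open>The slope at which the affine minorant is exact at the averages.\<close>
  define p where "p = M /\<^sub>R m"
  have i0: "integrable \<gamma> (\<lambda>z. (norm (F (x + sqrt t *\<^sub>R z)))\<^sup>2 / f (x + sqrt t *\<^sub>R z))"
    using integrable_gauss_bounded[of "\<lambda>x. (norm (F x))\<^sup>2 / f x" "L\<^sup>2 / c" 1 x "sqrt t"] fisher_bounded[OF f c] by simp
  have i1: "integrable \<gamma> (\<lambda>z. f (x + sqrt t *\<^sub>R z))"
    using integrable_gauss_bounded[of f L 1 x "sqrt t"] C11D(3)[OF f] by simp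
  have i2: "integrable \<gamma> (\<lambda>z. F (x + sqrt t *\<^sub>R z))"
    using integrable_gauss_bounded[of F L 1 x "sqrt t"] C11D(4)[OF f] by simp
  have pw: "2 * (F y \<bullet> p) - f y * (norm p)\<^sup>2 \<le> (norm (F y))\<^sup>2 / f y" for y
  proof -
    have fy: "0 < f y" using c(1) c(2)[of y] by linarith
    have "0 \<le> (norm (F y - f y *\<^sub>R p))\<^sup>2" by simp
    also have "\<dots> = (norm (F y))\<^sup>2 - f y * (2 * (F y \<bullet> p) - f y * (norm p)\<^sup>2)"
      unfolding power2_norm_eq_inner by (simp add: inner_diff_left inner_diff_right inner_commute algebra_simps)
    finally show ?thesis using fy by (simp add: le_divide_eq mult.commute)
  qed
  have "(norm M)\<^sup>2 / m = 2 * (M \<bullet> p) - m * (norm p)\<^sup>2"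
    using m unfolding p_def power2_norm_eq_inner by (simp add: field_simps)
  also have "\<dots> = (\<integral>z. 2 * (F (x + sqrt t *\<^sub>R z) \<bullet> p) - f (x + sqrt t *\<^sub>R z) * (norm p)\<^sup>2 \<partial>\<gamma>)"
    using i1 i2 by (simp add: gauss_avg_def m_def M_def)
  also have "\<dots> \<le> heat t (\<lambda>x. (norm (F x))\<^sup>2 / f x) x"
    unfolding gauss_avg_def using i0 i1 i2 pw by (intro integral_mono) auto
  finally show ?thesis by (simp add: m_def M_def)
qed

text \<open>
  Each further step is the local estimate applied to the function already averaged. Its Fisher density
  is dominated by the average of the original one, so all steps contribute the same Fisher term.
\<close>

lemma heat_entropy_steps:
  fixes f :: "'a::euclidean_space \<Rightarrow> real"
  assumes f: "C11 L f F" and c: "0 < c" "\<And>x. c \<le> f x" and h: "0 < h" "h \<le> 1"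
  defines "K \<equiv> (\<integral>z. entropy_remainder L c (norm z) \<partial>(\<gamma>::'a measure))"
  shows "heat (real (Suc k) * h) (\<lambda>x. xlnx (f x)) x - xlnx (heat (real (Suc k) * h) f x) \<le>
     real (Suc k) * (h / 2 * heat (real k * h) (\<lambda>x. (norm (F x))\<^sup>2 / f x) x + h * sqrt h * K)"
proof (induction k arbitrary: x)
  case 0
  have "heat 0 g x = g x" for g :: "'a \<Rightarrow> real" by (simp add: gauss_avg_def)
  then show ?case using heat_entropy_step[OF f c h, of x] by (simp add: K_def)
next
  case (Suc k)
  note [measurable] = C11D(1,2)[OF f]
  define \<Phi> where "\<Phi> x = (norm (F x))\<^sup>2 / f x" for x
  have [measurable]: "\<Phi> \<in> borel_measurable borel" unfolding \<Phi>_def[abs_def] by measurable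
  define t where "t = real (Suc k) * h"
  have t: "0 \<le> t" using h by (simp add: t_def)
  have th: "real (Suc (Suc k)) * h = h + t" by (simp add: t_def algebra_simps)
  obtain B where B: "\<And>x. \<bar>xlnx (f x)\<bar> \<le> B" using xlnx_bounded[of c f L] c C11D(3)[OF f] by (auto simp: xlnx_def)
  define u where "u = heat t f"
  have u: "C11 L u (heat t F)" unfolding u_def by (rule gauss_avg_C11[OF f])
  note [measurable] = C11D(1)[OF u]
  have uc: "c \<le> u x" for x unfolding u_def by (rule gauss_avg_ge[OF _ C11D(3)[OF f] c(2)]) simp
  obtain B' where B': "\<And>x. \<bar>xlnx (u x)\<bar> \<le> B'" using xlnx_bounded[of c u L] c(1) uc C11D(3)[OF u] by (auto simp: xlnx_def)
  have \<Phi>b: "\<bar>\<Phi> x\<bar> \<le> L\<^sup>2 / c" for x unfolding \<Phi>_def by (rule fisher_bounded[OF f c])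
  have h\<Phi>b: "\<bar>heat s \<Phi> x\<bar> \<le> L\<^sup>2 / c" for s x using norm_gauss_avg_le[of \<Phi> "L\<^sup>2 / c"] \<Phi>b by simp
  have hB: "\<bar>heat t (\<lambda>x. xlnx (f x)) x\<bar> \<le> B" for x using norm_gauss_avg_le[of "\<lambda>x. xlnx (f x)" B] B by simp
  have 1: "heat h (\<lambda>x. xlnx (u x)) x - xlnx (heat h u x) \<le> h / 2 * heat t \<Phi> x + h * sqrt h * K"
  proof -
    have "h / 2 * ((norm (heat t F x))\<^sup>2 / u x) \<le> h / 2 * heat t \<Phi> x"
      unfolding u_def \<Phi>_def[abs_def] using h by (intro mult_left_mono fisher_heat_le[OF f c]) auto
    then show ?thesis
      using heat_entropy_step[OF u c(1) uc h, of x] unfolding K_def by linarith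
  qed
  have 2: "heat h (\<lambda>x. heat t (\<lambda>x. xlnx (f x)) x - xlnx (u x)) x \<le>
     heat h (\<lambda>x. real (Suc k) * (h / 2 * heat (real k * h) \<Phi> x + h * sqrt h * K)) x"
  proof (rule gauss_avg_mono)
    show "\<bar>heat t (\<lambda>x. xlnx (f x)) x - xlnx (u x)\<bar> \<le> B + B'" for x using hB[of x] B'[of x] by linarith
    show "\<bar>real (Suc k) * (h / 2 * heat (real k * h) \<Phi> x + h * sqrt h * K)\<bar> \<le> real (Suc k) * (h / 2 * (L\<^sup>2 / c) + \<bar>h * sqrt h * K\<bar>)" for x
      unfolding abs_mult[of "real (Suc k)"] using h\<Phi>b[of "real k * h" x] mult_left_mono[OF h\<Phi>b[of "real k * h" x], of h] h
      by (intro mult_mono order_trans[OF abs_triangle_ineq] add_mono) (auto simp: abs_mult intro!: mult_left_mono)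
    show "heat t (\<lambda>x. xlnx (f x)) x - xlnx (u x) \<le> real (Suc k) * (h / 2 * heat (real k * h) \<Phi> x + h * sqrt h * K)" for x
      using Suc.IH[of x] unfolding t_def u_def \<Phi>_def[abs_def] by simp
  qed auto
  have 3: "heat h (\<lambda>x. heat t (\<lambda>x. xlnx (f x)) x - xlnx (u x)) x = heat (h + t) (\<lambda>x. xlnx (f x)) x - heat h (\<lambda>x. xlnx (u x)) x"
  proof -
    have "integrable \<gamma> (\<lambda>z. heat t (\<lambda>x. xlnx (f x)) (1 *\<^sub>R x + sqrt h *\<^sub>R z))"
      by (rule integrable_gauss_bounded[of _ B]) (use hB in auto)
    moreover have "integrable \<gamma> (\<lambda>z. xlnx (u (1 *\<^sub>R x + sqrt h *\<^sub>R z)))"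
      by (rule integrable_gauss_bounded[of "\<lambda>x. xlnx (u x)" B']) (use B' in auto)
    ultimately have "heat h (\<lambda>x. heat t (\<lambda>x. xlnx (f x)) x - xlnx (u x)) x = heat h (heat t (\<lambda>x. xlnx (f x))) x - heat h (\<lambda>x. xlnx (u x)) x"
      unfolding gauss_avg_def[of 1 "sqrt h"] by (rule Bochner_Integration.integral_diff)
    also have "heat h (heat t (\<lambda>x. xlnx (f x))) x = heat (h + t) (\<lambda>x. xlnx (f x)) x"
      using heat_heat[of h t "\<lambda>x. xlnx (f x)" B x] h t B by simp
    finally show ?thesis .
  qed
  have 4: "heat h (\<lambda>x. real (Suc k) * (h / 2 * heat (real k * h) \<Phi> x + h * sqrt h * K)) x =
     real (Suc k) * (h / 2 * heat t \<Phi> x + h * sqrt h * K)"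
  proof -
    have i: "integrable \<gamma> (\<lambda>z. heat (real k * h) \<Phi> (1 *\<^sub>R x + sqrt h *\<^sub>R z))"
      by (rule integrable_gauss_bounded[of _ "L\<^sup>2 / c"]) (use h\<Phi>b in auto)
    have "heat h (\<lambda>x. real (Suc k) * (h / 2 * heat (real k * h) \<Phi> x + h * sqrt h * K)) x =
       real (Suc k) * (h / 2 * heat h (heat (real k * h) \<Phi>) x + h * sqrt h * K)"
      unfolding gauss_avg_def[of 1 "sqrt h"] using i by simp
    also have "heat h (heat (real k * h) \<Phi>) x = heat t \<Phi> x"
      using heat_heat[of h "real k * h" \<Phi> "L\<^sup>2 / c" x] h \<Phi>b by (simp add: t_def algebra_simps)
    finally show ?thesis .
  qed
  have 5: "heat h u x = heat (h + t) f x"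
    unfolding u_def using heat_heat[of h t f L x] h t C11D(3)[OF f] by simp
  have "heat (h + t) (\<lambda>x. xlnx (f x)) x - xlnx (heat (h + t) f x) \<le>
      real (Suc k) * (h / 2 * heat t \<Phi> x + h * sqrt h * K) + (h / 2 * heat t \<Phi> x + h * sqrt h * K)"
    using 1 2 unfolding 3 4 5 by linarith
  also have "\<dots> = real (Suc (Suc k)) * (h / 2 * heat t \<Phi> x + h * sqrt h * K)" by (simp add: algebra_simps)
  finally show ?case unfolding th t_def[symmetric] \<Phi>_def[abs_def] .
qed

lemma heat_tendsto:
  fixes g :: "'a::euclidean_space \<Rightarrow> real"
  assumes c: "\<And>x. isCont g x" and b: "\<And>x. \<bar>g x\<bar> \<le> B" and t: "t \<longlonglongrightarrow> 1"
  shows "(\<lambda>k. heat (t k) g x) \<longlonglongrightarrow> heat 1 g x"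
  unfolding gauss_avg_def
proof (rule integral_dominated_convergence[where w = "\<lambda>_. B"])
  have [measurable]: "g \<in> borel_measurable borel"
    using c by (auto intro!: borel_measurable_continuous_onI continuous_at_imp_continuous_on)
  show "(\<lambda>z. g (1 *\<^sub>R x + sqrt 1 *\<^sub>R z)) \<in> borel_measurable \<gamma>" "(\<lambda>z. g (1 *\<^sub>R x + sqrt (t k) *\<^sub>R z)) \<in> borel_measurable \<gamma>" for k
    by measurable
  show "AE z in \<gamma>. (\<lambda>k. g (1 *\<^sub>R x + sqrt (t k) *\<^sub>R z)) \<longlonglongrightarrow> g (1 *\<^sub>R x + sqrt 1 *\<^sub>R z)"
    by (intro AE_I2 isCont_tendsto_compose[OF c] tendsto_intros t)
qed (use b in auto)

text \<open>
  The limit of infinitely many steps. The errors add up to the order \<open>\<surd>h\<close>.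
\<close>

lemma log_sobolev_C11:
  fixes f :: "'a::euclidean_space \<Rightarrow> real"
  assumes f: "C11 L f F" and c: "0 < c" "\<And>x. c \<le> f x"
  shows "(\<integral>z. xlnx (f z) \<partial>\<gamma>) - xlnx (\<integral>z. f z \<partial>\<gamma>) \<le> 1 / 2 * (\<integral>z. (norm (F z))\<^sup>2 / f z \<partial>\<gamma>)"
proof -
  define K where "K = (\<integral>z. entropy_remainder L c (norm z) \<partial>(\<gamma>::'a measure))"
  define \<Phi> where "\<Phi> x = (norm (F x))\<^sup>2 / f x" for x
  obtain B where B: "\<And>x. \<bar>xlnx (f x)\<bar> \<le> B" using xlnx_bounded[of c f L] c C11D(3)[OF f] by (auto simp: xlnx_def)
  \<comment> \<open>With \<open>m + 2\<close> steps of length \<open>1 / (m + 1)\<close> the Fisher term is averaged at time exactly 1, whatever \<open>m\<close>.\<close>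
  define t where "t m = 1 + 1 / (real m + 1)" for m :: nat
  have t: "t \<longlonglongrightarrow> 1" unfolding t_def by real_asymp
  have fpos: "0 < f x" for x using c(1) c(2)[of x] by linarith
  have xc: "isCont xlnx u" if "0 < u" for u unfolding xlnx_def[abs_def] using that by (intro continuous_intros) auto
  have cont: "isCont (\<lambda>x. xlnx (f x)) x" for x
    by (rule continuous_within_compose3[OF _ C11_continuous[OF f]]) (rule xc[OF fpos])
  have m: "c \<le> heat 1 f 0" by (rule gauss_avg_ge[of f L c]) (use c C11D[OF f] in auto)
  have "(\<lambda>m. heat (t m) (\<lambda>x. xlnx (f x)) 0 - xlnx (heat (t m) f 0)) \<longlonglongrightarrow> heat 1 (\<lambda>x. xlnx (f x)) 0 - xlnx (heat 1 f 0)"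
    using m c(1)
    by (intro tendsto_diff heat_tendsto[OF cont B t] isCont_tendsto_compose[OF xc] heat_tendsto[OF C11_continuous[OF f] C11D(3)[OF f] t]) linarith
  moreover have "(\<lambda>m. t m * (1 / 2 * heat 1 \<Phi> 0 + sqrt (1 / (real m + 1)) * K)) \<longlonglongrightarrow> 1 * (1 / 2 * heat 1 \<Phi> 0 + 0 * K)"
    by (intro tendsto_intros t) real_asymp
  ultimately have "heat 1 (\<lambda>x. xlnx (f x)) 0 - xlnx (heat 1 f 0) \<le> 1 * (1 / 2 * heat 1 \<Phi> 0 + 0 * K)"
  proof (rule LIMSEQ_le, intro exI[of _ 0] allI impI)
    fix m :: nat
    define h where "h = 1 / (real m + 1)"
    have h: "0 < h" "h \<le> 1" by (auto simp: h_def)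
    have e: "real (Suc m) * h = 1" "real (Suc (Suc m)) * h = t m" by (auto simp: h_def t_def field_simps)
    have "heat (t m) (\<lambda>x. xlnx (f x)) 0 - xlnx (heat (t m) f 0) \<le> real (Suc (Suc m)) * (h / 2 * heat 1 \<Phi> 0 + h * sqrt h * K)"
      using heat_entropy_steps[OF f c h, of "Suc m" 0] unfolding e K_def \<Phi>_def[abs_def] .
    also have "\<dots> = (real (Suc (Suc m)) * h) * (1 / 2 * heat 1 \<Phi> 0 + sqrt h * K)" by (simp add: algebra_simps)
    finally show "heat (t m) (\<lambda>x. xlnx (f x)) 0 - xlnx (heat (t m) f 0) \<le> t m * (1 / 2 * heat 1 \<Phi> 0 + sqrt (1 / (real m + 1)) * K)"
      unfolding e unfolding h_def .
  qed
  then show ?thesis by (simp add: gauss_avg_def \<Phi>_def)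
qed

lemma C11_affine:
  assumes f: "C11 L f F" and s: "0 \<le> s" "s \<le> 1"
  shows "C11 L (\<lambda>z. f (a + s *\<^sub>R z)) (\<lambda>z. s *\<^sub>R F (a + s *\<^sub>R z))"
  unfolding C11_def
proof (intro conjI allI)
  note [measurable] = C11D(1,2)[OF f]
  show "(\<lambda>z. f (a + s *\<^sub>R z)) \<in> borel_measurable borel" "(\<lambda>z. s *\<^sub>R F (a + s *\<^sub>R z)) \<in> borel_measurable borel" by measurable
  fix x v
  show "\<bar>f (a + s *\<^sub>R x)\<bar> \<le> L" by (rule C11D(3)[OF f])
  show "norm (s *\<^sub>R F (a + s *\<^sub>R x)) \<le> L"
    using mult_left_le_one_le[OF norm_ge_zero s, of "F (a + s *\<^sub>R x)"] C11D(4)[OF f, of "a + s *\<^sub>R x"] s by simp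
  have "\<bar>f (a + s *\<^sub>R x + s *\<^sub>R v) - f (a + s *\<^sub>R x) - F (a + s *\<^sub>R x) \<bullet> (s *\<^sub>R v)\<bar> \<le> L * (norm (s *\<^sub>R v))\<^sup>2"
    by (rule C11D(5)[OF f])
  also have "\<dots> \<le> L * (norm v)\<^sup>2"
    using C11D(6)[OF f] s by (intro mult_left_mono power_mono) (auto simp: mult_left_le_one_le)
  finally show "\<bar>f (a + s *\<^sub>R (x + v)) - f (a + s *\<^sub>R x) - s *\<^sub>R F (a + s *\<^sub>R x) \<bullet> v\<bar> \<le> L * (norm v)\<^sup>2"
    by (simp add: scaleR_add_right add.assoc)
qed

lemma C11_square_plus:
  assumes f: "C11 L h H" and c: "0 \<le> c"
  shows "C11 (6 * L\<^sup>2 + c) (\<lambda>x. (h x)\<^sup>2 + c) (\<lambda>x. (2 * h x) *\<^sub>R H x)"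
  unfolding C11_def
proof (intro conjI allI)
  note [measurable] = C11D(1,2)[OF f]
  have L: "0 \<le> L" by (rule C11D(6)[OF f])
  show "(\<lambda>x. (h x)\<^sup>2 + c) \<in> borel_measurable borel" "(\<lambda>x. (2 * h x) *\<^sub>R H x) \<in> borel_measurable borel" by measurable
  fix x v
  have h2: "(h x)\<^sup>2 \<le> L\<^sup>2" using power_mono[OF C11D(3)[OF f, of x], of 2] by simp
  then show "\<bar>(h x)\<^sup>2 + c\<bar> \<le> 6 * L\<^sup>2 + c" using c zero_le_power2[of L] zero_le_power2[of "h x"] by linarith
  have "norm ((2 * h x) *\<^sub>R H x) = 2 * (\<bar>h x\<bar> * norm (H x))" by (simp add: abs_mult)
  also have "\<dots> \<le> 2 * (L * L)" using C11D(3,4)[OF f, of x] L by (intro mult_left_mono mult_mono) auto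
  also have "\<dots> \<le> 6 * L\<^sup>2 + c" using c L by (simp add: power2_eq_square)
  finally show "norm ((2 * h x) *\<^sub>R H x) \<le> 6 * L\<^sup>2 + c" .
  define d where "d = h (x + v) - h x"
  have d: "\<bar>d\<bar> \<le> 2 * L * norm v"
  proof (cases "norm v \<le> 1")
    case True
    have "\<bar>d\<bar> \<le> L * (norm v + (norm v)\<^sup>2)" unfolding d_def by (rule C11_increment[OF f])
    also have "\<dots> \<le> L * (norm v + norm v)"
      using L True by (intro mult_left_mono add_left_mono) (auto simp: power2_eq_square mult_left_le)
    finally show ?thesis by simp
  next
    case False
    have "\<bar>d\<bar> \<le> 2 * L * 1" using C11D(3)[OF f, of x] C11D(3)[OF f, of "x + v"] unfolding d_def by linarith
    also have "\<dots> \<le> 2 * L * norm v" using False L by (intro mult_left_mono) auto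
    finally show ?thesis .
  qed
  have "\<bar>(h (x + v))\<^sup>2 + c - ((h x)\<^sup>2 + c) - (2 * h x) *\<^sub>R H x \<bullet> v\<bar> = \<bar>d\<^sup>2 + 2 * h x * (h (x + v) - h x - H x \<bullet> v)\<bar>"
    by (simp add: d_def power2_eq_square algebra_simps)
  also have "\<dots> \<le> \<bar>d\<bar>\<^sup>2 + 2 * (\<bar>h x\<bar> * \<bar>h (x + v) - h x - H x \<bullet> v\<bar>)"
    by (rule order_trans[OF abs_triangle_ineq]) (simp add: abs_mult)
  also have "\<dots> \<le> (2 * L * norm v)\<^sup>2 + 2 * (L * (L * (norm v)\<^sup>2))"
    using d C11D(3,5)[OF f] L by (intro add_mono power_mono mult_left_mono mult_mono) auto
  also have "\<dots> = (6 * L\<^sup>2) * (norm v)\<^sup>2" by (simp add: power2_eq_square)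
  also have "\<dots> \<le> (6 * L\<^sup>2 + c) * (norm v)\<^sup>2" using c by (intro mult_right_mono) auto
  finally show "\<bar>(h (x + v))\<^sup>2 + c - ((h x)\<^sup>2 + c) - (2 * h x) *\<^sub>R H x \<bullet> v\<bar> \<le> (6 * L\<^sup>2 + c) * (norm v)\<^sup>2" .
qed

text \<open>
  The inequality for \<open>h\<^sup>2 + c\<close>. The constant \<open>c\<close> keeps the function away from 0 and can be sent to 0,
  because the Fisher density \<open>4 h\<^sup>2 \<bar>H\<bar>\<^sup>2 / (h\<^sup>2 + c)\<close> is at most \<open>4 \<bar>H\<bar>\<^sup>2\<close>.
\<close>

lemma log_sobolev_C11_affine:
  fixes h :: "'a::euclidean_space \<Rightarrow> real"
  assumes h: "C11 L h H" and s: "0 \<le> s" "s \<le> 1" and c: "0 < c"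
  shows "gauss_avg r s (\<lambda>x. xlnx ((h x)\<^sup>2 + c)) y - xlnx (gauss_avg r s (\<lambda>x. (h x)\<^sup>2 + c) y) \<le>
    2 * s\<^sup>2 * gauss_avg r s (\<lambda>x. (norm (H x))\<^sup>2) y"
proof -
  note [measurable] = C11D(1,2)[OF h]
  let ?A = "\<lambda>z. r *\<^sub>R y + s *\<^sub>R z"
  have f: "C11 (6 * L\<^sup>2 + c) (\<lambda>z. (h (?A z))\<^sup>2 + c) (\<lambda>z. s *\<^sub>R (2 * h (?A z)) *\<^sub>R H (?A z))"
    by (rule C11_affine[OF C11_square_plus[OF h] s]) (use c in auto)
  have "gauss_avg r s (\<lambda>x. xlnx ((h x)\<^sup>2 + c)) y - xlnx (gauss_avg r s (\<lambda>x. (h x)\<^sup>2 + c) y) \<le>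
     1 / 2 * (\<integral>z. (norm (s *\<^sub>R (2 * h (?A z)) *\<^sub>R H (?A z)))\<^sup>2 / ((h (?A z))\<^sup>2 + c) \<partial>\<gamma>)"
    unfolding gauss_avg_def by (rule log_sobolev_C11[OF f c]) auto
  also have "\<dots> \<le> 1 / 2 * (\<integral>z. 4 * s\<^sup>2 * (norm (H (?A z)))\<^sup>2 \<partial>\<gamma>)"
  proof (intro mult_left_mono integral_mono')
    have "\<bar>(norm (H x))\<^sup>2\<bar> \<le> L\<^sup>2" for x using power_mono[OF C11D(4)[OF h, of x], of 2] by simp
    then show "integrable \<gamma> (\<lambda>z. 4 * s\<^sup>2 * (norm (H (?A z)))\<^sup>2)"
      by (intro integrable_mult_right integrable_gauss_bounded[of "\<lambda>x. (norm (H x))\<^sup>2" "L\<^sup>2"]) auto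
    show "(norm (s *\<^sub>R (2 * h (?A z)) *\<^sub>R H (?A z)))\<^sup>2 / ((h (?A z))\<^sup>2 + c) \<le> 4 * s\<^sup>2 * (norm (H (?A z)))\<^sup>2" for z
    proof -
      have p: "0 < (h (?A z))\<^sup>2 + c" using c by (simp add: add_nonneg_pos)
      have "(norm (s *\<^sub>R (2 * h (?A z)) *\<^sub>R H (?A z)))\<^sup>2 = (4 * s\<^sup>2 * (norm (H (?A z)))\<^sup>2) * (h (?A z))\<^sup>2"
        by (simp add: power_mult_distrib)
      also have "\<dots> \<le> (4 * s\<^sup>2 * (norm (H (?A z)))\<^sup>2) * ((h (?A z))\<^sup>2 + c)"
        using c by (intro mult_left_mono) auto
      finally show ?thesis using p by (simp add: divide_le_eq)
    qed
  qed auto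
  also have "\<dots> = 2 * s\<^sup>2 * gauss_avg r s (\<lambda>x. (norm (H x))\<^sup>2) y" by (simp add: gauss_avg_def)
  finally show ?thesis .
qed

section \<open>The conditional logarithmic Sobolev inequality\<close>

lemma ou_abs_le:
  fixes w :: "'a::euclidean_space \<Rightarrow> real"
  assumes r: "\<bar>r\<bar> < 1" and w: "integrable \<gamma> w"
  shows "\<bar>ou r w y\<bar> \<le> (1 / sqrt (1 - r\<^sup>2)) ^ DIM('a) * exp ((norm y)\<^sup>2 / 2) * (\<integral>x. \<bar>w x\<bar> \<partial>\<gamma>)"
proof -
  have "\<bar>ou r w y\<bar> \<le> (\<integral>x. \<bar>mehler r y x * w x\<bar> \<partial>\<gamma>)"
    unfolding ou_eq_mehler[OF r w] real_scaleR_def by (rule integral_abs_bound)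
  also have "\<dots> \<le> (\<integral>x. (1 / sqrt (1 - r\<^sup>2)) ^ DIM('a) * exp ((norm y)\<^sup>2 / 2) * \<bar>w x\<bar> \<partial>\<gamma>)"
  proof (rule integral_mono)
    show "integrable \<gamma> (\<lambda>x. \<bar>mehler r y x * w x\<bar>)"
      using integrable_mult_mehler[OF r w, of y] by (intro integrable_abs) simp
    show "integrable \<gamma> (\<lambda>x. (1 / sqrt (1 - r\<^sup>2)) ^ DIM('a) * exp ((norm y)\<^sup>2 / 2) * \<bar>w x\<bar>)"
      by (intro integrable_mult_right integrable_abs w)
    show "\<bar>mehler r y x * w x\<bar> \<le> (1 / sqrt (1 - r\<^sup>2)) ^ DIM('a) * exp ((norm y)\<^sup>2 / 2) * \<bar>w x\<bar>" for x
      unfolding abs_mult using mehler_le[OF r, of y x] mehler_nonneg[OF r, of y x]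
      by (intro mult_right_mono) auto
  qed
  finally show ?thesis by (subst (asm) integral_mult_right_zero)
qed

text \<open>
  The kernel is bounded, so it suffices that the squares converge in \<open>L\<^sup>1(\<gamma>)\<close>. This follows from
  \<open>\<bar>h\<^sup>2 - g\<^sup>2\<bar> \<le> (1 + e) (h - g)\<^sup>2 + g\<^sup>2 / e\<close> with \<open>e\<close> tending slowly to infinity.
\<close>

lemma ou_square_tendsto:
  fixes h :: "nat \<Rightarrow> 'a::euclidean_space \<Rightarrow> real"
  assumes [measurable]: "\<And>k. h k \<in> borel_measurable borel" "g \<in> borel_measurable borel"
    and g: "integrable \<gamma> (\<lambda>x. (g x)\<^sup>2)"
    and d: "\<And>k. (\<integral>\<^sup>+x. ennreal (\<bar>h k x - g x\<bar>\<^sup>2) \<partial>\<gamma>) \<le> ennreal (1 / (real k + 1))" and r: "\<bar>r\<bar> < 1"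
  shows "integrable \<gamma> (\<lambda>x. (h k x)\<^sup>2)" "(\<lambda>k. ou r (\<lambda>x. (h k x)\<^sup>2) y) \<longlonglongrightarrow> ou r (\<lambda>x. (g x)\<^sup>2) y"
    "integrable \<gamma> (\<lambda>x. (h k x - g x)\<^sup>2)" "(\<integral>x. (h k x - g x)\<^sup>2 \<partial>\<gamma>) \<le> 1 / (real k + 1)"
proof -
  have di: "integrable \<gamma> (\<lambda>x. (h k x - g x)\<^sup>2)" for k
  proof (rule integrableI_bounded)
    show "(\<integral>\<^sup>+x. ennreal (norm ((h k x - g x)\<^sup>2)) \<partial>\<gamma>) < \<infinity>"
      using le_less_trans[OF d[of k] ennreal_less_top] by simp
  qed simp
  have dle: "(\<integral>x. (h k x - g x)\<^sup>2 \<partial>\<gamma>) \<le> 1 / (real k + 1)" for k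
  proof -
    have "ennreal (\<integral>x. (h k x - g x)\<^sup>2 \<partial>\<gamma>) = (\<integral>\<^sup>+x. ennreal ((h k x - g x)\<^sup>2) \<partial>\<gamma>)"
      by (rule nn_integral_eq_integral[OF di, symmetric]) simp
    also have "\<dots> \<le> ennreal (1 / (real k + 1))" using d[of k] by simp
    finally show ?thesis by (subst (asm) ennreal_le_iff) auto
  qed
  have hi: "integrable \<gamma> (\<lambda>x. (h k x)\<^sup>2)" for k
  proof (rule Bochner_Integration.integrable_bound)
    show "integrable \<gamma> (\<lambda>x. 4 * ((h k x - g x)\<^sup>2 + (g x)\<^sup>2))" using di g by simp
    show "AE x in \<gamma>. norm ((h k x)\<^sup>2) \<le> norm (4 * ((h k x - g x)\<^sup>2 + (g x)\<^sup>2))"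
    proof (rule AE_I2)
      fix x :: 'a
      show "norm ((h k x)\<^sup>2) \<le> norm (4 * ((h k x - g x)\<^sup>2 + (g x)\<^sup>2))"
        using add_power_le[of "h k x - g x" "g x" 2] by simp
    qed
  qed simp
  show "integrable \<gamma> (\<lambda>x. (h k x)\<^sup>2)" "integrable \<gamma> (\<lambda>x. (h k x - g x)\<^sup>2)" "(\<integral>x. (h k x - g x)\<^sup>2 \<partial>\<gamma>) \<le> 1 / (real k + 1)"
    using hi di dle by auto
  define B where "B = (1 / sqrt (1 - r\<^sup>2)) ^ DIM('a) * exp ((norm y)\<^sup>2 / 2)"
  have B: "0 \<le> B" using r by (simp add: B_def abs_square_le_1)
  define A where "A = (\<integral>x. (g x)\<^sup>2 \<partial>\<gamma>)"
  have bound: "\<bar>ou r (\<lambda>x. (h k x)\<^sup>2) y - ou r (\<lambda>x. (g x)\<^sup>2) y\<bar> \<le> B * ((1 + sqrt (real k + 1)) * (1 / (real k + 1)) + 1 / sqrt (real k + 1) * A)" for k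
  proof -
    \<comment> \<open>This choice balances \<open>e\<close> times the distance \<open>1 / (k + 1)\<close> against \<open>1 / e\<close>.\<close>
    define e where "e = sqrt (real k + 1)"
    have e: "0 < e" by (simp add: e_def)
    have pw: "\<bar>(h k x)\<^sup>2 - (g x)\<^sup>2\<bar> \<le> (1 + e) * (h k x - g x)\<^sup>2 + 1 / e * (g x)\<^sup>2" for x
    proof -
      define a b where "a = h k x - g x" and "b = g x"
      have "0 \<le> (e * \<bar>a\<bar> - \<bar>b\<bar>)\<^sup>2" by simp
      then have "e * (2 * (\<bar>a\<bar> * \<bar>b\<bar>)) \<le> e * (e * a\<^sup>2 + 1 / e * b\<^sup>2)"
        using e by (simp add: power2_diff power_mult_distrib distrib_left power2_eq_square[of e] algebra_simps)
      then have 1: "2 * (\<bar>a\<bar> * \<bar>b\<bar>) \<le> e * a\<^sup>2 + 1 / e * b\<^sup>2" using e by (simp only: mult_le_cancel_left_pos)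
      have "(h k x)\<^sup>2 - (g x)\<^sup>2 = a\<^sup>2 + 2 * (a * b)" by (simp add: a_def b_def power2_eq_square algebra_simps)
      also have "\<bar>\<dots>\<bar> \<le> a\<^sup>2 + 2 * (\<bar>a\<bar> * \<bar>b\<bar>)"
        by (rule order_trans[OF abs_triangle_ineq]) (simp add: abs_mult)
      also have "\<dots> \<le> (1 + e) * a\<^sup>2 + 1 / e * b\<^sup>2" using 1 by (simp add: algebra_simps)
      finally show ?thesis by (simp add: a_def b_def)
    qed
    have "ou r (\<lambda>x. (h k x)\<^sup>2) y - ou r (\<lambda>x. (g x)\<^sup>2) y = ou r (\<lambda>x. (h k x)\<^sup>2 - (g x)\<^sup>2) y"
      by (rule ou_diff[symmetric]) (use r hi g in auto)
    also have "\<bar>\<dots>\<bar> \<le> B * (\<integral>x. \<bar>(h k x)\<^sup>2 - (g x)\<^sup>2\<bar> \<partial>\<gamma>)"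
      unfolding B_def by (rule ou_abs_le) (use r hi g in auto)
    also have "\<dots> \<le> B * (\<integral>x. (1 + e) * (h k x - g x)\<^sup>2 + 1 / e * (g x)\<^sup>2 \<partial>\<gamma>)"
      using B pw di hi g by (intro mult_left_mono integral_mono) auto
    also have "(\<integral>x. (1 + e) * (h k x - g x)\<^sup>2 + 1 / e * (g x)\<^sup>2 \<partial>\<gamma>) = (1 + e) * (\<integral>x. (h k x - g x)\<^sup>2 \<partial>\<gamma>) + 1 / e * A"
      unfolding A_def using di[of k] g by (subst Bochner_Integration.integral_add) (auto intro!: integrable_mult_right integrable_divide)
    also have "B * \<dots> \<le> B * ((1 + e) * (1 / (real k + 1)) + 1 / e * A)"
      using B e dle[of k] by (intro mult_left_mono add_mono) auto
    finally show ?thesis by (simp add: e_def)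
  qed
  have "(\<lambda>k. B * ((1 + sqrt (real k + 1)) * (1 / (real k + 1)) + 1 / sqrt (real k + 1) * A)) \<longlonglongrightarrow> 0"
    by real_asymp
  then have "(\<lambda>k. ou r (\<lambda>x. (h k x)\<^sup>2) y - ou r (\<lambda>x. (g x)\<^sup>2) y) \<longlonglongrightarrow> 0"
    by (rule Lim_null_comparison[rotated]) (use bound in auto)
  then show "(\<lambda>k. ou r (\<lambda>x. (h k x)\<^sup>2) y) \<longlonglongrightarrow> ou r (\<lambda>x. (g x)\<^sup>2) y"
    by (rule LIM_zero_cancel)
qed

lemma xlnx_tendsto:
  assumes u: "u \<longlonglongrightarrow> a" and nn: "\<And>k. 0 \<le> u k"
  shows "(\<lambda>k. xlnx (u k)) \<longlonglongrightarrow> xlnx a"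
proof -
  have a: "0 \<le> a" by (rule LIMSEQ_le_const[OF u]) (use nn in auto)
  show ?thesis
  proof (cases "a = 0")
    case False
    then have "(\<lambda>k. u k * ln (u k)) \<longlonglongrightarrow> a * ln a" using a by (intro tendsto_intros u) auto
    then show ?thesis by (simp add: xlnx_def)
  next
    case True
    have "((\<lambda>x::real. x * ln x) \<longlongrightarrow> 0) (at_right 0)" by real_asymp
    then have t: "(xlnx \<longlongrightarrow> 0) (at 0 within {0..})"
      unfolding xlnx_def[abs_def]
      by (simp add: tendsto_within_subset filterlim_at_within_If at_within_Ici_at_right)
    have "continuous (at 0 within {0..}) xlnx" using t by (simp add: continuous_within xlnx_def)
    then have "(xlnx \<circ> u) \<longlonglongrightarrow> xlnx 0"
      unfolding continuous_within_sequentially using u nn True by auto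
    then show ?thesis using True by (simp add: o_def)
  qed
qed

lemma xlnx_ge: "0 \<le> u \<Longrightarrow> -1 \<le> xlnx u"
proof (cases "u = 0")
  case False
  assume "0 \<le> u"
  with False show ?thesis using xlnx_tangent[of 1 u] by (auto simp: xlnx_def)
qed (simp add: xlnx_def)

lemma xlnx_le: "0 \<le> u \<Longrightarrow> xlnx u \<le> u\<^sup>2 - u"
proof (cases "u = 0")
  case False
  assume "0 \<le> u"
  with False have "u * ln u \<le> u * (u - 1)" by (intro mult_left_mono ln_le_minus_one) auto
  then show ?thesis by (simp add: xlnx_def power2_eq_square algebra_simps)
qed (simp add: xlnx_def)

lemma AE_gauss_affine:
  assumes P: "AE x in \<gamma>. P x" and r: "\<bar>r\<bar> < 1" and [measurable]: "Measurable.pred borel P"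
  shows "AE z in \<gamma>. P (r *\<^sub>R y + sqrt (1 - r\<^sup>2) *\<^sub>R z)"
proof -
  have "AE x in density \<gamma> (\<lambda>x. ennreal (mehler r y x)). P x"
    using P by (subst AE_density) auto
  then show ?thesis
    unfolding distr_std_gauss_mehler[OF r, symmetric] by (subst (asm) AE_distr_iff) auto
qed

text \<open>
  The inequality for the regular approximations passes to the limit: the terms on the right converge,
  and Fatou's lemma along an almost everywhere convergent subsequence handles the entropy. The summand 1
  makes the integrand nonnegative. For \<open>r = 0\<close> this is the logarithmic Sobolev inequality for \<open>\<gamma>\<close>.
\<close>

lemma conditional_log_sobolev:
  fixes g :: "'a::euclidean_space \<Rightarrow> real"
  assumes G: "has_weak_gradient g G" and i: "integrable \<gamma> (\<lambda>x. (g x)\<^sup>2 + (norm (G x))\<^sup>2)" and r: "0 \<le> r" "r < 1"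
  shows "(\<integral>\<^sup>+z. ennreal (xlnx ((g (r *\<^sub>R y + sqrt (1 - r\<^sup>2) *\<^sub>R z))\<^sup>2) + 1) \<partial>\<gamma>) \<le>
    ennreal (xlnx (ou r (\<lambda>x. (g x)\<^sup>2) y) + 1 + 2 * (1 - r\<^sup>2) * ou r (\<lambda>x. (norm (G x))\<^sup>2) y)"
proof -
  have r': "\<bar>r\<bar> < 1" and r2: "0 \<le> 1 - r\<^sup>2" "1 - r\<^sup>2 \<le> 1" using r by (auto simp: power_le_one)
  have [measurable]: "g \<in> borel_measurable borel" "G \<in> borel_measurable borel"
    using G by (auto simp: has_weak_gradient_def intro: locally_integrable_measurable)
  have ig: "integrable \<gamma> (\<lambda>x. (g x)\<^sup>2)" and iG: "integrable \<gamma> (\<lambda>x. (norm (G x))\<^sup>2)"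
    by (rule Bochner_Integration.integrable_bound[OF i]; simp)+
  have iGb: "integrable \<gamma> (\<lambda>x. (G x \<bullet> b)\<^sup>2)" if "b \<in> Basis" for b
    by (rule Bochner_Integration.integrable_bound[OF iG]) (use Basis_le_norm[OF that] in \<open>auto simp: abs_le_square_iff[symmetric]\<close>)
  have "\<forall>k. \<exists>L h H. C11 L h H \<and> (\<integral>\<^sup>+x. ennreal (\<bar>h x - g x\<bar>\<^sup>2) \<partial>\<gamma>) \<le> ennreal (1 / (real k + 1)) \<and>
    (\<forall>b\<in>Basis. (\<integral>\<^sup>+x. ennreal (\<bar>H x \<bullet> b - G x \<bullet> b\<bar>\<^sup>2) \<partial>\<gamma>) \<le> ennreal (1 / (real k + 1)))"
    by (intro allI C11_approximation[OF G i]) simp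
  then have "\<exists>L h H. \<forall>k. C11 (L k) (h k) (H k) \<and> (\<integral>\<^sup>+x. ennreal (\<bar>h k x - g x\<bar>\<^sup>2) \<partial>\<gamma>) \<le> ennreal (1 / (real k + 1)) \<and>
    (\<forall>b\<in>Basis. (\<integral>\<^sup>+x. ennreal (\<bar>H k x \<bullet> b - G x \<bullet> b\<bar>\<^sup>2) \<partial>\<gamma>) \<le> ennreal (1 / (real k + 1)))"
    by (simp only: choice_iff)
  then obtain L h H where C: "\<And>k. C11 (L k) (h k) (H k)"
    and hd: "\<And>k. (\<integral>\<^sup>+x. ennreal (\<bar>h k x - g x\<bar>\<^sup>2) \<partial>\<gamma>) \<le> ennreal (1 / (real k + 1))"
    and Hd: "\<And>k b. b \<in> Basis \<Longrightarrow> (\<integral>\<^sup>+x. ennreal (\<bar>H k x \<bullet> b - G x \<bullet> b\<bar>\<^sup>2) \<partial>\<gamma>) \<le> ennreal (1 / (real k + 1))"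
    by blast
  note [measurable] = C11D(1,2)[OF C]
  note h_sq = ou_square_tendsto[of h g r, OF _ _ ig hd r', simplified]
  define c where "c k = 1 / (real k + 1)" for k :: nat
  have c: "0 < c k" for k by (simp add: c_def)
  define f where "f k x = (h k x)\<^sup>2 + c k" for k x
  have f0: "0 \<le> f k x" for k x using c[of k] by (simp add: f_def)
  have [measurable]: "f k \<in> borel_measurable borel" for k unfolding f_def[abs_def] by measurable
  have ou_f: "ou r (f k) y = ou r (\<lambda>x. (h k x)\<^sup>2) y + c k" for k
    unfolding f_def gauss_avg_def using integrable_ou_inner(1)[OF r' h_sq(1), of k y]
    by simp
  define m where "m = ou r (\<lambda>x. (g x)\<^sup>2) y"
  define v where "v = ou r (\<lambda>x. (norm (G x))\<^sup>2) y"
  have lim_m: "(\<lambda>k. ou r (f k) y) \<longlonglongrightarrow> m"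
  proof -
    have "(\<lambda>k. ou r (\<lambda>x. (h k x)\<^sup>2) y + c k) \<longlonglongrightarrow> m + 0"
      unfolding m_def c_def by (intro tendsto_add h_sq(2)) real_asymp
    then show ?thesis by (simp add: ou_f)
  qed
  have norm_sum: "(norm a)\<^sup>2 = (\<Sum>b\<in>Basis. (a \<bullet> b)\<^sup>2)" for a :: 'a
    unfolding power2_norm_eq_inner by (subst euclidean_inner) (simp add: power2_eq_square)
  have lim_v: "(\<lambda>k. ou r (\<lambda>x. (norm (H k x))\<^sup>2) y) \<longlonglongrightarrow> v"
  proof -
    have Hb: "integrable \<gamma> (\<lambda>x. (H k x \<bullet> b)\<^sup>2)" "(\<lambda>k. ou r (\<lambda>x. (H k x \<bullet> b)\<^sup>2) y) \<longlonglongrightarrow> ou r (\<lambda>x. (G x \<bullet> b)\<^sup>2) y"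
      if "b \<in> Basis" for b k
      using ou_square_tendsto(1,2)[of "\<lambda>k x. H k x \<bullet> b" "\<lambda>x. G x \<bullet> b" r, OF _ _ iGb[OF that] Hd[OF that] r'] by auto
    have "ou r (\<lambda>x. (norm (H k x))\<^sup>2) y = (\<Sum>b\<in>Basis. ou r (\<lambda>x. (H k x \<bullet> b)\<^sup>2) y)" for k
      unfolding norm_sum gauss_avg_def
      by (rule Bochner_Integration.integral_sum) (rule integrable_ou_inner(1)[OF r' Hb(1)])
    moreover have "v = (\<Sum>b\<in>Basis. ou r (\<lambda>x. (G x \<bullet> b)\<^sup>2) y)"
      unfolding v_def norm_sum gauss_avg_def
      by (rule Bochner_Integration.integral_sum) (rule integrable_ou_inner(1)[OF r' iGb])
    ultimately show ?thesis using Hb(2) by (simp add: tendsto_sum)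
  qed
  have "(\<lambda>k. \<integral>x. norm ((h k x - g x)\<^sup>2) \<partial>\<gamma>) \<longlonglongrightarrow> 0"
  proof (rule Lim_null_comparison[OF always_eventually])
    show "\<forall>k. norm (\<integral>x. norm ((h k x - g x)\<^sup>2) \<partial>\<gamma>) \<le> 1 / (real k + 1)" using h_sq(4) by simp
    show "(\<lambda>k. 1 / (real k + 1)) \<longlonglongrightarrow> 0" by real_asymp
  qed
  from tendsto_L1_AE_subseq[OF h_sq(3) this] obtain s where s: "strict_mono s"
    and AE: "AE x in \<gamma>. (\<lambda>k. (h (s k) x - g x)\<^sup>2) \<longlonglongrightarrow> 0" by blast
  define A where "A z = r *\<^sub>R y + sqrt (1 - r\<^sup>2) *\<^sub>R z" for z
  have [measurable]: "A \<in> borel_measurable borel" unfolding A_def[abs_def] by measurable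
  have AE2: "AE z in \<gamma>. (\<lambda>k. xlnx (f (s k) (A z)) + 1) \<longlonglongrightarrow> xlnx ((g (A z))\<^sup>2) + 1"
  proof -
    have "AE z in \<gamma>. (\<lambda>k. (h (s k) (A z) - g (A z))\<^sup>2) \<longlonglongrightarrow> 0"
      unfolding A_def by (rule AE_gauss_affine[OF AE r']) measurable
    then show ?thesis
    proof eventually_elim
      case (elim z)
      then have "(\<lambda>k. sqrt ((h (s k) (A z) - g (A z))\<^sup>2)) \<longlonglongrightarrow> sqrt 0" by (rule tendsto_real_sqrt)
      then have "(\<lambda>k. h (s k) (A z) - g (A z)) \<longlonglongrightarrow> 0" by (simp add: tendsto_rabs_zero_iff)
      then have 1: "(\<lambda>k. h (s k) (A z)) \<longlonglongrightarrow> g (A z)" by (rule LIM_zero_cancel)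
      have "c \<longlonglongrightarrow> 0" unfolding c_def[abs_def] by real_asymp
      then have 2: "(\<lambda>k. c (s k)) \<longlonglongrightarrow> 0" using LIMSEQ_subseq_LIMSEQ[OF _ s] by (simp add: o_def)
      have "(\<lambda>k. (h (s k) (A z))\<^sup>2 + c (s k)) \<longlonglongrightarrow> (g (A z))\<^sup>2 + 0" by (intro tendsto_intros 1 2)
      then have "(\<lambda>k. f (s k) (A z)) \<longlonglongrightarrow> (g (A z))\<^sup>2" by (simp add: f_def)
      from xlnx_tendsto[OF this f0] show ?case by (intro tendsto_intros)
    qed
  qed
  have each: "(\<integral>\<^sup>+z. ennreal (xlnx (f k (A z)) + 1) \<partial>\<gamma>) \<le> ennreal (xlnx (ou r (f k) y) + 1 + 2 * (1 - r\<^sup>2) * ou r (\<lambda>x. (norm (H k x))\<^sup>2) y)" for k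
  proof -
    have "\<bar>f k x\<bar> \<le> (L k)\<^sup>2 + c k" for x
      using power_mono[OF C11D(3)[OF C, of k x], of 2] c[of k] by (simp add: f_def)
    moreover have "c k \<le> f k x" for x by (simp add: f_def)
    ultimately obtain B where B: "\<And>x. \<bar>xlnx (f k x)\<bar> \<le> B"
      using xlnx_bounded[of "c k" "f k" "(L k)\<^sup>2 + c k"] c by (auto simp: xlnx_def)
    have ib: "integrable \<gamma> (\<lambda>z. xlnx (f k (A z)))"
      unfolding A_def using integrable_gauss_bounded[of "\<lambda>x. xlnx (f k x)" B r y] B by simp
    have "(\<integral>\<^sup>+z. ennreal (xlnx (f k (A z)) + 1) \<partial>\<gamma>) = ennreal (\<integral>z. xlnx (f k (A z)) + 1 \<partial>\<gamma>)"
    proof (rule nn_integral_eq_integral)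
      show "AE z in \<gamma>. 0 \<le> xlnx (f k (A z)) + 1"
      proof (rule AE_I2)
        show "0 \<le> xlnx (f k (A z)) + 1" for z using xlnx_ge[OF f0, of k "A z"] by linarith
      qed
    qed (use ib in simp)
    also have "(\<integral>z. xlnx (f k (A z)) + 1 \<partial>\<gamma>) = ou r (\<lambda>x. xlnx (f k x)) y + 1"
      using ib by (simp add: gauss_avg_def A_def)
    also have "\<dots> \<le> xlnx (ou r (f k) y) + 1 + 2 * (1 - r\<^sup>2) * ou r (\<lambda>x. (norm (H k x))\<^sup>2) y"
      using log_sobolev_C11_affine[OF C[of k], of "sqrt (1 - r\<^sup>2)" "c k" r y] c r2
      by (simp add: f_def[abs_def])
    finally show ?thesis by (simp add: ennreal_leI)
  qed
  have lim: "(\<lambda>k. ennreal (xlnx (ou r (f (s k)) y) + 1 + 2 * (1 - r\<^sup>2) * ou r (\<lambda>x. (norm (H (s k) x))\<^sup>2) y)) \<longlonglongrightarrow> ennreal (xlnx m + 1 + 2 * (1 - r\<^sup>2) * v)"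
  proof (intro tendsto_ennrealI tendsto_intros)
    have fnn: "0 \<le> ou r (f k) y" for k unfolding gauss_avg_def by (rule Bochner_Integration.integral_nonneg) (rule f0)
    show "(\<lambda>k. xlnx (ou r (f (s k)) y)) \<longlonglongrightarrow> xlnx m"
      using LIMSEQ_subseq_LIMSEQ[OF lim_m s] by (intro xlnx_tendsto fnn) (simp add: o_def)
    show "(\<lambda>k. ou r (\<lambda>x. (norm (H (s k) x))\<^sup>2) y) \<longlonglongrightarrow> v"
      using LIMSEQ_subseq_LIMSEQ[OF lim_v s] by (simp add: o_def)
  qed
  have "(\<integral>\<^sup>+z. ennreal (xlnx ((g (A z))\<^sup>2) + 1) \<partial>\<gamma>) = (\<integral>\<^sup>+z. liminf (\<lambda>k. ennreal (xlnx (f (s k) (A z)) + 1)) \<partial>\<gamma>)"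
  proof (rule nn_integral_cong_AE, use AE2 in eventually_elim)
    case (elim z)
    from lim_imp_Liminf[OF sequentially_bot tendsto_ennrealI[OF elim]] show ?case by simp
  qed
  also have "\<dots> \<le> liminf (\<lambda>k. \<integral>\<^sup>+z. ennreal (xlnx (f (s k) (A z)) + 1) \<partial>\<gamma>)"
    by (rule nn_integral_liminf) measurable
  also have "\<dots> \<le> liminf (\<lambda>k. ennreal (xlnx (ou r (f (s k)) y) + 1 + 2 * (1 - r\<^sup>2) * ou r (\<lambda>x. (norm (H (s k) x))\<^sup>2) y))"
    by (intro Liminf_mono always_eventually allI each)
  also have "\<dots> = ennreal (xlnx m + 1 + 2 * (1 - r\<^sup>2) * v)"
    by (rule lim_imp_Liminf[OF sequentially_bot lim])
  finally show ?thesis by (simp add: A_def m_def v_def)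
qed

section \<open>The deficit controls the Fisher information\<close>

lemma integral_mehler:
  fixes F :: "'a::euclidean_space \<Rightarrow> real"
  assumes r: "\<bar>r\<bar> < 1" and F: "integrable \<gamma> F"
  shows "integrable \<gamma> (\<lambda>y. mehler r x y * F y)" "(\<integral>y. mehler r x y * F y \<partial>\<gamma>) = ou r F x"
  using integrable_mult_mehler[OF r F, of x] ou_eq_mehler[OF r F, of x] by auto

lemma integral_mehler_1:
  assumes r: "\<bar>r\<bar> < 1"
  shows "integrable \<gamma> (mehler r x)" "(\<integral>y. mehler r x y \<partial>\<gamma>) = 1"
  using integral_mehler[OF r, of "\<lambda>_. 1" x] by (auto simp: gauss_avg_def)

lemma integral_mehler_inner:
  assumes r: "\<bar>r\<bar> < 1"
  shows "integrable \<gamma> (\<lambda>y. mehler r x y * (x \<bullet> y))" "(\<integral>y. mehler r x y * (x \<bullet> y) \<partial>\<gamma>) = r * (norm x)\<^sup>2"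
proof -
  show "integrable \<gamma> (\<lambda>y. mehler r x y * (x \<bullet> y))" by (rule integral_mehler[OF r]) simp
  have "ou r (\<lambda>y. x \<bullet> y) x = (\<integral>z. r * (x \<bullet> x) + sqrt (1 - r\<^sup>2) * (x \<bullet> z) \<partial>\<gamma>)"
    by (simp add: gauss_avg_def inner_add_right)
  also have "\<dots> = r * (norm x)\<^sup>2" by (simp add: power2_norm_eq_inner)
  finally show "(\<integral>y. mehler r x y * (x \<bullet> y) \<partial>\<gamma>) = r * (norm x)\<^sup>2" by (simp add: integral_mehler(2)[OF r])
qed

text \<open>
  The value is the Mehler kernel with parameter \<open>r\<^sup>2\<close> on the diagonal, as the semigroup law predicts.
\<close>

lemma integral_mehler_square:
  fixes x :: "'a::euclidean_space"
  assumes r: "\<bar>r\<bar> < 1"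
  shows "integrable \<gamma> (\<lambda>y. (mehler r x y)\<^sup>2)"
    "(\<integral>y. (mehler r x y)\<^sup>2 \<partial>\<gamma>) = (1 / sqrt (1 - r ^ 4)) ^ DIM('a) * exp (r\<^sup>2 * (norm x)\<^sup>2 / (1 + r\<^sup>2))"
proof -
  define p where "p = 1 - r\<^sup>2"
  have p: "0 < p" using r by (simp add: p_def abs_square_less_1)
  have q: "0 < 1 + r\<^sup>2" by (simp add: add_pos_nonneg)
  define b where "b = (2 * r / p) *\<^sub>R x"
  define c where "c = - (r\<^sup>2 / p)"
  have c: "c < 1/2" using p by (simp add: c_def) (smt (verit) divide_nonneg_pos zero_le_power2)
  have c2: "1 - 2 * c = (1 + r\<^sup>2) / p" using p by (simp add: c_def p_def field_simps)
  define E where "E = (1 / p) ^ DIM('a) * exp (- (r\<^sup>2 * (norm x)\<^sup>2 / p))"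
  have eq: "(mehler r x y)\<^sup>2 = E * exp (b \<bullet> y + c * (norm y)\<^sup>2)" for y
  proof -
    have "2 * (- (r\<^sup>2 * (norm y)\<^sup>2 + r\<^sup>2 * (norm x)\<^sup>2 - 2 * r * (y \<bullet> x)) / (2 * p)) =
       - (r\<^sup>2 * (norm x)\<^sup>2 / p) + (b \<bullet> y + c * (norm y)\<^sup>2)"
      using p by (simp add: b_def c_def inner_commute field_simps)
    then have "exp (- (r\<^sup>2 * (norm y)\<^sup>2 + r\<^sup>2 * (norm x)\<^sup>2 - 2 * r * (y \<bullet> x)) / (2 * p)) ^ 2 =
       exp (- (r\<^sup>2 * (norm x)\<^sup>2 / p)) * exp (b \<bullet> y + c * (norm y)\<^sup>2)"
      by (metis exp_double mult_exp_exp)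
    moreover have "((1 / sqrt p) ^ DIM('a)) ^ 2 = (1 / p) ^ DIM('a)"
    proof -
      have "((1 / sqrt p) ^ DIM('a)) ^ 2 = ((1 / sqrt p) ^ 2) ^ DIM('a)" by (simp only: power_mult[symmetric] mult.commute)
      also have "(1 / sqrt p) ^ 2 = 1 / p" using p by (simp add: power_divide)
      finally show ?thesis .
    qed
    ultimately show ?thesis unfolding mehler_def E_def p_def[symmetric] power_mult_distrib by simp
  qed
  show "integrable \<gamma> (\<lambda>y. (mehler r x y)\<^sup>2)"
    unfolding eq by (intro integrable_mult_right integrable_std_gauss_exp c)
  have s: "sqrt ((1 + r\<^sup>2) / p) * p = sqrt (1 - r ^ 4)"
  proof -
    have "1 - r ^ 4 = (1 + r\<^sup>2) / p * p\<^sup>2"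
      using p by (simp add: p_def field_simps power2_eq_square power4_eq_xxxx)
    then show ?thesis using p by (simp only: real_sqrt_mult) (simp)
  qed
  have ex: "- (r\<^sup>2 * (norm x)\<^sup>2 / p) + (norm b)\<^sup>2 / (2 * ((1 + r\<^sup>2) / p)) = r\<^sup>2 * (norm x)\<^sup>2 / (1 + r\<^sup>2)"
  proof -
    have "(norm b)\<^sup>2 = 4 * r\<^sup>2 / p\<^sup>2 * (norm x)\<^sup>2" using p by (simp add: b_def power_mult_distrib power_divide)
    then have "(norm b)\<^sup>2 / (2 * ((1 + r\<^sup>2) / p)) = r\<^sup>2 * (norm x)\<^sup>2 * 2 / (p * (1 + r\<^sup>2))"
    proof -
      have "4 * a / p\<^sup>2 * X / (2 * (w / p)) = a * X * 2 / (p * w)" if "0 < w" for a X w :: real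
        using p that by (simp add: power2_eq_square)
      from this[OF q] show ?thesis unfolding \<open>(norm b)\<^sup>2 = _\<close> .
    qed
    moreover have "- (r\<^sup>2 * (norm x)\<^sup>2 / p) = - (r\<^sup>2 * (norm x)\<^sup>2 * (1 + r\<^sup>2)) / (p * (1 + r\<^sup>2))"
      using q by simp
    moreover have "r\<^sup>2 * (norm x)\<^sup>2 / (1 + r\<^sup>2) = (r\<^sup>2 * (norm x)\<^sup>2 * p) / (p * (1 + r\<^sup>2))"
      using p by simp
    moreover have "- (r\<^sup>2 * (norm x)\<^sup>2 * (1 + r\<^sup>2)) + r\<^sup>2 * (norm x)\<^sup>2 * 2 = r\<^sup>2 * (norm x)\<^sup>2 * p"
      by (simp add: p_def algebra_simps)
    ultimately show ?thesis by (simp only: add_divide_distrib[symmetric])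
  qed
  have "(\<integral>y. (mehler r x y)\<^sup>2 \<partial>\<gamma>) = E * ((1 / sqrt ((1 + r\<^sup>2) / p)) ^ DIM('a) * exp ((norm b)\<^sup>2 / (2 * ((1 + r\<^sup>2) / p))))"
    unfolding eq by (simp only: integral_mult_right_zero integral_std_gauss_exp[OF c] c2)
  also have "\<dots> = (1 / (sqrt ((1 + r\<^sup>2) / p) * p)) ^ DIM('a) * (exp (- (r\<^sup>2 * (norm x)\<^sup>2 / p)) * exp ((norm b)\<^sup>2 / (2 * ((1 + r\<^sup>2) / p))))"
    unfolding E_def by (simp add: power_divide power_mult_distrib)
  finally show "(\<integral>y. (mehler r x y)\<^sup>2 \<partial>\<gamma>) = (1 / sqrt (1 - r ^ 4)) ^ DIM('a) * exp (r\<^sup>2 * (norm x)\<^sup>2 / (1 + r\<^sup>2))"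
    unfolding s mult_exp_exp ex .
qed

text \<open>
  What is left of the Mehler kernel after removing its Hermite components of degree 0 and 1.
\<close>

definition mehler_remainder :: "real \<Rightarrow> 'a::euclidean_space \<Rightarrow> 'a \<Rightarrow> real" where
  "mehler_remainder r x y = mehler r x y - 1 - r * (x \<bullet> y)"

lemma measurable_mehler_remainder [measurable]:
  "(\<lambda>p. mehler_remainder r (fst p) (snd p)) \<in> borel_measurable (borel \<Otimes>\<^sub>M borel)"
  "mehler_remainder r x \<in> borel_measurable borel"
  unfolding mehler_remainder_def mehler_def by measurable

lemma mehler_remainder_commute: "mehler_remainder r x y = mehler_remainder r y x"
  by (simp add: mehler_remainder_def mehler_commute[of r x] inner_commute)

lemma integral_mehler_remainder_square:
  fixes x :: "'a::euclidean_space"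
  assumes r: "\<bar>r\<bar> < 1"
  shows "integrable \<gamma> (\<lambda>y. (mehler_remainder r x y)\<^sup>2)"
    "(\<integral>y. (mehler_remainder r x y)\<^sup>2 \<partial>\<gamma>) =
      (1 / sqrt (1 - r ^ 4)) ^ DIM('a) * exp (r\<^sup>2 * (norm x)\<^sup>2 / (1 + r\<^sup>2)) - 1 - r\<^sup>2 * (norm x)\<^sup>2"
proof -
  have eq: "(mehler_remainder r x y)\<^sup>2 = (mehler r x y)\<^sup>2 - 2 * mehler r x y - 2 * r * (mehler r x y * (x \<bullet> y)) + 1 +
     2 * r * (x \<bullet> y) + r\<^sup>2 * (x \<bullet> y)\<^sup>2" for y
    by (simp add: mehler_remainder_def power2_eq_square algebra_simps)
  note i = integral_mehler_square(1)[OF r, of x] integral_mehler_1(1)[OF r, of x] integral_mehler_inner(1)[OF r, of x]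
  show "integrable \<gamma> (\<lambda>y. (mehler_remainder r x y)\<^sup>2)" unfolding eq using i by simp
  show "(\<integral>y. (mehler_remainder r x y)\<^sup>2 \<partial>\<gamma>) =
      (1 / sqrt (1 - r ^ 4)) ^ DIM('a) * exp (r\<^sup>2 * (norm x)\<^sup>2 / (1 + r\<^sup>2)) - 1 - r\<^sup>2 * (norm x)\<^sup>2"
    unfolding eq using i
    by (simp add: integral_mehler_1(2)[OF r] integral_mehler_square(2)[OF r] integral_mehler_inner(2)[OF r])
       (simp add: power2_eq_square)
qed

lemma exp_minus_1_le: "exp w - 1 \<le> w * exp w" for w :: real
proof -
  have "1 - w \<le> exp (- w)" using exp_ge_add_one_self[of "- w"] by simp
  then have "(1 - w) * exp w \<le> exp (- w) * exp w" by (rule mult_right_mono) simp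
  then show ?thesis by (simp add: mult_exp_exp algebra_simps)
qed

text \<open>
  The order \<open>r\<^sup>4\<close> is what makes the remainder negligible against the gain of order \<open>r\<^sup>2\<close>. It appears
  because the expansion of the exponential cancels the constant and the quadratic term.
\<close>

lemma mehler_remainder_square_le:
  fixes x :: "'a::euclidean_space"
  assumes \<kappa>: "0 < \<kappa>" and r: "0 \<le> r" "r\<^sup>2 \<le> \<kappa> / 2" "r\<^sup>2 \<le> 1 / 2"
  shows "(\<integral>y. (mehler_remainder r x y)\<^sup>2 \<partial>\<gamma>) \<le>
    r ^ 4 * ((2 * real DIM('a) * exp (real DIM('a)) + 8 / \<kappa>\<^sup>2) * exp (\<kappa> * (norm x)\<^sup>2))"
proof -
  define n where "n = real DIM('a)"
  define t where "t = (norm x)\<^sup>2"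
  define u where "u = r ^ 4"
  have t: "0 \<le> t" and n: "0 \<le> n" by (auto simp: t_def n_def)
  have ur: "u = (r\<^sup>2)\<^sup>2" by (simp add: u_def)
  have u: "0 \<le> u" "u \<le> 1 / 2"
  proof -
    have "(r\<^sup>2)\<^sup>2 \<le> 1 / 2 * (1 / 2)" unfolding power2_eq_square[of "r\<^sup>2"] using r by (intro mult_mono) auto
    then show "0 \<le> u" "u \<le> 1 / 2" by (auto simp: ur)
  qed
  have "r\<^sup>2 < 1" using r(3) by linarith
  then have r1: "\<bar>r\<bar> < 1" by (simp only: abs_square_less_1)
  define a where "a = (1 / sqrt (1 - u)) ^ DIM('a)"
  have a: "a \<le> exp (2 * n * u)"
  proof -
    have "1 - u \<le> sqrt (1 - u)" using u real_le_rsqrt[of "1 - u" "1 - u"] by (simp add: power2_eq_square mult_left_le)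
    then have "1 / sqrt (1 - u) \<le> 1 / (1 - u)" using u by (intro divide_left_mono) auto
    also have "\<dots> \<le> 1 + 2 * u"
    proof -
      have "0 \<le> u * (1 - 2 * u)" using u by simp
      then have "1 \<le> (1 + 2 * u) * (1 - u)" by (simp add: algebra_simps)
      then show ?thesis using u by (simp add: divide_le_eq)
    qed
    also have "\<dots> \<le> exp (2 * u)" by (rule exp_ge_add_one_self)
    finally have "a \<le> exp (2 * u) ^ DIM('a)" unfolding a_def using u by (intro power_mono) auto
    also have "\<dots> = exp (2 * n * u)" by (simp add: n_def exp_of_nat_mult[symmetric] mult_ac)
    finally show ?thesis .
  qed
  have a1: "a - 1 \<le> 2 * n * exp n * u"
  proof -
    have "a - 1 \<le> exp (2 * n * u) - 1" using a by simp
    also have "\<dots> \<le> 2 * n * u * exp (2 * n * u)" by (rule exp_minus_1_le)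
    also have "\<dots> \<le> 2 * n * u * exp n" using u n mult_left_mono[of "2 * u" 1 n] by (intro mult_left_mono) auto
    finally show ?thesis by (simp add: algebra_simps)
  qed
  have a0: "0 \<le> a" using u by (simp add: a_def)
  have e1: "exp (r\<^sup>2 * t / (1 + r\<^sup>2)) \<le> exp (r\<^sup>2 * t)"
  proof -
    have "r\<^sup>2 * t / (1 + r\<^sup>2) \<le> r\<^sup>2 * t / 1" using t by (intro divide_left_mono) (auto simp: add_pos_nonneg)
    then show ?thesis by simp
  qed
  have s0: "0 \<le> r\<^sup>2 * t" using t by simp
  have e2: "exp (r\<^sup>2 * t) \<le> exp (\<kappa> / 2 * t)" using mult_right_mono[OF r(2) t] by simp
  have e3: "exp (\<kappa> / 2 * t) \<le> exp (\<kappa> * t)" using \<kappa> t by simp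
  have e4: "exp (r\<^sup>2 * t) - 1 - r\<^sup>2 * t \<le> u * (8 / \<kappa>\<^sup>2 * exp (\<kappa> * t))"
  proof -
    have "exp (r\<^sup>2 * t) - 1 - r\<^sup>2 * t \<le> r\<^sup>2 * t * (exp (r\<^sup>2 * t) - 1)"
      using exp_minus_1_le[of "r\<^sup>2 * t"] by (simp add: algebra_simps)
    also have "\<dots> \<le> r\<^sup>2 * t * (r\<^sup>2 * t * exp (r\<^sup>2 * t))"
      by (intro mult_left_mono exp_minus_1_le s0)
    also have "\<dots> = u * (t\<^sup>2 * exp (r\<^sup>2 * t))" by (simp add: ur power2_eq_square)
    also have "\<dots> \<le> u * ((8 / \<kappa>\<^sup>2 * exp (\<kappa> / 2 * t)) * exp (\<kappa> / 2 * t))"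
    proof (intro mult_left_mono mult_mono e2)
      have "(\<kappa> / 2 * t)\<^sup>2 \<le> 2 * exp (\<kappa> / 2 * t)" using power_le_fact_exp[of "\<kappa> / 2 * t" 2] \<kappa> t by simp
      then show "t\<^sup>2 \<le> 8 / \<kappa>\<^sup>2 * exp (\<kappa> / 2 * t)" using \<kappa> by (simp add: power_mult_distrib power_divide field_simps)
    qed (use u in auto)
    also have "\<dots> = u * (8 / \<kappa>\<^sup>2 * exp (\<kappa> * t))" by (simp add: mult_exp_exp)
    finally show ?thesis .
  qed
  have "(\<integral>y. (mehler_remainder r x y)\<^sup>2 \<partial>\<gamma>) = a * exp (r\<^sup>2 * t / (1 + r\<^sup>2)) - 1 - r\<^sup>2 * t"
    by (simp add: integral_mehler_remainder_square(2)[OF r1] a_def t_def u_def)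
  also have "\<dots> \<le> a * exp (r\<^sup>2 * t) - 1 - r\<^sup>2 * t" using e1 a0 by (simp add: mult_left_mono)
  also have "\<dots> = (a - 1) * exp (r\<^sup>2 * t) + (exp (r\<^sup>2 * t) - 1 - r\<^sup>2 * t)" by (simp add: algebra_simps)
  also have "\<dots> \<le> (2 * n * exp n * u) * exp (\<kappa> * t) + u * (8 / \<kappa>\<^sup>2 * exp (\<kappa> * t))"
  proof (intro add_mono e4)
    have "(a - 1) * exp (r\<^sup>2 * t) \<le> (2 * n * exp n * u) * exp (r\<^sup>2 * t)" using a1 by (rule mult_right_mono) simp
    also have "\<dots> \<le> (2 * n * exp n * u) * exp (\<kappa> * t)" using e2 e3 n u by (intro mult_left_mono) auto
    finally show "(a - 1) * exp (r\<^sup>2 * t) \<le> (2 * n * exp n * u) * exp (\<kappa> * t)" .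
  qed
  also have "\<dots> = u * ((2 * n * exp n + 8 / \<kappa>\<^sup>2) * exp (\<kappa> * t))" by (simp add: algebra_simps)
  finally show ?thesis by (simp add: u_def n_def t_def)
qed

lemma centred_inner:
  fixes f :: "'a::euclidean_space \<Rightarrow> real"
  assumes "has_bochner_integral \<gamma> (\<lambda>x. f x *\<^sub>R x) 0"
  shows "integrable \<gamma> (\<lambda>x. f x * (y \<bullet> x))" "(\<integral>x. f x * (y \<bullet> x) \<partial>\<gamma>) = 0"
proof -
  have "has_bochner_integral \<gamma> (\<lambda>x. y \<bullet> (f x *\<^sub>R x)) (y \<bullet> 0)"
    by (rule has_bochner_integral_inner_right) (rule assms)
  then show "integrable \<gamma> (\<lambda>x. f x * (y \<bullet> x))" "(\<integral>x. f x * (y \<bullet> x) \<partial>\<gamma>) = 0"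
    by (simp_all add: has_bochner_integral_iff)
qed

text \<open>
  Subtracting 1 and the linear term from the Mehler kernel changes nothing, since \<open>f - 1\<close> integrates to
  zero against affine functions. Cauchy-Schwarz for \<open>f - 1 = (\<surd>f - 1) (\<surd>f + 1)\<close> then separates the Hellinger
  distance \<open>D\<close> from the square integral of the remainder, which the exponential moment of \<open>f\<close> controls.
\<close>

lemma ou_minus_1_square_le:
  fixes f :: "'a::euclidean_space \<Rightarrow> real"
  assumes f: "has_bochner_integral \<gamma> f 1" and f0: "\<And>x. 0 \<le> f x" and fx: "has_bochner_integral \<gamma> (\<lambda>x. f x *\<^sub>R x) 0"
    and \<kappa>: "0 < \<kappa>" "\<kappa> < 1/2" and r: "0 \<le> r" "r\<^sup>2 \<le> \<kappa> / 2" "r\<^sup>2 \<le> 1 / 2"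
    and A: "(\<integral>\<^sup>+x. ennreal (f x * exp (\<kappa> * (norm x)\<^sup>2)) \<partial>\<gamma>) \<le> ennreal A" "0 \<le> A"
    and D: "(\<integral>\<^sup>+x. ennreal ((sqrt (f x) - 1)\<^sup>2) \<partial>\<gamma>) = ennreal D" "0 \<le> D"
  shows "(\<integral>\<^sup>+y. ennreal ((ou r f y - 1)\<^sup>2) \<partial>\<gamma>) \<le>
    ennreal (D * (2 * r ^ 4 * (2 * real DIM('a) * exp (real DIM('a)) + 8 / \<kappa>\<^sup>2) * (A + (1 / sqrt (1 - 2 * \<kappa>)) ^ DIM('a))))"
proof -
  have "r\<^sup>2 < 1" using r(3) by linarith
  then have r1: "\<bar>r\<bar> < 1" by (simp only: abs_square_less_1)
  have fi: "integrable \<gamma> f" "(\<integral>x. f x \<partial>\<gamma>) = 1" using f by (auto simp: has_bochner_integral_iff)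
  have [measurable]: "f \<in> borel_measurable borel" using borel_measurable_integrable[OF fi(1)] by simp
  define C where "C = 2 * real DIM('a) * exp (real DIM('a)) + 8 / \<kappa>\<^sup>2"
  have C: "0 \<le> C" by (simp add: C_def)
  have eq: "ou r f y - 1 = (\<integral>x. (f x - 1) * mehler_remainder r y x \<partial>\<gamma>)" for y
  proof -
    have i1: "integrable \<gamma> (\<lambda>x. mehler r y x * f x)" by (rule integral_mehler(1)[OF r1 fi(1)])
    note i2 = centred_inner(1)[OF fx, of y] and z = centred_inner(2)[OF fx, of y]
    have "(\<integral>x. (f x - 1) * mehler_remainder r y x \<partial>\<gamma>) =
       (\<integral>x. mehler r y x * f x - f x - r * (f x * (y \<bullet> x)) - mehler r y x + 1 + r * (y \<bullet> x) \<partial>\<gamma>)"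
      by (simp add: mehler_remainder_def algebra_simps)
    also have "\<dots> = ou r f y - 1"
      using i1 i2 fi(1) integral_mehler_1(1)[OF r1, of y]
      by (simp add: z fi(2) integral_mehler_1(2)[OF r1] integral_mehler(2)[OF r1 fi(1)])
    finally show ?thesis by simp
  qed
  have pw: "ennreal ((ou r f y - 1)\<^sup>2) \<le> ennreal D * (\<integral>\<^sup>+x. ennreal (2 * (f x + 1) * (mehler_remainder r y x)\<^sup>2) \<partial>\<gamma>)" for y
  proof -
    have "ennreal \<bar>ou r f y - 1\<bar> \<le> (\<integral>\<^sup>+x. ennreal \<bar>(f x - 1) * mehler_remainder r y x\<bar> \<partial>\<gamma>)"
    proof (cases "integrable \<gamma> (\<lambda>x. (f x - 1) * mehler_remainder r y x)")
      case True
      from integral_norm_bound_ennreal[OF this] show ?thesis by (simp add: eq)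
    next
      case False
      then show ?thesis by (simp add: eq not_integrable_integral_eq)
    qed
    also have "\<dots> = (\<integral>\<^sup>+x. ennreal \<bar>sqrt (f x) - 1\<bar> * ennreal (\<bar>sqrt (f x) + 1\<bar> * \<bar>mehler_remainder r y x\<bar>) \<partial>\<gamma>)"
    proof (rule nn_integral_cong)
      fix x :: 'a
      have "f x - 1 = (sqrt (f x) - 1) * (sqrt (f x) + 1)" using f0[of x] by (simp add: algebra_simps)
      then show "ennreal \<bar>(f x - 1) * mehler_remainder r y x\<bar> = ennreal \<bar>sqrt (f x) - 1\<bar> * ennreal (\<bar>sqrt (f x) + 1\<bar> * \<bar>mehler_remainder r y x\<bar>)"
        by (simp add: abs_mult ennreal_mult[symmetric] mult.assoc)
    qed
    finally have "(ennreal \<bar>ou r f y - 1\<bar>)\<^sup>2 \<le> (\<integral>\<^sup>+x. ennreal \<bar>sqrt (f x) - 1\<bar> * ennreal (\<bar>sqrt (f x) + 1\<bar> * \<bar>mehler_remainder r y x\<bar>) \<partial>\<gamma>)\<^sup>2"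
      by (rule power_mono) simp
    also have "\<dots> \<le> (\<integral>\<^sup>+x. (ennreal \<bar>sqrt (f x) - 1\<bar>)\<^sup>2 \<partial>\<gamma>) * (\<integral>\<^sup>+x. (ennreal (\<bar>sqrt (f x) + 1\<bar> * \<bar>mehler_remainder r y x\<bar>))\<^sup>2 \<partial>\<gamma>)"
      by (rule Cauchy_Schwarz_nn_integral) measurable
    also have "(\<integral>\<^sup>+x. (ennreal \<bar>sqrt (f x) - 1\<bar>)\<^sup>2 \<partial>\<gamma>) = ennreal D" using D(1) by (simp add: ennreal_power)
    also have "(\<integral>\<^sup>+x. (ennreal (\<bar>sqrt (f x) + 1\<bar> * \<bar>mehler_remainder r y x\<bar>))\<^sup>2 \<partial>\<gamma>) \<le> (\<integral>\<^sup>+x. ennreal (2 * (f x + 1) * (mehler_remainder r y x)\<^sup>2) \<partial>\<gamma>)"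
    proof (rule nn_integral_mono)
      fix x :: 'a
      have "(sqrt (f x) + 1)\<^sup>2 \<le> 2 * (f x + 1)"
        using f0[of x] zero_le_power2[of "sqrt (f x) - 1"] by (simp add: power2_eq_square algebra_simps)
      then have "(sqrt (f x) + 1)\<^sup>2 * (mehler_remainder r y x)\<^sup>2 \<le> 2 * (f x + 1) * (mehler_remainder r y x)\<^sup>2"
        by (rule mult_right_mono) simp
      then show "(ennreal (\<bar>sqrt (f x) + 1\<bar> * \<bar>mehler_remainder r y x\<bar>))\<^sup>2 \<le> ennreal (2 * (f x + 1) * (mehler_remainder r y x)\<^sup>2)"
        by (simp add: ennreal_power power_mult_distrib ennreal_leI)
    qed
    finally show ?thesis by (simp add: ennreal_power mult_left_mono)
  qed
  have "(\<integral>\<^sup>+y. ennreal ((ou r f y - 1)\<^sup>2) \<partial>\<gamma>) \<le> (\<integral>\<^sup>+y. ennreal D * (\<integral>\<^sup>+x. ennreal (2 * (f x + 1) * (mehler_remainder r y x)\<^sup>2) \<partial>\<gamma>) \<partial>\<gamma>)"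
    by (intro nn_integral_mono pw)
  also have "\<dots> = ennreal D * (\<integral>\<^sup>+y. \<integral>\<^sup>+x. ennreal (2 * (f x + 1) * (mehler_remainder r y x)\<^sup>2) \<partial>\<gamma> \<partial>\<gamma>)"
  proof (rule nn_integral_cmult)
    have "(\<lambda>p::'a\<times>'a. ennreal (2 * (f (snd p) + 1) * (mehler_remainder r (fst p) (snd p))\<^sup>2)) \<in> borel_measurable (\<gamma> \<Otimes>\<^sub>M \<gamma>)"
      by measurable
    from gauss.borel_measurable_nn_integral_fst[OF this]
    show "(\<lambda>y. \<integral>\<^sup>+x. ennreal (2 * (f x + 1) * (mehler_remainder r y x)\<^sup>2) \<partial>\<gamma>) \<in> borel_measurable \<gamma>" by simp
  qed
  also have "(\<integral>\<^sup>+y. \<integral>\<^sup>+x. ennreal (2 * (f x + 1) * (mehler_remainder r y x)\<^sup>2) \<partial>\<gamma> \<partial>\<gamma>) =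
     (\<integral>\<^sup>+x. \<integral>\<^sup>+y. ennreal (2 * (f x + 1) * (mehler_remainder r y x)\<^sup>2) \<partial>\<gamma> \<partial>\<gamma>)"
  proof (rule pair_sigma_finite.Fubini'[symmetric])
    show "pair_sigma_finite (\<gamma> :: 'a measure) (\<gamma> :: 'a measure)" ..
    show "(\<lambda>(y, x). ennreal (2 * (f x + 1) * (mehler_remainder r y x)\<^sup>2)) \<in> borel_measurable ((\<gamma> :: 'a measure) \<Otimes>\<^sub>M \<gamma>)"
      unfolding split_beta' by measurable
  qed
  finally have outer: "(\<integral>\<^sup>+y. ennreal ((ou r f y - 1)\<^sup>2) \<partial>\<gamma>) \<le>
     ennreal D * (\<integral>\<^sup>+x. \<integral>\<^sup>+y. ennreal (2 * (f x + 1) * (mehler_remainder r y x)\<^sup>2) \<partial>\<gamma> \<partial>\<gamma>)" .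
  have "(\<integral>\<^sup>+x. \<integral>\<^sup>+y. ennreal (2 * (f x + 1) * (mehler_remainder r y x)\<^sup>2) \<partial>\<gamma> \<partial>\<gamma>) \<le>
     (\<integral>\<^sup>+x. ennreal (2 * r ^ 4 * C) * (ennreal (f x * exp (\<kappa> * (norm x)\<^sup>2)) + ennreal (exp (\<kappa> * (norm x)\<^sup>2))) \<partial>\<gamma>)"
  proof (rule nn_integral_mono)
    fix x :: 'a
    have "(\<integral>\<^sup>+y. ennreal (2 * (f x + 1) * (mehler_remainder r y x)\<^sup>2) \<partial>\<gamma>) = (\<integral>\<^sup>+y. ennreal (2 * (f x + 1) * (mehler_remainder r x y)\<^sup>2) \<partial>\<gamma>)"
      by (simp add: mehler_remainder_commute[of r _ x])
    also have "\<dots> = ennreal (\<integral>y. 2 * (f x + 1) * (mehler_remainder r x y)\<^sup>2 \<partial>\<gamma>)"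
      using f0[of x] integral_mehler_remainder_square(1)[OF r1, of x] by (intro nn_integral_eq_integral) auto
    also have "(\<integral>y. 2 * (f x + 1) * (mehler_remainder r x y)\<^sup>2 \<partial>\<gamma>) = 2 * (f x + 1) * (\<integral>y. (mehler_remainder r x y)\<^sup>2 \<partial>\<gamma>)"
      by (rule integral_mult_right_zero)
    also have "\<dots> \<le> 2 * (f x + 1) * (r ^ 4 * (C * exp (\<kappa> * (norm x)\<^sup>2)))"
      unfolding C_def using f0[of x] by (intro mult_left_mono mehler_remainder_square_le \<kappa> r) auto
    also have "\<dots> = 2 * r ^ 4 * C * (f x * exp (\<kappa> * (norm x)\<^sup>2) + exp (\<kappa> * (norm x)\<^sup>2))" by (simp add: algebra_simps)
    finally have le: "(\<integral>\<^sup>+y. ennreal (2 * (f x + 1) * (mehler_remainder r y x)\<^sup>2) \<partial>\<gamma>) \<le>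
       ennreal (2 * r ^ 4 * C * (f x * exp (\<kappa> * (norm x)\<^sup>2) + exp (\<kappa> * (norm x)\<^sup>2)))"
      by (simp only: ennreal_leI)
    have "0 \<le> 2 * r ^ 4 * C" "0 \<le> f x * exp (\<kappa> * (norm x)\<^sup>2)" "0 \<le> exp (\<kappa> * (norm x)\<^sup>2)"
      using C f0[of x] by auto
    then show "(\<integral>\<^sup>+y. ennreal (2 * (f x + 1) * (mehler_remainder r y x)\<^sup>2) \<partial>\<gamma>) \<le>
       ennreal (2 * r ^ 4 * C) * (ennreal (f x * exp (\<kappa> * (norm x)\<^sup>2)) + ennreal (exp (\<kappa> * (norm x)\<^sup>2)))"
      using le by (simp only: ennreal_plus[symmetric] ennreal_mult[symmetric] add_nonneg_nonneg)
  qed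
  also have "\<dots> = ennreal (2 * r ^ 4 * C) * ((\<integral>\<^sup>+x. ennreal (f x * exp (\<kappa> * (norm x)\<^sup>2)) \<partial>\<gamma>) + (\<integral>\<^sup>+(x::'a). ennreal (exp (\<kappa> * (norm x)\<^sup>2)) \<partial>\<gamma>))"
    by (simp add: nn_integral_cmult nn_integral_add)
  also have "(\<integral>\<^sup>+(x::'a). ennreal (exp (\<kappa> * (norm x)\<^sup>2)) \<partial>\<gamma>) = ennreal ((1 / sqrt (1 - 2 * \<kappa>)) ^ DIM('a))"
    using nn_integral_exp_quadratic[of "- 2 * \<kappa>" "0::'a"] \<kappa> by simp
  also have "ennreal (2 * r ^ 4 * C) * ((\<integral>\<^sup>+x. ennreal (f x * exp (\<kappa> * (norm x)\<^sup>2)) \<partial>\<gamma>) + ennreal ((1 / sqrt (1 - 2 * \<kappa>)) ^ DIM('a))) \<le>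
     ennreal (2 * r ^ 4 * C) * (ennreal A + ennreal ((1 / sqrt (1 - 2 * \<kappa>)) ^ DIM('a)))"
    by (intro mult_left_mono add_right_mono A) auto
  finally have inner: "(\<integral>\<^sup>+x. \<integral>\<^sup>+y. ennreal (2 * (f x + 1) * (mehler_remainder r y x)\<^sup>2) \<partial>\<gamma> \<partial>\<gamma>) \<le>
     ennreal (2 * r ^ 4 * C) * (ennreal A + ennreal ((1 / sqrt (1 - 2 * \<kappa>)) ^ DIM('a)))" .
  have "(\<integral>\<^sup>+y. ennreal ((ou r f y - 1)\<^sup>2) \<partial>\<gamma>) \<le>
     ennreal D * (ennreal (2 * r ^ 4 * C) * (ennreal A + ennreal ((1 / sqrt (1 - 2 * \<kappa>)) ^ DIM('a))))"
    by (rule order_trans[OF outer mult_left_mono[OF inner]]) simp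
  also have "\<dots> = ennreal (D * (2 * r ^ 4 * C * (A + (1 / sqrt (1 - 2 * \<kappa>)) ^ DIM('a))))"
  proof -
    have "0 \<le> (1 / sqrt (1 - 2 * \<kappa>)) ^ DIM('a)" "0 \<le> 2 * r ^ 4 * C" using \<kappa> C by auto
    then show ?thesis using D A by (simp only: ennreal_plus[symmetric] ennreal_mult[symmetric] add_nonneg_nonneg mult_nonneg_nonneg)
  qed
  finally show ?thesis unfolding C_def .
qed

lemma nn_integral_ou_mean:
  fixes f :: "'a::euclidean_space \<Rightarrow> real"
  assumes f: "integrable \<gamma> f" and f0: "\<And>x. 0 \<le> f x" and r: "0 \<le> r" "r < 1"
  shows "(\<integral>\<^sup>+y. ennreal (ou r f y) \<partial>\<gamma>) = ennreal (\<integral>x. f x \<partial>\<gamma>)"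
proof -
  have [measurable]: "f \<in> borel_measurable borel" using borel_measurable_integrable[OF f] by simp
  have "ennreal (ou r f y) = (\<integral>\<^sup>+z. ennreal (f (r *\<^sub>R y + sqrt (1 - r\<^sup>2) *\<^sub>R z)) \<partial>\<gamma>)" for y
    unfolding gauss_avg_def
    by (rule nn_integral_eq_integral[symmetric]) (use integrable_ou_inner(1)[of r f y] r f f0 in auto)
  then have "(\<integral>\<^sup>+y. ennreal (ou r f y) \<partial>\<gamma>) = (\<integral>\<^sup>+x. ennreal (f x) \<partial>\<gamma>)"
    using nn_integral_ou[of r "\<lambda>x. ennreal (f x)"] r by simp
  also have "\<dots> = ennreal (\<integral>x. f x \<partial>\<gamma>)"
    by (rule nn_integral_eq_integral) (use f f0 in auto)
  finally show ?thesis .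
qed

text \<open>
  The conditional inequality, integrated over \<open>y\<close>. The entropy of the average \<open>u\<close> is estimated by
  \<open>u ln u + 1 \<le> (u - 1)\<^sup>2 + u\<close>, where \<open>u\<close> has integral 1. The third statement is the
  conditional inequality for \<open>r = 0\<close>.
\<close>

lemma log_sobolev:
  fixes f :: "'a::euclidean_space \<Rightarrow> real"
  assumes f: "has_bochner_integral \<gamma> f 1" and f0: "\<And>x. 0 \<le> f x"
    and G: "has_weak_gradient (\<lambda>x. sqrt (f x)) G" and iG: "integrable \<gamma> (\<lambda>x. (norm (G x))\<^sup>2)"
  shows "integrable \<gamma> (\<lambda>x. xlnx (f x))"
    and log_sobolev_remainder: "0 \<le> r \<Longrightarrow> r < 1 \<Longrightarrow> ennreal (1 + (\<integral>x. xlnx (f x) \<partial>\<gamma>)) \<le>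
      (\<integral>\<^sup>+y. ennreal ((ou r f y - 1)\<^sup>2) \<partial>\<gamma>) + ennreal (1 + 2 * (1 - r\<^sup>2) * (\<integral>x. (norm (G x))\<^sup>2 \<partial>\<gamma>))"
    and log_sobolev_ineq: "(\<integral>x. xlnx (f x) \<partial>\<gamma>) \<le> 2 * (\<integral>x. (norm (G x))\<^sup>2 \<partial>\<gamma>)"
proof -
  have fi: "integrable \<gamma> f" "(\<integral>x. f x \<partial>\<gamma>) = 1" using f by (auto simp: has_bochner_integral_iff)
  have [measurable]: "f \<in> borel_measurable borel" using borel_measurable_integrable[OF fi(1)] by simp
  have [measurable]: "G \<in> borel_measurable borel"
    using G by (auto simp: has_weak_gradient_def intro: locally_integrable_measurable)
  define J where "J = (\<integral>x. (norm (G x))\<^sup>2 \<partial>\<gamma>)"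
  have J: "0 \<le> J" by (simp add: J_def)
  have i: "integrable \<gamma> (\<lambda>x. (sqrt (f x))\<^sup>2 + (norm (G x))\<^sup>2)" using fi(1) iG f0 by simp
  have cond: "(\<integral>\<^sup>+z. ennreal (xlnx (f (r *\<^sub>R y + sqrt (1 - r\<^sup>2) *\<^sub>R z)) + 1) \<partial>\<gamma>) \<le>
    ennreal (xlnx (ou r f y) + 1 + 2 * (1 - r\<^sup>2) * ou r (\<lambda>x. (norm (G x))\<^sup>2) y)" if "0 \<le> r" "r < 1" for r y
    using conditional_log_sobolev[OF G i that, of y] f0 by simp
  have base: "(\<integral>\<^sup>+z. ennreal (xlnx (f z) + 1) \<partial>\<gamma>) \<le> ennreal (1 + 2 * J)"
    using cond[of 0 0] by (simp add: gauss_avg_def fi(2) J_def) (simp add: xlnx_def)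
  have nn: "0 \<le> xlnx (f x) + 1" for x using xlnx_ge[OF f0, of x] by linarith
  have int1: "integrable \<gamma> (\<lambda>x. xlnx (f x) + 1)"
  proof (rule integrableI_bounded)
    show "(\<integral>\<^sup>+x. ennreal (norm (xlnx (f x) + 1)) \<partial>\<gamma>) < \<infinity>"
      using le_less_trans[OF base ennreal_less_top] nn by simp
  qed simp
  have "integrable \<gamma> (\<lambda>x. (xlnx (f x) + 1) - 1)" by (intro Bochner_Integration.integrable_diff int1) simp
  then show int: "integrable \<gamma> (\<lambda>x. xlnx (f x))" by simp
  define E where "E = (\<integral>x. xlnx (f x) \<partial>\<gamma>)"
  have E: "(\<integral>\<^sup>+x. ennreal (xlnx (f x) + 1) \<partial>\<gamma>) = ennreal (1 + E)"
  proof -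
    have "(\<integral>\<^sup>+x. ennreal (xlnx (f x) + 1) \<partial>\<gamma>) = ennreal (\<integral>x. xlnx (f x) + 1 \<partial>\<gamma>)"
      by (rule nn_integral_eq_integral[OF int1]) (use nn in auto)
    then show ?thesis using int by (simp add: E_def add.commute)
  qed
  have "1 + E \<le> 1 + 2 * J" using base J unfolding E by (subst (asm) ennreal_le_iff) auto
  then show "(\<integral>x. xlnx (f x) \<partial>\<gamma>) \<le> 2 * (\<integral>x. (norm (G x))\<^sup>2 \<partial>\<gamma>)" by (simp add: E_def J_def)
  assume r: "0 \<le> r" "r < 1"
  have r2: "0 \<le> 1 - r\<^sup>2" using r by (simp add: power_le_one)
  have unn: "0 \<le> ou r f y" for y unfolding gauss_avg_def by (rule Bochner_Integration.integral_nonneg) (rule f0)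
  have vnn: "0 \<le> ou r (\<lambda>x. (norm (G x))\<^sup>2) y" for y unfolding gauss_avg_def by (rule Bochner_Integration.integral_nonneg) simp
  have "ennreal (1 + E) = (\<integral>\<^sup>+y. \<integral>\<^sup>+z. ennreal (xlnx (f (r *\<^sub>R y + sqrt (1 - r\<^sup>2) *\<^sub>R z)) + 1) \<partial>\<gamma> \<partial>\<gamma>)"
    unfolding E[symmetric] using nn_integral_ou[of r "\<lambda>x. ennreal (xlnx (f x) + 1)"] r by simp
  also have "\<dots> \<le> (\<integral>\<^sup>+y. ennreal ((ou r f y - 1)\<^sup>2) + (ennreal (ou r f y) + ennreal (2 * (1 - r\<^sup>2)) * ennreal (ou r (\<lambda>x. (norm (G x))\<^sup>2) y)) \<partial>\<gamma>)"
  proof (rule nn_integral_mono)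
    fix y :: 'a
    have "xlnx (ou r f y) + 1 + 2 * (1 - r\<^sup>2) * ou r (\<lambda>x. (norm (G x))\<^sup>2) y \<le>
      (ou r f y - 1)\<^sup>2 + (ou r f y + 2 * (1 - r\<^sup>2) * ou r (\<lambda>x. (norm (G x))\<^sup>2) y)"
      using xlnx_le[OF unn, of y] by (simp add: power2_eq_square algebra_simps)
    from order_trans[OF cond[OF r, of y] ennreal_leI[OF this]]
    show "(\<integral>\<^sup>+z. ennreal (xlnx (f (r *\<^sub>R y + sqrt (1 - r\<^sup>2) *\<^sub>R z)) + 1) \<partial>\<gamma>) \<le>
       ennreal ((ou r f y - 1)\<^sup>2) + (ennreal (ou r f y) + ennreal (2 * (1 - r\<^sup>2)) * ennreal (ou r (\<lambda>x. (norm (G x))\<^sup>2) y))"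
      using unn[of y] vnn[of y] r2
      by (subst ennreal_mult[symmetric], simp, simp, subst ennreal_plus[symmetric], simp, simp, subst ennreal_plus[symmetric]) auto
  qed
  also have "\<dots> = (\<integral>\<^sup>+y. ennreal ((ou r f y - 1)\<^sup>2) \<partial>\<gamma>) + ((\<integral>\<^sup>+y. ennreal (ou r f y) \<partial>\<gamma>) + ennreal (2 * (1 - r\<^sup>2)) * (\<integral>\<^sup>+y. ennreal (ou r (\<lambda>x. (norm (G x))\<^sup>2) y) \<partial>\<gamma>))"
    by (simp add: nn_integral_add nn_integral_cmult)
  also have "(\<integral>\<^sup>+y. ennreal (ou r f y) \<partial>\<gamma>) = ennreal 1"
    using nn_integral_ou_mean[OF fi(1) f0 r] by (simp only: fi(2))
  also have "(\<integral>\<^sup>+y. ennreal (ou r (\<lambda>x. (norm (G x))\<^sup>2) y) \<partial>\<gamma>) = ennreal J"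
    unfolding J_def by (rule nn_integral_ou_mean[OF iG _ r]) simp
  also have "ennreal 1 + ennreal (2 * (1 - r\<^sup>2)) * ennreal J = ennreal (1 + 2 * (1 - r\<^sup>2) * J)"
    using J r2 by (subst ennreal_mult[symmetric], simp, simp, subst ennreal_plus) auto
  finally show "ennreal (1 + (\<integral>x. xlnx (f x) \<partial>\<gamma>)) \<le>
      (\<integral>\<^sup>+y. ennreal ((ou r f y - 1)\<^sup>2) \<partial>\<gamma>) + ennreal (1 + 2 * (1 - r\<^sup>2) * (\<integral>x. (norm (G x))\<^sup>2 \<partial>\<gamma>))"
    by (simp only: E_def J_def)
qed

text \<open>
  This is \<open>ln (1 / \<surd>u) \<le> 1 / \<surd>u - 1\<close>, multiplied by \<open>2 u\<close>.
\<close>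

lemma xlnx_ge_sqrt: "0 \<le> u \<Longrightarrow> 2 * u - 2 * sqrt u \<le> xlnx u"
proof (cases "u = 0")
  case False
  assume "0 \<le> u"
  with False have u: "0 < u" by simp
  have "ln (1 / sqrt u) \<le> 1 / sqrt u - 1" using u by (intro ln_le_minus_one) auto
  then have "u * (- (ln u / 2)) \<le> u * (1 / sqrt u - 1)"
    using u by (intro mult_left_mono) (auto simp: ln_div ln_sqrt)
  moreover have "u * (1 / sqrt u) = sqrt u" using u by (simp add: real_div_sqrt)
  ultimately show ?thesis by (simp add: xlnx_def algebra_simps)
qed (simp add: xlnx_def)

lemma hellinger_le_entropy:
  fixes f :: "'a::euclidean_space \<Rightarrow> real"
  assumes f: "has_bochner_integral \<gamma> f 1" and f0: "\<And>x. 0 \<le> f x" and e: "integrable \<gamma> (\<lambda>x. xlnx (f x))"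
  shows "integrable \<gamma> (\<lambda>x. (sqrt (f x) - 1)\<^sup>2)" "(\<integral>x. (sqrt (f x) - 1)\<^sup>2 \<partial>\<gamma>) \<le> (\<integral>x. xlnx (f x) \<partial>\<gamma>)"
proof -
  have fi: "integrable \<gamma> f" "(\<integral>x. f x \<partial>\<gamma>) = 1" using f by (auto simp: has_bochner_integral_iff)
  have [measurable]: "f \<in> borel_measurable borel" using borel_measurable_integrable[OF fi(1)] by simp
  have s: "integrable \<gamma> (\<lambda>x. sqrt (f x))"
    by (rule integrable_of_power[of _ 2]) (use fi(1) f0 in auto)
  have eq: "(sqrt (f x) - 1)\<^sup>2 = f x - 2 * sqrt (f x) + 1" for x
    using f0[of x] by (simp add: power2_diff)
  show "integrable \<gamma> (\<lambda>x. (sqrt (f x) - 1)\<^sup>2)" unfolding eq using fi(1) s by simp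
  have "(\<integral>x. (sqrt (f x) - 1)\<^sup>2 \<partial>\<gamma>) = 2 - 2 * (\<integral>x. sqrt (f x) \<partial>\<gamma>)"
    unfolding eq using fi s by simp
  also have "\<dots> = (\<integral>x. 2 * f x - 2 * sqrt (f x) \<partial>\<gamma>)" using fi s by simp
  also have "\<dots> \<le> (\<integral>x. xlnx (f x) \<partial>\<gamma>)"
    by (rule integral_mono) (use fi(1) s e xlnx_ge_sqrt f0 in auto)
  finally show "(\<integral>x. (sqrt (f x) - 1)\<^sup>2 \<partial>\<gamma>) \<le> (\<integral>x. xlnx (f x) \<partial>\<gamma>)" .
qed

text \<open>
  With \<open>q = r\<^sup>2\<close>, the entropy is at most \<open>2 (1 - q) J\<close> plus a term of order \<open>q\<^sup>2 J\<close>, and \<open>q\<close> is chosen so small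
  that this term is at most \<open>q J\<close>.
\<close>

lemma fisher_le_deficit:
  fixes A \<kappa> :: real
  assumes \<kappa>: "0 < \<kappa>" "\<kappa> < 1/2" and A: "0 \<le> A"
  shows "\<exists>c>0. \<forall>(f::'a::euclidean_space \<Rightarrow> real) G. has_bochner_integral \<gamma> f 1 \<longrightarrow> (\<forall>x. 0 \<le> f x) \<longrightarrow>
     has_bochner_integral \<gamma> (\<lambda>x. f x *\<^sub>R x) 0 \<longrightarrow> has_weak_gradient (\<lambda>x. sqrt (f x)) G \<longrightarrow>
     integrable \<gamma> (\<lambda>x. (norm (G x))\<^sup>2) \<longrightarrow>
     (\<integral>\<^sup>+x. ennreal (f x * exp (\<kappa> * (norm x)\<^sup>2)) \<partial>\<gamma>) \<le> ennreal A \<longrightarrow>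
     c * (\<integral>x. (norm (G x))\<^sup>2 \<partial>\<gamma>) \<le> 2 * (\<integral>x. (norm (G x))\<^sup>2 \<partial>\<gamma>) - (\<integral>x. xlnx (f x) \<partial>\<gamma>)"
proof -
  define B where "B = (2 * real DIM('a) * exp (real DIM('a)) + 8 / \<kappa>\<^sup>2) * (A + (1 / sqrt (1 - 2 * \<kappa>)) ^ DIM('a))"
  have B: "0 \<le> B" unfolding B_def using A \<kappa> by (intro mult_nonneg_nonneg add_nonneg_nonneg) auto
  \<comment> \<open>The first two bounds are those of the remainder estimate, the third absorbs its constant \<open>B\<close>.\<close>
  define q where "q = min (\<kappa> / 2) (min (1 / 2) (1 / (4 * (B + 1))))"
  have q: "0 < q" "q \<le> \<kappa> / 2" "q \<le> 1 / 2" "q \<le> 1 / (4 * (B + 1))" using \<kappa> B by (auto simp: q_def)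
  define r where "r = sqrt q"
  have r: "0 \<le> r" "r\<^sup>2 = q" using q by (auto simp: r_def)
  have "r\<^sup>2 < 1" using q r(2) by linarith
  then have r1: "r < 1" using r(1) by (simp only: abs_square_less_1 abs_of_nonneg)
  have qB: "4 * q * B \<le> 1"
  proof -
    have "4 * q * B \<le> 4 * (1 / (4 * (B + 1))) * B" using q B by (intro mult_right_mono mult_left_mono) auto
    also have "\<dots> \<le> 1" using B by (simp add: field_simps)
    finally show ?thesis .
  qed
  show ?thesis
  proof (intro exI[of _ q] conjI allI impI q)
    fix f :: "'a \<Rightarrow> real" and G
    assume f: "has_bochner_integral \<gamma> f 1" and f0': "\<forall>x. 0 \<le> f x" and fx: "has_bochner_integral \<gamma> (\<lambda>x. f x *\<^sub>R x) 0"
      and G: "has_weak_gradient (\<lambda>x. sqrt (f x)) G" and iG: "integrable \<gamma> (\<lambda>x. (norm (G x))\<^sup>2)"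
      and Af: "(\<integral>\<^sup>+x. ennreal (f x * exp (\<kappa> * (norm x)\<^sup>2)) \<partial>\<gamma>) \<le> ennreal A"
    have f0: "0 \<le> f x" for x using f0' by blast
    define J where "J = (\<integral>x. (norm (G x))\<^sup>2 \<partial>\<gamma>)"
    define E where "E = (\<integral>x. xlnx (f x) \<partial>\<gamma>)"
    define D where "D = (\<integral>x. (sqrt (f x) - 1)\<^sup>2 \<partial>\<gamma>)"
    have J: "0 \<le> J" by (simp add: J_def)
    have D0: "0 \<le> D" by (simp add: D_def)
    note ei = log_sobolev(1)[OF f f0 G iG]
    have EJ: "E \<le> 2 * J" using log_sobolev_ineq[OF f f0 G iG] by (simp add: E_def J_def)
    have DE: "D \<le> E" using hellinger_le_entropy(2)[OF f f0 ei] by (simp add: E_def D_def)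
    have Dn: "(\<integral>\<^sup>+x. ennreal ((sqrt (f x) - 1)\<^sup>2) \<partial>\<gamma>) = ennreal D"
      unfolding D_def by (rule nn_integral_eq_integral[OF hellinger_le_entropy(1)[OF f f0 ei]]) simp
    have r4: "r ^ 4 = q * q" using r(2) by (simp add: power4_eq_xxxx power2_eq_square mult.assoc)
    have "ennreal (1 + E) \<le> ennreal (D * (2 * r ^ 4 * (2 * real DIM('a) * exp (real DIM('a)) + 8 / \<kappa>\<^sup>2) * (A + (1 / sqrt (1 - 2 * \<kappa>)) ^ DIM('a)))) +
       ennreal (1 + 2 * (1 - r\<^sup>2) * J)"
      unfolding E_def J_def
      by (rule order_trans[OF log_sobolev_remainder[OF f f0 G iG r(1) r1] add_right_mono[OF ou_minus_1_square_le[OF f f0 fx \<kappa> r(1) _ _ Af A Dn D0]]])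
         (use q r in auto)
    also have "D * (2 * r ^ 4 * (2 * real DIM('a) * exp (real DIM('a)) + 8 / \<kappa>\<^sup>2) * (A + (1 / sqrt (1 - 2 * \<kappa>)) ^ DIM('a))) = D * (2 * (q * q) * B)"
      unfolding r4 B_def by (simp add: mult.assoc)
    also have "ennreal (D * (2 * (q * q) * B)) + ennreal (1 + 2 * (1 - r\<^sup>2) * J) = ennreal (D * (2 * (q * q) * B) + (1 + 2 * (1 - q) * J))"
      unfolding r(2) using D0 B q J by (intro ennreal_plus[symmetric]) auto
    finally have "1 + E \<le> D * (2 * (q * q) * B) + (1 + 2 * (1 - q) * J)"
      using D0 B q J by (subst (asm) ennreal_le_iff) auto
    moreover have "D * (2 * (q * q) * B) \<le> q * J"
    proof -
      have "D * (2 * (q * q) * B) \<le> (2 * J) * (2 * (q * q) * B)"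
        using DE EJ B q by (intro mult_right_mono) auto
      also have "\<dots> = (q * J) * (4 * q * B)" by simp
      also have "\<dots> \<le> q * J" using qB q J by (intro mult_left_le) auto
      finally show ?thesis .
    qed
    ultimately have "E \<le> q * J + 2 * (1 - q) * J" by linarith
    then have "q * J \<le> 2 * J - E" by (simp add: algebra_simps)
    then show "q * (\<integral>x. (norm (G x))\<^sup>2 \<partial>\<gamma>) \<le> 2 * (\<integral>x. (norm (G x))\<^sup>2 \<partial>\<gamma>) - (\<integral>x. xlnx (f x) \<partial>\<gamma>)"
      by (simp only: J_def E_def)
  qed
qed

section \<open>Transport cost and the upper bound\<close>

lemma density_std_gauss_AE_1:
  assumes "f \<in> borel_measurable borel" "AE x in \<gamma>. f x = (1::real)"
  shows "density \<gamma> (\<lambda>x. ennreal (f x)) = \<gamma>"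
proof -
  have "density \<gamma> (\<lambda>x. ennreal (f x)) = density \<gamma> (\<lambda>x. 1)"
    by (rule density_cong) (use assms in auto)
  then show ?thesis by (simp add: density_1)
qed

lemma wasserstein1_self: "W\<^sub>1 \<gamma> (\<gamma> :: 'a::euclidean_space measure) = 0"
proof -
  define \<pi> where "\<pi> = distr (\<gamma> :: 'a measure) (borel \<Otimes>\<^sub>M borel) (\<lambda>x. (x, x))"
  have "\<pi> \<in> couplings \<gamma> \<gamma>"
    unfolding couplings_def \<pi>_def
    by (auto simp: distr_distr o_def distr_id2 intro!: gauss.prob_space_distr)
  then have "W\<^sub>1 \<gamma> (\<gamma> :: 'a measure) \<le> (\<integral>\<^sup>+(x, y). ennreal (norm (x - y)) \<partial>\<pi>)"
    unfolding wasserstein1_def by (rule INF_lower)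
  also have "\<dots> = 0" unfolding \<pi>_def by (subst nn_integral_distr) (auto simp: split_beta')
  finally show ?thesis by simp
qed

definition excess :: "('a \<Rightarrow> real) \<Rightarrow> 'a \<Rightarrow> real" where "excess f x = max 0 (f x - 1)"
definition defect :: "('a \<Rightarrow> real) \<Rightarrow> 'a \<Rightarrow> real" where "defect f x = max 0 (1 - f x)"

text \<open>
  The mass common to \<open>f\<close> and 1 stays where it is, and the excess is sent to the places of too little
  mass independently of its origin. The Boolean component tells the two cases apart, and \<open>m\<close> is the mass
  that moves.
\<close>

definition stay_coupling :: "('a::euclidean_space \<Rightarrow> real) \<Rightarrow> real \<Rightarrow> ('a \<times> 'a) measure" where
  "stay_coupling f m = distr
     (density (count_space UNIV \<Otimes>\<^sub>M (\<gamma> \<Otimes>\<^sub>M \<gamma>))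
       (\<lambda>p. ennreal (if fst p then min (f (fst (snd p))) 1 else excess f (fst (snd p)) * defect f (snd (snd p)) / m)))
     (borel \<Otimes>\<^sub>M borel) (\<lambda>p. (fst (snd p), if fst p then fst (snd p) else snd (snd p)))"

lemma nn_integral_stay_coupling:
  fixes f :: "'a::euclidean_space \<Rightarrow> real"
  assumes [measurable]: "f \<in> borel_measurable borel" "F \<in> borel_measurable (borel \<Otimes>\<^sub>M borel)"
  shows "(\<integral>\<^sup>+p. F p \<partial>stay_coupling f m) = (\<integral>\<^sup>+x. ennreal (min (f x) 1) * F (x, x) \<partial>\<gamma>) +
    (\<integral>\<^sup>+x. \<integral>\<^sup>+y. ennreal (excess f x * defect f y / m) * F (x, y) \<partial>\<gamma> \<partial>\<gamma>)"
proof -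
  have [measurable]: "excess f \<in> borel_measurable borel" "defect f \<in> borel_measurable borel"
    unfolding excess_def[abs_def] defect_def[abs_def] by measurable
  interpret P: pair_prob_space "\<gamma> :: 'a measure" "\<gamma> :: 'a measure" ..
  let ?d = "\<lambda>p. ennreal (if fst p then min (f (fst (snd p))) 1 else excess f (fst (snd p)) * defect f (snd (snd p)) / m)"
  let ?T = "\<lambda>p. (fst (snd p), if fst p then fst (snd p) else snd (snd p))"
  have "(\<integral>\<^sup>+p. F p \<partial>stay_coupling f m) = (\<integral>\<^sup>+p. ?d p * F (?T p) \<partial>(count_space UNIV \<Otimes>\<^sub>M (\<gamma> \<Otimes>\<^sub>M \<gamma>)))"
    unfolding stay_coupling_def by (subst nn_integral_distr, simp, simp, subst nn_integral_density) simp_all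
  also have "\<dots> = (\<integral>\<^sup>+b. \<integral>\<^sup>+q. ?d (b, q) * F (?T (b, q)) \<partial>(\<gamma> \<Otimes>\<^sub>M \<gamma>) \<partial>count_space UNIV)"
    by (rule P.P.nn_integral_fst[symmetric]) measurable
  also have "\<dots> = (\<integral>\<^sup>+q. ?d (True, q) * F (?T (True, q)) \<partial>(\<gamma> \<Otimes>\<^sub>M \<gamma>)) + (\<integral>\<^sup>+q. ?d (False, q) * F (?T (False, q)) \<partial>(\<gamma> \<Otimes>\<^sub>M \<gamma>))"
    by (subst nn_integral_count_space_finite) (auto simp: UNIV_bool add.commute)
  also have "(\<integral>\<^sup>+q. ?d (True, q) * F (?T (True, q)) \<partial>(\<gamma> \<Otimes>\<^sub>M \<gamma>)) = (\<integral>\<^sup>+x. ennreal (min (f x) 1) * F (x, x) \<partial>\<gamma>)"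
    by (subst gauss.nn_integral_fst[symmetric]) (simp_all)
  also have "(\<integral>\<^sup>+q. ?d (False, q) * F (?T (False, q)) \<partial>(\<gamma> \<Otimes>\<^sub>M \<gamma>)) = (\<integral>\<^sup>+x. \<integral>\<^sup>+y. ennreal (excess f x * defect f y / m) * F (x, y) \<partial>\<gamma> \<partial>\<gamma>)"
    by (subst gauss.nn_integral_fst[symmetric]) (simp_all)
  finally show ?thesis .
qed

text \<open>
  Moving a unit of mass from \<open>x\<close> to \<open>y\<close> costs at most \<open>\<bar>x\<bar> + \<bar>y\<bar>\<close>, and only the excess of \<open>f\<close> over 1 moves.
\<close>

lemma wasserstein1_le_weighted_L1:
  fixes f :: "'a::euclidean_space \<Rightarrow> real"
  assumes f: "has_bochner_integral \<gamma> f 1" and f0: "\<And>x. 0 \<le> f x"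
  shows "W\<^sub>1 (density \<gamma> (\<lambda>x. ennreal (f x))) \<gamma> \<le> (\<integral>\<^sup>+x. ennreal (norm x * \<bar>f x - 1\<bar>) \<partial>\<gamma>)"
proof -
  have fi: "integrable \<gamma> f" "(\<integral>x. f x \<partial>\<gamma>) = 1" using f by (auto simp: has_bochner_integral_iff)
  have [measurable]: "f \<in> borel_measurable borel" using borel_measurable_integrable[OF fi(1)] by simp
  have [measurable]: "excess f \<in> borel_measurable borel" "defect f \<in> borel_measurable borel"
    unfolding excess_def[abs_def] defect_def[abs_def] by measurable
  have pq0: "0 \<le> excess f x" "0 \<le> defect f x" for x by (auto simp: excess_def defect_def)
  have pi: "integrable \<gamma> (excess f)" and qi: "integrable \<gamma> (defect f)"
    unfolding excess_def[abs_def] defect_def[abs_def] using fi(1) by auto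
  define m where "m = (\<integral>x. excess f x \<partial>\<gamma>)"
  have m0: "0 \<le> m" unfolding m_def by (rule Bochner_Integration.integral_nonneg) (rule pq0)
  have mq: "(\<integral>x. defect f x \<partial>\<gamma>) = m"
  proof -
    have "(\<integral>x. excess f x \<partial>\<gamma>) - (\<integral>x. defect f x \<partial>\<gamma>) = (\<integral>x. excess f x - defect f x \<partial>\<gamma>)"
      using pi qi by simp
    also have "\<dots> = (\<integral>x. f x - 1 \<partial>\<gamma>)" by (intro Bochner_Integration.integral_cong) (auto simp: excess_def defect_def)
    also have "\<dots> = 0" using fi by simp
    finally show ?thesis by (simp add: m_def)
  qed
  have np: "(\<integral>\<^sup>+x. ennreal (excess f x) \<partial>\<gamma>) = ennreal m"
    unfolding m_def by (rule nn_integral_eq_integral[OF pi]) (simp add: pq0)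
  have nq: "(\<integral>\<^sup>+x. ennreal (defect f x) \<partial>\<gamma>) = ennreal m"
    unfolding mq[symmetric] by (rule nn_integral_eq_integral[OF qi]) (simp add: pq0)
  show ?thesis
  proof (cases "m = 0")
    case True
    have "AE x in \<gamma>. excess f x = 0" "AE x in \<gamma>. defect f x = 0"
      using np nq pq0 unfolding True by (auto simp: nn_integral_0_iff_AE ennreal_eq_0_iff order_antisym_conv)
    then have "AE x in \<gamma>. f x = 1" by eventually_elim (auto simp: excess_def defect_def)
    then show ?thesis by (simp add: density_std_gauss_AE_1 wasserstein1_self)
  next
    case False
    then have m: "0 < m" using m0 by simp
    define \<pi> where "\<pi> = stay_coupling f m"
    have prodm: "ennreal (excess f x * defect f y / m) = ennreal (excess f x) * ennreal (defect f y / m)" for x y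
      using pq0 m by (simp add: ennreal_mult[symmetric])
    have q1: "(\<integral>\<^sup>+y. ennreal (defect f y / m) \<partial>\<gamma>) = 1"
    proof -
      have "(\<integral>\<^sup>+y. ennreal (defect f y / m) \<partial>\<gamma>) = (\<integral>\<^sup>+y. ennreal (1 / m) * ennreal (defect f y) \<partial>\<gamma>)"
        using m pq0 by (simp add: ennreal_mult[symmetric])
      also have "\<dots> = ennreal (1 / m) * ennreal m" by (simp add: nn_integral_cmult nq)
      also have "\<dots> = 1" using m by (simp add: ennreal_mult[symmetric])
      finally show ?thesis .
    qed
    have p1: "(\<integral>\<^sup>+x. ennreal (excess f x * c / m) \<partial>\<gamma>) = ennreal c" if "0 \<le> c" for c
    proof -
      have "(\<integral>\<^sup>+x. ennreal (excess f x * c / m) \<partial>\<gamma>) = (\<integral>\<^sup>+x. ennreal (c / m) * ennreal (excess f x) \<partial>\<gamma>)"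
        using m pq0 that by (simp add: ennreal_mult[symmetric] mult.commute)
      also have "\<dots> = ennreal (c / m) * ennreal m" by (simp add: nn_integral_cmult np)
      also have "\<dots> = ennreal c" using m that by (simp add: ennreal_mult[symmetric])
      finally show ?thesis .
    qed
    have fst_int: "(\<integral>\<^sup>+x. \<integral>\<^sup>+y. ennreal (excess f x * defect f y / m) * G x \<partial>\<gamma> \<partial>\<gamma>) = (\<integral>\<^sup>+x. ennreal (excess f x) * G x \<partial>\<gamma>)"
      for G :: "'a \<Rightarrow> ennreal"
    proof (rule nn_integral_cong)
      fix x :: 'a
      have "(\<integral>\<^sup>+y. ennreal (excess f x * defect f y / m) * G x \<partial>\<gamma>) = (\<integral>\<^sup>+y. (ennreal (excess f x) * G x) * ennreal (defect f y / m) \<partial>\<gamma>)"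
        unfolding prodm by (simp add: ac_simps)
      then show "(\<integral>\<^sup>+y. ennreal (excess f x * defect f y / m) * G x \<partial>\<gamma>) = ennreal (excess f x) * G x"
        by (simp add: nn_integral_cmult q1)
    qed
    have snd_int: "(\<integral>\<^sup>+x. \<integral>\<^sup>+y. ennreal (excess f x * defect f y / m) * G y \<partial>\<gamma> \<partial>\<gamma>) = (\<integral>\<^sup>+y. ennreal (defect f y) * G y \<partial>\<gamma>)"
      if [measurable]: "G \<in> borel_measurable borel" for G :: "'a \<Rightarrow> ennreal"
    proof -
      have "(\<integral>\<^sup>+x. \<integral>\<^sup>+y. ennreal (excess f x * defect f y / m) * G y \<partial>\<gamma> \<partial>\<gamma>) = (\<integral>\<^sup>+y. \<integral>\<^sup>+x. ennreal (excess f x * defect f y / m) * G y \<partial>\<gamma> \<partial>\<gamma>)"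
      proof (rule pair_sigma_finite.Fubini'[symmetric])
        show "pair_sigma_finite (\<gamma> :: 'a measure) (\<gamma> :: 'a measure)" ..
        show "(\<lambda>(x, y). ennreal (excess f x * defect f y / m) * G y) \<in> borel_measurable ((\<gamma> :: 'a measure) \<Otimes>\<^sub>M \<gamma>)"
          unfolding split_beta' by measurable
      qed
      also have "\<dots> = (\<integral>\<^sup>+y. ennreal (defect f y) * G y \<partial>\<gamma>)"
        by (intro nn_integral_cong) (simp add: nn_integral_multc p1 pq0)
      finally show ?thesis .
    qed
    have minp: "ennreal (min (f x) 1) + ennreal (excess f x) = ennreal (f x)" for x
    proof -
      have "min (f x) 1 + excess f x = f x" by (simp add: excess_def)
      then show ?thesis using ennreal_plus[of "min (f x) 1" "excess f x"] f0[of x] pq0(1)[of x] by simp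
    qed
    have minq: "ennreal (min (f x) 1) + ennreal (defect f x) = 1" for x
    proof -
      have "min (f x) 1 + defect f x = 1" by (simp add: defect_def)
      then show ?thesis using ennreal_plus[of "min (f x) 1" "defect f x"] f0[of x] pq0(2)[of x] by simp
    qed
    have sets_\<pi>: "sets \<pi> = sets (borel \<Otimes>\<^sub>M borel)" by (simp add: \<pi>_def stay_coupling_def)
    have mfst: "distr \<pi> borel fst = density \<gamma> (\<lambda>x. ennreal (f x))"
    proof (rule measure_eqI)
      fix B assume "B \<in> sets (distr \<pi> borel fst)"
      then have [measurable]: "B \<in> sets borel" by simp
      have "emeasure (distr \<pi> borel fst) B = (\<integral>\<^sup>+x. indicator B x \<partial>distr \<pi> borel fst)" by simp
      also have "\<dots> = (\<integral>\<^sup>+p. indicator B (fst p) \<partial>\<pi>)"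
        by (rule nn_integral_distr) (simp_all add: measurable_cong_sets[OF sets_\<pi> refl])
      also have "\<dots> = (\<integral>\<^sup>+x. ennreal (min (f x) 1) * indicator B x \<partial>\<gamma>) + (\<integral>\<^sup>+x. ennreal (excess f x) * indicator B x \<partial>\<gamma>)"
        unfolding \<pi>_def by (subst nn_integral_stay_coupling) (simp_all add: fst_int)
      also have "\<dots> = (\<integral>\<^sup>+x. ennreal (f x) * indicator B x \<partial>\<gamma>)"
        by (subst nn_integral_add[symmetric]) (simp_all add: distrib_right[symmetric] minp)
      also have "\<dots> = emeasure (density \<gamma> (\<lambda>x. ennreal (f x))) B" by (simp add: emeasure_density)
      finally show "emeasure (distr \<pi> borel fst) B = emeasure (density \<gamma> (\<lambda>x. ennreal (f x))) B" .
    qed simp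
    have msnd: "distr \<pi> borel snd = \<gamma>"
    proof (rule measure_eqI)
      fix B assume "B \<in> sets (distr \<pi> borel snd)"
      then have [measurable]: "B \<in> sets borel" by simp
      have "emeasure (distr \<pi> borel snd) B = (\<integral>\<^sup>+x. indicator B x \<partial>distr \<pi> borel snd)" by simp
      also have "\<dots> = (\<integral>\<^sup>+p. indicator B (snd p) \<partial>\<pi>)"
        by (rule nn_integral_distr) (simp_all add: measurable_cong_sets[OF sets_\<pi> refl])
      also have "\<dots> = (\<integral>\<^sup>+x. ennreal (min (f x) 1) * indicator B x \<partial>\<gamma>) + (\<integral>\<^sup>+x. ennreal (defect f x) * indicator B x \<partial>\<gamma>)"
        unfolding \<pi>_def by (subst nn_integral_stay_coupling) (simp_all add: snd_int)
      also have "\<dots> = (\<integral>\<^sup>+x. indicator B x \<partial>\<gamma>)"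
        by (subst nn_integral_add[symmetric]) (simp_all add: distrib_right[symmetric] minq)
      also have "\<dots> = emeasure \<gamma> B" by simp
      finally show "emeasure (distr \<pi> borel snd) B = emeasure \<gamma> B" .
    qed simp
    have "prob_space \<pi>"
    proof (rule prob_spaceI)
      have "emeasure \<pi> (space \<pi>) = emeasure (distr \<pi> borel snd) (space (distr \<pi> borel snd))"
        by (subst emeasure_distr) (simp_all add: measurable_cong_sets[OF sets_\<pi> refl])
      then show "emeasure \<pi> (space \<pi>) = 1" unfolding msnd by simp
    qed
    then have "\<pi> \<in> couplings (density \<gamma> (\<lambda>x. ennreal (f x))) \<gamma>"
      using sets_\<pi> mfst msnd by (simp add: couplings_def)
    then have "W\<^sub>1 (density \<gamma> (\<lambda>x. ennreal (f x))) \<gamma> \<le> (\<integral>\<^sup>+(x, y). ennreal (norm (x - y)) \<partial>\<pi>)"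
      unfolding wasserstein1_def by (rule INF_lower)
    also have "\<dots> = (\<integral>\<^sup>+x. \<integral>\<^sup>+y. ennreal (excess f x * defect f y / m) * ennreal (norm (x - y)) \<partial>\<gamma> \<partial>\<gamma>)"
      unfolding \<pi>_def by (subst nn_integral_stay_coupling) (simp_all add: split_beta')
    also have "\<dots> \<le> (\<integral>\<^sup>+x. \<integral>\<^sup>+y. ennreal (excess f x * defect f y / m) * ennreal (norm x) + ennreal (excess f x * defect f y / m) * ennreal (norm y) \<partial>\<gamma> \<partial>\<gamma>)"
      by (intro nn_integral_mono) (simp add: distrib_left[symmetric] mult_left_mono norm_triangle_ineq4 flip: ennreal_plus)
    also have "\<dots> = (\<integral>\<^sup>+x. \<integral>\<^sup>+y. ennreal (excess f x * defect f y / m) * ennreal (norm x) \<partial>\<gamma> \<partial>\<gamma>) +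
       (\<integral>\<^sup>+x. \<integral>\<^sup>+y. ennreal (excess f x * defect f y / m) * ennreal (norm y) \<partial>\<gamma> \<partial>\<gamma>)"
      by (subst nn_integral_add[symmetric]) (auto simp: nn_integral_add)
    also have "\<dots> = (\<integral>\<^sup>+x. ennreal (excess f x) * ennreal (norm x) \<partial>\<gamma>) + (\<integral>\<^sup>+x. ennreal (defect f x) * ennreal (norm x) \<partial>\<gamma>)"
      by (simp add: fst_int snd_int)
    also have "\<dots> = (\<integral>\<^sup>+x. ennreal (norm x * \<bar>f x - 1\<bar>) \<partial>\<gamma>)"
    proof (subst nn_integral_add[symmetric])
      have "ennreal (excess f x) * ennreal (norm x) + ennreal (defect f x) * ennreal (norm x) = ennreal (norm x * \<bar>f x - 1\<bar>)" for x
      proof -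
        have "excess f x * norm x + defect f x * norm x = norm x * \<bar>f x - 1\<bar>"
          by (auto simp: excess_def defect_def max_def abs_if algebra_simps)
        moreover have "ennreal (excess f x * norm x + defect f x * norm x) = ennreal (excess f x) * ennreal (norm x) + ennreal (defect f x) * ennreal (norm x)"
          using pq0[of x] by (subst ennreal_plus) (auto simp: ennreal_mult)
        ultimately show ?thesis by simp
      qed
      then show "(\<integral>\<^sup>+x. ennreal (excess f x) * ennreal (norm x) + ennreal (defect f x) * ennreal (norm x) \<partial>\<gamma>) = (\<integral>\<^sup>+x. ennreal (norm x * \<bar>f x - 1\<bar>) \<partial>\<gamma>)"
        by simp
    qed auto
    finally show ?thesis .
  qed
qed

lemma ennreal_le_of_square_le:
  assumes "X\<^sup>2 \<le> ennreal (s\<^sup>2)" "0 \<le> s" shows "X \<le> ennreal s"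
proof (cases X)
  case (real x)
  have "ennreal (x\<^sup>2) \<le> ennreal (s\<^sup>2)"
    using assms(1) unfolding real(2) ennreal_power[OF real(1)] .
  then have "x\<^sup>2 \<le> s\<^sup>2" by (simp only: ennreal_le_iff[OF zero_le_power2])
  then have "x \<le> s" using assms(2) by (rule power2_le_imp_le)
  then show ?thesis unfolding real(2) by (rule ennreal_leI)
next
  case top
  then show ?thesis using assms(1) by (simp add: top_power_ennreal top_unique)
qed

lemma ennreal_integral_le_nn_integral:
  assumes "integrable M g" shows "ennreal (\<integral>x. g x \<partial>M) \<le> (\<integral>\<^sup>+x. ennreal (g x) \<partial>M)"
proof -
  have "(\<integral>x. g x \<partial>M) \<le> (\<integral>x. max 0 (g x) \<partial>M)" using assms by (intro integral_mono) auto
  then have "ennreal (\<integral>x. g x \<partial>M) \<le> ennreal (\<integral>x. max 0 (g x) \<partial>M)" by (rule ennreal_leI)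
  also have "\<dots> = (\<integral>\<^sup>+x. ennreal (max 0 (g x)) \<partial>M)" using assms by (intro nn_integral_eq_integral[symmetric]) auto
  also have "\<dots> = (\<integral>\<^sup>+x. ennreal (g x) \<partial>M)" by (intro nn_integral_cong) (auto simp: max_def ennreal_neg)
  finally show ?thesis .
qed

text \<open>
  The bound \<open>exp (\<epsilon> \<bar>x - y\<bar>\<^sup>2) \<ge> exp (\<epsilon> \<bar>x\<bar>\<^sup>2) (1 - 2 \<epsilon> (x \<bullet> y))\<close> is affine in \<open>y\<close> on the right, and the linear
  term integrates to zero against a centred function.
\<close>

lemma exp_moment_of_centred:
  fixes f :: "'a::euclidean_space \<Rightarrow> real"
  assumes f: "has_bochner_integral \<gamma> f 1" and f0: "\<And>x. 0 \<le> f x" and fx: "has_bochner_integral \<gamma> (\<lambda>x. f x *\<^sub>R x) 0"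
    and e: "0 < \<epsilon>"
    and a: "(\<integral>\<^sup>+x. \<integral>\<^sup>+y. ennreal (f x * f y * exp (\<epsilon> * (norm (x - y))\<^sup>2)) \<partial>\<gamma> \<partial>\<gamma>) \<le> ennreal \<alpha>"
  shows "(\<integral>\<^sup>+x. ennreal (f x * exp (\<epsilon> * (norm x)\<^sup>2)) \<partial>\<gamma>) \<le> ennreal \<alpha>"
proof -
  have fi: "integrable \<gamma> f" "(\<integral>x. f x \<partial>\<gamma>) = 1" using f by (auto simp: has_bochner_integral_iff)
  have "ennreal (f x * exp (\<epsilon> * (norm x)\<^sup>2)) \<le> (\<integral>\<^sup>+y. ennreal (f x * f y * exp (\<epsilon> * (norm (x - y))\<^sup>2)) \<partial>\<gamma>)" for x
  proof -
    define g where "g y = f x * exp (\<epsilon> * (norm x)\<^sup>2) * (f y - 2 * \<epsilon> * (f y * (x \<bullet> y)))" for y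
    note i2 = centred_inner(1)[OF fx, of x] and z = centred_inner(2)[OF fx, of x]
    have gi: "integrable \<gamma> g" unfolding g_def[abs_def] using fi(1) i2 by simp
    have "(\<integral>y. g y \<partial>\<gamma>) = f x * exp (\<epsilon> * (norm x)\<^sup>2)"
      unfolding g_def using fi i2 by (simp add: z)
    then have "ennreal (f x * exp (\<epsilon> * (norm x)\<^sup>2)) \<le> (\<integral>\<^sup>+y. ennreal (g y) \<partial>\<gamma>)"
      using ennreal_integral_le_nn_integral[OF gi] by simp
    also have "\<dots> \<le> (\<integral>\<^sup>+y. ennreal (f x * f y * exp (\<epsilon> * (norm (x - y))\<^sup>2)) \<partial>\<gamma>)"
    proof (intro nn_integral_mono ennreal_leI)
      fix y :: 'a
      have "(norm (x - y))\<^sup>2 = (norm x)\<^sup>2 + (norm y)\<^sup>2 - 2 * (x \<bullet> y)"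
        unfolding power2_norm_eq_inner by (simp add: inner_diff_left inner_diff_right inner_commute)
      then have "(norm x)\<^sup>2 - 2 * (x \<bullet> y) \<le> (norm (x - y))\<^sup>2" by simp
      from mult_left_mono[OF this, of \<epsilon>] e have "\<epsilon> * (norm x)\<^sup>2 + (- 2 * \<epsilon> * (x \<bullet> y)) \<le> \<epsilon> * (norm (x - y))\<^sup>2"
        by (simp add: right_diff_distrib)
      then have "exp (\<epsilon> * (norm x)\<^sup>2) * exp (- 2 * \<epsilon> * (x \<bullet> y)) \<le> exp (\<epsilon> * (norm (x - y))\<^sup>2)"
        unfolding mult_exp_exp by simp
      moreover have "exp (\<epsilon> * (norm x)\<^sup>2) * (1 + (- 2 * \<epsilon> * (x \<bullet> y))) \<le> exp (\<epsilon> * (norm x)\<^sup>2) * exp (- 2 * \<epsilon> * (x \<bullet> y))"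
        by (intro mult_left_mono exp_ge_add_one_self) simp
      ultimately have "exp (\<epsilon> * (norm x)\<^sup>2) * (1 + (- 2 * \<epsilon> * (x \<bullet> y))) \<le> exp (\<epsilon> * (norm (x - y))\<^sup>2)" by linarith
      from mult_left_mono[OF this, of "f x * f y"] f0[of x] f0[of y]
      show "g y \<le> f x * f y * exp (\<epsilon> * (norm (x - y))\<^sup>2)"
        by (simp add: g_def algebra_simps)
    qed
    finally show ?thesis .
  qed
  then have "(\<integral>\<^sup>+x. ennreal (f x * exp (\<epsilon> * (norm x)\<^sup>2)) \<partial>\<gamma>) \<le> (\<integral>\<^sup>+x. \<integral>\<^sup>+y. ennreal (f x * f y * exp (\<epsilon> * (norm (x - y))\<^sup>2)) \<partial>\<gamma> \<partial>\<gamma>)"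
    by (intro nn_integral_mono)
  then show ?thesis using a by (rule order_trans)
qed

text \<open>
  Cauchy-Schwarz for \<open>\<bar>x\<bar> (\<surd>f + 1)\<close> and \<open>\<bar>\<surd>f - 1\<bar>\<close>, with \<open>(\<surd>f + 1)\<^sup>2 \<le> 2 (f + 1)\<close>.
\<close>

lemma wasserstein1_le_hellinger:
  fixes f :: "'a::euclidean_space \<Rightarrow> real"
  assumes f: "has_bochner_integral \<gamma> f 1" and f0: "\<And>x. 0 \<le> f x"
    and D: "(\<integral>\<^sup>+x. ennreal ((sqrt (f x) - 1)\<^sup>2) \<partial>\<gamma>) = ennreal D" "0 \<le> D"
    and S: "(\<integral>\<^sup>+x. ennreal ((norm x)\<^sup>2 * f x) \<partial>\<gamma>) \<le> ennreal S" "0 \<le> S"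
  shows "W\<^sub>1 (density \<gamma> (\<lambda>x. ennreal (f x))) \<gamma> \<le> ennreal (sqrt (D * (2 * (S + real DIM('a)))))"
proof (rule order_trans[OF wasserstein1_le_weighted_L1[OF f f0]], rule ennreal_le_of_square_le)
  have [measurable]: "f \<in> borel_measurable borel" using f by (auto dest: borel_measurable_has_bochner_integral)
  have "(\<integral>\<^sup>+x. ennreal (norm x * \<bar>f x - 1\<bar>) \<partial>\<gamma>) = (\<integral>\<^sup>+x. ennreal \<bar>sqrt (f x) - 1\<bar> * ennreal (norm x * \<bar>sqrt (f x) + 1\<bar>) \<partial>\<gamma>)"
  proof (rule nn_integral_cong)
    fix x :: 'a
    have "f x - 1 = (sqrt (f x) - 1) * (sqrt (f x) + 1)" using f0[of x] by (simp add: algebra_simps)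
    then show "ennreal (norm x * \<bar>f x - 1\<bar>) = ennreal \<bar>sqrt (f x) - 1\<bar> * ennreal (norm x * \<bar>sqrt (f x) + 1\<bar>)"
      by (simp add: abs_mult ennreal_mult[symmetric] ac_simps)
  qed
  then have "(\<integral>\<^sup>+x. ennreal (norm x * \<bar>f x - 1\<bar>) \<partial>\<gamma>)\<^sup>2 \<le> (\<integral>\<^sup>+x. (ennreal \<bar>sqrt (f x) - 1\<bar>)\<^sup>2 \<partial>\<gamma>) * (\<integral>\<^sup>+x. (ennreal (norm x * \<bar>sqrt (f x) + 1\<bar>))\<^sup>2 \<partial>\<gamma>)"
    by (simp only:) (rule Cauchy_Schwarz_nn_integral; measurable)
  also have "(\<integral>\<^sup>+x. (ennreal \<bar>sqrt (f x) - 1\<bar>)\<^sup>2 \<partial>\<gamma>) = ennreal D" using D(1) by (simp add: ennreal_power)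
  also have "(\<integral>\<^sup>+x. (ennreal (norm x * \<bar>sqrt (f x) + 1\<bar>))\<^sup>2 \<partial>\<gamma>) \<le> (\<integral>\<^sup>+x. ennreal 2 * (ennreal ((norm x)\<^sup>2 * f x) + ennreal ((norm x)\<^sup>2)) \<partial>\<gamma>)"
  proof (rule nn_integral_mono)
    fix x :: 'a
    have "(sqrt (f x) + 1)\<^sup>2 \<le> 2 * (f x + 1)"
      using f0[of x] zero_le_power2[of "sqrt (f x) - 1"] by (simp add: power2_eq_square algebra_simps)
    then have "(norm x)\<^sup>2 * (sqrt (f x) + 1)\<^sup>2 \<le> (norm x)\<^sup>2 * (2 * (f x + 1))" by (rule mult_left_mono) simp
    also have "\<dots> = 2 * ((norm x)\<^sup>2 * f x + (norm x)\<^sup>2)" by (simp add: algebra_simps)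
    finally have "ennreal ((norm x * \<bar>sqrt (f x) + 1\<bar>)\<^sup>2) \<le> ennreal (2 * ((norm x)\<^sup>2 * f x + (norm x)\<^sup>2))"
      by (intro ennreal_leI) (simp add: power_mult_distrib)
    also have "\<dots> = ennreal 2 * (ennreal ((norm x)\<^sup>2 * f x) + ennreal ((norm x)\<^sup>2))"
      using f0[of x] by (subst ennreal_mult) auto
    finally show "(ennreal (norm x * \<bar>sqrt (f x) + 1\<bar>))\<^sup>2 \<le> ennreal 2 * (ennreal ((norm x)\<^sup>2 * f x) + ennreal ((norm x)\<^sup>2))"
      by (simp add: ennreal_power)
  qed
  also have "\<dots> = ennreal 2 * ((\<integral>\<^sup>+x. ennreal ((norm x)\<^sup>2 * f x) \<partial>\<gamma>) + (\<integral>\<^sup>+(x::'a). ennreal ((norm x)\<^sup>2) \<partial>\<gamma>))"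
    by (simp add: nn_integral_cmult nn_integral_add)
  also have "(\<integral>\<^sup>+(x::'a). ennreal ((norm x)\<^sup>2) \<partial>\<gamma>) = ennreal (real DIM('a))"
    by (subst nn_integral_eq_integral) (simp_all add: integral_std_gauss_norm_sq)
  also have "ennreal D * (ennreal 2 * ((\<integral>\<^sup>+x. ennreal ((norm x)\<^sup>2 * f x) \<partial>\<gamma>) + ennreal (real DIM('a)))) \<le> ennreal D * (ennreal 2 * (ennreal S + ennreal (real DIM('a))))"
    by (intro mult_left_mono add_right_mono S) auto
  also have "\<dots> = ennreal (D * (2 * (S + real DIM('a))))"
    using D S by (simp only: ennreal_plus[symmetric] ennreal_mult[symmetric] add_nonneg_nonneg mult_nonneg_nonneg of_nat_0_le_iff zero_le_numeral)
  also have "\<dots> = ennreal ((sqrt (D * (2 * (S + real DIM('a)))))\<^sup>2)" using D S by simp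
  finally show "(\<integral>\<^sup>+x. ennreal (norm x * \<bar>f x - 1\<bar>) \<partial>\<gamma>)\<^sup>2 \<le> ennreal ((sqrt (D * (2 * (S + real DIM('a)))))\<^sup>2)"
    by (simp add: mult_left_mono)
  show "0 \<le> sqrt (D * (2 * (S + real DIM('a))))" using D S by simp
qed

lemma weak_gradient_AE_eq:
  assumes "has_weak_gradient g G"
  shows "has_weak_gradient g (weak_gradient g)" "AE x in \<gamma>. weak_gradient g x = G x"
proof -
  show *: "has_weak_gradient g (weak_gradient g)" unfolding weak_gradient_def by (rule someI[of "has_weak_gradient g", OF assms])
  show "AE x in \<gamma>. weak_gradient g x = G x" by (rule AE_std_gauss[OF weak_gradient_unique[OF * assms]])
qed

lemma deficit_eq:
  fixes f :: "'a::euclidean_space \<Rightarrow> real"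
  shows "\<delta> f = 2 * (\<integral>x. (norm (weak_gradient (\<lambda>y. sqrt (f y)) x))\<^sup>2 \<partial>\<gamma>) - (\<integral>x. xlnx (f x) \<partial>\<gamma>)"
  unfolding deficit_def xlnx_def by simp

text \<open>
  The Hellinger distance is at most the entropy, hence at most \<open>2 J\<close>, and the deficit controls \<open>J\<close>. The
  exponential moment also bounds the second moment of \<open>f\<close>.
\<close>

theorem wasserstein1_deficit_bound:
  assumes "0 < \<alpha>" "0 < \<epsilon>"
  shows "\<exists>a>0. deficit_bound (\<F> \<alpha> \<epsilon> :: ('a::euclidean_space \<Rightarrow> real) set) (1/2) a"
proof -
  \<comment> \<open>The exponential moment is used with a rate below 1/2, where it is finite for \<open>\<gamma>\<close> itself.\<close>
  define \<kappa> where "\<kappa> = min \<epsilon> (1/4)"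
  have \<kappa>: "0 < \<kappa>" "\<kappa> < 1/2" "\<kappa> \<le> \<epsilon>" using assms by (auto simp: \<kappa>_def)
  obtain c where c: "0 < c" and cJ: "\<And>(f::'a \<Rightarrow> real) G. has_bochner_integral \<gamma> f 1 \<Longrightarrow> (\<forall>x. 0 \<le> f x) \<Longrightarrow>
     has_bochner_integral \<gamma> (\<lambda>x. f x *\<^sub>R x) 0 \<Longrightarrow> has_weak_gradient (\<lambda>x. sqrt (f x)) G \<Longrightarrow>
     integrable \<gamma> (\<lambda>x. (norm (G x))\<^sup>2) \<Longrightarrow>
     (\<integral>\<^sup>+x. ennreal (f x * exp (\<kappa> * (norm x)\<^sup>2)) \<partial>\<gamma>) \<le> ennreal \<alpha> \<Longrightarrow>
     c * (\<integral>x. (norm (G x))\<^sup>2 \<partial>\<gamma>) \<le> 2 * (\<integral>x. (norm (G x))\<^sup>2 \<partial>\<gamma>) - (\<integral>x. xlnx (f x) \<partial>\<gamma>)"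
    using fisher_le_deficit[OF \<kappa>(1,2), of \<alpha>, where 'a = 'a] assms(1) by (auto simp: less_imp_le)
  define S where "S = \<alpha> / \<epsilon>"
  have S: "0 < S" using assms by (simp add: S_def)
  define a where "a = sqrt (2 / c * (2 * (S + real DIM('a))))"
  have a: "0 < a" using c S by (simp add: a_def add_pos_nonneg)
  have "deficit_bound (\<F> \<alpha> \<epsilon> :: ('a \<Rightarrow> real) set) (1/2) a"
    unfolding deficit_bound_def
  proof
    fix f :: "'a \<Rightarrow> real" assume "f \<in> \<F> \<alpha> \<epsilon>"
    then have f0': "\<forall>x. 0 \<le> f x" and sob: "(\<lambda>x. sqrt (f x)) \<in> W\<^sup>1\<^sup>,\<^sup>2(\<gamma>)" and f: "has_bochner_integral \<gamma> f 1"
      and fx: "has_bochner_integral \<gamma> (\<lambda>x. f x *\<^sub>R x) 0"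
      and al: "(\<integral>\<^sup>+x. \<integral>\<^sup>+y. ennreal (f x * f y * exp (\<epsilon> * (norm (x - y))\<^sup>2)) \<partial>\<gamma> \<partial>\<gamma>) \<le> ennreal \<alpha>"
      by (auto simp: exp_class_def)
    have f0: "0 \<le> f x" for x using f0' by blast
    have [measurable]: "f \<in> borel_measurable borel" using f by (auto dest: borel_measurable_has_bochner_integral)
    from sob obtain G0 where G0: "has_weak_gradient (\<lambda>x. sqrt (f x)) G0"
      and i0: "integrable \<gamma> (\<lambda>x. (sqrt (f x))\<^sup>2 + (norm (G0 x))\<^sup>2)" by (auto simp: sobolev_gauss_def)
    define G where "G = weak_gradient (\<lambda>x. sqrt (f x))"
    have G: "has_weak_gradient (\<lambda>x. sqrt (f x)) G" and GG0: "AE x in \<gamma>. G x = G0 x"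
      unfolding G_def by (rule weak_gradient_AE_eq[OF G0])+
    have [measurable]: "G \<in> borel_measurable borel" "G0 \<in> borel_measurable borel"
      using G G0 by (auto simp: has_weak_gradient_def intro: locally_integrable_measurable)
    have iG: "integrable \<gamma> (\<lambda>x. (norm (G x))\<^sup>2)"
    proof (rule Bochner_Integration.integrable_bound[OF i0])
      show "AE x in \<gamma>. norm ((norm (G x))\<^sup>2) \<le> norm ((sqrt (f x))\<^sup>2 + (norm (G0 x))\<^sup>2)"
        using GG0 by eventually_elim simp
    qed simp
    have em: "(\<integral>\<^sup>+x. ennreal (f x * exp (\<epsilon> * (norm x)\<^sup>2)) \<partial>\<gamma>) \<le> ennreal \<alpha>"
      by (rule exp_moment_of_centred[OF f f0 fx assms(2) al])
    have em\<kappa>: "(\<integral>\<^sup>+x. ennreal (f x * exp (\<kappa> * (norm x)\<^sup>2)) \<partial>\<gamma>) \<le> ennreal \<alpha>"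
      by (rule order_trans[OF nn_integral_mono em])
         (use \<kappa>(3) f0 in \<open>auto intro!: ennreal_leI mult_left_mono mult_right_mono\<close>)
    define J where "J = (\<integral>x. (norm (G x))\<^sup>2 \<partial>\<gamma>)"
    define E where "E = (\<integral>x. xlnx (f x) \<partial>\<gamma>)"
    define D where "D = (\<integral>x. (sqrt (f x) - 1)\<^sup>2 \<partial>\<gamma>)"
    have D0: "0 \<le> D" by (simp add: D_def)
    have J0: "0 \<le> J" by (simp add: J_def)
    note ei = log_sobolev(1)[OF f f0 G iG]
    have EJ: "E \<le> 2 * J" using log_sobolev_ineq[OF f f0 G iG] by (simp add: E_def J_def)
    have DE: "D \<le> E" using hellinger_le_entropy(2)[OF f f0 ei] by (simp add: E_def D_def)
    have Dn: "(\<integral>\<^sup>+x. ennreal ((sqrt (f x) - 1)\<^sup>2) \<partial>\<gamma>) = ennreal D"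
      unfolding D_def by (rule nn_integral_eq_integral[OF hellinger_le_entropy(1)[OF f f0 ei]]) simp
    have \<delta>: "\<delta> f = 2 * J - E" unfolding deficit_eq J_def E_def G_def ..
    have cJ': "c * J \<le> \<delta> f" unfolding \<delta> J_def E_def by (rule cJ[OF f f0' fx G iG em\<kappa>])
    have "0 \<le> c * J" using c J0 by simp
    then have \<delta>0: "0 \<le> \<delta> f" using cJ' by linarith
    have mom: "(\<integral>\<^sup>+x. ennreal ((norm x)\<^sup>2 * f x) \<partial>\<gamma>) \<le> ennreal S"
    proof -
      have "(\<integral>\<^sup>+x. ennreal ((norm x)\<^sup>2 * f x) \<partial>\<gamma>) \<le> (\<integral>\<^sup>+x. ennreal (1 / \<epsilon>) * ennreal (f x * exp (\<epsilon> * (norm x)\<^sup>2)) \<partial>\<gamma>)"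
      proof (rule nn_integral_mono)
        fix x :: 'a
        have "\<epsilon> * (norm x)\<^sup>2 \<le> exp (\<epsilon> * (norm x)\<^sup>2)" using exp_ge_add_one_self[of "\<epsilon> * (norm x)\<^sup>2"] by linarith
        then have "(norm x)\<^sup>2 \<le> 1 / \<epsilon> * exp (\<epsilon> * (norm x)\<^sup>2)" using assms(2) by (simp add: field_simps)
        from mult_right_mono[OF this f0[of x]]
        have "ennreal ((norm x)\<^sup>2 * f x) \<le> ennreal (1 / \<epsilon> * (f x * exp (\<epsilon> * (norm x)\<^sup>2)))"
          by (intro ennreal_leI) (simp add: ac_simps)
        then show "ennreal ((norm x)\<^sup>2 * f x) \<le> ennreal (1 / \<epsilon>) * ennreal (f x * exp (\<epsilon> * (norm x)\<^sup>2))"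
          using assms(2) f0[of x] by (subst ennreal_mult[symmetric]) auto
      qed
      also have "\<dots> \<le> ennreal (1 / \<epsilon>) * ennreal \<alpha>"
        by (subst nn_integral_cmult) (auto intro!: mult_left_mono em)
      also have "\<dots> = ennreal S" using assms by (subst ennreal_mult[symmetric]) (auto simp: S_def)
      finally show ?thesis .
    qed
    have "W\<^sub>1 (density \<gamma> (\<lambda>x. ennreal (f x))) \<gamma> \<le> ennreal (sqrt (D * (2 * (S + real DIM('a)))))"
      by (rule wasserstein1_le_hellinger[OF f f0 Dn D0 mom less_imp_le[OF S]])
    also have "\<dots> \<le> ennreal (sqrt (2 / c * \<delta> f * (2 * (S + real DIM('a)))))"
    proof (intro ennreal_leI real_sqrt_le_mono mult_right_mono)
      have "D \<le> 2 * J" using DE EJ by linarith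
      also have "\<dots> \<le> 2 / c * \<delta> f" using cJ' c by (simp add: field_simps)
      finally show "D \<le> 2 / c * \<delta> f" .
    qed (use S in auto)
    also have "sqrt (2 / c * \<delta> f * (2 * (S + real DIM('a)))) = a * \<delta> f powr (1/2)"
      unfolding a_def using \<delta>0 by (simp add: powr_half_sqrt real_sqrt_mult[symmetric] ac_simps)
    finally show "W\<^sub>1 (density \<gamma> (\<lambda>x. ennreal (f x))) \<gamma> \<le> ennreal (a * \<delta> f powr (1/2))" .
  qed
  then show ?thesis using a by blast
qed

section \<open>Centred Gaussians as test cases\<close>

text \<open>
  Difference quotients integrate to zero by translation invariance, and they converge with bounds
  that are uniform because of the bounded support.
\<close>

lemma integral_directional_derivative_eq_0:
  fixes F :: "'a::euclidean_space \<Rightarrow> real"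
  assumes D: "\<And>x. (F has_derivative D x) (at x)" and cont: "continuous_on UNIV (\<lambda>x. D x i)"
    and supp: "\<And>x. R < norm x \<Longrightarrow> F x = 0" and i: "i \<in> Basis" and R: "0 \<le> R"
  shows "integrable lborel (\<lambda>x. D x i)" "(LINT x|lborel. D x i) = 0"
proof -
  have "continuous_on UNIV F" using D by (auto intro: has_derivative_continuous_on)
  then have [measurable]: "F \<in> borel_measurable borel" by (rule borel_measurable_continuous_onI)
  have [measurable]: "(\<lambda>x. D x i) \<in> borel_measurable borel" using cont by (rule borel_measurable_continuous_onI)
  have "compact ((\<lambda>x. D x i) ` cball 0 (R + 2))"
    by (rule compact_continuous_image[OF continuous_on_subset[OF cont]]) auto
  from compact_imp_bounded[OF this, unfolded bounded_iff]
  obtain B where "\<forall>d\<in>(\<lambda>x. D x i) ` cball 0 (R + 2). norm d \<le> B" ..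
  then have B: "\<bar>D x i\<bar> \<le> B" if "x \<in> cball 0 (R + 2)" for x using that by auto
  have B0: "0 \<le> B" using B[of 0] R by auto
  define t where "t n = 1 / (real n + 1)" for n :: nat
  have t: "0 < t n" "t n \<le> 1" for n by (auto simp: t_def)
  define q where "q n x = (F (x + t n *\<^sub>R i) - F x) / t n" for n x
  have ni: "norm i = 1" using i by simp
  have F_int: "integrable lborel F"
  proof -
    have "integrable lborel (\<lambda>x. indicator (cball 0 R) x *\<^sub>R F x)"
      by (rule borel_integrable_compact) (auto intro: continuous_on_subset[OF \<open>continuous_on UNIV F\<close>])
    moreover have "indicator (cball 0 R) x *\<^sub>R F x = F x" for x using supp[of x] by (cases "norm x \<le> R") auto
    ultimately show ?thesis by (simp only:)
  qed
  have q0: "(LINT x|lborel. q n x) = 0" for n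
  proof -
    have "integrable lborel (\<lambda>x. F (x + t n *\<^sub>R i))" "(LINT x|lborel. F (x + t n *\<^sub>R i)) = (LINT x|lborel. F x)"
    proof -
      have e: "distr lborel borel ((+) (t n *\<^sub>R i)) = lborel" by (rule lborel_distr_plus)
      have "integrable (distr lborel borel ((+) (t n *\<^sub>R i))) F" unfolding e by (rule F_int)
      then show "integrable lborel (\<lambda>x. F (x + t n *\<^sub>R i))" by (subst (asm) integrable_distr_eq) (auto simp: add.commute)
      have "(LINT x|lborel. F x) = (LINT x|distr lborel borel ((+) (t n *\<^sub>R i)). F x)" unfolding e ..
      also have "\<dots> = (LINT x|lborel. F (t n *\<^sub>R i + x))" by (rule integral_distr) auto
      finally show "(LINT x|lborel. F (x + t n *\<^sub>R i)) = (LINT x|lborel. F x)" by (simp add: add.commute)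
    qed
    then show ?thesis unfolding q_def using F_int by simp
  qed
  have q_le: "norm (q n x) \<le> B * indicator (cball 0 (R + 1)) x" for n x
  proof (cases "norm x \<le> R + 1")
    case True
    have "((\<lambda>u. F (x + u *\<^sub>R i)) has_real_derivative D (x + u *\<^sub>R i) i) (at u)" for u
    proof -
      have "((\<lambda>u. x + u *\<^sub>R i) has_derivative (\<lambda>v. v *\<^sub>R i)) (at u)" by (auto intro!: derivative_eq_intros)
      from has_derivative_compose[OF this D]
      have "((\<lambda>u. F (x + u *\<^sub>R i)) has_derivative (\<lambda>v. D (x + u *\<^sub>R i) (v *\<^sub>R i))) (at u)" .
      moreover have "D (x + u *\<^sub>R i) (v *\<^sub>R i) = D (x + u *\<^sub>R i) i * v" for v
        using linear_scale[OF has_derivative_linear[OF D]] by simp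
      ultimately show ?thesis by (simp add: has_field_derivative_def)
    qed
    then obtain z where z: "0 < z" "z < t n" "F (x + t n *\<^sub>R i) - F (x + 0 *\<^sub>R i) = (t n - 0) * D (x + z *\<^sub>R i) i"
      using MVT2[of 0 "t n" "\<lambda>u. F (x + u *\<^sub>R i)" "\<lambda>u. D (x + u *\<^sub>R i) i"] t(1) by blast
    have "norm (x + z *\<^sub>R i) \<le> norm x + norm (z *\<^sub>R i)" by (rule norm_triangle_ineq)
    also have "\<dots> \<le> R + 2" using True z t(2)[of n] ni by simp
    finally have "\<bar>D (x + z *\<^sub>R i) i\<bar> \<le> B" using B by simp
    moreover have "q n x = D (x + z *\<^sub>R i) i" using z(3) t(1)[of n] by (simp add: q_def)
    ultimately show ?thesis using True by simp
  next
    case False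
    have "norm x - norm (t n *\<^sub>R i) \<le> norm (x + t n *\<^sub>R i)" by (rule norm_diff_ineq)
    then have "R < norm (x + t n *\<^sub>R i)" using False t[of n] ni by simp
    then show ?thesis using supp[of x] supp[of "x + t n *\<^sub>R i"] False B0 by (simp add: q_def)
  qed
  have lim: "(\<lambda>n. q n x) \<longlonglongrightarrow> D x i" for x
  proof -
    have "((\<lambda>u. x + u *\<^sub>R i) has_derivative (\<lambda>v. v *\<^sub>R i)) (at 0)" by (auto intro!: derivative_eq_intros)
    from has_derivative_compose[OF this, of F "D x"] D[of x]
    have "((\<lambda>u. F (x + u *\<^sub>R i)) has_derivative (\<lambda>v. D x (v *\<^sub>R i))) (at 0)" by simp
    moreover have "D x (v *\<^sub>R i) = D x i * v" for v
      using linear_scale[OF has_derivative_linear[OF D]] by simp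
    ultimately have "((\<lambda>u. F (x + u *\<^sub>R i)) has_real_derivative D x i) (at 0)" by (simp add: has_field_derivative_def)
    then have l: "((\<lambda>h. (F (x + h *\<^sub>R i) - F x) / h) \<longlongrightarrow> D x i) (at 0)" by (simp add: DERIV_def)
    have "filterlim t (at 0) sequentially"
    proof (rule filterlim_atI)
      show "t \<longlonglongrightarrow> 0" unfolding t_def[abs_def] by real_asymp
      show "\<forall>\<^sub>F n in sequentially. t n \<noteq> 0" using t(1) by (auto intro!: always_eventually simp: less_imp_neq[symmetric])
    qed
    from filterlim_compose[OF l this] show ?thesis by (simp add: q_def)
  qed
  have w: "integrable lborel (\<lambda>x. B * indicator (cball 0 (R + 1)) (x::'a))"
    using emeasure_bounded_finite[of "cball 0 (R+1)"] by (intro integrable_mult_right integrable_real_indicator) auto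
  have [measurable]: "q n \<in> borel_measurable borel" for n unfolding q_def[abs_def] by measurable
  show "integrable lborel (\<lambda>x. D x i)"
    by (rule integrable_dominated_convergence[OF _ _ w, of _ q]) (use lim q_le in auto)
  have "(\<lambda>n. LINT x|lborel. q n x) \<longlonglongrightarrow> (LINT x|lborel. D x i)"
    by (rule integral_dominated_convergence[OF _ _ w]) (use lim q_le in auto)
  then show "(LINT x|lborel. D x i) = 0" by (simp add: q0 LIMSEQ_const_iff)
qed

lemma locally_integrable_continuous:
  fixes g :: "'a::euclidean_space \<Rightarrow> 'b::euclidean_space"
  assumes "continuous_on UNIV g" shows "locally_integrable g"
  unfolding locally_integrable_def set_integrable_def
  by (auto intro: borel_integrable_compact continuous_on_subset[OF assms])

lemma has_weak_gradient_classical: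
  fixes g :: "'a::euclidean_space \<Rightarrow> real"
  assumes g: "\<And>x. (g has_derivative (\<lambda>v. G x \<bullet> v)) (at x)" and G: "continuous_on UNIV G"
  shows "has_weak_gradient g G"
  unfolding has_weak_gradient_def
proof (intro conjI allI impI ballI)
  have gc: "continuous_on UNIV g" using has_derivative_continuous[OF g] by (intro continuous_at_imp_continuous_on) auto
  show "locally_integrable g" "locally_integrable G" using gc G by (auto intro: locally_integrable_continuous)
  fix \<phi> :: "'a \<Rightarrow> real" and i :: 'a assume \<phi>: "test_function \<phi>" and i: "i \<in> Basis"
  have cd: "continuously_differentiable (Suc 0) \<phi>" using \<phi> by (auto simp: test_function_def simp del: continuously_differentiable.simps)
  have D\<phi>: "(\<phi> has_derivative frechet_derivative \<phi> (at x)) (at x)" for x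
    by (rule continuously_differentiable_Suc_has_derivative[OF cd])
  have c\<phi>: "continuous_on UNIV \<phi>" using has_derivative_continuous[OF D\<phi>] by (intro continuous_at_imp_continuous_on) auto
  have cD: "continuous_on UNIV (\<lambda>x. frechet_derivative \<phi> (at x) i)" using cd i by simp
  define K where "K = closure {x. \<phi> x \<noteq> 0}"
  have K: "compact K" using \<phi> by (simp add: test_function_def K_def)
  have \<phi>K: "\<phi> x = 0" if "x \<notin> K" for x using that closure_subset[of "{x. \<phi> x \<noteq> 0}"] by (auto simp: K_def)
  obtain R where R: "0 < R" "\<And>x. x \<in> K \<Longrightarrow> norm x \<le> R" using compact_imp_bounded[OF K] by (auto simp: bounded_pos)
  let ?D = "\<lambda>x v. g x * frechet_derivative \<phi> (at x) v + (G x \<bullet> v) * \<phi> x"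
  have D: "((\<lambda>x. g x * \<phi> x) has_derivative ?D x) (at x)" for x by (rule has_derivative_mult[OF g D\<phi>])
  have c: "continuous_on UNIV (\<lambda>x. ?D x i)" by (intro continuous_intros gc cD G c\<phi>)
  have s: "g x * \<phi> x = 0" if "R < norm x" for x using that R(2)[of x] \<phi>K[of x] by fastforce
  have I: "integrable lborel (\<lambda>x. ?D x i)" "(LINT x|lborel. ?D x i) = 0"
    using integral_directional_derivative_eq_0[OF D c s i] R(1) by auto
  have J: "integrable lborel (\<lambda>x. (G x \<bullet> i) * \<phi> x)"
  proof -
    have "integrable lborel (\<lambda>x. indicator K x *\<^sub>R ((G x \<bullet> i) * \<phi> x))"
      by (rule borel_integrable_compact[OF K]) (intro continuous_intros continuous_on_subset[OF G] continuous_on_subset[OF c\<phi>]; simp)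
    moreover have "indicator K x *\<^sub>R ((G x \<bullet> i) * \<phi> x) = (G x \<bullet> i) * \<phi> x" for x using \<phi>K[of x] by (cases "x \<in> K") auto
    ultimately show ?thesis by (simp only:)
  qed
  have "(LINT x|lborel. g x * frechet_derivative \<phi> (at x) i) = (LINT x|lborel. ?D x i - (G x \<bullet> i) * \<phi> x)" by simp
  also have "\<dots> = (LINT x|lborel. ?D x i) - (LINT x|lborel. (G x \<bullet> i) * \<phi> x)" by (rule Bochner_Integration.integral_diff[OF I(1) J])
  finally show "(LINT x|lborel. g x * frechet_derivative \<phi> (at x) i) = - (LINT x|lborel. (G x \<bullet> i) * \<phi> x)" by (simp add: I(2))
qed

text \<open>
  The density with respect to \<open>\<gamma>\<close> of the centred normal law with standard deviation \<open>s\<close>.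
\<close>

definition gauss_ratio :: "real \<Rightarrow> 'a::euclidean_space \<Rightarrow> real" where
  "gauss_ratio s x = (1 / s) ^ DIM('a) * exp (- ((1 / s\<^sup>2 - 1) * (norm x)\<^sup>2 / 2))"

context
  fixes s :: real
  assumes s: "0 < s" "s < 1"
begin

lemma gauss_ratio_pos: "0 < gauss_ratio s x"
  using s by (simp add: gauss_ratio_def)

lemma measurable_gauss_ratio [measurable]: "gauss_ratio s \<in> borel_measurable borel"
  unfolding gauss_ratio_def[abs_def] by measurable

lemma normal_dens_eq_gauss_ratio: "normal_dens 0 s x = normal_dens 0 1 x * gauss_ratio s x"
proof -
  have "- ((norm x)\<^sup>2 / (2 * s\<^sup>2)) = - ((norm x)\<^sup>2 / 2) + - ((1 / s\<^sup>2 - 1) * (norm x)\<^sup>2 / 2)"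
    using s by (simp add: field_simps)
  from arg_cong[OF this, of exp, unfolded exp_add]
  show ?thesis using s unfolding normal_dens_def gauss_ratio_def
    by (simp add: real_sqrt_mult power_divide power_mult_distrib)
qed

lemma density_gauss_ratio: "density \<gamma> (\<lambda>x. ennreal (gauss_ratio s x)) = distr \<gamma> borel (\<lambda>z::'a::euclidean_space. s *\<^sub>R z)"
proof -
  have "density \<gamma> (\<lambda>x::'a. ennreal (gauss_ratio s x)) = density lborel (\<lambda>x. ennreal (normal_dens 0 s x))"
    unfolding std_gauss_eq normal_dens_eq_gauss_ratio
    by (subst density_density_eq) (auto simp: ennreal_mult less_imp_le[OF gauss_ratio_pos])
  then show ?thesis using distr_std_gauss_affine[OF s(1), of "0::'a"] by simp
qed

lemma integral_gauss_ratio: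
  fixes F :: "'a::euclidean_space \<Rightarrow> 'b::{banach,second_countable_topology}"
  assumes [measurable]: "F \<in> borel_measurable borel" and i: "integrable \<gamma> (\<lambda>z. F (s *\<^sub>R z))"
  shows "has_bochner_integral \<gamma> (\<lambda>x. gauss_ratio s x *\<^sub>R F x) (\<integral>z. F (s *\<^sub>R z) \<partial>\<gamma>)"
proof -
  have "integrable (distr \<gamma> borel (\<lambda>z. s *\<^sub>R z)) F" using i by (subst integrable_distr_eq) auto
  then have 1: "integrable \<gamma> (\<lambda>x. gauss_ratio s x *\<^sub>R F x)"
    unfolding density_gauss_ratio[symmetric] by (subst (asm) integrable_density) (auto simp: less_imp_le[OF gauss_ratio_pos])
  have "(\<integral>x. gauss_ratio s x *\<^sub>R F x \<partial>\<gamma>) = (\<integral>x. F x \<partial>density \<gamma> (\<lambda>x. ennreal (gauss_ratio s x)))"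
    by (subst integral_density) (auto simp: less_imp_le[OF gauss_ratio_pos])
  also have "\<dots> = (\<integral>z. F (s *\<^sub>R z) \<partial>\<gamma>)" unfolding density_gauss_ratio by (subst integral_distr) auto
  finally show ?thesis using 1 by (simp add: has_bochner_integral_iff)
qed

lemma nn_integral_gauss_ratio:
  fixes F :: "'a::euclidean_space \<Rightarrow> ennreal"
  assumes [measurable]: "F \<in> borel_measurable borel"
  shows "(\<integral>\<^sup>+x. ennreal (gauss_ratio s x) * F x \<partial>\<gamma>) = (\<integral>\<^sup>+z. F (s *\<^sub>R z) \<partial>\<gamma>)"
proof -
  have "(\<integral>\<^sup>+x. ennreal (gauss_ratio s x) * F x \<partial>\<gamma>) = (\<integral>\<^sup>+x. F x \<partial>density \<gamma> (\<lambda>x. ennreal (gauss_ratio s x)))"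
    by (subst nn_integral_density) auto
  also have "\<dots> = (\<integral>\<^sup>+z. F (s *\<^sub>R z) \<partial>\<gamma>)" unfolding density_gauss_ratio by (subst nn_integral_distr) auto
  finally show ?thesis .
qed

definition sqrt_gauss_ratio_grad :: "'a::euclidean_space \<Rightarrow> 'a" where
  "sqrt_gauss_ratio_grad x = (- ((1 / s\<^sup>2 - 1) / 2) * sqrt (gauss_ratio s x)) *\<^sub>R x"

lemma has_weak_gradient_sqrt_gauss_ratio:
  "has_weak_gradient (\<lambda>x::'a::euclidean_space. sqrt (gauss_ratio s x)) sqrt_gauss_ratio_grad"
proof (rule has_weak_gradient_classical)
  define b where "b = 1 / s\<^sup>2 - 1"
  define c where "c = sqrt ((1 / s) ^ DIM('a))"
  have eq: "sqrt (gauss_ratio s x) = c * exp (- (b / 4 * (x \<bullet> x)))" for x :: 'a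
  proof -
    have "exp (- (b * (norm x)\<^sup>2 / 2)) = (exp (- (b / 4 * (x \<bullet> x))))\<^sup>2"
      unfolding exp_double[symmetric] by (simp add: power2_norm_eq_inner)
    then show ?thesis unfolding gauss_ratio_def b_def[symmetric] c_def by (simp add: real_sqrt_mult)
  qed
  show "((\<lambda>x. sqrt (gauss_ratio s x)) has_derivative (\<lambda>v. sqrt_gauss_ratio_grad x \<bullet> v)) (at x)" for x :: 'a
    unfolding sqrt_gauss_ratio_grad_def eq b_def[symmetric]
    by (auto intro!: derivative_eq_intros simp: inner_commute)
  show "continuous_on UNIV (sqrt_gauss_ratio_grad :: 'a \<Rightarrow> 'a)"
    unfolding sqrt_gauss_ratio_grad_def eq b_def[symmetric] by (intro continuous_intros)
qed

lemma norm_sqrt_gauss_ratio_grad: "(norm (sqrt_gauss_ratio_grad x))\<^sup>2 = gauss_ratio s x *\<^sub>R ((1 / s\<^sup>2 - 1)\<^sup>2 / 4 * (norm x)\<^sup>2)"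
  unfolding sqrt_gauss_ratio_grad_def
  by (simp add: power_mult_distrib power_divide less_imp_le[OF gauss_ratio_pos])

lemma gauss_ratio_fisher:
  "has_bochner_integral \<gamma> (\<lambda>x::'a::euclidean_space. (norm (sqrt_gauss_ratio_grad x))\<^sup>2) ((1 / s\<^sup>2 - 1)\<^sup>2 / 4 * (s\<^sup>2 * real DIM('a)))"
proof -
  have "has_bochner_integral \<gamma> (\<lambda>x::'a. (norm (sqrt_gauss_ratio_grad x))\<^sup>2) (\<integral>(z::'a). (1 / s\<^sup>2 - 1)\<^sup>2 / 4 * (norm (s *\<^sub>R z))\<^sup>2 \<partial>\<gamma>)"
    unfolding norm_sqrt_gauss_ratio_grad by (rule integral_gauss_ratio) (simp_all add: power_mult_distrib)
  also have "(\<integral>(z::'a). (1 / s\<^sup>2 - 1)\<^sup>2 / 4 * (norm (s *\<^sub>R z))\<^sup>2 \<partial>\<gamma>) = (1 / s\<^sup>2 - 1)\<^sup>2 / 4 * (s\<^sup>2 * real DIM('a))"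
    by (simp add: power_mult_distrib integral_std_gauss_norm_sq)
  finally show ?thesis .
qed

lemma gauss_ratio_entropy:
  "(\<integral>(x::'a::euclidean_space). xlnx (gauss_ratio s x) \<partial>\<gamma>) = - real DIM('a) * ln s - (1 / s\<^sup>2 - 1) * (s\<^sup>2 * real DIM('a)) / 2"
proof -
  have ln: "ln (gauss_ratio s x) = - real DIM('a) * ln s - (1 / s\<^sup>2 - 1) * (norm x)\<^sup>2 / 2" for x :: 'a
    using s by (simp add: gauss_ratio_def ln_mult_pos ln_realpow ln_div)
  have "(\<integral>(x::'a). xlnx (gauss_ratio s x) \<partial>\<gamma>) = (\<integral>(x::'a). gauss_ratio s x *\<^sub>R (- real DIM('a) * ln s - (1 / s\<^sup>2 - 1) * (norm x)\<^sup>2 / 2) \<partial>\<gamma>)"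
    by (simp add: xlnx_def ln)
  also have "\<dots> = (\<integral>(z::'a). - real DIM('a) * ln s - (1 / s\<^sup>2 - 1) * (norm (s *\<^sub>R z))\<^sup>2 / 2 \<partial>\<gamma>)"
    by (rule has_bochner_integral_integral_eq[OF integral_gauss_ratio]) (simp_all add: power_mult_distrib)
  also have "\<dots> = - real DIM('a) * ln s - (1 / s\<^sup>2 - 1) * (s\<^sup>2 * real DIM('a)) / 2"
    by (simp add: power_mult_distrib integral_std_gauss_norm_sq)
  finally show ?thesis .
qed

lemma deficit_gauss_ratio:
  "\<delta> (gauss_ratio s :: 'a::euclidean_space \<Rightarrow> real) = real DIM('a) / 2 * (1 / s\<^sup>2 - 1 + 2 * ln s)"
proof -
  note wg = weak_gradient_AE_eq[OF has_weak_gradient_sqrt_gauss_ratio[where 'a = 'a]]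
  have [measurable]: "weak_gradient (\<lambda>x::'a. sqrt (gauss_ratio s x)) \<in> borel_measurable borel"
    "(sqrt_gauss_ratio_grad :: 'a \<Rightarrow> 'a) \<in> borel_measurable borel"
    using wg(1) has_weak_gradient_sqrt_gauss_ratio[where 'a = 'a]
    by (auto simp: has_weak_gradient_def intro: locally_integrable_measurable)
  have "(\<integral>x. (norm (weak_gradient (\<lambda>x::'a. sqrt (gauss_ratio s x)) x))\<^sup>2 \<partial>\<gamma>) = (\<integral>(x::'a). (norm (sqrt_gauss_ratio_grad x))\<^sup>2 \<partial>\<gamma>)"
    by (rule integral_cong_AE) (use wg(2) in \<open>auto elim: eventually_mono\<close>)
  also have "\<dots> = (1 / s\<^sup>2 - 1)\<^sup>2 / 4 * (s\<^sup>2 * real DIM('a))" by (rule has_bochner_integral_integral_eq[OF gauss_ratio_fisher])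
  finally have "\<delta> (gauss_ratio s :: 'a \<Rightarrow> real) = 2 * ((1 / s\<^sup>2 - 1)\<^sup>2 / 4 * (s\<^sup>2 * real DIM('a))) -
     (- real DIM('a) * ln s - (1 / s\<^sup>2 - 1) * (s\<^sup>2 * real DIM('a)) / 2)"
    by (simp only: deficit_eq gauss_ratio_entropy)
  also have "\<dots> = real DIM('a) / 2 * (1 / s\<^sup>2 - 1 + 2 * ln s)"
    using s by (simp add: field_simps power2_eq_square)
  finally show ?thesis .
qed

text \<open>
  The double integral is \<open>(1 - 4 \<epsilon> s\<^sup>2)\<close> to the power \<open>- n / 2\<close>, because the difference of two independent vectors has
  variance \<open>2 s\<^sup>2\<close>. For \<open>s < 1\<close> this is below \<open>(1 - 4 \<epsilon>)\<close> to the power \<open>- n\<close>.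
\<close>

lemma gauss_ratio_in_exp_class:
  assumes e: "0 < \<epsilon>" "\<epsilon> < 1/4" and \<alpha>: "(1 / (1 - 4 * \<epsilon>)) ^ DIM('a) \<le> \<alpha>"
  shows "(gauss_ratio s :: 'a::euclidean_space \<Rightarrow> real) \<in> \<F> \<alpha> \<epsilon>"
  unfolding exp_class_def mem_Collect_eq
proof (intro conjI allI)
  have nn: "0 \<le> gauss_ratio s x" for x :: 'a by (rule less_imp_le[OF gauss_ratio_pos])
  show "0 \<le> gauss_ratio s x" for x :: 'a by (rule nn)
  show bi: "has_bochner_integral \<gamma> (gauss_ratio s :: 'a \<Rightarrow> real) 1"
    using integral_gauss_ratio[of "\<lambda>_::'a. 1::real"] by simp
  show "(\<lambda>x::'a. sqrt (gauss_ratio s x)) \<in> W\<^sup>1\<^sup>,\<^sup>2(\<gamma>)"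
    unfolding sobolev_gauss_def mem_Collect_eq
  proof (intro exI conjI)
    show "has_weak_gradient (\<lambda>x::'a. sqrt (gauss_ratio s x)) sqrt_gauss_ratio_grad" by (rule has_weak_gradient_sqrt_gauss_ratio)
    show "integrable \<gamma> (\<lambda>x::'a. (sqrt (gauss_ratio s x))\<^sup>2 + (norm (sqrt_gauss_ratio_grad x))\<^sup>2)"
    proof (rule Bochner_Integration.integrable_add)
      show "integrable \<gamma> (\<lambda>x::'a. (sqrt (gauss_ratio s x))\<^sup>2)"
        using bi nn by (simp add: has_bochner_integral_iff)
      show "integrable \<gamma> (\<lambda>x::'a. (norm (sqrt_gauss_ratio_grad x))\<^sup>2)"
        using gauss_ratio_fisher[where 'a = 'a] by (simp add: has_bochner_integral_iff)
    qed
  qed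
  have iz: "integrable \<gamma> (\<lambda>z::'a. z)" by (rule Bochner_Integration.integrable_bound[OF integrable_std_gauss_norm]) auto
  have "(\<integral>(z::'a). s *\<^sub>R z \<partial>\<gamma>) = 0"
  proof -
    have "(\<integral>(z::'a). z \<partial>\<gamma>) = 0"
    proof (rule euclidean_eqI)
      fix b :: 'a
      have "(\<integral>(z::'a). z \<partial>\<gamma>) \<bullet> b = b \<bullet> (\<integral>(z::'a). z \<partial>\<gamma>)" by (rule inner_commute)
      also have "\<dots> = (\<integral>(z::'a). b \<bullet> z \<partial>\<gamma>)" by (rule integral_inner_right[symmetric]) (rule iz)
      also have "\<dots> = 0" by (rule integral_std_gauss_inner)
      finally show "(\<integral>(z::'a). z \<partial>\<gamma>) \<bullet> b = 0 \<bullet> b" by (simp only: inner_zero_left)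
    qed
    then show ?thesis by (simp only: integral_scaleR_right scaleR_zero_right)
  qed
  then show "has_bochner_integral \<gamma> (\<lambda>x::'a. gauss_ratio s x *\<^sub>R x) 0"
    using integral_gauss_ratio[of "\<lambda>x::'a. x", OF _ integrable_scaleR_right[OF iz]] by (simp only:) simp
  have e2: "2 * (\<epsilon> * s\<^sup>2) < 1/2" "1 - 4 * \<epsilon> \<le> 1 - 4 * (\<epsilon> * s\<^sup>2)"
  proof -
    have "\<epsilon> * s\<^sup>2 \<le> \<epsilon> * 1" using s e by (intro mult_left_mono) (auto simp: power_le_one)
    then show "2 * (\<epsilon> * s\<^sup>2) < 1/2" "1 - 4 * \<epsilon> \<le> 1 - 4 * (\<epsilon> * s\<^sup>2)" using e by linarith+
  qed
  have "(\<integral>\<^sup>+x. \<integral>\<^sup>+y. ennreal (gauss_ratio s x * gauss_ratio s y * exp (\<epsilon> * (norm (x - y))\<^sup>2)) \<partial>\<gamma> \<partial>(\<gamma>::'a measure)) =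
    (\<integral>\<^sup>+x. ennreal (gauss_ratio s x) * (\<integral>\<^sup>+y. ennreal (gauss_ratio s y) * ennreal (exp (\<epsilon> * (norm (x - y))\<^sup>2)) \<partial>\<gamma>) \<partial>(\<gamma>::'a measure))"
    by (subst nn_integral_cmult[symmetric]) (auto simp: ennreal_mult nn mult.assoc)
  also have "\<dots> = (\<integral>\<^sup>+x. ennreal (gauss_ratio s x) * (\<integral>\<^sup>+y. ennreal (exp (\<epsilon> * (norm (x - s *\<^sub>R y))\<^sup>2)) \<partial>\<gamma>) \<partial>(\<gamma>::'a measure))"
    by (subst nn_integral_gauss_ratio) auto
  also have "\<dots> = (\<integral>\<^sup>+x. \<integral>\<^sup>+y. ennreal (exp (\<epsilon> * (norm (s *\<^sub>R x - s *\<^sub>R y))\<^sup>2)) \<partial>\<gamma> \<partial>(\<gamma>::'a measure))"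
    by (subst nn_integral_gauss_ratio) auto
  also have "\<dots> = (\<integral>\<^sup>+x. \<integral>\<^sup>+y. ennreal (exp (\<epsilon> * s\<^sup>2 * (norm (1 *\<^sub>R x + 1 *\<^sub>R y))\<^sup>2)) \<partial>\<gamma> \<partial>(\<gamma>::'a measure))"
  proof (rule nn_integral_cong)
    fix x :: 'a
    have "(\<integral>\<^sup>+y. ennreal (exp (\<epsilon> * (norm (s *\<^sub>R x - s *\<^sub>R y))\<^sup>2)) \<partial>\<gamma>) = (\<integral>\<^sup>+y. ennreal (exp (\<epsilon> * (norm (s *\<^sub>R x - s *\<^sub>R y))\<^sup>2)) \<partial>distr \<gamma> borel uminus)"
      unfolding distr_std_gauss_uminus ..
    also have "\<dots> = (\<integral>\<^sup>+y. ennreal (exp (\<epsilon> * (norm (s *\<^sub>R x - s *\<^sub>R (- y)))\<^sup>2)) \<partial>\<gamma>)"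
      by (rule nn_integral_distr) auto
    also have "\<dots> = (\<integral>\<^sup>+y. ennreal (exp (\<epsilon> * s\<^sup>2 * (norm (1 *\<^sub>R x + 1 *\<^sub>R y))\<^sup>2)) \<partial>\<gamma>)"
      by (simp add: power_mult_distrib mult.assoc flip: scaleR_add_right)
    finally show "(\<integral>\<^sup>+y. ennreal (exp (\<epsilon> * (norm (s *\<^sub>R x - s *\<^sub>R y))\<^sup>2)) \<partial>\<gamma>) = (\<integral>\<^sup>+y. ennreal (exp (\<epsilon> * s\<^sup>2 * (norm (1 *\<^sub>R x + 1 *\<^sub>R y))\<^sup>2)) \<partial>\<gamma>)" .
  qed
  also have "\<dots> = (\<integral>\<^sup>+(z::'a). ennreal (exp (\<epsilon> * s\<^sup>2 * (norm (sqrt (1\<^sup>2 + 1\<^sup>2) *\<^sub>R z))\<^sup>2)) \<partial>\<gamma>)"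
    by (rule nn_integral_gauss_sum) auto
  also have "\<dots> = (\<integral>\<^sup>+(z::'a). ennreal (exp (0 \<bullet> z - (- (4 * (\<epsilon> * s\<^sup>2))) * (norm z)\<^sup>2 / 2)) \<partial>\<gamma>)"
    by (simp add: power_mult_distrib algebra_simps)
  also have "\<dots> = ennreal ((1 / sqrt (1 - 4 * (\<epsilon> * s\<^sup>2))) ^ DIM('a))"
    using nn_integral_exp_quadratic[of "- (4 * (\<epsilon> * s\<^sup>2))" "0::'a"] e2 by simp
  also have "\<dots> \<le> ennreal \<alpha>"
  proof (rule ennreal_leI, rule order_trans[OF power_mono \<alpha>])
    define w where "w = 1 - 4 * (\<epsilon> * s\<^sup>2)"
    have "0 \<le> \<epsilon> * s\<^sup>2" using e by simp
    then have w: "0 < w" "w \<le> 1" "1 - 4 * \<epsilon> \<le> w" using e2 unfolding w_def by linarith+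
    have "w\<^sup>2 \<le> w" using w by (simp add: power2_eq_square mult_left_le)
    then have "w \<le> sqrt w" by (rule real_le_rsqrt)
    then have "1 - 4 * \<epsilon> \<le> sqrt w" using w by linarith
    then have "1 / sqrt w \<le> 1 / (1 - 4 * \<epsilon>)" using e w by (intro divide_left_mono) auto
    then show "1 / sqrt (1 - 4 * (\<epsilon> * s\<^sup>2)) \<le> 1 / (1 - 4 * \<epsilon>)" by (simp add: w_def)
    show "0 \<le> 1 / sqrt (1 - 4 * (\<epsilon> * s\<^sup>2))" using w by (simp add: w_def)
  qed
  finally show "(\<integral>\<^sup>+x. \<integral>\<^sup>+y. ennreal (gauss_ratio s x * gauss_ratio s y * exp (\<epsilon> * (norm (x - y))\<^sup>2)) \<partial>\<gamma> \<partial>(\<gamma>::'a measure)) \<le> ennreal \<alpha>" .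
qed

text \<open>
  The norm is 1-Lipschitz, so the transport cost is at least the difference of the first moments.
\<close>

lemma wasserstein1_gauss_ratio_ge:
  "ennreal ((1 - s) * (\<integral>(x::'a::euclidean_space). norm x \<partial>\<gamma>)) \<le> W\<^sub>1 (density \<gamma> (\<lambda>x::'a. ennreal (gauss_ratio s x))) \<gamma>"
  unfolding wasserstein1_def
proof (rule INF_greatest)
  define m where "m = (\<integral>(x::'a). norm x \<partial>\<gamma>)"
  have m: "0 \<le> m" by (simp add: m_def)
  have nm: "(\<integral>\<^sup>+(x::'a). ennreal (norm x) \<partial>\<gamma>) = ennreal m"
    unfolding m_def by (rule nn_integral_eq_integral) auto
  fix \<pi> :: "('a \<times> 'a) measure" assume "\<pi> \<in> couplings (density \<gamma> (\<lambda>x::'a. ennreal (gauss_ratio s x))) \<gamma>"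
  then have sets: "sets \<pi> = sets (borel \<Otimes>\<^sub>M borel)" and 1: "distr \<pi> borel fst = distr \<gamma> borel (\<lambda>z. s *\<^sub>R z)" and 2: "distr \<pi> borel snd = \<gamma>"
    by (auto simp: couplings_def density_gauss_ratio)
  note [measurable_cong] = sets
  define c where "c = (\<integral>\<^sup>+(x, y). ennreal (norm (x - y)) \<partial>\<pi>)"
  have "ennreal m = (\<integral>\<^sup>+y. ennreal (norm y) \<partial>distr \<pi> borel snd)" unfolding 2 nm ..
  also have "\<dots> = (\<integral>\<^sup>+p. ennreal (norm (snd p)) \<partial>\<pi>)" by (rule nn_integral_distr) measurable
  also have "\<dots> \<le> (\<integral>\<^sup>+p. ennreal (norm (fst p)) + ennreal (case p of (x, y) \<Rightarrow> norm (x - y)) \<partial>\<pi>)"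
  proof (rule nn_integral_mono)
    fix p :: "'a \<times> 'a"
    have "norm (snd p) \<le> norm (fst p) + norm (fst p - snd p)"
      using norm_triangle_ineq4[of "fst p" "fst p - snd p"] by simp
    from ennreal_leI[OF this]
    show "ennreal (norm (snd p)) \<le> ennreal (norm (fst p)) + ennreal (case p of (x, y) \<Rightarrow> norm (x - y))"
      by (simp add: split_beta')
  qed
  also have "\<dots> = (\<integral>\<^sup>+p. ennreal (norm (fst p)) \<partial>\<pi>) + c"
    unfolding c_def by (subst nn_integral_add) (auto simp: split_beta')
  also have "(\<integral>\<^sup>+p. ennreal (norm (fst p)) \<partial>\<pi>) = (\<integral>\<^sup>+x. ennreal (norm x) \<partial>distr \<pi> borel fst)"
    by (rule nn_integral_distr[symmetric]) measurable
  also have "\<dots> = (\<integral>\<^sup>+(z::'a). ennreal (norm (s *\<^sub>R z)) \<partial>\<gamma>)" unfolding 1 by (rule nn_integral_distr) auto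
  also have "\<dots> = ennreal s * (\<integral>\<^sup>+(z::'a). ennreal (norm z) \<partial>\<gamma>)"
    using s by (subst nn_integral_cmult[symmetric]) (auto simp: ennreal_mult)
  also have "\<dots> = ennreal (s * m)" unfolding nm using s m by (subst ennreal_mult) auto
  finally have *: "ennreal m \<le> ennreal (s * m) + c" .
  have "ennreal ((1 - s) * m) \<le> c"
  proof (cases c)
    case (real r)
    have "ennreal m \<le> ennreal (s * m + r)" using * s m real by (subst ennreal_plus) auto
    then have "m \<le> s * m + r" using s m real(1) by (subst (asm) ennreal_le_iff) auto
    then show ?thesis unfolding real(2) by (intro ennreal_leI) (simp add: algebra_simps)
  next
    case top
    then show ?thesis by simp
  qed
  then show "ennreal ((1 - s) * (\<integral>(x::'a). norm x \<partial>\<gamma>)) \<le> (\<integral>\<^sup>+(x, y). ennreal (norm (x - y)) \<partial>\<pi>)"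
    by (simp only: m_def c_def)
qed

end

section \<open>Sharpness\<close>

lemma gauss_first_moment_pos: "0 < (\<integral>(x::'a::euclidean_space). norm x \<partial>\<gamma>)"
proof -
  have "(\<integral>(x::'a). norm x \<partial>\<gamma>) \<noteq> 0"
  proof
    assume "(\<integral>(x::'a). norm x \<partial>\<gamma>) = 0"
    then have "AE x in \<gamma>. norm (x::'a) = 0"
      by (subst (asm) integral_nonneg_eq_0_iff_AE) auto
    then have "(\<integral>(x::'a). (norm x)\<^sup>2 \<partial>\<gamma>) = (\<integral>(x::'a). 0 \<partial>\<gamma>)"
      by (intro integral_cong_AE) (auto elim: eventually_mono)
    then show False by (simp add: integral_std_gauss_norm_sq)
  qed
  moreover have "0 \<le> (\<integral>(x::'a). norm x \<partial>\<gamma>)" by (rule Bochner_Integration.integral_nonneg) simp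
  ultimately show ?thesis by linarith
qed

text \<open>
  Comparison with the centred normal law of variance \<open>1 / (1 + b)\<close> gives the integral of
  \<open>\<bar>x\<bar> exp (- b \<bar>x\<bar>\<^sup>2 / 2)\<close> as \<open>(1 + b)\<close> to the power \<open>- (n + 1) / 2\<close> times the first moment. The derivative of this
  identity at \<open>b = 0\<close> is the claim.
\<close>

lemma gauss_third_moment:
  "(\<integral>(x::'a::euclidean_space). norm x ^ 3 \<partial>\<gamma>) = (real DIM('a) + 1) * (\<integral>(x::'a). norm x \<partial>\<gamma>)"
proof -
  define m where "m = (\<integral>(x::'a). norm x \<partial>\<gamma>)"
  define n where "n = real DIM('a)"
  define b where "b k = 1 / (real k + 1)" for k :: nat
  have b: "0 < b k" for k by (simp add: b_def)
  have val: "(\<integral>(x::'a). norm x * exp (- (b k * (norm x)\<^sup>2 / 2)) \<partial>\<gamma>) = (1 + b k) powr (- ((n + 1) / 2)) * m" for k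
  proof -
    define s where "s = (1 + b k) powr (- (1 / 2))"
    have s0: "0 < s" using b[of k] by (simp add: s_def)
    have s1: "s < 1" using b[of k] powr_less_one[of "1 + b k" "- (1/2)"] by (simp add: s_def)
    have s2: "1 / s\<^sup>2 - 1 = b k"
    proof -
      have "s\<^sup>2 = (1 + b k) powr (- 1)" using b[of k] by (simp add: s_def power2_eq_square flip: powr_add)
      then show ?thesis using b[of k] by (simp add: powr_minus_divide)
    qed
    have g: "has_bochner_integral \<gamma> (\<lambda>x::'a. gauss_ratio s x *\<^sub>R norm x) (\<integral>(z::'a). norm (s *\<^sub>R z) \<partial>\<gamma>)"
      by (rule integral_gauss_ratio[OF s0 s1]) (simp_all add: s0)
    have "(\<integral>(x::'a). norm x * exp (- (b k * (norm x)\<^sup>2 / 2)) \<partial>\<gamma>) = (\<integral>(x::'a). s ^ DIM('a) * (gauss_ratio s x *\<^sub>R norm x) \<partial>\<gamma>)"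
      using s0 by (intro Bochner_Integration.integral_cong) (simp_all add: gauss_ratio_def s2 power_divide)
    also have "\<dots> = s ^ DIM('a) * (s * m)"
      using has_bochner_integral_integral_eq[OF g] s0 by (simp only: integral_mult_right_zero) (simp add: m_def)
    also have "\<dots> = s powr (n + 1) * m" using s0 by (simp add: n_def powr_add powr_realpow)
    also have "s powr (n + 1) = (1 + b k) powr (- ((n + 1) / 2))" by (simp add: s_def powr_powr)
    finally show ?thesis .
  qed
  have L1: "(\<lambda>k. \<integral>(x::'a). norm x * ((1 - exp (- (b k * (norm x)\<^sup>2 / 2))) / b k) \<partial>\<gamma>) \<longlonglongrightarrow> (\<integral>(x::'a). norm x * ((norm x)\<^sup>2 / 2) \<partial>\<gamma>)"
  proof (rule integral_dominated_convergence[where w = "\<lambda>x. norm x ^ 3"])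
    show "AE x in \<gamma>. (\<lambda>k. norm (x::'a) * ((1 - exp (- (b k * (norm x)\<^sup>2 / 2))) / b k)) \<longlonglongrightarrow> norm x * ((norm x)\<^sup>2 / 2)"
    proof (rule AE_I2)
      fix x :: 'a
      have l: "(\<lambda>k. (1 - exp (- (b k * t / 2))) / b k) \<longlonglongrightarrow> t / 2" for t :: real
        unfolding b_def by real_asymp
      show "(\<lambda>k. norm x * ((1 - exp (- (b k * (norm x)\<^sup>2 / 2))) / b k)) \<longlonglongrightarrow> norm x * ((norm x)\<^sup>2 / 2)"
        by (rule tendsto_mult[OF tendsto_const l])
    qed
    show "AE x in \<gamma>. norm (norm (x::'a) * ((1 - exp (- (b k * (norm x)\<^sup>2 / 2))) / b k)) \<le> norm x ^ 3" for k
    proof (rule AE_I2)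
      fix x :: 'a
      have "1 - exp (- (b k * (norm x)\<^sup>2 / 2)) \<le> b k * (norm x)\<^sup>2 / 2"
        using exp_ge_add_one_self[of "- (b k * (norm x)\<^sup>2 / 2)"] by linarith
      also have "\<dots> \<le> b k * (norm x)\<^sup>2" using b[of k] by simp
      finally have 1: "(1 - exp (- (b k * (norm x)\<^sup>2 / 2))) / b k \<le> (norm x)\<^sup>2" using b[of k] by (simp add: divide_le_eq mult.commute)
      have 0: "0 \<le> (1 - exp (- (b k * (norm x)\<^sup>2 / 2))) / b k" using b[of k] by simp
      have "norm x * ((1 - exp (- (b k * (norm x)\<^sup>2 / 2))) / b k) \<le> norm x * (norm x)\<^sup>2" using 1 by (rule mult_left_mono) simp
      moreover have "norm (norm x * ((1 - exp (- (b k * (norm x)\<^sup>2 / 2))) / b k)) = norm x * ((1 - exp (- (b k * (norm x)\<^sup>2 / 2))) / b k)"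
        unfolding real_norm_def using 0 by (intro abs_of_nonneg mult_nonneg_nonneg) auto
      moreover have "norm x ^ 3 = norm x * (norm x)\<^sup>2" by (simp add: power3_eq_cube power2_eq_square)
      ultimately show "norm (norm x * ((1 - exp (- (b k * (norm x)\<^sup>2 / 2))) / b k)) \<le> norm x ^ 3" by simp
    qed
  qed simp_all
  have L2: "(\<integral>(x::'a). norm x * ((1 - exp (- (b k * (norm x)\<^sup>2 / 2))) / b k) \<partial>\<gamma>) = m * ((1 - (1 + b k) powr (- ((n + 1) / 2))) / b k)" for k
  proof -
    have i: "integrable \<gamma> (\<lambda>x::'a. norm x * exp (- (b k * (norm x)\<^sup>2 / 2)))"
      by (rule Bochner_Integration.integrable_bound[OF integrable_std_gauss_norm]) (use b[of k] in \<open>auto intro!: AE_I2 mult_left_le\<close>)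
    have "(\<integral>(x::'a). norm x * ((1 - exp (- (b k * (norm x)\<^sup>2 / 2))) / b k) \<partial>\<gamma>) = (\<integral>(x::'a). (norm x - norm x * exp (- (b k * (norm x)\<^sup>2 / 2))) / b k \<partial>\<gamma>)"
      by (simp add: right_diff_distrib diff_divide_distrib)
    also have "\<dots> = (m - (1 + b k) powr (- ((n + 1) / 2)) * m) / b k"
      unfolding integral_divide_zero by (subst Bochner_Integration.integral_diff[OF integrable_std_gauss_norm i]) (simp only: val m_def)
    finally show ?thesis by (simp add: algebra_simps diff_divide_distrib)
  qed
  have L3: "(\<lambda>k. m * ((1 - (1 + b k) powr (- ((n + 1) / 2))) / b k)) \<longlonglongrightarrow> m * ((n + 1) / 2)"
  proof (rule tendsto_mult[OF tendsto_const])
    have "((\<lambda>u. (1 + u) powr (- ((n + 1) / 2))) has_real_derivative - ((n + 1) / 2)) (at 0)"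
      by (auto intro!: derivative_eq_intros)
    then have l: "((\<lambda>u. ((1 + u) powr (- ((n + 1) / 2)) - 1) / u) \<longlongrightarrow> - ((n + 1) / 2)) (at 0)"
      by (simp add: DERIV_def)
    have "filterlim b (at 0) sequentially"
    proof (rule filterlim_atI)
      show "b \<longlonglongrightarrow> 0" unfolding b_def[abs_def] by real_asymp
      show "\<forall>\<^sub>F k in sequentially. b k \<noteq> 0" using b by (auto intro!: always_eventually simp: less_imp_neq[symmetric])
    qed
    from tendsto_minus[OF filterlim_compose[OF l this]]
    show "(\<lambda>k. (1 - (1 + b k) powr (- ((n + 1) / 2))) / b k) \<longlonglongrightarrow> (n + 1) / 2"
      by (simp add: minus_divide_left add.commute)
  qed
  have "(\<integral>(x::'a). norm x * ((norm x)\<^sup>2 / 2) \<partial>\<gamma>) = m * ((n + 1) / 2)"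
    by (rule LIMSEQ_unique[OF L1[unfolded L2] L3])
  moreover have "(\<integral>(x::'a). norm x * ((norm x)\<^sup>2 / 2) \<partial>\<gamma>) = (\<integral>(x::'a). norm x ^ 3 / 2 \<partial>\<gamma>)"
    by (intro Bochner_Integration.integral_cong) (simp_all add: power3_eq_cube power2_eq_square)
  ultimately show ?thesis by (simp add: m_def n_def field_simps)
qed

lemma lborel_eq_distr_scaleR:
  assumes b: "Basis = {b :: 'a::euclidean_space}"
  shows "distr lborel borel (\<lambda>t. t *\<^sub>R b) = (lborel :: 'a measure)"
proof (rule lborel_eqI[symmetric])
  have bb: "b \<bullet> b = 1" by (rule inner_same_Basis) (simp add: b)
  fix l u :: 'a assume le: "\<And>c. c \<in> Basis \<Longrightarrow> l \<bullet> c \<le> u \<bullet> c"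
  have "(\<lambda>t. t *\<^sub>R b) -` box l u = {l \<bullet> b <..< u \<bullet> b}" by (auto simp: box_def b bb)
  then show "emeasure (distr lborel borel (\<lambda>t. t *\<^sub>R b)) (box l u) = (\<Prod>c\<in>Basis. (u - l) \<bullet> c)"
    using le by (subst emeasure_distr) (auto simp: b inner_diff_left)
qed simp

lemma gauss_first_moment_1D:
  assumes "DIM('a::euclidean_space) = 1"
  shows "(\<integral>(x::'a). norm x \<partial>\<gamma>) = sqrt (2 / pi)"
proof -
  obtain b :: 'a where b: "Basis = {b}" using assms by (auto simp: card_1_singleton_iff)
  have nb: "norm b = 1" by (rule norm_Basis) (simp add: b)
  have "(\<integral>(x::'a). norm x \<partial>\<gamma>) = (LINT x|lborel. normal_dens 0 1 (x::'a) *\<^sub>R norm x)"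
    unfolding std_gauss_eq by (rule integral_density) auto
  also have "\<dots> = (LINT t|lborel. normal_dens 0 1 (t *\<^sub>R b) *\<^sub>R norm (t *\<^sub>R b))"
    unfolding lborel_eq_distr_scaleR[OF b, symmetric] by (rule integral_distr) auto
  also have "\<dots> = (LINT t|lborel. std_normal_density t * \<bar>t\<bar> ^ (2 * 0 + 1))"
    using assms nb by (intro Bochner_Integration.integral_cong) (auto simp: normal_dens_def std_normal_density_def)
  also have "\<dots> = sqrt (2 / pi)" by (subst integral_std_normal_moment_abs_odd) simp
  finally show ?thesis .
qed

lemma abs_moment_1: "abs_moment 1 (\<gamma> :: 'a::euclidean_space measure) = (\<integral>(x::'a). norm x \<partial>\<gamma>)"
  by (simp add: abs_moment_def)

lemma abs_moment_3: "abs_moment 3 (\<gamma> :: 'a::euclidean_space measure) = (\<integral>(x::'a). norm x ^ 3 \<partial>\<gamma>)"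
proof -
  have "norm x powr 3 = norm x ^ 3" for x :: 'a using powr_numeral[of "norm x" "num.Bit1 num.One"] by (cases "x = 0") auto
  then show ?thesis by (simp add: abs_moment_def)
qed

context
  fixes \<alpha> \<epsilon> :: real
  assumes e: "0 < \<epsilon>" "\<epsilon> < 1/4" and al: "(1 / (1 - 4 * \<epsilon>)) ^ DIM('a::euclidean_space) \<le> \<alpha>"
begin

lemma deficit_bound_gauss_ratio:
  assumes C: "0 \<le> C" and db: "deficit_bound (\<F> \<alpha> \<epsilon> :: ('a \<Rightarrow> real) set) \<beta> C" and s: "0 < s" "s < 1"
  shows "(1 - s) * (\<integral>(x::'a). norm x \<partial>\<gamma>) \<le> C * (real DIM('a) / 2 * (1 / s\<^sup>2 - 1 + 2 * ln s)) powr \<beta>"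
proof -
  have "ennreal ((1 - s) * (\<integral>(x::'a). norm x \<partial>\<gamma>)) \<le> W\<^sub>1 (density \<gamma> (\<lambda>x::'a. ennreal (gauss_ratio s x))) \<gamma>"
    by (rule wasserstein1_gauss_ratio_ge[OF s])
  also have "\<dots> \<le> ennreal (C * \<delta> (gauss_ratio s :: 'a \<Rightarrow> real) powr \<beta>)"
    using db gauss_ratio_in_exp_class[OF s e al] unfolding deficit_bound_def by blast
  finally show ?thesis unfolding deficit_gauss_ratio[OF s] using C by (subst (asm) ennreal_le_iff) auto
qed

lemma gauss_deficit_asymp:
  "((\<lambda>s. (1 - s) / sqrt (1 / s\<^sup>2 - 1 + 2 * ln s)) \<longlongrightarrow> 1 / sqrt 2) (at_left (1::real))"
  "((\<lambda>s. 1 / s\<^sup>2 - 1 + 2 * ln s) \<longlongrightarrow> 0) (at_left (1::real))"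
  "\<forall>\<^sub>F s in at_left (1::real). 0 < 1 / s\<^sup>2 - 1 + 2 * ln s"
proof -
  have "inverse (2 powr (1 / 2)) = 1 / sqrt (2::real)" by (simp add: powr_half_sqrt inverse_eq_divide)
  moreover have "((\<lambda>s. (1 - s) / sqrt (1 / s\<^sup>2 - 1 + 2 * ln s)) \<longlongrightarrow> inverse (2 powr (1 / 2))) (at_left (1::real))"
    by real_asymp
  ultimately show "((\<lambda>s. (1 - s) / sqrt (1 / s\<^sup>2 - 1 + 2 * ln s)) \<longlongrightarrow> 1 / sqrt 2) (at_left (1::real))"
    by simp
  show "((\<lambda>s. 1 / s\<^sup>2 - 1 + 2 * ln s) \<longlongrightarrow> 0) (at_left (1::real))" by real_asymp
  show "\<forall>\<^sub>F s in at_left (1::real). 0 < 1 / s\<^sup>2 - 1 + 2 * ln s" by real_asymp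
qed

lemma eventually_01: "\<forall>\<^sub>F s in at_left (1::real). 0 < s \<and> s < 1"
  using eventually_at_left_real[of 0 1] by (auto elim: eventually_mono)

text \<open>
  As \<open>s\<close> tends to 1, the square root of the deficit behaves like \<open>\<surd>n (1 - s)\<close>, and the distance is at least
  \<open>1 - s\<close> times the first moment.
\<close>

lemma deficit_constant_ge:
  assumes a: "0 < a" and db: "deficit_bound (\<F> \<alpha> \<epsilon> :: ('a \<Rightarrow> real) set) (1/2) a"
  shows "(\<integral>(x::'a). norm x \<partial>\<gamma>) / sqrt (real DIM('a)) \<le> a"
proof -
  define m where "m = (\<integral>(x::'a). norm x \<partial>\<gamma>)"
  define n where "n = real DIM('a)"
  have n: "0 < n" by (simp add: n_def)
  have "\<forall>\<^sub>F s in at_left 1. m * ((1 - s) / sqrt (1 / s\<^sup>2 - 1 + 2 * ln s)) \<le> a * sqrt (n / 2)"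
    using eventually_01 gauss_deficit_asymp(3)
  proof eventually_elim
    case (elim s)
    define \<phi> where "\<phi> = 1 / s\<^sup>2 - 1 + 2 * ln s"
    have \<phi>: "0 < \<phi>" using elim by (simp add: \<phi>_def)
    have "(1 - s) * m \<le> a * (n / 2 * \<phi>) powr (1/2)"
      using deficit_bound_gauss_ratio[OF less_imp_le[OF a] db, of s] elim by (simp add: m_def n_def \<phi>_def)
    also have "(n / 2 * \<phi>) powr (1/2) = sqrt (n / 2) * sqrt \<phi>"
      using n \<phi> by (simp add: powr_half_sqrt real_sqrt_mult[symmetric] del: real_sqrt_mult)
    finally show ?case using \<phi> unfolding \<phi>_def[symmetric] by (simp add: divide_le_eq mult_ac)
  qed
  then have "m * (1 / sqrt 2) \<le> a * sqrt (n / 2)"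
    by (intro tendsto_upperbound[OF tendsto_mult[OF tendsto_const gauss_deficit_asymp(1)]]) auto
  then show ?thesis using n unfolding m_def[symmetric] n_def[symmetric]
    by (simp add: real_sqrt_divide divide_le_eq)
qed

text \<open>
  A larger exponent would leave a positive power of the deficit, which vanishes as \<open>s\<close> tends to 1,
  above the positive limit of the distance divided by the square root of the deficit.
\<close>

lemma deficit_exponent_sharp:
  assumes \<beta>: "1/2 < \<beta>" and C: "0 < C" and db: "deficit_bound (\<F> \<alpha> \<epsilon> :: ('a \<Rightarrow> real) set) \<beta> C"
  shows False
proof -
  define m where "m = (\<integral>(x::'a). norm x \<partial>\<gamma>)"
  define n where "n = real DIM('a)"
  have n: "0 < n" by (simp add: n_def)
  have ev: "\<forall>\<^sub>F s in at_left 1. m * ((1 - s) / sqrt (1 / s\<^sup>2 - 1 + 2 * ln s)) \<le> C * sqrt (n / 2) * (n / 2 * (1 / s\<^sup>2 - 1 + 2 * ln s)) powr (\<beta> - 1/2)"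
    using eventually_01 gauss_deficit_asymp(3)
  proof eventually_elim
    case (elim s)
    define \<phi> where "\<phi> = 1 / s\<^sup>2 - 1 + 2 * ln s"
    have \<phi>: "0 < \<phi>" using elim by (simp add: \<phi>_def)
    have "(1 - s) * m \<le> C * (n / 2 * \<phi>) powr \<beta>"
      using deficit_bound_gauss_ratio[OF less_imp_le[OF C] db, of s] elim by (simp add: m_def n_def \<phi>_def)
    also have "(n / 2 * \<phi>) powr \<beta> = (n / 2 * \<phi>) powr (1/2) * (n / 2 * \<phi>) powr (\<beta> - 1/2)"
      by (simp flip: powr_add)
    also have "(n / 2 * \<phi>) powr (1/2) = sqrt (n / 2) * sqrt \<phi>"
      using n \<phi> by (simp add: powr_half_sqrt real_sqrt_mult[symmetric] del: real_sqrt_mult)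
    finally show ?case using \<phi> unfolding \<phi>_def[symmetric] by (simp add: divide_le_eq mult_ac)
  qed
  have "((\<lambda>s. C * sqrt (n / 2) * (n / 2 * (1 / s\<^sup>2 - 1 + 2 * ln s)) powr (\<beta> - 1/2)) \<longlongrightarrow> C * sqrt (n / 2) * 0) (at_left 1)"
  proof (intro tendsto_mult tendsto_const)
    have "((\<lambda>s. n / 2 * (1 / s\<^sup>2 - 1 + 2 * ln s)) \<longlongrightarrow> n / 2 * 0) (at_left 1)"
      by (intro tendsto_mult tendsto_const gauss_deficit_asymp(2))
    then have "((\<lambda>s. n / 2 * (1 / s\<^sup>2 - 1 + 2 * ln s)) \<longlongrightarrow> 0) (at_left 1)" by simp
    moreover have "\<forall>\<^sub>F s in at_left 1. 0 \<le> n / 2 * (1 / s\<^sup>2 - 1 + 2 * ln s)"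
      using gauss_deficit_asymp(3) by eventually_elim (use n in simp)
    ultimately show "((\<lambda>s. (n / 2 * (1 / s\<^sup>2 - 1 + 2 * ln s)) powr (\<beta> - 1/2)) \<longlongrightarrow> 0) (at_left 1)"
      using \<beta> by (intro tendsto_zero_powrI[OF _ tendsto_const]) auto
  qed
  then have "m * (1 / sqrt 2) \<le> C * sqrt (n / 2) * 0"
    by (rule tendsto_le[OF _ _ tendsto_mult[OF tendsto_const gauss_deficit_asymp(1)] ev, rotated]) simp
  then show False using gauss_first_moment_pos[where 'a = 'a] by (simp add: m_def divide_le_0_iff)
qed

end

theorem theorem1p3:
  fixes \<alpha> \<epsilon> :: real
  assumes "0 < \<alpha>" and "0 < \<epsilon>"
  shows "(\<exists>a>0. deficit_bound (\<F> \<alpha> \<epsilon> :: (real ^ 'n::finite \<Rightarrow> real) set) (1/2) a) \<and>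
    (\<epsilon> < 1/4 \<and>
     \<alpha> > 1 / (2 * pi) ^ CARD('n) * (pi / (1/2 - 2 * \<epsilon>)) ^ CARD('n) \<longrightarrow>
       best_constant (\<F> \<alpha> \<epsilon> :: (real ^ 'n \<Rightarrow> real) set) \<ge>
         \<bar>real CARD('n) * abs_moment 1 (\<gamma> :: (real ^ 'n) measure)
            - abs_moment 3 (\<gamma> :: (real ^ 'n) measure)\<bar> / sqrt (real CARD('n)) \<and>
       (CARD('n) = 1 \<longrightarrow>
         best_constant (\<F> \<alpha> \<epsilon> :: (real ^ 'n \<Rightarrow> real) set) \<ge> sqrt (2 / pi)) \<and>
       (\<forall>\<beta>>1/2. \<not> (\<exists>C>0. deficit_bound (\<F> \<alpha> \<epsilon> :: (real ^ 'n \<Rightarrow> real) set) \<beta> C)))"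
proof (intro conjI impI)
  show ex: "\<exists>a>0. deficit_bound (\<F> \<alpha> \<epsilon> :: (real ^ 'n \<Rightarrow> real) set) (1/2) a"
    by (rule wasserstein1_deficit_bound[OF assms])
  assume *: "\<epsilon> < 1/4 \<and> \<alpha> > 1 / (2 * pi) ^ CARD('n) * (pi / (1/2 - 2 * \<epsilon>)) ^ CARD('n)"
  then have e: "\<epsilon> < 1/4" by simp
  have dim: "DIM(real ^ 'n) = CARD('n)" by simp
  define m where "m = (\<integral>(x::real ^ 'n). norm x \<partial>\<gamma>)"
  have al: "(1 / (1 - 4 * \<epsilon>)) ^ DIM(real ^ 'n) \<le> \<alpha>"
  proof -
    have "pi / (1/2 - 2 * \<epsilon>) / (2 * pi) = 1 / (1 - 4 * \<epsilon>)" using e by (simp add: field_simps)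
    then have "1 / (2 * pi) ^ CARD('n) * (pi / (1/2 - 2 * \<epsilon>)) ^ CARD('n) = (1 / (1 - 4 * \<epsilon>)) ^ CARD('n)"
      by (metis mult.commute mult_1 power_divide times_divide_eq_left times_divide_eq_right)
    then show ?thesis using * unfolding dim by linarith
  qed
  have best: "m / sqrt (real CARD('n)) \<le> best_constant (\<F> \<alpha> \<epsilon> :: (real ^ 'n \<Rightarrow> real) set)"
    unfolding best_constant_def
  proof (rule cInf_greatest)
    show "{a. 0 < a \<and> deficit_bound (\<F> \<alpha> \<epsilon> :: (real ^ 'n \<Rightarrow> real) set) (1/2) a} \<noteq> {}" using ex by auto
    show "m / sqrt (real CARD('n)) \<le> a" if "a \<in> {a. 0 < a \<and> deficit_bound (\<F> \<alpha> \<epsilon> :: (real ^ 'n \<Rightarrow> real) set) (1/2) a}" for a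
      using deficit_constant_ge[OF assms(2) e al, of a] that unfolding m_def dim by blast
  qed
  have m0: "0 < m" unfolding m_def by (rule gauss_first_moment_pos)
  have "real CARD('n) * abs_moment 1 (\<gamma> :: (real ^ 'n) measure) - abs_moment 3 (\<gamma> :: (real ^ 'n) measure) = - m"
    using gauss_third_moment[where 'a = "real ^ 'n"]
    by (simp add: abs_moment_1 abs_moment_3 m_def algebra_simps)
  then show "\<bar>real CARD('n) * abs_moment 1 (\<gamma> :: (real ^ 'n) measure)
            - abs_moment 3 (\<gamma> :: (real ^ 'n) measure)\<bar> / sqrt (real CARD('n)) \<le> best_constant (\<F> \<alpha> \<epsilon> :: (real ^ 'n \<Rightarrow> real) set)"
    using best m0 by simp
  show "sqrt (2 / pi) \<le> best_constant (\<F> \<alpha> \<epsilon> :: (real ^ 'n \<Rightarrow> real) set)" if "CARD('n) = 1"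
    using best gauss_first_moment_1D[where 'a = "real ^ 'n"] that by (simp add: m_def)
  show "\<forall>\<beta>>1/2. \<not> (\<exists>C>0. deficit_bound (\<F> \<alpha> \<epsilon> :: (real ^ 'n \<Rightarrow> real) set) \<beta> C)"
    using deficit_exponent_sharp[OF assms(2) e al] by blast
qed

end
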